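(* Let $X\colon\mathbb R^2\to\mathbb R^n$ be smooth, and let $\alpha^X,\beta^X$, the completed free crossed module $(\tau\colon\overline{\mathfrak g_{-1}}\to\overline{\mathfrak g_0},\ddot\triangleright)$, the logarithm of the path signature $\omega^{\alpha^X}$ and the surface Magnus expansion $\Omega^{\alpha^X,\beta^X}$ be as defined in the context. The maps $$\omega^{\alpha^X}\colon\mathsf{Paths}_2\to\overline{\mathfrak g_0},\qquad \Omega^{\alpha^X,\beta^X}\colon\mathsf{Rect}\to\overline{\mathfrak g_{-1}}$$ satisfy: - for every $\square\in\mathsf{Rect}$, $\tau(\Omega^{\alpha^X,\beta^X}(\square))=\omega^{\alpha^X}(\partial\square)$; - for horizontally composable rectangles, $$\Omega^{\alpha^X,\beta^X}(\square_A\square_B)=\mathsf{BCH}\big(\exp(\ddot\triangleright_{\omega^{\alpha^X}(\rightarrow_A)})\,\Omega^{\alpha^X,\beta^X}(\square_B),\ \Omega^{\alpha^X,\beta^X}(\square_A)\big),$$ and for vertically composable rectangles, $$\Omega^{\alpha^X,\beta^X}\Big(\genfrac{}{}{0pt}{1}{\square_B}{\square_A}\Big)=\mathsf{BCH}\big(\Omega^{\alpha^X,\beta^X}(\square_A),\ \exp(\ddot\triangleright_{\omega^{\alpha^X}(\uparrow_A)})\,\Omega^{\alpha^X,\beta^X}(\square_B)\big),$$ where $\mathsf{BCH}$ is the Baker--Campbell--Hausdorff series of the Lie algebra $\overline{\mathfrak g_{-1}}$.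
   Context: Free crossed module: let $\mathfrak f^\bullet$ be the free graded Lie algebra over $\mathbb R$ on $\mathtt Z_i$ ($1\le i\le n$) of degree $0$ and $\mathtt Z_{ij}$ ($1\le i<j\le n$) of degree $-1$ (further generators of degree $\le -2$ play no role here), with $[x,y]=(-1)^{|x||y|+1}[y,x]$, and let $d$ be of degree $+1$ with $d[x,y]=[dx,y]+(-1)^{|x|}[x,dy]$, $d\mathtt Z_i=0$, $d\mathtt Z_{ij}=[\mathtt Z_i,\mathtt Z_j]$. Put $\mathfrak g_0:=\mathfrak f^0$ (the free Lie algebra on $\mathtt Z_1,\dots,\mathtt Z_n$) and $\mathfrak g_{-1}:=\mathfrak f^{-1}/d[\mathfrak f^{-1},\mathfrak f^{-1}]$ with Lie bracket $[x,y]_{\mathfrak g_{-1}}:=[dx,y]$ (derived bracket). $\tau\colon\mathfrak g_{-1}\to\mathfrak g_0$ is induced by $d$ and $\ddot\triangleright_x(y):=[x,y]$ for $x\in\mathfrak g_0$, $y\in\mathfrak g_{-1}$. Grade both by weight: $\mathtt Z_i$ has weight $1$, $\mathtt Z_{ij}$ has weight $2$, and weights add under the bracket of $\mathfrak f^\bullet$. $\overline{\mathfrak g_0}$, $\overline{\mathfrak g_{-1}}$ are the spaces of formal infinite series of weight-homogeneous elements (products of the homogeneous components, each finite-dimensional); $\tau$, $\ddot\triangleright$ and the brackets extend to them. Forms: with coordinates $(t_1,t_2)$ on $\mathbb R^2$, $$\alpha^X=X^*\Big(\sum_i\mathtt Z_i\,dx^i\Big),\qquad \beta^X=X^*\Big(\sum_{i<j}\mathtt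 Z_{ij}\,dx^i\wedge dx^j\Big)=\sum_{i<j}J^{(ij)}_{t_1,t_2}\mathtt Z_{ij}\,dt^1\wedge dt^2,$$ $J^{(ij)}=\partial_1X^{(i)}\partial_2X^{(j)}-\partial_1X^{(j)}\partial_2X^{(i)}$; write $\beta^X_{r,t}:=\sum_{i<j}J^{(ij)}_{r,t}\mathtt Z_{ij}$. Paths and rectangles: $\mathsf{Paths}_2$ is the set of thin-homotopy classes of piecewise smooth paths in $\mathbb R^2$. $\mathsf{Rect}$ is the set of axis-parallel rectangles in $\mathbb R^2$, given by bottom-left corner $(v_1,v_2)$ and top-right corner $(s_1,s_2)$, $v_i\le s_i$. $\square_A\square_B$ is the horizontal concatenation (right edge of $\square_A$ = left edge of $\square_B$), $\genfrac{}{}{0pt}{1}{\square_B}{\square_A}$ the vertical one (top edge of $\square_A$ = bottom edge of $\square_B$). $\partial\square$ is the counter-clockwise boundary path from the bottom-left corner. $\rightarrow_A$ is the path along the bottom edge of $\square_A$ from bottom-left to bottom-right; $\uparrow_A$ the path along the left edge of $\square_A$ from bottom-left to top-left. $\omega^{\alpha^X}(\gamma)\in\overline{\mathfrak g_0}$ is the logarithm, in the tensor series algebra $T((\mathbb R^n))$, of the path signature $S_1$ of $\eta=X\circ\gamma$, where $dS_t=S_t\otimes\sum_i\mathtt Z_i\,d\eta^{(i)}_t$, $S_0=\mathbf 1$. $\Omega^{\alpha^X,\beta^X}$: for $v_1\le r$, $v_2\le t$ let $\omega^{r,t}:=\omega^{\alpha^X}(\gamma)$, where $\gamma$ is the path going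 straight up from $(v_1,v_2)$ to $(v_1,t)$ and then straight right to $(r,t)$. Put $$K_{v_1,v_2;s_1,t}:=\int_{v_1}^{s_1}e^{\ddot\triangleright_{\omega^{r,t}}}(\beta^X_{r,t})\,dr\in\overline{\mathfrak g_{-1}},$$ and let $\Omega_{v_1,v_2;s_1,t}\in\overline{\mathfrak g_{-1}}$ solve $$\frac{d}{dt}\Omega_{v_1,v_2;s_1,t}=\frac{\mathrm{ad}_{\Omega_{v_1,v_2;s_1,t}}}{1-\exp(-\mathrm{ad}_{\Omega_{v_1,v_2;s_1,t}})}(K_{v_1,v_2;s_1,t}),\qquad \Omega_{v_1,v_2;s_1,v_2}=0,$$ with $\mathrm{ad}$ taken for the derived bracket and $\frac{z}{1-e^{-z}}$ read as power series. For the rectangle $\square$ with corners $(v_1,v_2),(s_1,s_2)$, $\Omega^{\alpha^X,\beta^X}(\square):=\Omega_{v_1,v_2;s_1,s_2}$. *)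

theory Defs
  imports "HOL-Analysis.Analysis" "HOL-Computational_Algebra.Formal_Power_Series"
begin

section \<open>Formal power series in non-commuting letters\<close>

typedef 'a ncps = "UNIV :: ('a list \<Rightarrow> real) set"
  morphisms wcoeff Ncps ..

lemma wcoeff_Ncps [simp]: "wcoeff (Ncps f) = f"
  by (simp add: Ncps_inverse)

lemma ncps_eq_iff: "a = b \<longleftrightarrow> (\<forall>w. wcoeff a w = wcoeff b w)"
  by (metis ext wcoeff_inject)

lemma ncps_eqI: "(\<And>w. wcoeff a w = wcoeff b w) \<Longrightarrow> a = b"
  by (simp add: ncps_eq_iff)

instantiation ncps :: (type) real_algebra_1
begin

definition "0 = Ncps (\<lambda>w. 0)"
definition "1 = Ncps (\<lambda>w. if w = [] then 1 else 0)"
definition "a + b = Ncps (\<lambda>w. wcoeff a w + wcoeff b w)"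
definition "a - b = Ncps (\<lambda>w. wcoeff a w - wcoeff b w)"
definition "- a = Ncps (\<lambda>w. - wcoeff a w)"
definition "c *\<^sub>R a = Ncps (\<lambda>w. c * wcoeff a w)"
definition "a * b = Ncps (\<lambda>w. \<Sum>k\<le>length w. wcoeff a (take k w) * wcoeff b (drop k w))"

lemmas ncps_defs = zero_ncps_def one_ncps_def plus_ncps_def minus_ncps_def uminus_ncps_def
  scaleR_ncps_def times_ncps_def

instance
proof
  fix a b c :: "'a ncps"
  show "a * b * c = a * (b * c)"
  proof (rule ncps_eqI)
    fix w :: "'a list"
    let ?n = "length w"
    let ?t = "\<lambda>j k. wcoeff a (take j w) * wcoeff b (drop j (take k w)) * wcoeff c (drop k w)"
    have "wcoeff (a * b * c) w = (\<Sum>k\<le>?n. \<Sum>j\<le>k. ?t j k)"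
      unfolding times_ncps_def
      by (auto simp: sum_distrib_right min_def intro!: sum.cong)
    also have "\<dots> = (\<Sum>(k,j)\<in>(SIGMA k:{..?n}. {..k}). ?t j k)"
      by (simp add: sum.Sigma)
    also have "\<dots> = (\<Sum>(j,i)\<in>(SIGMA j:{..?n}. {..?n - j}). ?t j (i + j))"
      by (rule sum.reindex_bij_witness[where j = "\<lambda>(k,j). (j, k - j)" and i = "\<lambda>(j,i). (i + j, j)"]) auto
    also have "\<dots> = (\<Sum>j\<le>?n. \<Sum>i\<le>?n - j. ?t j (i + j))"
      by (simp add: sum.Sigma)
    also have "\<dots> = wcoeff (a * (b * c)) w"
      unfolding times_ncps_def
      by (auto simp: sum_distrib_left drop_take mult.assoc intro!: sum.cong)
    finally show "wcoeff (a * b * c) w = wcoeff (a * (b * c)) w" .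
  qed
  show "(0::'a ncps) \<noteq> 1"
    by (auto simp: ncps_eq_iff one_ncps_def zero_ncps_def intro!: exI[of _ "[]"])
  show "1 * a = a"
  proof (rule ncps_eqI)
    fix w :: "'a list"
    have "wcoeff (1 * a) w = (\<Sum>k\<le>length w. wcoeff 1 (take k w) * wcoeff a (drop k w))"
      by (simp add: times_ncps_def)
    also have "\<dots> = (\<Sum>k\<le>length w. if k = 0 then wcoeff a w else 0)"
      by (rule sum.cong) (auto simp: one_ncps_def)
    finally show "wcoeff (1 * a) w = wcoeff a w" by simp
  qed
  show "a * 1 = a"
  proof (rule ncps_eqI)
    fix w :: "'a list"
    have "wcoeff (a * 1) w = (\<Sum>k\<le>length w. wcoeff a (take k w) * wcoeff 1 (drop k w))"
      by (simp add: times_ncps_def)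
    also have "\<dots> = (\<Sum>k\<le>length w. if k = length w then wcoeff a w else 0)"
      by (rule sum.cong) (auto simp: one_ncps_def)
    finally show "wcoeff (a * 1) w = wcoeff a w" by simp
  qed
qed (auto simp: ncps_eq_iff ncps_defs algebra_simps sum.distrib sum_distrib_left)

end

lemma wcoeff_simps [simp]:
  "wcoeff 0 w = 0" "wcoeff 1 w = (if w = [] then 1 else 0)"
  "wcoeff (a + b) w = wcoeff a w + wcoeff b w" "wcoeff (a - b) w = wcoeff a w - wcoeff b w"
  "wcoeff (- a) w = - wcoeff a w" "wcoeff (c *\<^sub>R a) w = c * wcoeff a w"
  by (simp_all add: ncps_defs)

lemma wcoeff_mult:
  "wcoeff (a * b) w = (\<Sum>k\<le>length w. wcoeff a (take k w) * wcoeff b (drop k w))"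
  by (simp add: times_ncps_def)

definition mono_nc :: "'a list \<Rightarrow> 'a ncps" where
  "mono_nc w = Ncps (\<lambda>u. if u = w then 1 else 0)"

abbreviation letter :: "'a \<Rightarrow> 'a ncps" where
  "letter x \<equiv> mono_nc [x]"

text \<open>The series \<open>\<Sum>m. c m * T^m y\<close> for an operator \<open>T\<close>, summed coefficientwise.  In every use
  below \<open>T\<close> strictly increases the minimal word length, so that each coefficient is a finite sum.\<close>

definition op_series :: "(nat \<Rightarrow> real) \<Rightarrow> ('a ncps \<Rightarrow> 'a ncps) \<Rightarrow> 'a ncps \<Rightarrow> 'a ncps" where
  "op_series c T y = Ncps (\<lambda>w. \<Sum>m. c m * wcoeff ((T ^^ m) y) w)"

definition nc_exp :: "'a ncps \<Rightarrow> 'a ncps" where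
  "nc_exp a = op_series (\<lambda>m. 1 / fact m) (\<lambda>u. a * u) 1"

definition nc_log :: "'a ncps \<Rightarrow> 'a ncps" where
  "nc_log a = op_series (\<lambda>m. if m = 0 then 0 else (-1) ^ (m + 1) / real m) (\<lambda>u. (a - 1) * u) 1"


section \<open>The free graded Lie algebra\<close>

text \<open>\<open>Z i\<close> has degree 0 and \<open>ZZ i j\<close> has degree -1; only the \<open>ZZ i j\<close> with \<open>i < j\<close> are generators.
  As all degrees are nonpositive, natural numbers \<open>p\<close> are used as indices for the degree \<open>-p\<close>.\<close>

datatype 'n gen = Z 'n | ZZ 'n 'n

fun gdeg :: "'n gen \<Rightarrow> nat" where
  "gdeg (Z i) = 0"
| "gdeg (ZZ i j) = 1"

fun gweight :: "'n gen \<Rightarrow> nat" where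
  "gweight (Z i) = 1"
| "gweight (ZZ i j) = 2"

definition generators :: "'n::linorder gen set" where
  "generators = range Z \<union> {ZZ i j | i j. i < j}"

definition wdeg :: "'n gen list \<Rightarrow> nat" where
  "wdeg w = sum_list (map gdeg w)"

definition weight :: "'n gen list \<Rightarrow> nat" where
  "weight w = sum_list (map gweight w)"

text \<open>Graded commutator of elements of degrees \<open>-p\<close> and \<open>-q\<close>.\<close>

definition gbr :: "nat \<Rightarrow> nat \<Rightarrow> 'a ncps \<Rightarrow> 'a ncps \<Rightarrow> 'a ncps" where
  "gbr p q a b = a * b - (-1) ^ (p * q) *\<^sub>R (b * a)"

text \<open>The free graded Lie algebra, realised as the graded Lie polynomials in the free associative
  algebra; \<open>fLie p\<close> is its part of degree \<open>-p\<close>.  That this is free on the generators is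
  proved in \<open>fLie_universal\<close> below.\<close>

inductive_set fLie_pairs :: "(nat \<times> 'n::linorder gen ncps) set" where
  fLie_gen: "g \<in> generators \<Longrightarrow> (gdeg g, letter g) \<in> fLie_pairs"
| fLie_zero: "(p, 0) \<in> fLie_pairs"
| fLie_add: "(p, a) \<in> fLie_pairs \<Longrightarrow> (p, b) \<in> fLie_pairs \<Longrightarrow> (p, a + b) \<in> fLie_pairs"
| fLie_scale: "(p, a) \<in> fLie_pairs \<Longrightarrow> (p, c *\<^sub>R a) \<in> fLie_pairs"
| fLie_br: "(p, a) \<in> fLie_pairs \<Longrightarrow> (q, b) \<in> fLie_pairs \<Longrightarrow> (p + q, gbr p q a b) \<in> fLie_pairs"

definition fLie :: "nat \<Rightarrow> 'n::linorder gen ncps set" where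
  "fLie p = {a. (p, a) \<in> fLie_pairs}"

text \<open>Graded Lie algebras concentrated in nonpositive degrees, \<open>M p\<close> being the part of degree
  \<open>-p\<close>, and their homomorphisms.\<close>

locale graded_lie =
  fixes M :: "nat \<Rightarrow> 'm::real_vector set" and br :: "nat \<Rightarrow> nat \<Rightarrow> 'm \<Rightarrow> 'm \<Rightarrow> 'm"
  assumes subspace: "subspace (M p)"
    and closed: "x \<in> M p \<Longrightarrow> y \<in> M q \<Longrightarrow> br p q x y \<in> M (p + q)"
    and add_left: "x \<in> M p \<Longrightarrow> x' \<in> M p \<Longrightarrow> y \<in> M q \<Longrightarrow> br p q (x + x') y = br p q x y + br p q x' y"
    and add_right: "x \<in> M p \<Longrightarrow> y \<in> M q \<Longrightarrow> y' \<in> M q \<Longrightarrow> br p q x (y + y') = br p q x y + br p q x y'"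
    and scale_left: "x \<in> M p \<Longrightarrow> y \<in> M q \<Longrightarrow> br p q (c *\<^sub>R x) y = c *\<^sub>R br p q x y"
    and scale_right: "x \<in> M p \<Longrightarrow> y \<in> M q \<Longrightarrow> br p q x (c *\<^sub>R y) = c *\<^sub>R br p q x y"
    and antisym: "x \<in> M p \<Longrightarrow> y \<in> M q \<Longrightarrow> br p q x y = (-1) ^ (p * q + 1) *\<^sub>R br q p y x"
    and jacobi: "x \<in> M p \<Longrightarrow> y \<in> M q \<Longrightarrow> z \<in> M r \<Longrightarrow>
      br p (q + r) x (br q r y z) =
        br (p + q) r (br p q x y) z + (-1) ^ (p * q) *\<^sub>R br q (p + r) y (br p r x z)"

definition graded_lie_hom ::
    "(nat \<Rightarrow> 'l::real_vector set) \<Rightarrow> (nat \<Rightarrow> nat \<Rightarrow> 'l \<Rightarrow> 'l \<Rightarrow> 'l) \<Rightarrow>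
     (nat \<Rightarrow> 'm::real_vector set) \<Rightarrow> (nat \<Rightarrow> nat \<Rightarrow> 'm \<Rightarrow> 'm \<Rightarrow> 'm) \<Rightarrow> (nat \<Rightarrow> 'l \<Rightarrow> 'm) \<Rightarrow> bool" where
  "graded_lie_hom L brL M brM \<phi> \<longleftrightarrow>
     (\<forall>p. \<forall>a\<in>L p. \<phi> p a \<in> M p) \<and>
     (\<forall>p c. \<forall>a\<in>L p. \<phi> p (c *\<^sub>R a) = c *\<^sub>R \<phi> p a) \<and>
     (\<forall>p. \<forall>a\<in>L p. \<forall>b\<in>L p. \<phi> p (a + b) = \<phi> p a + \<phi> p b) \<and>
     (\<forall>p q. \<forall>a\<in>L p. \<forall>b\<in>L q. \<phi> (p + q) (brL p q a b) = brM p q (\<phi> p a) (\<phi> q b))"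

lemma fLie_subspace: "subspace (fLie p)"
  by (auto simp: subspace_def fLie_def intro: fLie_pairs.intros)

lemma gbr_bilinear:
  "gbr p q (a + a') b = gbr p q a b + gbr p q a' b"
  "gbr p q a (b + b') = gbr p q a b + gbr p q a b'"
  "gbr p q (c *\<^sub>R a) b = c *\<^sub>R gbr p q a b"
  "gbr p q a (c *\<^sub>R b) = c *\<^sub>R gbr p q a b"
  "gbr p q 0 b = 0" "gbr p q a 0 = 0"
  by (simp_all add: gbr_def algebra_simps)

lemma sign_sq: "(-1) ^ n * ((-1) ^ n * x) = (x::real)"
  by (simp add: mult.assoc[symmetric] power_mult_distrib[symmetric])

theorem fLie_graded_lie: "graded_lie (fLie :: nat \<Rightarrow> 'n::linorder gen ncps set) gbr"
proof
  fix p q r :: nat and x y z :: "'n gen ncps"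
  show "gbr p q x y = (-1) ^ (p * q + 1) *\<^sub>R gbr q p y x"
    by (simp add: gbr_def algebra_simps sign_sq)
  show "gbr p (q + r) x (gbr q r y z) =
        gbr (p + q) r (gbr p q x y) z + (-1) ^ (p * q) *\<^sub>R gbr q (p + r) y (gbr p r x z)"
    by (simp add: gbr_def algebra_simps sign_sq power_add)
qed (auto simp: fLie_subspace gbr_bilinear, auto simp: fLie_def intro: fLie_br)

definition fin_supp :: "'a ncps \<Rightarrow> bool" where
  "fin_supp a \<longleftrightarrow> finite {w. wcoeff a w \<noteq> 0}"

definition lin_ext :: "('a list \<Rightarrow> 'm::real_vector) \<Rightarrow> 'a ncps \<Rightarrow> 'm" where
  "lin_ext h a = (\<Sum>w | wcoeff a w \<noteq> 0. wcoeff a w *\<^sub>R h w)"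

lemma wcoeff_mono [simp]: "wcoeff (mono_nc w) u = (if u = w then 1 else 0)"
  by (simp add: mono_nc_def)

lemma fin_supp_simps [simp]:
  "fin_supp 0" "fin_supp (mono_nc w)"
  "fin_supp a \<Longrightarrow> fin_supp b \<Longrightarrow> fin_supp (a + b)" 
  "fin_supp a \<Longrightarrow> fin_supp b \<Longrightarrow> fin_supp (a - b)" "fin_supp a \<Longrightarrow> fin_supp (c *\<^sub>R a)"
  by (auto simp: fin_supp_def
    intro: finite_subset[of _ "{w. wcoeff a w \<noteq> 0} \<union> {w. wcoeff b w \<noteq> 0}"]
      finite_subset[of _ "{w. wcoeff a w \<noteq> 0}"])

lemma fin_supp_subspace: "subspace {a. fin_supp a}"
  by (auto simp: subspace_def)

lemma wcoeff_sum: "wcoeff (\<Sum>i\<in>I. F i) w = (\<Sum>i\<in>I. wcoeff (F i) w)"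
  by (induction I rule: infinite_finite_induct) auto

lemma fin_supp_expand:
  assumes "fin_supp a"
  shows "a = (\<Sum>w | wcoeff a w \<noteq> 0. wcoeff a w *\<^sub>R mono_nc w)"
proof (rule ncps_eqI)
  fix w
  have "wcoeff (\<Sum>w | wcoeff a w \<noteq> 0. wcoeff a w *\<^sub>R mono_nc w) w =
      (\<Sum>u | wcoeff a u \<noteq> 0. if w = u then wcoeff a u else 0)"
    by (auto simp: wcoeff_sum intro!: sum.cong)
  also have "\<dots> = wcoeff a w"
    using assms by (simp add: fin_supp_def)
  finally show "wcoeff a w = wcoeff (\<Sum>w | wcoeff a w \<noteq> 0. wcoeff a w *\<^sub>R mono_nc w) w" by simp
qed

lemma fin_supp_induct [consumes 1, case_names zero mono add scale]:
  assumes a: "fin_supp a" and P: "P 0" "\<And>w. P (mono_nc w)"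
    "\<And>a b. fin_supp a \<Longrightarrow> fin_supp b \<Longrightarrow> P a \<Longrightarrow> P b \<Longrightarrow> P (a + b)"
    "\<And>a c. fin_supp a \<Longrightarrow> P a \<Longrightarrow> P (c *\<^sub>R a)"
  shows "P a"
proof -
  have "P (\<Sum>w\<in>S. c w *\<^sub>R mono_nc w) \<and> fin_supp (\<Sum>w\<in>S. c w *\<^sub>R mono_nc w)" if "finite S" for S c
    using that by induction (auto intro!: P)
  from this[of "{w. wcoeff a w \<noteq> 0}" "wcoeff a"] fin_supp_expand[OF a] a show ?thesis
    by (simp add: fin_supp_def)
qed

lemma lin_ext_superset:
  "finite S \<Longrightarrow> {w. wcoeff a w \<noteq> 0} \<subseteq> S \<Longrightarrow> lin_ext h a = (\<Sum>w\<in>S. wcoeff a w *\<^sub>R h w)"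
  unfolding lin_ext_def by (rule sum.mono_neutral_left) auto

lemma lin_ext_simps [simp]:
  shows lin_ext_0: "lin_ext h 0 = 0"
    and lin_ext_mono: "lin_ext h (mono_nc w) = h w"
    and lin_ext_add: "fin_supp a \<Longrightarrow> fin_supp b \<Longrightarrow> lin_ext h (a + b) = lin_ext h a + lin_ext h b"
    and lin_ext_scale: "fin_supp a \<Longrightarrow> lin_ext h (c *\<^sub>R a) = c *\<^sub>R lin_ext h a"
proof -
  show "lin_ext h 0 = 0" "lin_ext h (mono_nc w) = h w"
    by (simp_all add: lin_ext_def)
  show "lin_ext h (c *\<^sub>R a) = c *\<^sub>R lin_ext h a" if "fin_supp a"
  proof -
    have "lin_ext h (c *\<^sub>R a) = (\<Sum>w | wcoeff a w \<noteq> 0. wcoeff (c *\<^sub>R a) w *\<^sub>R h w)"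
      using that by (intro lin_ext_superset) (auto simp: fin_supp_def)
    then show ?thesis by (simp add: lin_ext_def scaleR_sum_right)
  qed
  show "lin_ext h (a + b) = lin_ext h a + lin_ext h b" if "fin_supp a" "fin_supp b"
  proof -
    let ?S = "{w. wcoeff a w \<noteq> 0} \<union> {w. wcoeff b w \<noteq> 0}"
    have "finite ?S" using that by (simp add: fin_supp_def)
    then have "lin_ext h c = (\<Sum>w\<in>?S. wcoeff c w *\<^sub>R h w)" if "c \<in> {a, b, a + b}" for c
      using that by (intro lin_ext_superset) auto
    then show ?thesis by (simp add: sum.distrib scaleR_add_left)
  qed
qed

lemma lin_ext_diff:
  "fin_supp a \<Longrightarrow> fin_supp b \<Longrightarrow> lin_ext h (a - b) = lin_ext h a - lin_ext h b"
  using lin_ext_add[of a "(-1) *\<^sub>R b" h] lin_ext_scale[of b h "-1"] fin_supp_simps(5)[of b "-1"] by simp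

lemma mono_nc_mult: "mono_nc u * mono_nc v = mono_nc (u @ v)"
proof (rule ncps_eqI)
  fix w
  have "wcoeff (mono_nc u * mono_nc v) w =
      (\<Sum>k\<le>length w. if k = length u then (if w = u @ v then 1 else 0) else 0)"
    unfolding wcoeff_mult
  proof (rule sum.cong[OF refl])
    fix k assume "k \<in> {..length w}"
    then have "take k w = u \<and> drop k w = v \<longleftrightarrow> k = length u \<and> w = u @ v"
      by (auto simp: min_def)
    then show "wcoeff (mono_nc u) (take k w) * wcoeff (mono_nc v) (drop k w) =
        (if k = length u then (if w = u @ v then 1 else 0) else 0)"
      unfolding wcoeff_mono by (cases "take k w = u"; cases "drop k w = v") simp_all
  qed
  then show "wcoeff (mono_nc u * mono_nc v) w = wcoeff (mono_nc (u @ v)) w"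
    by auto
qed

lemma lin_ext_mult:
  assumes "fin_supp a" "fin_supp b"
  shows "fin_supp (a * b)" "lin_ext h (a * b) = lin_ext (\<lambda>u. lin_ext (\<lambda>v. h (u @ v)) b) a"
proof -
  have 1: "fin_supp (mono_nc u * b) \<and> lin_ext h (mono_nc u * b) = lin_ext (\<lambda>v. h (u @ v)) b" for u
    using assms(2) by (induction rule: fin_supp_induct) (auto simp: mono_nc_mult distrib_left)
  have "fin_supp (a * b) \<and> lin_ext h (a * b) = lin_ext (\<lambda>u. lin_ext (\<lambda>v. h (u @ v)) b) a"
    using assms(1) by (induction rule: fin_supp_induct) (auto simp: 1 distrib_right)
  then show "fin_supp (a * b)" "lin_ext h (a * b) = lin_ext (\<lambda>u. lin_ext (\<lambda>v. h (u @ v)) b) a"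
    by auto
qed

lemma lin_ext_cong: "(\<And>w. wcoeff a w \<noteq> 0 \<Longrightarrow> h w = h' w) \<Longrightarrow> lin_ext h a = lin_ext h' a"
  unfolding lin_ext_def by (auto intro: sum.cong)

definition bihom :: "nat \<Rightarrow> nat \<Rightarrow> 'n gen ncps \<Rightarrow> bool" where
  "bihom p k a \<longleftrightarrow> fin_supp a \<and> (\<forall>w. wcoeff a w \<noteq> 0 \<longrightarrow> wdeg w = p \<and> length w = k)"

lemma wdeg_append: "wdeg (u @ v) = wdeg u + wdeg v"
  by (simp add: wdeg_def)

lemma bihom_mult:
  assumes "bihom p k a" "bihom q l b" shows "bihom (p + q) (k + l) (a * b)"
proof -
  have "wdeg w = p + q \<and> length w = k + l" if "wcoeff (a * b) w \<noteq> 0" for w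
  proof -
    from that obtain i where "i \<le> length w" "wcoeff a (take i w) * wcoeff b (drop i w) \<noteq> 0"
      unfolding wcoeff_mult by (metis (lifting) atMost_iff sum.neutral)
    then have "wdeg (take i w) = p \<and> length (take i w) = k \<and> wdeg (drop i w) = q \<and> length (drop i w) = l"
      using assms by (auto simp: bihom_def)
    then show ?thesis
      using wdeg_append[of "take i w" "drop i w"] \<open>i \<le> length w\<close> by auto
  qed
  moreover have "fin_supp (a * b)" using assms by (intro lin_ext_mult(1)) (simp_all add: bihom_def)
  ultimately show ?thesis unfolding bihom_def by blast
qed

lemma bihom_support:
  assumes "bihom p k a" "bihom p k b" "fin_supp c"
    and "\<And>w. wcoeff a w = 0 \<Longrightarrow> wcoeff b w = 0 \<Longrightarrow> wcoeff c w = 0"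
  shows "bihom p k c"
  unfolding bihom_def
proof (intro conjI allI impI)
  fix w assume "wcoeff c w \<noteq> 0"
  then have "wcoeff a w \<noteq> 0 \<or> wcoeff b w \<noteq> 0" using assms(4) by metis
  then show "wdeg w = p" "length w = k" using assms(1,2) by (auto simp: bihom_def)
qed (fact assms(3))

lemma bihom_lin:
  assumes "bihom p k a"
  shows "bihom p k (c *\<^sub>R a)" and "bihom p k b \<Longrightarrow> bihom p k (a - b)"
proof -
  have fin: "fin_supp x" if "bihom p k x" for x :: "'a gen ncps"
    using that by (simp add: bihom_def)
  show "bihom p k (c *\<^sub>R a)"
    by (rule bihom_support[OF assms assms]) (use fin[OF assms] in simp_all)
  show "bihom p k (a - b)" if b: "bihom p k b"
    by (rule bihom_support[OF assms b]) (use fin[OF assms] fin[OF b] in simp_all)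
qed

lemma bihom_gbr:
  assumes "bihom p k a" "bihom q l b" shows "bihom (p + q) (k + l) (gbr p q a b)"
proof -
  have "bihom (p + q) (k + l) (b * a)"
    using bihom_mult[OF assms(2,1)] by (simp add: add.commute)
  then show ?thesis
    unfolding gbr_def using bihom_lin(2)[OF bihom_mult[OF assms] bihom_lin(1)] by blast
qed

text \<open>The Lie polynomials that are homogeneous also in the word length.\<close>

inductive_set fLie_len :: "(nat \<times> nat \<times> 'n::linorder gen ncps) set" where
  "g \<in> generators \<Longrightarrow> (gdeg g, 1, letter g) \<in> fLie_len"
| "(p, k, a) \<in> fLie_len \<Longrightarrow> (q, l, b) \<in> fLie_len \<Longrightarrow> (p + q, k + l, gbr p q a b) \<in> fLie_len"

lemma fLie_len_bihom: "(p, k, a) \<in> fLie_len \<Longrightarrow> bihom p k a \<and> k > 0"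
  by (induction p k a rule: fLie_len.induct)
    (auto simp: bihom_gbr, auto simp: bihom_def wdeg_def split: if_splits)

lemma fLie_pairs_span: "(p, a) \<in> fLie_pairs \<Longrightarrow> a \<in> span {b. \<exists>k. (p, k, b) \<in> fLie_len}"
proof (induction p a rule: fLie_pairs.induct)
  case (fLie_gen g)
  then show ?case by (auto intro!: span_base exI[of _ 1] fLie_len.intros)
next
  case (fLie_br p a q b)
  let ?S = "span {b. \<exists>k. (p + q, k, b) \<in> fLie_len}"
  have "subspace {b. gbr p q a b \<in> ?S}" "subspace {a. gbr p q a b \<in> ?S}" for a b
    by (auto simp: subspace_def gbr_bilinear span_0 span_add span_scale)
  note sub = this
  have "gbr p q a b \<in> ?S" if "(p, k, a) \<in> fLie_len" for k a
    using fLie_br.IH(2)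
  proof (rule span_induct[OF _ sub(1)])
    show "gbr p q a x \<in> ?S" if "x \<in> {b. \<exists>k. (q, k, b) \<in> fLie_len}" for x
      using that \<open>(p, k, a) \<in> fLie_len\<close> by (auto intro!: span_base fLie_len.intros)
  qed
  then show ?case
    by (intro span_induct[OF fLie_br.IH(1) sub(2)]) auto
qed (auto intro: span_0 span_add span_scale)

locale lie_extension = graded_lie M br for M :: "nat \<Rightarrow> 'm::real_vector set" and br +
  fixes f :: "'n::linorder gen \<Rightarrow> 'm"
  assumes f_in: "f g \<in> M (gdeg g)"
begin

lemma M_simps [simp]: "0 \<in> M p" "x \<in> M p \<Longrightarrow> y \<in> M p \<Longrightarrow> x + y \<in> M p" "x \<in> M p \<Longrightarrow> c *\<^sub>R x \<in> M p"
  using subspace by (auto simp: subspace_def)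

lemma br_0 [simp]: "x \<in> M p \<Longrightarrow> br p q x 0 = 0" "y \<in> M q \<Longrightarrow> br p q 0 y = 0"
  using scale_right[of x p 0 q 0] scale_left[of 0 p y q 0] by auto

fun wact :: "'n gen list \<Rightarrow> nat \<Rightarrow> 'm \<Rightarrow> 'm" where
  "wact [] q m = m"
| "wact (g # w) q m = br (gdeg g) (wdeg w + q) (f g) (wact w q m)"

fun nest :: "'n gen list \<Rightarrow> 'm" where
  "nest [] = 0"
| "nest [g] = f g"
| "nest (g # w) = br (gdeg g) (wdeg w) (f g) (nest w)"

definition phi :: "'n gen ncps \<Rightarrow> 'm" where
  "phi a = lin_ext (\<lambda>w. (1 / real (length w)) *\<^sub>R nest w) a"

definition Act :: "'n gen ncps \<Rightarrow> nat \<Rightarrow> 'm \<Rightarrow> 'm" where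
  "Act a q m = lin_ext (\<lambda>w. wact w q m) a"

lemma wdeg_simps [simp]: "wdeg [] = 0" "wdeg (g # w) = gdeg g + wdeg w"
  by (auto simp: wdeg_def)

lemma wact_in: "m \<in> M q \<Longrightarrow> wact w q m \<in> M (wdeg w + q)"
  by (induction w) (auto simp: add.assoc intro!: closed f_in)

lemma wact_lin:
  "m \<in> M q \<Longrightarrow> m' \<in> M q \<Longrightarrow> wact w q (m + m') = wact w q m + wact w q m'"
  "m \<in> M q \<Longrightarrow> wact w q (c *\<^sub>R m) = c *\<^sub>R wact w q m"
  "wact w q 0 = 0"
  by (induction w) (auto simp: add_right scale_right f_in wact_in)

lemma wact_append: "wact (u @ v) q m = wact u (wdeg v + q) (wact v q m)"
  by (induction u) (auto simp: wdeg_append add.assoc)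

lemma nest_append: "v \<noteq> [] \<Longrightarrow> nest (u @ v) = wact u (wdeg v) (nest v)"
proof (induction u)
  case (Cons g u)
  then obtain h w where "u @ v = h # w" by (cases "u @ v") auto
  with Cons show ?case using wdeg_append[of u v] by (metis append_Cons nest.simps(3) wact.simps(2))
qed auto

lemma nest_in: "nest w \<in> M (wdeg w)"
proof (induction w rule: nest.induct)
  case (2 g)
  then show ?case using f_in[of g] by simp
next
  case (3 g v w)
  then show ?case using closed[OF f_in[of g], of "nest (v # w)" "wdeg (v # w)"] by simp
qed simp

lemma sum_lin_in: "(\<And>w. w \<in> S \<Longrightarrow> h w \<in> M p) \<Longrightarrow> (\<Sum>w\<in>S. c w *\<^sub>R h w) \<in> M p"
  by (induction S rule: infinite_finite_induct) auto

lemma wact_sum: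
  "(\<And>w. w \<in> S \<Longrightarrow> h w \<in> M q) \<Longrightarrow> wact u q (\<Sum>w\<in>S. c w *\<^sub>R h w) = (\<Sum>w\<in>S. c w *\<^sub>R wact u q (h w))"
  by (induction S rule: infinite_finite_induct) (auto simp: wact_lin sum_lin_in)

lemma lin_ext_in: "(\<And>w. wcoeff a w \<noteq> 0 \<Longrightarrow> h w \<in> M p) \<Longrightarrow> lin_ext h a \<in> M p"
  unfolding lin_ext_def by (rule sum_lin_in) auto

lemma wact_lin_ext:
  "(\<And>w. wcoeff a w \<noteq> 0 \<Longrightarrow> h w \<in> M q) \<Longrightarrow> wact u q (lin_ext h a) = lin_ext (\<lambda>w. wact u q (h w)) a"
  unfolding lin_ext_def by (rule wact_sum) auto

lemma nest_mult:
  assumes "fin_supp a" "bihom q l b" "l > 0"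
  shows "lin_ext nest (a * b) = Act a q (lin_ext nest b)"
proof -
  have "lin_ext (\<lambda>v. nest (u @ v)) b = wact u q (lin_ext nest b)" for u
  proof -
    have "lin_ext (\<lambda>v. nest (u @ v)) b = lin_ext (\<lambda>v. wact u q (nest v)) b"
      using assms by (intro lin_ext_cong) (auto simp: bihom_def nest_append)
    also have "\<dots> = wact u q (lin_ext nest b)"
      using assms nest_in by (intro wact_lin_ext[symmetric]) (auto simp: bihom_def)
    finally show ?thesis .
  qed
  then show ?thesis
    using assms by (simp add: lin_ext_mult(2) Act_def bihom_def)
qed

lemma Act_mult:
  assumes "fin_supp a" "bihom q l b" "m \<in> M r"
  shows "Act (a * b) r m = Act a (q + r) (Act b r m)"
proof -
  have "lin_ext (\<lambda>v. wact (u @ v) r m) b = wact u (q + r) (lin_ext (\<lambda>v. wact v r m) b)" for u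
  proof -
    have "lin_ext (\<lambda>v. wact (u @ v) r m) b = lin_ext (\<lambda>v. wact u (q + r) (wact v r m)) b"
      using assms by (intro lin_ext_cong) (auto simp: bihom_def wact_append)
    also have "\<dots> = wact u (q + r) (lin_ext (\<lambda>v. wact v r m) b)"
      using assms wact_in[of m r] by (intro wact_lin_ext[symmetric]) (auto simp: bihom_def)
    finally show ?thesis .
  qed
  then show ?thesis
    using assms by (simp add: lin_ext_mult(2) Act_def bihom_def)
qed

lemma phi_bihom:
  assumes "bihom p k a" "k > 0" shows "lin_ext nest a = real k *\<^sub>R phi a"
  unfolding phi_def lin_ext_def scaleR_sum_right
proof (rule sum.cong[OF refl])
  fix w assume "w \<in> {w. wcoeff a w \<noteq> 0}"
  then have "length w = k" using assms by (simp add: bihom_def)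
  then show "wcoeff a w *\<^sub>R nest w = real k *\<^sub>R wcoeff a w *\<^sub>R (1 / real (length w)) *\<^sub>R nest w"
    using assms(2) by simp
qed

lemma phi_key:
  "(p, k, a) \<in> fLie_len \<Longrightarrow> phi a \<in> M p \<and> (\<forall>q. \<forall>m\<in>M q. Act a q m = br p q (phi a) m)"
  "(p, k, a) \<in> fLie_len \<Longrightarrow> (q, l, b) \<in> fLie_len \<Longrightarrow> phi (gbr p q a b) = br p q (phi a) (phi b)"
proof -
  have br_eq: "phi (gbr p q a b) = br p q (phi a) (phi b)"
    if a: "(p, k, a) \<in> fLie_len" "phi a \<in> M p" "\<forall>q. \<forall>m\<in>M q. Act a q m = br p q (phi a) m"
    and b: "(q, l, b) \<in> fLie_len" "phi b \<in> M q" "\<forall>p. \<forall>m\<in>M p. Act b p m = br q p (phi b) m"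
    for p k a q l b
  proof -
    note ha = fLie_len_bihom[OF a(1)] and hb = fLie_len_bihom[OF b(1)]
    have fin: "fin_supp a" "fin_supp b" using ha hb by (auto simp: bihom_def)
    have "real (k + l) *\<^sub>R phi (gbr p q a b) = lin_ext nest (gbr p q a b)"
      using phi_bihom[OF bihom_gbr[of p k a q l b]] ha hb by simp
    also have "\<dots> = lin_ext nest (a * b) - (-1) ^ (p * q) *\<^sub>R lin_ext nest (b * a)"
      unfolding gbr_def using fin by (simp add: lin_ext_diff lin_ext_mult(1))
    also have "\<dots> = Act a q (real l *\<^sub>R phi b) - (-1) ^ (p * q) *\<^sub>R Act b p (real k *\<^sub>R phi a)"
      using nest_mult[OF fin(1), of q l b] nest_mult[OF fin(2), of p k a] ha hb
        phi_bihom[of p k a] phi_bihom[of q l b] by simp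
    also have "\<dots> = real l *\<^sub>R br p q (phi a) (phi b) - (-1) ^ (p * q) *\<^sub>R real k *\<^sub>R br q p (phi b) (phi a)"
      using a b by (simp add: scale_right)
    also have "\<dots> = real (k + l) *\<^sub>R br p q (phi a) (phi b)"
      using antisym[OF a(2) b(2)] by (simp add: algebra_simps)
    finally show ?thesis using ha by simp
  qed
  have key: "phi a \<in> M p \<and> (\<forall>q. \<forall>m\<in>M q. Act a q m = br p q (phi a) m)" if "(p, k, a) \<in> fLie_len" for p k a
    using that
  proof (induction p k a rule: fLie_len.induct)
    case (1 g)
    show ?case using f_in by (auto simp: phi_def Act_def)
  next
    case (2 p k a q l b)
    note ha = fLie_len_bihom[OF 2(1)] and hb = fLie_len_bihom[OF 2(2)]
    have fin: "fin_supp a" "fin_supp b" using ha hb by (auto simp: bihom_def)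
    have e: "phi (gbr p q a b) = br p q (phi a) (phi b)"
      using br_eq 2 by blast
    have "Act (gbr p q a b) r m = br (p + q) r (br p q (phi a) (phi b)) m" if m: "m \<in> M r" for r m
    proof -
      have "Act (gbr p q a b) r m = Act (a * b) r m - (-1) ^ (p * q) *\<^sub>R Act (b * a) r m"
        unfolding gbr_def Act_def using fin by (simp add: lin_ext_diff lin_ext_mult(1))
      also have "\<dots> = Act a (q + r) (Act b r m) - (-1) ^ (p * q) *\<^sub>R Act b (p + r) (Act a r m)"
        using ha hb m Act_mult[OF fin(1), of q l b m r] Act_mult[OF fin(2), of p k a m r] by simp
      also have "\<dots> = br p (q + r) (phi a) (br q r (phi b) m)
          - (-1) ^ (p * q) *\<^sub>R br q (p + r) (phi b) (br p r (phi a) m)"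
        using 2 m closed by simp
      also have "\<dots> = br (p + q) r (br p q (phi a) (phi b)) m"
        using jacobi[of "phi a" p "phi b" q m r] 2 m by simp
      finally show ?thesis .
    qed
    then show ?case using e 2 closed by simp
  qed
  from key show "(p, k, a) \<in> fLie_len \<Longrightarrow> phi a \<in> M p \<and> (\<forall>q. \<forall>m\<in>M q. Act a q m = br p q (phi a) m)" .
  show "(p, k, a) \<in> fLie_len \<Longrightarrow> (q, l, b) \<in> fLie_len \<Longrightarrow> phi (gbr p q a b) = br p q (phi a) (phi b)"
    using br_eq key by blast
qed

lemma fin_gbr: "fin_supp a \<Longrightarrow> fin_supp b \<Longrightarrow> fin_supp (gbr p q a b)"
  by (simp add: gbr_def lin_ext_mult(1))

lemma phi_lin [simp]:
  "phi 0 = 0" "fin_supp a \<Longrightarrow> fin_supp b \<Longrightarrow> phi (a + b) = phi a + phi b"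
  "fin_supp a \<Longrightarrow> phi (c *\<^sub>R a) = c *\<^sub>R phi a"
  by (auto simp: phi_def)

lemma fLie_phi: "a \<in> fLie p \<Longrightarrow> fin_supp a \<and> phi a \<in> M p"
proof -
  assume "a \<in> fLie p"
  then have "a \<in> span {b. \<exists>k. (p, k, b) \<in> fLie_len}" by (simp add: fLie_def fLie_pairs_span)
  then show ?thesis
  proof (rule span_induct)
    show "subspace {a. fin_supp a \<and> phi a \<in> M p}" by (auto simp: subspace_def)
  qed (use phi_key(1) fLie_len_bihom in \<open>fastforce simp: bihom_def\<close>)
qed

lemma phi_br:
  assumes "a \<in> fLie p" "b \<in> fLie q"
  shows "phi (gbr p q a b) = br p q (phi a) (phi b)"
proof -
  let ?A = "\<lambda>p. {b. \<exists>k. (p, k, b) \<in> fLie_len}"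
  define good where "good p a \<longleftrightarrow> fin_supp a \<and> phi a \<in> M p" for p a
  have base: "good p a" if "a \<in> ?A p" for p a
    using that phi_key(1) fLie_len_bihom by (fastforce simp: bihom_def good_def)
  have sp: "x \<in> span (?A p)" if "x \<in> fLie p" for x p
    using that by (simp add: fLie_def fLie_pairs_span)
  have "good q b \<and> phi (gbr p q a b) = br p q (phi a) (phi b)" if a: "a \<in> ?A p" for a
    using sp[OF assms(2)]
  proof (rule span_induct)
    show "subspace {b. good q b \<and> phi (gbr p q a b) = br p q (phi a) (phi b)}"
      using base[OF a]
      by (auto simp: subspace_def good_def gbr_bilinear fin_gbr add_right scale_right)
  qed (use a base phi_key(2) in blast)
  note 1 = this
  have gb: "good q b" using fLie_phi assms by (simp add: good_def)
  have "good p a \<and> phi (gbr p q a b) = br p q (phi a) (phi b)"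
    using sp[OF assms(1)]
  proof (rule span_induct)
    show "subspace {a. good p a \<and> phi (gbr p q a b) = br p q (phi a) (phi b)}"
      using gb
      by (auto simp: subspace_def good_def gbr_bilinear fin_gbr add_left scale_left)
  qed (use 1 base in blast)
  then show ?thesis by blast
qed

end

theorem fLie_universal:
  fixes f :: "'n::linorder gen \<Rightarrow> 'm::real_vector" and \<phi> \<psi> :: "nat \<Rightarrow> 'n gen ncps \<Rightarrow> 'm"
  assumes "graded_lie M br" and f: "\<forall>g\<in>generators. f g \<in> M (gdeg g)"
  shows "\<exists>\<phi>. graded_lie_hom (fLie :: nat \<Rightarrow> 'n gen ncps set) gbr M br \<phi> \<and>
      (\<forall>g\<in>generators. \<phi> (gdeg g) (letter g) = f g)"
    and "graded_lie_hom fLie gbr M br \<phi> \<Longrightarrow> graded_lie_hom fLie gbr M br \<psi> \<Longrightarrow>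
      (\<forall>g\<in>generators. \<phi> (gdeg g) (letter g) = \<psi> (gdeg g) (letter g)) \<Longrightarrow> a \<in> fLie p \<Longrightarrow> \<phi> p a = \<psi> p a"
proof -
  interpret graded_lie M br by fact
  let ?f = "\<lambda>g. if g \<in> generators then f g else 0"
  interpret E: lie_extension M br ?f
    using f subspace by unfold_locales (auto simp: subspace_def)
  have "graded_lie_hom fLie gbr M br (\<lambda>p. E.phi)"
    unfolding graded_lie_hom_def using E.fLie_phi E.phi_br by auto
  moreover have "E.phi (letter g) = f g" if "g \<in> generators" for g
    using that by (simp add: E.phi_def)
  ultimately show "\<exists>\<phi>. graded_lie_hom fLie gbr M br \<phi> \<and> (\<forall>g\<in>generators. \<phi> (gdeg g) (letter g) = f g)"
    by blast
  assume h: "graded_lie_hom fLie gbr M br \<phi>" "graded_lie_hom fLie gbr M br \<psi>"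
    "\<forall>g\<in>generators. \<phi> (gdeg g) (letter g) = \<psi> (gdeg g) (letter g)" and a: "a \<in> fLie p"
  have "(p, a) \<in> fLie_pairs \<Longrightarrow> \<phi> p a = \<psi> p a"
  proof (induction p a rule: fLie_pairs.induct)
    case (fLie_zero p)
    have z: "(0::'n gen ncps) \<in> fLie p" by (simp add: fLie_def fLie_pairs.intros)
    have "X p 0 = 0" if "graded_lie_hom fLie gbr M br X" for X :: "nat \<Rightarrow> 'n gen ncps \<Rightarrow> 'm"
    proof -
      have "\<forall>c. X p (c *\<^sub>R 0) = c *\<^sub>R X p 0"
        using that z unfolding graded_lie_hom_def by blast
      from this[rule_format, of 0] show ?thesis by simp
    qed
    from this[OF h(1)] this[OF h(2)] show ?case by simp
  qed (use h in \<open>simp_all add: graded_lie_hom_def fLie_def\<close>)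
  with a show "\<phi> p a = \<psi> p a" by (simp add: fLie_def)
qed

lemma mono_nc_Nil: "mono_nc [] = 1"
  by (auto simp: ncps_eq_iff)

lemma mono_nc_Cons: "mono_nc (x # w) = letter x * mono_nc w"
  by (simp add: mono_nc_mult)


section \<open>The differential\<close>

text \<open>The differential: the graded derivation of degree 1 with \<open>d Z_i = 0\<close> and
  \<open>d Z_ij = [Z_i, Z_j]\<close>, first on words, then extended linearly and continuously.  It preserves the
  weight, and there are finitely many words of a given weight.\<close>

fun d_word :: "'n gen list \<Rightarrow> 'n gen ncps" where
  "d_word [] = 0"
| "d_word (Z i # w) = letter (Z i) * d_word w"
| "d_word (ZZ i j # w) =
     gbr 0 0 (letter (Z i)) (letter (Z j)) * mono_nc w - letter (ZZ i j) * d_word w"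

lemma d_word_append:
  "d_word (u @ v) = d_word u * mono_nc v + (-1) ^ wdeg u *\<^sub>R (mono_nc u * d_word v)"
proof (induction u rule: d_word.induct)
  case (2 i w)
  then show ?case
    using mono_nc_Cons[of "Z i" w] by (simp add: wdeg_def distrib_left mult.assoc)
next
  case (3 i j w)
  then show ?case
    using mono_nc_Cons[of "ZZ i j" w] mono_nc_mult[of w v, symmetric]
    by (simp add: wdeg_def algebra_simps)
qed (simp add: mono_nc_Nil wdeg_def)

definition dd :: "'n::finite gen ncps \<Rightarrow> 'n gen ncps" where
  "dd a = Ncps (\<lambda>w. \<Sum>u | weight u = weight w. wcoeff a u * wcoeff (d_word u) w)"


section \<open>The completed free crossed module\<close>

definition homog :: "nat \<Rightarrow> 'n gen ncps \<Rightarrow> 'n gen ncps" where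
  "homog k a = Ncps (\<lambda>w. if weight w = k then wcoeff a w else 0)"

definition wcompletion :: "'n gen ncps set \<Rightarrow> 'n gen ncps set" where
  "wcompletion V = {a. \<forall>k. homog k a \<in> V}"

definition g0bar :: "'n::{finite,linorder} gen ncps set" where
  "g0bar = wcompletion (fLie 0)"

definition f1bar :: "'n::{finite,linorder} gen ncps set" where
  "f1bar = wcompletion (fLie 1)"

definition peiffer :: "'n::{finite,linorder} gen ncps set" where
  "peiffer = dd ` span {gbr 1 1 a b | a b. a \<in> fLie 1 \<and> b \<in> fLie 1}"

definition peiffer_rel :: "('n::{finite,linorder} gen ncps \<times> 'n gen ncps) set" where
  "peiffer_rel = {(a, b). a \<in> f1bar \<and> b \<in> f1bar \<and> a - b \<in> wcompletion peiffer}"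

text \<open>The product over all weights of the homogeneous components of \<open>f\<^sup>-\<^sup>1 / d[f\<^sup>-\<^sup>1, f\<^sup>-\<^sup>1]\<close>, as the
  quotient of the corresponding products.\<close>

definition gm1bar :: "'n::{finite,linorder} gen ncps set set" where
  "gm1bar = f1bar // peiffer_rel"

definition cls :: "'n::{finite,linorder} gen ncps \<Rightarrow> 'n gen ncps set" where
  "cls a = peiffer_rel `` {a}"

definition tau :: "'n::{finite,linorder} gen ncps set \<Rightarrow> 'n gen ncps" where
  "tau A = the_elem (dd ` A)"

text \<open>Elements of degree 0 act on all elements by the ordinary commutator, which is \<open>gbr 0 p\<close>.\<close>

definition act :: "'a ncps \<Rightarrow> 'a ncps \<Rightarrow> 'a ncps" where
  "act x y = gbr 0 1 x y"

definition exp_act :: "'a ncps \<Rightarrow> 'a ncps \<Rightarrow> 'a ncps" where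
  "exp_act x y = op_series (\<lambda>m. 1 / fact m) (act x) y"

definition exp_act_q :: "'n::{finite,linorder} gen ncps \<Rightarrow> 'n gen ncps set \<Rightarrow> 'n gen ncps set" where
  "exp_act_q x A = (\<Union>y\<in>A. cls (exp_act x y))"

definition derived_br :: "'n::finite gen ncps \<Rightarrow> 'n gen ncps \<Rightarrow> 'n gen ncps" where
  "derived_br x y = gbr 0 1 (dd x) y"

text \<open>The power series of \<open>z / (1 - exp (-z))\<close>, applied to \<open>ad x\<close> for the derived bracket.\<close>

definition todd :: "'n::finite gen ncps \<Rightarrow> 'n gen ncps \<Rightarrow> 'n gen ncps" where
  "todd x k = op_series (fps_nth (fps_X / (1 - fps_exp (-1)))) (derived_br x) k"

lemma todd_series: "(1 - fps_exp (-1)) * (fps_X / (1 - fps_exp (-1))) = (fps_X :: real fps)"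
proof -
  let ?E = "1 - fps_exp (-1) :: real fps"
  have n1: "fps_nth ?E 1 = 1" and n0: "fps_nth ?E 0 = 0" by (simp_all add: fact_numeral)
  have sd: "subdegree ?E = 1" by (rule subdegreeI) (use n1 n0 in auto)
  have "?E dvd fps_X" using n1 sd by (subst fps_dvd_iff) auto
  then show "?E * (fps_X / ?E) = fps_X" by (rule dvd_mult_div_cancel)
qed

definition todd_q :: "'n::{finite,linorder} gen ncps set \<Rightarrow> 'n gen ncps set \<Rightarrow> 'n gen ncps set" where
  "todd_q A B = (\<Union>x\<in>A. \<Union>k\<in>B. cls (todd x k))"

text \<open>The Baker--Campbell--Hausdorff series in Dynkin's form: in \<open>log (exp x * exp y)\<close>, computed in
  free associative variables (\<open>True\<close> for \<open>x\<close>, \<open>False\<close> for \<open>y\<close>), every word of length \<open>m > 0\<close> is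
  replaced by the corresponding right-nested bracket divided by \<open>m\<close>.\<close>

definition bch_coeff :: "bool list \<Rightarrow> real" where
  "bch_coeff w = wcoeff (nc_log (nc_exp (letter True) * nc_exp (letter False))) w / real (length w)"

fun nested_br :: "('b \<Rightarrow> 'b \<Rightarrow> 'b::zero) \<Rightarrow> 'b \<Rightarrow> 'b \<Rightarrow> bool list \<Rightarrow> 'b" where
  "nested_br br x y [] = 0"
| "nested_br br x y [b] = (if b then x else y)"
| "nested_br br x y (b # w) = br (if b then x else y) (nested_br br x y w)"

definition bch :: "'n::finite gen ncps \<Rightarrow> 'n gen ncps \<Rightarrow> 'n gen ncps" where
  "bch x y = Ncps (\<lambda>v. \<Sum>m. \<Sum>w | length w = m. bch_coeff w * wcoeff (nested_br derived_br x y w) v)"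

definition BCH :: "'n::{finite,linorder} gen ncps set \<Rightarrow> 'n gen ncps set \<Rightarrow> 'n gen ncps set" where
  "BCH A B = (\<Union>x\<in>A. \<Union>y\<in>B. cls (bch x y))"


section \<open>Paths, thin homotopy and rectangles\<close>

primrec Ck :: "nat \<Rightarrow> ('a::real_normed_vector \<Rightarrow> 'b::real_normed_vector) \<Rightarrow> bool" where
  "Ck 0 f = continuous_on UNIV f"
| "Ck (Suc k) f = ((\<forall>x. f differentiable at x) \<and> (\<forall>v. Ck k (\<lambda>x. frechet_derivative f (at x) v)))"

definition smooth :: "('a::real_normed_vector \<Rightarrow> 'b::real_normed_vector) \<Rightarrow> bool" where
  "smooth f \<longleftrightarrow> (\<forall>k. Ck k f)"

definition mesh :: "real set \<Rightarrow> bool" where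
  "mesh K \<longleftrightarrow> finite K \<and> 0 \<in> K \<and> 1 \<in> K \<and> K \<subseteq> {0..1}"

definition cells :: "real set \<Rightarrow> (real \<times> real) set" where
  "cells K = {(a, b). a \<in> K \<and> b \<in> K \<and> a < b \<and> {a<..<b} \<inter> K = {}}"

text \<open>Paths are parametrised by \<open>{0..1}\<close>, as in the library.\<close>

definition piecewise_smooth :: "(real \<Rightarrow> real \<times> real) \<Rightarrow> bool" where
  "piecewise_smooth \<gamma> \<longleftrightarrow> path \<gamma> \<and>
     (\<exists>K. mesh K \<and> (\<forall>(a, b)\<in>cells K. \<exists>f. smooth f \<and> (\<forall>s\<in>{a..b}. \<gamma> s = f s)))"

text \<open>A thin homotopy is a piecewise smooth homotopy relative to the end points whose differential
  has rank at most 1.\<close>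

definition thin_homotopy ::
    "(real \<Rightarrow> real \<times> real) \<Rightarrow> (real \<Rightarrow> real \<times> real) \<Rightarrow> (real \<times> real \<Rightarrow> real \<times> real) \<Rightarrow> bool" where
  "thin_homotopy \<gamma> \<gamma>' h \<longleftrightarrow>
     continuous_on ({0..1} \<times> {0..1}) h \<and>
     (\<forall>t\<in>{0..1}. h (0, t) = \<gamma> t \<and> h (1, t) = \<gamma>' t) \<and>
     (\<forall>s\<in>{0..1}. h (s, 0) = pathstart \<gamma> \<and> h (s, 1) = pathfinish \<gamma>) \<and>
     (\<exists>K L. mesh K \<and> mesh L \<and>
        (\<forall>(a, b)\<in>cells K. \<forall>(a', b')\<in>cells L.
           (\<exists>f. smooth f \<and> (\<forall>p\<in>{a..b} \<times> {a'..b'}. h p = f p)) \<and>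
           (\<forall>p\<in>{a<..<b} \<times> {a'<..<b'}. dim (range (frechet_derivative h (at p))) \<le> 1)))"

definition thin_rel :: "((real \<Rightarrow> real \<times> real) \<times> (real \<Rightarrow> real \<times> real)) set" where
  "thin_rel = {(\<gamma>, \<gamma>'). piecewise_smooth \<gamma> \<and> piecewise_smooth \<gamma>' \<and> (\<exists>h. thin_homotopy \<gamma> \<gamma>' h)}"

definition Paths2 :: "(real \<Rightarrow> real \<times> real) set set" where
  "Paths2 = Collect piecewise_smooth // thin_rel"

definition pclass :: "(real \<Rightarrow> real \<times> real) \<Rightarrow> (real \<Rightarrow> real \<times> real) set" where
  "pclass \<gamma> = thin_rel `` {\<gamma>}"

text \<open>A rectangle is given by its bottom-left and its top-right corner.\<close>

type_synonym rect = "(real \<times> real) \<times> (real \<times> real)"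

definition Rect :: "rect set" where
  "Rect = {((v1, v2), (s1, s2)) | v1 v2 s1 s2. v1 \<le> s1 \<and> v2 \<le> s2}"

fun bottom_edge :: "rect \<Rightarrow> real \<Rightarrow> real \<times> real" where
  "bottom_edge ((v1, v2), (s1, s2)) = linepath (v1, v2) (s1, v2)"

fun top_edge :: "rect \<Rightarrow> real \<Rightarrow> real \<times> real" where
  "top_edge ((v1, v2), (s1, s2)) = linepath (v1, s2) (s1, s2)"

fun left_edge :: "rect \<Rightarrow> real \<Rightarrow> real \<times> real" where
  "left_edge ((v1, v2), (s1, s2)) = linepath (v1, v2) (v1, s2)"

fun right_edge :: "rect \<Rightarrow> real \<Rightarrow> real \<times> real" where
  "right_edge ((v1, v2), (s1, s2)) = linepath (s1, v2) (s1, s2)"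

definition boundary_path :: "rect \<Rightarrow> real \<Rightarrow> real \<times> real" where
  "boundary_path R = bottom_edge R +++ right_edge R +++ reversepath (top_edge R) +++
     reversepath (left_edge R)"

definition hcomposable :: "rect \<Rightarrow> rect \<Rightarrow> bool" where
  "hcomposable A B \<longleftrightarrow> right_edge A = left_edge B"

definition vcomposable :: "rect \<Rightarrow> rect \<Rightarrow> bool" where
  "vcomposable A B \<longleftrightarrow> top_edge A = bottom_edge B"

text \<open>The horizontal composite of \<open>A\<close> and \<open>B\<close> (\<open>B\<close> to the right of \<open>A\<close>) and the vertical one
  (\<open>B\<close> on top of \<open>A\<close>) both run from the bottom-left corner of \<open>A\<close> to the top-right corner of \<open>B\<close>.\<close>

definition compose_rect :: "rect \<Rightarrow> rect \<Rightarrow> rect" where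
  "compose_rect A B = (fst A, snd B)"


section \<open>The logarithm of the path signature\<close>

text \<open>The equation \<open>dS = S (\<Sum>i. Z_i d\<eta>_i)\<close>, \<open>S 0 = 1\<close> in integrated form, coefficient by
  coefficient; the case \<open>t = 0\<close> is the initial condition.\<close>

definition signature_eq :: "(real \<Rightarrow> real ^ 'n::finite) \<Rightarrow> (real \<Rightarrow> 'n gen ncps) \<Rightarrow> bool" where
  "signature_eq \<eta> S \<longleftrightarrow> (\<forall>t\<in>{0..1}. \<forall>w.
     ((\<lambda>s. wcoeff (S s * (\<Sum>i\<in>UNIV. (vector_derivative \<eta> (at s) $ i) *\<^sub>R letter (Z i))) w)
        has_integral (wcoeff (S t) w - wcoeff 1 w)) {0..t})"

definition path_signature :: "(real \<Rightarrow> real ^ 'n::finite) \<Rightarrow> 'n gen ncps" where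
  "path_signature \<eta> = (THE s. \<exists>S. signature_eq \<eta> S \<and> S 1 = s)"

definition omega ::
    "(real \<times> real \<Rightarrow> real ^ 'n::{finite,linorder}) \<Rightarrow> (real \<Rightarrow> real \<times> real) set \<Rightarrow> 'n gen ncps" where
  "omega X C = the_elem ((\<lambda>\<gamma>. nc_log (path_signature (X \<circ> \<gamma>))) ` C)"


section \<open>The surface Magnus expansion\<close>

definition jac :: "(real \<times> real \<Rightarrow> real ^ 'n::finite) \<Rightarrow> 'n \<Rightarrow> 'n \<Rightarrow> real \<times> real \<Rightarrow> real" where
  "jac X i j p =
     (frechet_derivative X (at p) (1, 0) $ i) * (frechet_derivative X (at p) (0, 1) $ j) -
     (frechet_derivative X (at p) (1, 0) $ j) * (frechet_derivative X (at p) (0, 1) $ i)"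

definition beta :: "(real \<times> real \<Rightarrow> real ^ 'n::{finite,linorder}) \<Rightarrow> real \<times> real \<Rightarrow> 'n gen ncps" where
  "beta X p = (\<Sum>(i, j) | i < j. jac X i j p *\<^sub>R letter (ZZ i j))"

definition tail_path :: "real \<Rightarrow> real \<Rightarrow> real \<Rightarrow> real \<Rightarrow> real \<Rightarrow> real \<times> real" where
  "tail_path v1 v2 r t = linepath (v1, v2) (v1, t) +++ linepath (v1, t) (r, t)"

definition Kint :: "(real \<times> real \<Rightarrow> real ^ 'n::{finite,linorder}) \<Rightarrow> real \<Rightarrow> real \<Rightarrow> real \<Rightarrow> real
    \<Rightarrow> 'n gen ncps set" where
  "Kint X v1 v2 s1 t = cls (Ncps (\<lambda>w. integral {v1..s1}
     (\<lambda>r. wcoeff (exp_act (omega X (pclass (tail_path v1 v2 r t))) (beta X (r, t))) w)))"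

text \<open>A curve in the quotient has derivative \<open>D\<close> iff it lifts to a curve whose coefficients are
  differentiable with derivatives representing \<open>D\<close>; homogeneous components being
  finite-dimensional, this is differentiability in every component of the product.\<close>

definition has_quotient_derivative ::
    "(real \<Rightarrow> 'n gen ncps set) \<Rightarrow> 'n gen ncps set \<Rightarrow> real \<Rightarrow> real set \<Rightarrow> bool" where
  "has_quotient_derivative Om D t T \<longleftrightarrow> (\<exists>f f'. f' \<in> D \<and> (\<forall>s\<in>T. f s \<in> Om s) \<and>
     (\<forall>w. ((\<lambda>s. wcoeff (f s) w) has_real_derivative wcoeff f' w) (at t within T)))"

definition magnus_eq :: "(real \<times> real \<Rightarrow> real ^ 'n::{finite,linorder}) \<Rightarrow> real \<Rightarrow> real \<Rightarrow> real
    \<Rightarrow> (real \<Rightarrow> 'n gen ncps set) \<Rightarrow> bool" where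
  "magnus_eq X v1 v2 s1 Om \<longleftrightarrow> Om v2 = cls 0 \<and>
     (\<forall>t\<ge>v2. Om t \<in> gm1bar \<and>
        has_quotient_derivative Om (todd_q (Om t) (Kint X v1 v2 s1 t)) t {v2..})"

fun Omega :: "(real \<times> real \<Rightarrow> real ^ 'n::{finite,linorder}) \<Rightarrow> rect \<Rightarrow> 'n gen ncps set" where
  "Omega X ((v1, v2), (s1, s2)) = (THE A. \<exists>Om. magnus_eq X v1 v2 s1 Om \<and> Om s2 = A)"

end

theory Submission
  imports Defs
begin

text \<open>Let \<open>H(t)\<close> be the signature of the boundary of the rectangle up to height \<open>t\<close>.  The non-abelian
  Stokes theorem says \<open>H' = H (d K)\<close>, so \<open>\<omega> = log H\<close> solves the Magnus equation \<open>\<omega>' = todd (ad \<omega>) (d K)\<close>.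
  The derived bracket depends on its left argument only through \<open>d\<close>, so the surface Magnus
  expansion is simply the integral of \<open>todd (ad \<omega>) K\<close>, and \<open>\<tau>\<close> of it is \<open>\<omega>\<close>.

  For the composition laws the crossed module is embedded into the degree \<open>-1\<close> part of the free
  associative dg algebra modulo boundaries, which is an associative algebra for
  \<open>x * y = dx y = x dy\<close>.  There the exponential of the expansion is one plus the integral of \<open>H K\<close>, and
  both laws become elementary identities between such integrals.  The embedding is injective because
  the weighted Dynkin operator commutes with \<open>d\<close>.\<close>


section \<open>Operator series\<close>

text \<open>The obstacle is the quotient. A solution of the Magnus equation is a curve of classes,
  and \<open>has_quotient_derivative\<close> allows a different lift at every time, so no single
  lift is known to be differentiable. Applying \<open>dd\<close> removes the ambiguity: it kills
  boundaries, so \<open>tau\<close> of a solution is a differentiable curve fixed by a linear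
  equation. The rest happens modulo a subspace: weight components are finite-dimensional, so
  functionals vanishing on the subspace reduce each claim to real functions with derivative zero.
  Convergence never enters, because every operator series raises the word length and each
  coefficient is a finite sum. That \<open>omega\<close> is constant on thin homotopy classes, as
  \<open>the_elem\<close> requires, is the Stokes theorem with zero curvature, cell by cell. That
  logarithms of signatures are Lie series comes from the Magnus equation by induction on the weight,
  and the same argument for exp(x) exp(ty) leads to Dynkin's form of the BCH series. In the algebra
  of the crossed module the power with m + 1 factors is (dx)^m x; this is why (e^z - 1)/z
  occurs.\<close>

definition ordge :: "nat \<Rightarrow> 'a ncps \<Rightarrow> bool" where
  "ordge n a \<longleftrightarrow> (\<forall>w. length w < n \<longrightarrow> wcoeff a w = 0)"

lemma ordge_simps [simp, intro]:
  "ordge n 0" "ordge 0 a" "ordge n a \<Longrightarrow> ordge n b \<Longrightarrow> ordge n (a + b)"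
  "ordge n a \<Longrightarrow> ordge n b \<Longrightarrow> ordge n (a - b)" "ordge n a \<Longrightarrow> ordge n (- a)"
  "ordge n a \<Longrightarrow> ordge n (c *\<^sub>R a)"
  by (simp_all add: ordge_def)

lemma ordge_sum [intro]: "(\<And>i. i \<in> I \<Longrightarrow> ordge n (F i)) \<Longrightarrow> ordge n (sum F I)"
  by (induction I rule: infinite_finite_induct) auto

lemma ordge_mono: "ordge n a \<Longrightarrow> m \<le> n \<Longrightarrow> ordge m a"
  by (simp add: ordge_def)

lemma ordge_mult: "ordge m a \<Longrightarrow> ordge n b \<Longrightarrow> ordge (m + n) (a * b)"
proof -
  assume ab: "ordge m a" "ordge n b"
  have "wcoeff a (take k w) * wcoeff b (drop k w) = 0" if "length w < m + n" "k \<le> length w" for k w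
  proof (cases "k < m")
    case True
    then show ?thesis using ab(1) that by (simp add: ordge_def)
  next
    case False
    then show ?thesis using ab(2) that by (simp add: ordge_def)
  qed
  then show ?thesis by (auto simp: ordge_def wcoeff_mult intro!: sum.neutral)
qed

lemma ordge_mult_left: "ordge n b \<Longrightarrow> ordge n (a * b)"
  and ordge_mult_right: "ordge n a \<Longrightarrow> ordge n (a * b)"
  using ordge_mult[of 0 a n b] ordge_mult[of n a 0 b] by auto

lemma ordge_1_iff: "ordge (Suc 0) a \<longleftrightarrow> wcoeff a [] = 0"
  by (auto simp: ordge_def)

lemma ordge_wcoeff: "ordge (Suc n) (a - b) \<Longrightarrow> length w \<le> n \<Longrightarrow> wcoeff a w = wcoeff b w"
  by (simp add: ordge_def)

lemma ncps_eq_ordge: "(\<And>n. ordge (Suc n) (a - b)) \<Longrightarrow> a = b"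
  by (metis ncps_eqI order_refl ordge_wcoeff)

text \<open>Guarantees that the formal sum in \<open>op_series\<close> is finite at each word: m
  applications of \<open>T\<close> leave nothing on words shorter than m.\<close>

definition raising :: "('a ncps \<Rightarrow> 'a ncps) \<Rightarrow> bool" where
  "raising T \<longleftrightarrow> linear T \<and> (\<forall>n a. ordge n a \<longrightarrow> ordge (Suc n) (T a))"

lemma raising_linear: "raising T \<Longrightarrow> linear T"
  by (simp add: raising_def)

lemma linear_funpow: "linear (T :: 'v::real_vector \<Rightarrow> 'v) \<Longrightarrow> linear (T ^^ m)"
  by (induction m) (auto intro: linear_compose linear_id)

lemma raising_pow: "raising T \<Longrightarrow> ordge k y \<Longrightarrow> ordge (m + k) ((T ^^ m) y)"
  by (induction m) (auto simp: raising_def)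

lemma op_series_coeff:
  assumes "raising T" "length w \<le> n"
  shows "wcoeff (op_series c T y) w = (\<Sum>m\<le>n. c m * wcoeff ((T ^^ m) y) w)"
proof -
  have "c m * wcoeff ((T ^^ m) y) w = 0" if "m \<notin> {..n}" for m
    using raising_pow[OF assms(1), of 0 y m] assms(2) that by (auto simp: ordge_def)
  then show ?thesis unfolding op_series_def wcoeff_Ncps by (intro suminf_finite) auto
qed

lemma op_series_approx:
  assumes "raising T"
  shows "ordge (Suc n) (op_series c T y - (\<Sum>m\<le>n. c m *\<^sub>R (T ^^ m) y))"
  by (simp add: ordge_def op_series_coeff[OF assms, of _ n] wcoeff_sum)

lemma op_series_eqI:
  assumes "raising T" "\<And>n. ordge (Suc n) (z - (\<Sum>m\<le>n. c m *\<^sub>R (T ^^ m) y))"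
  shows "op_series c T y = z"
proof (rule ncps_eq_ordge)
  fix n
  show "ordge (Suc n) (op_series c T y - z)"
    using ordge_simps(4)[OF op_series_approx[OF assms(1), of n c y] assms(2)[of n]] by simp
qed

text \<open>A filtered linear map that intertwines \<open>T\<close> and \<open>T'\<close> carries
  partial sums to partial sums with an error of the same order. It is applied to right
  multiplication, conjugation, substitution and the passage from letters \<open>Z i\<close> to plain
  letters.\<close>

lemma op_series_hom:
  fixes \<Phi> :: "'a ncps \<Rightarrow> 'b ncps"
  assumes T: "raising T" "raising T'" and \<Phi>: "linear \<Phi>" "\<And>n u. ordge n u \<Longrightarrow> ordge n (\<Phi> u)"
    and com: "\<And>u. \<Phi> (T u) = T' (\<Phi> u)"
  shows "\<Phi> (op_series c T y) = op_series c T' (\<Phi> y)"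
proof (rule op_series_eqI[OF T(2), symmetric])
  fix n
  have p: "\<Phi> ((T ^^ m) y) = (T' ^^ m) (\<Phi> y)" for m
    by (induction m) (auto simp: com)
  have "ordge (Suc n) (\<Phi> (op_series c T y - (\<Sum>m\<le>n. c m *\<^sub>R (T ^^ m) y)))"
    by (rule \<Phi>(2)[OF op_series_approx[OF T(1)]])
  then show "ordge (Suc n) (\<Phi> (op_series c T y) - (\<Sum>m\<le>n. c m *\<^sub>R (T' ^^ m) (\<Phi> y)))"
    by (simp add: linear_diff[OF \<Phi>(1)] linear_sum[OF \<Phi>(1)] linear_scale[OF \<Phi>(1)] p)
qed

lemma op_series_linear: "raising T \<Longrightarrow> linear (op_series c T)"
proof (rule linearI; rule ncps_eqI)
  fix x y w r
  assume T: "raising T"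
  note l = linear_funpow[OF raising_linear[OF T]]
  show "wcoeff (op_series c T (x + y)) w = wcoeff (op_series c T x + op_series c T y) w"
    by (simp add: op_series_coeff[OF T order_refl] linear_add[OF l] algebra_simps sum.distrib)
  show "wcoeff (op_series c T (r *\<^sub>R x)) w = wcoeff (r *\<^sub>R op_series c T x) w"
    by (simp add: op_series_coeff[OF T order_refl] linear_scale[OF l] sum_distrib_left algebra_simps)
qed

lemma sum_triangle:
  fixes t :: "nat \<Rightarrow> nat \<Rightarrow> 'v::comm_monoid_add"
  assumes z: "\<And>p q. n < p + q \<Longrightarrow> t p q = 0"
  shows "(\<Sum>p\<le>n. \<Sum>q\<le>n. t p q) = (\<Sum>m\<le>n. \<Sum>p\<le>m. t p (m - p))"
proof -
  have "(\<Sum>q\<le>n. t p q) = (\<Sum>q\<le>n - p. t p q)" if "p \<le> n" for p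
    using that by (intro sum.mono_neutral_right) (auto intro!: z)
  then have "(\<Sum>p\<le>n. \<Sum>q\<le>n. t p q) = (\<Sum>(p,q)\<in>(SIGMA p:{..n}. {..n - p}). t p q)"
    by (simp add: sum.Sigma[symmetric])
  also have "\<dots> = (\<Sum>(m,p)\<in>(SIGMA m:{..n}. {..m}). t p (m - p))"
    by (rule sum.reindex_bij_witness[where j = "\<lambda>(p,q). (p + q, p)" and i = "\<lambda>(m,p). (p, m - p)"]) auto
  also have "\<dots> = (\<Sum>m\<le>n. \<Sum>p\<le>m. t p (m - p))"
    by (simp add: sum.Sigma)
  finally show ?thesis .
qed

text \<open>Functional calculus: composing two series in one operator multiplies the scalar power
  series, so inverse series give inverse operators. Both sums may be cut at the length of the word,
  and the square is then summed along antidiagonals.\<close>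

lemma op_series_conv:
  fixes T :: "'a ncps \<Rightarrow> 'a ncps"
  assumes T: "raising T"
  shows "op_series (fps_nth f) T (op_series (fps_nth g) T y) = op_series (fps_nth (f * g)) T y"
proof (rule ncps_eqI)
  fix w :: "'a list"
  let ?n = "length w"
  let ?t = "\<lambda>m j. fps_nth f m * fps_nth g j * wcoeff ((T ^^ (m + j)) y) w"
  note l = linear_funpow[OF raising_linear[OF T]]
  have z: "?t m j = 0" if "m + j > ?n" for m j
    using raising_pow[OF T, of 0 y "m + j"] that by (auto simp: ordge_def)
  have in1: "wcoeff ((T ^^ m) (op_series (fps_nth g) T y)) w =
      (\<Sum>j\<le>?n. fps_nth g j * wcoeff ((T ^^ (m + j)) y) w)" for m
  proof -
    have "ordge (m + Suc ?n) ((T ^^ m) (op_series (fps_nth g) T y - (\<Sum>j\<le>?n. fps_nth g j *\<^sub>R (T ^^ j) y)))"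
      by (rule raising_pow[OF T op_series_approx[OF T]])
    then have "ordge (m + Suc ?n) ((T ^^ m) (op_series (fps_nth g) T y) - (\<Sum>j\<le>?n. fps_nth g j *\<^sub>R (T ^^ (m + j)) y))"
      by (simp add: linear_diff[OF l] linear_sum[OF l] linear_scale[OF l] funpow_add)
    then show ?thesis by (simp add: ordge_def wcoeff_sum)
  qed
  have "wcoeff (op_series (fps_nth f) T (op_series (fps_nth g) T y)) w = (\<Sum>m\<le>?n. \<Sum>j\<le>?n. ?t m j)"
    by (simp add: op_series_coeff[OF T order_refl, of "fps_nth f"] in1 sum_distrib_left mult.assoc)
  also have "\<dots> = (\<Sum>k\<le>?n. \<Sum>m\<le>k. ?t m (k - m))"
    using z by (rule sum_triangle)
  also have "\<dots> = wcoeff (op_series (fps_nth (f * g)) T y) w"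
    by (auto simp: op_series_coeff[OF T order_refl, of "fps_nth (f * g)"] fps_mult_nth sum_distrib_right
      atLeast0AtMost intro!: sum.cong)
  finally show "wcoeff (op_series (fps_nth f) T (op_series (fps_nth g) T y)) w =
    wcoeff (op_series (fps_nth (f * g)) T y) w" .
qed

lemma op_series_one: "raising T \<Longrightarrow> op_series (fps_nth 1) T y = y"
proof (rule ncps_eqI)
  fix w assume T: "raising T"
  have "wcoeff (op_series (fps_nth 1) T y) w = (\<Sum>m\<le>length w. if m = 0 then wcoeff y w else 0)"
    unfolding op_series_coeff[OF T order_refl] by (rule sum.cong) auto
  then show "wcoeff (op_series (fps_nth 1) T y) w = wcoeff y w" by simp
qed

lemma op_series_inverse:
  assumes "raising T" "f * g = 1"
  shows "op_series (fps_nth f) T (op_series (fps_nth g) T y) = y"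
  by (simp add: op_series_conv[OF assms(1)] assms(2) op_series_one[OF assms(1)])

lemma raising_mult: "wcoeff a [] = 0 \<Longrightarrow> raising ((*) a)"
  unfolding raising_def using ordge_mult[of 1 a] ordge_1_iff[of a]
  by (auto intro!: linearI simp: distrib_left)

lemma raising_act: "wcoeff a [] = 0 \<Longrightarrow> raising (act a)"
  unfolding raising_def act_def gbr_def
  using ordge_mult[of 1 a] ordge_mult[of _ _ 1 a] ordge_1_iff[of a]
  by (auto intro!: linearI ordge_simps simp: algebra_simps)

lemma act_eq: "act x y = x * y - y * x"
  by (simp add: act_def gbr_def)

lemma derived_br_eq: "derived_br x = act (dd x)"
  by (simp add: fun_eq_iff derived_br_def act_def)

subsection \<open>Exponential and logarithm\<close>

text \<open>The value of a scalar power series at a series without constant term. For fixed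
  \<open>a\<close> it is multiplicative in \<open>f\<close>, so the identities between exp and log
  are inherited from scalar power series.\<close>

definition ev_fps :: "real fps \<Rightarrow> 'a ncps \<Rightarrow> 'a ncps" where
  "ev_fps f a = op_series (fps_nth f) ((*) a) 1"

lemma funpow_mult_1: "((*) a ^^ m) y = a ^ m * (y :: 'a::monoid_mult)"
  by (induction m) (auto simp: mult.assoc)

lemma ev_fps_coeff:
  "wcoeff a [] = 0 \<Longrightarrow> length w \<le> n \<Longrightarrow> wcoeff (ev_fps f a) w = (\<Sum>m\<le>n. fps_nth f m * wcoeff (a ^ m) w)"
  by (simp add: ev_fps_def op_series_coeff[OF raising_mult] funpow_mult_1)

lemma ordge_power: "wcoeff a [] = 0 \<Longrightarrow> ordge m (a ^ m)"
  using raising_pow[OF raising_mult, of a 0 1 m] by (simp add: funpow_mult_1)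

lemma op_series_left_mult:
  assumes "wcoeff a [] = 0" shows "op_series (fps_nth f) ((*) a) y = ev_fps f a * y"
  unfolding ev_fps_def
  using op_series_hom[OF raising_mult[OF assms] raising_mult[OF assms], of "\<lambda>u. u * y" "fps_nth f" 1]
  by (simp add: linear_iff distrib_right ordge_mult_right mult.assoc)

lemma ev_fps_mult: "wcoeff a [] = 0 \<Longrightarrow> ev_fps (f * g) a = ev_fps f a * ev_fps g a"
  using op_series_conv[OF raising_mult, of a f g 1]
  by (simp add: op_series_left_mult flip: ev_fps_def)

lemma ev_fps_1 [simp]: "wcoeff a [] = 0 \<Longrightarrow> ev_fps 1 a = 1"
  by (simp add: ev_fps_def op_series_one raising_mult)

lemma ev_fps_power: "wcoeff a [] = 0 \<Longrightarrow> ev_fps (f ^ n) a = ev_fps f a ^ n"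
  by (induction n) (auto simp: ev_fps_mult)

lemma ev_fps_diff: "wcoeff a [] = 0 \<Longrightarrow> ev_fps (f - g) a = ev_fps f a - ev_fps g a"
  by (auto intro!: ncps_eqI simp: ev_fps_coeff[OF _ order_refl] algebra_simps sum_subtractf)

lemma ev_fps_Nil: "wcoeff a [] = 0 \<Longrightarrow> wcoeff (ev_fps f a) [] = fps_nth f 0"
  using ev_fps_coeff[of a "[]" 0 f] by simp

lemma ev_fps_X: "wcoeff a [] = 0 \<Longrightarrow> ev_fps fps_X a = a"
proof (rule ncps_eqI)
  fix w assume a: "wcoeff a [] = 0"
  have "wcoeff (ev_fps fps_X a) w = (\<Sum>m\<le>Suc (length w). if m = 1 then wcoeff a w else 0)"
    unfolding ev_fps_coeff[OF a le_SucI[OF order_refl]] by (rule sum.cong) auto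
  then show "wcoeff (ev_fps fps_X a) w = wcoeff a w"
    by (simp only: sum.delta[OF finite_atMost]) simp
qed

lemma ev_fps_compose:
  fixes a :: "'a ncps"
  assumes a: "wcoeff a [] = 0" and g: "fps_nth g 0 = 0"
  shows "ev_fps (f oo g) a = ev_fps f (ev_fps g a)"
proof (rule ncps_eqI)
  fix w :: "'a list"
  let ?n = "length w"
  have b: "wcoeff (ev_fps g a) [] = 0" using a g by (simp add: ev_fps_Nil)
  have z: "fps_nth (g ^ i) m = 0" if "m < i" for i m
    using g that by (intro startsby_zero_power_prefix[rule_format]) auto
  have "wcoeff (ev_fps f (ev_fps g a)) w = (\<Sum>i\<le>?n. \<Sum>m\<le>?n. fps_nth f i * fps_nth (g ^ i) m * wcoeff (a ^ m) w)"
    by (simp add: ev_fps_coeff[OF b order_refl] ev_fps_power[OF a, symmetric] ev_fps_coeff[OF a order_refl]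
      sum_distrib_left mult.assoc)
  also have "\<dots> = (\<Sum>m\<le>?n. \<Sum>i\<le>?n. fps_nth f i * fps_nth (g ^ i) m * wcoeff (a ^ m) w)"
    by (rule sum.swap)
  also have "\<dots> = (\<Sum>m\<le>?n. \<Sum>i=0..m. fps_nth f i * fps_nth (g ^ i) m * wcoeff (a ^ m) w)"
    by (rule sum.cong[OF refl], rule sum.mono_neutral_right) (auto simp: z)
  also have "\<dots> = wcoeff (ev_fps (f oo g) a) w"
    by (simp add: ev_fps_coeff[OF a order_refl] fps_compose_nth sum_distrib_right)
  finally show "wcoeff (ev_fps (f oo g) a) w = wcoeff (ev_fps f (ev_fps g a)) w" by simp
qed

lemma nc_exp_ev: "nc_exp a = ev_fps (fps_exp 1) a"
  unfolding nc_exp_def ev_fps_def by (rule arg_cong[of _ _ "\<lambda>c. op_series c _ _"]) auto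

lemma nc_log_ev: "nc_log a = ev_fps (fps_ln 1) (a - 1)"
  unfolding nc_log_def ev_fps_def
proof (rule arg_cong[of _ _ "\<lambda>c. op_series c _ _"], rule ext)
  fix m :: nat
  show "(if m = 0 then 0 else (-1) ^ (m + 1) / real m) = fps_nth (fps_ln 1) m"
    by (cases m) (auto simp: fps_ln_nth)
qed

lemma nc_exp_Nil [simp]: "wcoeff a [] = 0 \<Longrightarrow> wcoeff (nc_exp a) [] = 1"
  by (simp add: nc_exp_ev ev_fps_Nil)

lemma nc_log_Nil [simp]: "wcoeff a [] = 1 \<Longrightarrow> wcoeff (nc_log a) [] = 0"
  by (simp add: nc_log_ev ev_fps_Nil)

lemma nc_log_exp: "wcoeff a [] = 0 \<Longrightarrow> nc_log (nc_exp a) = a"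
proof -
  assume a: "wcoeff a [] = 0"
  have "nc_log (nc_exp a) = ev_fps (fps_ln 1 oo (fps_exp 1 - 1)) a"
    using a by (simp add: nc_log_ev nc_exp_ev ev_fps_compose ev_fps_diff)
  also have "fps_ln 1 oo (fps_exp 1 - 1) = (fps_X :: real fps)"
    by (simp add: fps_ln_fps_exp_inv fps_inv_fps_exp_compose)
  finally show ?thesis using a by (simp add: ev_fps_X)
qed

lemma nc_exp_log: "wcoeff a [] = 1 \<Longrightarrow> nc_exp (nc_log a) = a"
proof -
  assume "wcoeff a [] = 1"
  then have a: "wcoeff (a - 1) [] = 0" by simp
  have "ev_fps (fps_exp 1 - 1) (ev_fps (fps_ln 1) (a - 1)) = ev_fps ((fps_exp 1 - 1) oo fps_ln 1) (a - 1)"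
    using a by (simp add: ev_fps_compose)
  also have "(fps_exp 1 - 1) oo fps_ln 1 = (fps_X :: real fps)"
    by (simp add: fps_ln_fps_exp_inv fps_inv_fps_exp_compose)
  finally have "ev_fps (fps_exp 1) (ev_fps (fps_ln 1) (a - 1)) - 1 = a - 1"
    using a ev_fps_Nil[OF a] by (simp add: ev_fps_X ev_fps_diff)
  then show ?thesis by (simp add: nc_log_ev nc_exp_ev)
qed

lemma ev_fps_uminus: "wcoeff a [] = 0 \<Longrightarrow> ev_fps (fps_exp c) (- a) = ev_fps (fps_exp (- c)) a"
  by (auto intro!: ncps_eqI sum.cong simp: ev_fps_coeff[OF _ order_refl] power_minus[of a] power_minus[of c]
    minus_one_power_iff)

lemma nc_exp_minus:
  assumes "wcoeff a [] = 0"
  shows "nc_exp a * nc_exp (- a) = 1" "nc_exp (- a) * nc_exp a = 1"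
  using assms by (simp_all add: nc_exp_ev ev_fps_uminus ev_fps_mult[symmetric] fps_exp_add_mult[symmetric])

lemma nc_exp_0 [simp]: "nc_exp 0 = 1"
proof (rule ncps_eqI)
  fix w :: "'a list"
  have "wcoeff (nc_exp 0) w = (\<Sum>m\<le>length w. if m = 0 then wcoeff (1 :: 'a ncps) w else 0)"
    unfolding nc_exp_ev ev_fps_coeff[OF wcoeff_simps(1) order_refl]
    by (rule sum.cong) (auto simp: power_0_left)
  also have "\<dots> = wcoeff 1 w"
    by (simp only: sum.delta[OF finite_atMost]) simp
  finally show "wcoeff (nc_exp 0) w = wcoeff (1 :: 'a ncps) w" .
qed

text \<open>Inversion is routed through exp and log, so that continuity, differentiability and
  membership in degree 0 are inherited from \<open>ev_fps\<close>.\<close>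

definition nc_inv :: "'a ncps \<Rightarrow> 'a ncps" where
  "nc_inv a = nc_exp (- nc_log a)"

lemma nc_inv:
  assumes "wcoeff a [] = 1"
  shows "a * nc_inv a = 1" "nc_inv a * a = 1" "wcoeff (nc_inv a) [] = 1"
  using nc_exp_minus[of "nc_log a"] assms by (simp_all add: nc_inv_def nc_exp_log)

lemma nc_inv_unique:
  assumes "wcoeff a [] = 1" "a * b = 1 \<or> b * a = 1" shows "nc_inv a = b"
  using assms nc_inv(1,2)[OF assms(1)] by (metis mult.assoc mult.left_neutral mult.right_neutral)

lemma wcoeff_mult_Nil [simp]: "wcoeff (a * b) [] = wcoeff a [] * wcoeff b []"
  by (simp add: wcoeff_mult)

lemma nc_inv_mult:
  assumes "wcoeff a [] = 1" "wcoeff b [] = 1"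
  shows "nc_inv (a * b) = nc_inv b * nc_inv a"
proof (rule nc_inv_unique)
  have "(a * b) * (nc_inv b * nc_inv a) = a * (b * nc_inv b) * nc_inv a" by (simp only: mult.assoc)
  then show "a * b * (nc_inv b * nc_inv a) = 1 \<or> nc_inv b * nc_inv a * (a * b) = 1"
    using assms by (simp add: nc_inv)
qed (use assms in simp)

lemma nc_inv_1 [simp]: "nc_inv 1 = 1"
  by (rule nc_inv_unique) auto

subsection \<open>The adjoint action\<close>

text \<open>The series (1 - e^(-z))/z, which governs the derivative of the exponential; its inverse
  is the series z/(1 - e^(-z)) of the Magnus equation.\<close>

definition phi_fps :: "real fps" where
  "phi_fps = Abs_fps (\<lambda>q. (-1) ^ q / fact (q + 1))"

abbreviation todd_fps :: "real fps" where
  "todd_fps \<equiv> fps_X / (1 - fps_exp (-1))"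

lemma phi_todd: "phi_fps * todd_fps = 1"
proof -
  have "fps_X * phi_fps = 1 - fps_exp (-1)"
  proof (rule fps_ext)
    fix n show "fps_nth (fps_X * phi_fps) n = fps_nth (1 - fps_exp (-1)) n"
      by (cases n) (auto simp: phi_fps_def field_simps simp del: fact_Suc)
  qed
  then have "fps_X * (phi_fps * todd_fps) = fps_X * 1"
    using todd_series by (simp add: mult.assoc[symmetric])
  then show ?thesis by (simp only: mult_left_cancel[OF fps_X_neq_zero])
qed

lemma phi_todd_op: "wcoeff x [] = 0 \<Longrightarrow>
    op_series (fps_nth phi_fps) (act x) (op_series (fps_nth todd_fps) (act x) y) = y"
  and todd_phi_op: "wcoeff x [] = 0 \<Longrightarrow>
    op_series (fps_nth todd_fps) (act x) (op_series (fps_nth phi_fps) (act x) y) = y"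
  using phi_todd by (auto intro!: op_series_inverse raising_act simp: mult.commute)

text \<open>\<open>act x\<close> is the difference of left and right multiplication by
  \<open>x\<close>, which commute; this is the binomial theorem for that difference.\<close>

lemma act_pow_binomial:
  "(act x ^^ m) y = (\<Sum>p\<le>m. real (m choose p) *\<^sub>R (x ^ p * y * (- x) ^ (m - p)))"
proof (induction m)
  case (Suc m)
  let ?f = "\<lambda>p q. x ^ p * y * (- x) ^ q"
  have "(act x ^^ Suc m) y = x * (\<Sum>p\<le>m. real (m choose p) *\<^sub>R ?f p (m - p)) +
      (\<Sum>p\<le>m. real (m choose p) *\<^sub>R ?f p (m - p)) * (- x)"
    by (simp add: Suc act_eq)
  also have "\<dots> = (\<Sum>p\<le>m. real (m choose p) *\<^sub>R ?f (Suc p) (m - p)) +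
      (\<Sum>p\<le>m. real (m choose p) *\<^sub>R ?f p (Suc (m - p)))"
    by (simp add: sum_distrib_left sum_distrib_right power_Suc2[of "- x"] mult.assoc sum_negf del: power_Suc)
       (simp add: mult.assoc sum_negf)
  also have "(\<Sum>p\<le>m. real (m choose p) *\<^sub>R ?f p (Suc (m - p))) = (\<Sum>p\<le>m. real (m choose p) *\<^sub>R ?f p (Suc m - p))"
    by (rule sum.cong) (auto simp: Suc_diff_le)
  also have "\<dots> = (\<Sum>p\<le>Suc m. real (m choose p) *\<^sub>R ?f p (Suc m - p))"
    by (simp add: sum.atMost_Suc)
  also have "\<dots> = ?f 0 (Suc m) + (\<Sum>p\<le>m. real (m choose Suc p) *\<^sub>R ?f (Suc p) (m - p))"
    by (subst sum.atMost_Suc_shift) simp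
  also have "(\<Sum>p\<le>m. real (m choose p) *\<^sub>R ?f (Suc p) (m - p)) +
      (?f 0 (Suc m) + (\<Sum>p\<le>m. real (m choose Suc p) *\<^sub>R ?f (Suc p) (m - p))) =
      ?f 0 (Suc m) + (\<Sum>p\<le>m. real (Suc m choose Suc p) *\<^sub>R ?f (Suc p) (m - p))"
    by (simp add: scaleR_add_left sum.distrib)
  also have "\<dots> = (\<Sum>p\<le>Suc m. real (Suc m choose p) *\<^sub>R ?f p (Suc m - p))"
    by (subst sum.atMost_Suc_shift[where n = m]) simp
  finally show ?case .
qed simp

text \<open>Hadamard's identity. Divided by m!, the binomial expansion of the m-th power of ad x
  becomes the m-th antidiagonal in the Cauchy product of the two exponential series.\<close>

lemma exp_act_conj:
  fixes x :: "'a ncps"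
  assumes x: "wcoeff x [] = 0" shows "exp_act x y = nc_exp x * y * nc_exp (- x)"
proof (rule ncps_eqI)
  fix w :: "'a list"
  let ?n = "length w"
  let ?t = "\<lambda>p q. wcoeff (x ^ p * y * (- x) ^ q) w / (fact p * fact q)"
  have z: "ordge (p + q) (x ^ p * y * (- x) ^ q)" for p q
    using x by (intro ordge_mult ordge_mult_right ordge_power) auto
  have ap: "ordge (Suc ?n) (nc_exp x - (\<Sum>p\<le>?n. (1 / fact p) *\<^sub>R x ^ p))" if "wcoeff x [] = 0" for x :: "'a ncps"
    using op_series_approx[OF raising_mult[OF that], of ?n "\<lambda>m. 1 / fact m" 1]
    by (simp add: nc_exp_def funpow_mult_1)
  let ?A = "\<Sum>p\<le>?n. (1 / fact p) *\<^sub>R x ^ p" and ?B = "\<Sum>p\<le>?n. (1 / fact p) *\<^sub>R (- x) ^ p"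
  \<comment> \<open>Replacing both exponentials by partial sums changes nothing up to length n: the
    difference telescopes into two terms, each with a factor of order n + 1.\<close>
  have "nc_exp x * y * nc_exp (- x) - ?A * y * ?B =
      (nc_exp x - ?A) * (y * nc_exp (- x)) + (?A * y) * (nc_exp (- x) - ?B)"
    by (simp add: algebra_simps)
  then have "ordge (Suc ?n) (nc_exp x * y * nc_exp (- x) - ?A * y * ?B)"
    using ap[OF x] ap[of "- x"] x by (simp add: ordge_mult_left ordge_mult_right)
  then have "wcoeff (nc_exp x * y * nc_exp (- x)) w = wcoeff (?A * y * ?B) w"
    by (rule ordge_wcoeff) simp
  also have "\<dots> = (\<Sum>p\<le>?n. \<Sum>q\<le>?n. ?t p q)"
    by (simp add: sum_distrib_left sum_distrib_right wcoeff_sum) (subst sum.swap, simp add: mult.commute)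
  also have "\<dots> = (\<Sum>m\<le>?n. \<Sum>p\<le>m. ?t p (m - p))"
    using z by (intro sum_triangle) (auto simp: ordge_def)
  also have "\<dots> = (\<Sum>m\<le>?n. 1 / fact m * wcoeff ((act x ^^ m) y) w)"
    by (auto simp: act_pow_binomial wcoeff_sum sum_distrib_left binomial_fact intro!: sum.cong)
  also have "\<dots> = wcoeff (exp_act x y) w"
    using op_series_coeff[OF raising_act[OF x] order_refl] by (simp add: exp_act_def)
  finally show "wcoeff (exp_act x y) w = wcoeff (nc_exp x * y * nc_exp (- x)) w" by simp
qed

text \<open>With \<open>l\<close>, \<open>r\<close> the left and right multiplications by \<open>x\<close> and \<open>a = l - r\<close>, this is
  \<open>r\<^sup>m = (l - a)\<^sup>m\<close>.\<close>

lemma right_power_binomial: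
  "y * x ^ m = (\<Sum>q\<le>m. (real (m choose q) * (-1) ^ q) *\<^sub>R (x ^ (m - q) * (act x ^^ q) y))"
proof (induction m arbitrary: y)
  case (Suc m)
  let ?f = "\<lambda>p q. (-1) ^ q *\<^sub>R (x ^ p * (act x ^^ q) y)"
  have a: "linear (act x ^^ q)" for q
    by (intro linear_funpow linearI) (simp_all add: act_eq algebra_simps)
  have c: "(act x ^^ q) (x * y) = x * (act x ^^ q) y" for q y
    by (induction q) (auto simp: act_eq algebra_simps)
  \<comment> \<open>The induction hypothesis is applied to y x, written as x y - [x, y]; this is why
    \<open>y\<close> is arbitrary.\<close>
  have "y * x ^ Suc m = (x * y - act x y) * x ^ m"
    by (simp add: act_eq mult.assoc)
  also have "\<dots> = (\<Sum>q\<le>m. (real (m choose q) * (-1) ^ q) *\<^sub>R (x ^ (m - q) * (act x ^^ q) (x * y - act x y)))"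
    by (rule Suc)
  also have "\<dots> = (\<Sum>q\<le>m. real (m choose q) *\<^sub>R ?f (Suc m - q) q) + (\<Sum>q\<le>m. real (m choose q) *\<^sub>R ?f (m - q) (Suc q))"
    unfolding sum.distrib[symmetric]
  proof (rule sum.cong[OF refl])
    fix q assume "q \<in> {..m}"
    then have 1: "x ^ (Suc m - q) = x ^ (m - q) * x"
      by (simp only: Suc_diff_le atMost_iff power_Suc2)
    have 2: "(act x ^^ q) (act x y) = (act x ^^ Suc q) y"
      by (simp add: funpow_swap1)
    show "(real (m choose q) * (-1) ^ q) *\<^sub>R (x ^ (m - q) * (act x ^^ q) (x * y - act x y)) =
        real (m choose q) *\<^sub>R ?f (Suc m - q) q + real (m choose q) *\<^sub>R ?f (m - q) (Suc q)"
      unfolding linear_diff[OF a] c 1 2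
      by (simp add: right_diff_distrib scaleR_diff_right mult.assoc del: funpow.simps)
  qed
  also have "(\<Sum>q\<le>m. real (m choose q) *\<^sub>R ?f (Suc m - q) q) = (\<Sum>q\<le>Suc m. real (m choose q) *\<^sub>R ?f (Suc m - q) q)"
    by (simp add: sum.atMost_Suc)
  also have "\<dots> = ?f (Suc m) 0 + (\<Sum>q\<le>m. real (m choose Suc q) *\<^sub>R ?f (m - q) (Suc q))"
    by (subst sum.atMost_Suc_shift) simp
  also have "\<dots> + (\<Sum>q\<le>m. real (m choose q) *\<^sub>R ?f (m - q) (Suc q)) =
      ?f (Suc m) 0 + (\<Sum>q\<le>m. real (Suc m choose Suc q) *\<^sub>R ?f (m - q) (Suc q))"
    by (simp add: sum.distrib[symmetric] algebra_simps del: funpow.simps power_Suc)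
  also have "\<dots> = (\<Sum>q\<le>Suc m. real (Suc m choose q) *\<^sub>R ?f (Suc m - q) q)"
    by (subst sum.atMost_Suc_shift[where n = m]) simp
  finally show ?case by simp
qed simp

definition power_deriv :: "'a ncps \<Rightarrow> nat \<Rightarrow> 'a ncps \<Rightarrow> 'a ncps" where
  "power_deriv x m y = (\<Sum>i<m. x ^ (m - 1 - i) * y * x ^ i)"

lemma power_deriv_Suc: "power_deriv x (Suc m) y = x * power_deriv x m y + y * x ^ m"
proof -
  have "(\<Sum>i<m. x ^ (m - i) * y * x ^ i) = x * (\<Sum>i<m. x ^ (m - 1 - i) * y * x ^ i)"
    unfolding sum_distrib_left
  proof (rule sum.cong[OF refl])
    fix i assume "i \<in> {..<m}"
    then have "m - i = Suc (m - 1 - i)" by auto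
    then show "x ^ (m - i) * y * x ^ i = x * (x ^ (m - 1 - i) * y * x ^ i)"
      by (simp add: mult.assoc)
  qed
  then show ?thesis by (simp add: power_deriv_def)
qed

text \<open>All powers of \<open>x\<close> are moved to the left by
  \<open>right_power_binomial\<close>; Pascal's rule then collects the Leibniz sum into the
  coefficients \<open>m choose Suc q\<close>.\<close>

lemma power_deriv_binomial:
  "power_deriv x m y = (\<Sum>q<m. (real (m choose Suc q) * (-1) ^ q) *\<^sub>R (x ^ (m - 1 - q) * (act x ^^ q) y))"
proof (induction m)
  case (Suc m)
  let ?f = "\<lambda>p q. (-1) ^ q *\<^sub>R (x ^ p * (act x ^^ q) y)"
  have s: "x * ?f (m - 1 - q) q = ?f (m - q) q" if "q < m" for q
  proof -
    have "m - q = Suc (m - 1 - q)" using that by auto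
    then show ?thesis by (simp add: mult.assoc)
  qed
  have "x * power_deriv x m y = (\<Sum>q<m. real (m choose Suc q) *\<^sub>R ?f (m - q) q)"
    unfolding Suc sum_distrib_left using s by (intro sum.cong) auto
  also have "\<dots> = (\<Sum>q\<le>m. real (m choose Suc q) *\<^sub>R ?f (m - q) q)"
    by (simp add: lessThan_Suc_atMost[symmetric])
  finally have "power_deriv x (Suc m) y = (\<Sum>q\<le>m. real (m choose Suc q) *\<^sub>R ?f (m - q) q) +
      (\<Sum>q\<le>m. real (m choose q) *\<^sub>R ?f (m - q) q)"
    by (simp add: power_deriv_Suc right_power_binomial)
  also have "\<dots> = (\<Sum>q\<le>m. real (Suc m choose Suc q) *\<^sub>R ?f (m - q) q)"
    by (simp add: sum.distrib[symmetric] algebra_simps)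
  finally show ?case by (simp add: lessThan_Suc_atMost)
qed (simp add: power_deriv_def)

text \<open>The derivative of exp at \<open>x\<close> in direction \<open>y\<close> is e^x phi(ad x)
  y: dividing \<open>power_deriv_binomial\<close> by m! splits it into a Cauchy product. The range
  ends at \<open>Suc (length w)\<close> because the derivative of the m-th power keeps only m - 1
  factors \<open>x\<close>.\<close>

lemma exp_deriv_series:
  fixes x :: "'a ncps"
  assumes x: "wcoeff x [] = 0"
  shows "wcoeff (nc_exp x * op_series (fps_nth phi_fps) (act x) y) w =
    (\<Sum>m\<le>Suc (length w). wcoeff (power_deriv x m y) w / fact m)"
proof -
  let ?n = "length w"
  let ?t = "\<lambda>p q. (-1) ^ q * wcoeff (x ^ p * (act x ^^ q) y) w / (fact p * fact (Suc q))"
  have z: "ordge (p + q) (x ^ p * (act x ^^ q) y)" for p q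
    using raising_pow[OF raising_act[OF x], of 0 y q] x by (intro ordge_mult ordge_power) auto
  have a1: "ordge (Suc ?n) (nc_exp x - (\<Sum>p\<le>?n. (1 / fact p) *\<^sub>R x ^ p))"
    using op_series_approx[OF raising_mult[OF x], of ?n "\<lambda>m. 1 / fact m" 1]
    by (simp add: nc_exp_def funpow_mult_1)
  have a2: "ordge (Suc ?n) (op_series (fps_nth phi_fps) (act x) y - (\<Sum>q\<le>?n. fps_nth phi_fps q *\<^sub>R (act x ^^ q) y))"
    by (rule op_series_approx[OF raising_act[OF x]])
  let ?A = "\<Sum>p\<le>?n. (1 / fact p) *\<^sub>R x ^ p" and ?B = "\<Sum>q\<le>?n. fps_nth phi_fps q *\<^sub>R (act x ^^ q) y"
  have "nc_exp x * op_series (fps_nth phi_fps) (act x) y - ?A * ?B =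
      (nc_exp x - ?A) * op_series (fps_nth phi_fps) (act x) y + ?A * (op_series (fps_nth phi_fps) (act x) y - ?B)"
    by (simp add: algebra_simps)
  then have "ordge (Suc ?n) (nc_exp x * op_series (fps_nth phi_fps) (act x) y - ?A * ?B)"
    using a1 a2 by (simp add: ordge_mult_left ordge_mult_right)
  then have "wcoeff (nc_exp x * op_series (fps_nth phi_fps) (act x) y) w = wcoeff (?A * ?B) w"
    by (rule ordge_wcoeff) simp
  also have "\<dots> = (\<Sum>p\<le>?n. \<Sum>q\<le>?n. ?t p q)"
    by (simp add: sum_distrib_left sum_distrib_right wcoeff_sum phi_fps_def)
       (subst sum.swap, simp add: mult.commute)
  also have "\<dots> = (\<Sum>q\<le>?n. \<Sum>p\<le>?n. ?t p q)"
    by (rule sum.swap)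
  also have "\<dots> = (\<Sum>m\<le>?n. \<Sum>q\<le>m. ?t (m - q) q)"
    using z by (intro sum_triangle) (auto simp: ordge_def add.commute)
  also have "\<dots> = (\<Sum>m\<le>?n. wcoeff (power_deriv x (Suc m) y) w / fact (Suc m))"
  proof (rule sum.cong[OF refl])
    fix m
    have "?t (m - q) q = (real (Suc m choose Suc q) * (-1) ^ q) * wcoeff (x ^ (m - q) * (act x ^^ q) y) w / fact (Suc m)"
      if "q \<le> m" for q
    proof -
      have "real (Suc m choose Suc q) = fact (Suc m) / (fact (Suc q) * fact (m - q))"
        using binomial_fact[of "Suc q" "Suc m", where 'a = real] that by simp
      then show ?thesis by simp
    qed
    then show "(\<Sum>q\<le>m. ?t (m - q) q) = wcoeff (power_deriv x (Suc m) y) w / fact (Suc m)"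
      by (simp add: power_deriv_binomial wcoeff_sum sum_divide_distrib lessThan_Suc_atMost
        del: fact_Suc binomial_Suc_Suc)
  qed
  also have "\<dots> = (\<Sum>m\<le>Suc ?n. wcoeff (power_deriv x m y) w / fact m)"
    by (simp add: sum.atMost_Suc_shift[where n = ?n] power_deriv_def del: fact_Suc sum.atMost_Suc)
  finally show ?thesis .
qed


section \<open>Coefficientwise calculus\<close>

definition ncc :: "'t::topological_space set \<Rightarrow> ('t \<Rightarrow> 'a ncps) \<Rightarrow> bool" where
  "ncc S f \<longleftrightarrow> (\<forall>w. continuous_on S (\<lambda>t. wcoeff (f t) w))"

definition ncd :: "(real \<Rightarrow> 'a ncps) \<Rightarrow> 'a ncps \<Rightarrow> real \<Rightarrow> real set \<Rightarrow> bool" where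
  "ncd f f' t S \<longleftrightarrow> (\<forall>w. ((\<lambda>s. wcoeff (f s) w) has_real_derivative wcoeff f' w) (at t within S))"

lemma ncc_const [intro, simp]: "ncc S (\<lambda>t. a)"
  and ncc_add [intro]: "ncc S f \<Longrightarrow> ncc S g \<Longrightarrow> ncc S (\<lambda>t. f t + g t)"
  and ncc_diff [intro]: "ncc S f \<Longrightarrow> ncc S g \<Longrightarrow> ncc S (\<lambda>t. f t - g t)"
  and ncc_minus [intro]: "ncc S f \<Longrightarrow> ncc S (\<lambda>t. - f t)"
  and ncc_scale [intro]: "continuous_on S c \<Longrightarrow> ncc S f \<Longrightarrow> ncc S (\<lambda>t. c t *\<^sub>R f t)"
  and ncc_mult [intro]: "ncc S f \<Longrightarrow> ncc S g \<Longrightarrow> ncc S (\<lambda>t. f t * g t)"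
  by (auto simp: ncc_def wcoeff_mult intro!: continuous_intros)

lemma ncc_sum [intro]: "(\<And>i. i \<in> I \<Longrightarrow> ncc S (f i)) \<Longrightarrow> ncc S (\<lambda>t. \<Sum>i\<in>I. f i t)"
  by (induction I rule: infinite_finite_induct) auto

lemma ncc_power [intro]: "ncc S f \<Longrightarrow> ncc S (\<lambda>t. f t ^ m)"
  by (induction m) auto

lemma ncc_compose: "ncc S f \<Longrightarrow> continuous_on T g \<Longrightarrow> g ` T \<subseteq> S \<Longrightarrow> ncc T (\<lambda>t. f (g t))"
  unfolding ncc_def using continuous_on_compose2 by blast

lemma ncc_op_series:
  assumes "\<And>t. t \<in> S \<Longrightarrow> raising (T t)" and "\<And>m. ncc S (\<lambda>t. (T t ^^ m) (y t))"
  shows "ncc S (\<lambda>t. op_series c (T t) (y t))"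
  unfolding ncc_def
proof
  fix w
  have "continuous_on S (\<lambda>t. \<Sum>m\<le>length w. c m * wcoeff ((T t ^^ m) (y t)) w)"
    using assms(2) by (auto simp: ncc_def intro!: continuous_intros)
  then show "continuous_on S (\<lambda>t. wcoeff (op_series c (T t) (y t)) w)"
    by (simp add: op_series_coeff[OF assms(1) order_refl] cong: continuous_on_cong)
qed

lemma ncc_ev_fps: "ncc S f \<Longrightarrow> (\<And>t. t \<in> S \<Longrightarrow> wcoeff (f t) [] = 0) \<Longrightarrow> ncc S (\<lambda>t. ev_fps g (f t))"
  unfolding ev_fps_def
  by (rule ncc_op_series) (auto simp: funpow_mult_1 raising_mult)

lemma ncc_exp: "ncc S f \<Longrightarrow> (\<And>t. t \<in> S \<Longrightarrow> wcoeff (f t) [] = 0) \<Longrightarrow> ncc S (\<lambda>t. nc_exp (f t))"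
  and ncc_log: "ncc S f \<Longrightarrow> (\<And>t. t \<in> S \<Longrightarrow> wcoeff (f t) [] = 1) \<Longrightarrow> ncc S (\<lambda>t. nc_log (f t))"
  unfolding nc_exp_ev nc_log_ev by (auto intro!: ncc_ev_fps)

lemma ncc_inv: "ncc S f \<Longrightarrow> (\<And>t. t \<in> S \<Longrightarrow> wcoeff (f t) [] = 1) \<Longrightarrow> ncc S (\<lambda>t. nc_inv (f t))"
  unfolding nc_inv_def by (intro ncc_exp ncc_minus ncc_log) auto

lemma ncc_act_series:
  assumes "ncc S x" "ncc S y" "\<And>t. t \<in> S \<Longrightarrow> wcoeff (x t) [] = 0"
  shows "ncc S (\<lambda>t. op_series c (act (x t)) (y t))"
proof (rule ncc_op_series)
  show "ncc S (\<lambda>t. (act (x t) ^^ m) (y t))" for m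
    using assms(1,2) by (induction m) (auto simp: act_eq)
qed (use assms(3) in \<open>auto intro: raising_act\<close>)

lemma ncd_const [intro, simp]: "ncd (\<lambda>t. a) 0 t S"
  and ncd_add: "ncd f f' t S \<Longrightarrow> ncd g g' t S \<Longrightarrow> ncd (\<lambda>t. f t + g t) (f' + g') t S"
  and ncd_diff: "ncd f f' t S \<Longrightarrow> ncd g g' t S \<Longrightarrow> ncd (\<lambda>t. f t - g t) (f' - g') t S"
  and ncd_minus: "ncd f f' t S \<Longrightarrow> ncd (\<lambda>t. - f t) (- f') t S"
  by (auto simp: ncd_def intro!: derivative_eq_intros)

lemma ncd_mult: "ncd f f' t S \<Longrightarrow> ncd g g' t S \<Longrightarrow> ncd (\<lambda>t. f t * g t) (f' * g t + f t * g') t S"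
  unfolding ncd_def wcoeff_mult wcoeff_simps
  by (auto intro!: derivative_eq_intros sum.cong simp: sum.distrib[symmetric] mult.commute)

lemma ncd_mult_left: "ncd f f' t S \<Longrightarrow> ncd (\<lambda>t. a * f t) (a * f') t S"
  and ncd_mult_right: "ncd f f' t S \<Longrightarrow> ncd (\<lambda>t. f t * a) (f' * a) t S"
  using ncd_mult[OF ncd_const, of f f' t S a] ncd_mult[OF _ ncd_const, of f f' t S a] by auto

lemma ncd_power: "ncd f f' t S \<Longrightarrow> ncd (\<lambda>s. f s ^ m) (power_deriv (f t) m f') t S"
proof (induction m)
  case (Suc m)
  then have "ncd (\<lambda>s. f s * f s ^ m) (f' * f t ^ m + f t * power_deriv (f t) m f') t S"
    by (intro ncd_mult) auto
  then show ?case by (simp add: power_deriv_Suc add.commute)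
qed (simp add: power_deriv_def)

lemma ncd_subset: "ncd f f' t S \<Longrightarrow> T \<subseteq> S \<Longrightarrow> ncd f f' t T"
  by (auto simp: ncd_def intro: DERIV_subset)

lemma ncd_transform:
  assumes "ncd f f' t S" "t \<in> S" "\<And>s. s \<in> S \<Longrightarrow> g s = f s"
  shows "ncd g f' t S"
  using assms unfolding ncd_def has_field_derivative_def
  by (auto intro: has_derivative_transform[rotated 2])

lemma ncd_unique:
  assumes "ncd f f1 t S" "ncd f f2 t S" "at t within S \<noteq> bot"
  shows "f1 = f2"
  by (rule ncps_eqI)
     (use assms in \<open>auto simp: ncd_def has_field_derivative_iff intro: tendsto_unique\<close>)

lemma ncd_imp_ncc: "(\<And>t. t \<in> S \<Longrightarrow> ncd f (f' t) t S) \<Longrightarrow> ncc S f"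
  by (auto simp: ncd_def ncc_def intro!: DERIV_continuous_on)

text \<open>Only differentiability is recorded. Where the value matters, it is recovered afterwards
  by differentiating an identity such as exp(log H) = H.\<close>

lemma ncd_ev_fps:
  assumes "ncd f f' t S" "t \<in> S" "\<And>s. s \<in> S \<Longrightarrow> wcoeff (f s) [] = 0"
  shows "\<exists>g'. ncd (\<lambda>s. ev_fps g (f s)) g' t S"
proof
  let ?g' = "Ncps (\<lambda>w. \<Sum>m\<le>length w. fps_nth g m * wcoeff (power_deriv (f t) m f') w)"
  have "((\<lambda>s. \<Sum>m\<le>length w. fps_nth g m * wcoeff (f s ^ m) w) has_real_derivative wcoeff ?g' w) (at t within S)" for w
    using ncd_power[OF assms(1)] unfolding ncd_def wcoeff_Ncps by (intro DERIV_sum DERIV_cmult) blast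
  then show "ncd (\<lambda>s. ev_fps g (f s)) ?g' t S"
    unfolding ncd_def has_field_derivative_def
    by (auto intro!: has_derivative_transform[OF assms(2) ev_fps_coeff[OF assms(3) order_refl]])
qed

lemma ncd_exp:
  assumes "ncd f f' t S" "t \<in> S" "\<And>s. s \<in> S \<Longrightarrow> wcoeff (f s) [] = 0"
  shows "ncd (\<lambda>s. nc_exp (f s)) (nc_exp (f t) * op_series (fps_nth phi_fps) (act (f t)) f') t S"
  unfolding ncd_def
proof
  fix w
  have "((\<lambda>s. \<Sum>m\<le>Suc (length w). fps_nth (fps_exp 1) m * wcoeff (f s ^ m) w) has_real_derivative
      (\<Sum>m\<le>Suc (length w). fps_nth (fps_exp 1) m * wcoeff (power_deriv (f t) m f') w)) (at t within S)"
    using ncd_power[OF assms(1)] unfolding ncd_def by (intro DERIV_sum DERIV_cmult) blast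
  then show "((\<lambda>s. wcoeff (nc_exp (f s)) w) has_real_derivative
      wcoeff (nc_exp (f t) * op_series (fps_nth phi_fps) (act (f t)) f') w) (at t within S)"
    unfolding has_field_derivative_def exp_deriv_series[OF assms(3)[OF assms(2)]]
    by (rule has_derivative_transform[OF assms(2), rotated, OF has_derivative_eq_rhs])
       (auto simp: nc_exp_ev ev_fps_coeff[OF assms(3), of _ w "Suc (length w)"] fun_eq_iff field_simps
         simp del: sum.atMost_Suc fact_Suc)
qed

section \<open>The Magnus equation for logarithms and its equivalence with a linear equation\<close>

abbreviation toddad :: "'a ncps \<Rightarrow> 'a ncps \<Rightarrow> 'a ncps" where
  "toddad x k \<equiv> op_series (fps_nth todd_fps) (act x) k"

lemma todd_eq: "todd x k = toddad (dd x) k"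
  by (simp add: todd_def derived_br_eq)

text \<open>Differentiating exp(log H) = H gives H phi(ad L) L' = H B. Cancelling the unit H and
  inverting phi by the Todd series solves for L'.\<close>

lemma log_derivative:
  assumes H: "ncd H (H t * B) t S" and t: "t \<in> S" "at t within S \<noteq> bot"
    and H1: "\<And>s. s \<in> S \<Longrightarrow> wcoeff (H s) [] = 1"
  shows "ncd (\<lambda>s. nc_log (H s)) (toddad (nc_log (H t)) B) t S"
proof -
  let ?L = "\<lambda>s. nc_log (H s)"
  have L0: "wcoeff (?L s) [] = 0" if "s \<in> S" for s
    using H1[OF that] by simp
  obtain L' where L': "ncd ?L L' t S"
    using ncd_ev_fps[of "\<lambda>s. H s - 1" "H t * B" t S "fps_ln 1"] ncd_diff[OF H ncd_const] t(1) H1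
    by (auto simp: nc_log_ev)
  have "ncd (\<lambda>s. nc_exp (?L s)) (H t * op_series (fps_nth phi_fps) (act (?L t)) L') t S"
    using ncd_exp[OF L' t(1) L0] H1[OF t(1)] by (simp add: nc_exp_log)
  then have "ncd H (H t * op_series (fps_nth phi_fps) (act (?L t)) L') t S"
    by (rule ncd_transform[OF _ t(1)]) (simp add: H1 nc_exp_log)
  then have "H t * op_series (fps_nth phi_fps) (act (?L t)) L' = H t * B"
    by (rule ncd_unique[OF _ H t(2)])
  then have "nc_inv (H t) * H t * op_series (fps_nth phi_fps) (act (?L t)) L' = nc_inv (H t) * H t * B"
    by (simp add: mult.assoc)
  then have "op_series (fps_nth phi_fps) (act (?L t)) L' = B"
    using nc_inv(2)[OF H1[OF t(1)]] by simp
  then have "L' = toddad (?L t) B"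
    using todd_phi_op[OF L0[OF t(1)], of L'] by simp
  then show ?thesis using L' by simp
qed

text \<open>Converse of \<open>log_derivative\<close>: phi(ad L) undoes the Todd series, and the
  Magnus equation becomes linear for the exponential.\<close>

lemma log_ode_exp:
  assumes L: "ncd L (toddad (L t) B) t S" and t: "t \<in> S" and L0: "\<And>s. s \<in> S \<Longrightarrow> wcoeff (L s) [] = 0"
  shows "ncd (\<lambda>s. nc_exp (L s)) (nc_exp (L t) * B) t S"
  using ncd_exp[OF L t L0] phi_todd_op[OF L0[OF t]] by simp

text \<open>Since the coefficients of \<open>B\<close> at the empty word vanish, the equation \<open>H' = H B\<close> is triangular
  in the word length.\<close>

lemma linear_ode_unique:
  assumes "finite F" and G: "ncc {a..b} G" "\<And>t. t \<in> {a..b} - F \<Longrightarrow> ncd G (G t * B t) t {a..b}"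
    and H: "ncc {a..b} H" "\<And>t. t \<in> {a..b} - F \<Longrightarrow> ncd H (H t * B t) t {a..b}"
    and B: "\<And>t. t \<in> {a..b} - F \<Longrightarrow> wcoeff (B t) [] = 0" and ini: "G a = H a" and x: "x \<in> {a..b}"
  shows "G x = H x"
proof -
  have "\<forall>x\<in>{a..b}. wcoeff (G x - H x) w = 0" for w
  proof (induction w rule: length_induct)
    case (1 w)
    have "((\<lambda>s. wcoeff (G s - H s) w) has_derivative (\<lambda>h. 0)) (at t within {a..b})" if t: "t \<in> {a..b} - F" for t
    proof -
      have "ncd (\<lambda>s. G s - H s) ((G t - H t) * B t) t {a..b}"
        using ncd_diff[OF G(2)[OF t] H(2)[OF t]] by (simp add: algebra_simps)
      moreover have "wcoeff ((G t - H t) * B t) w = 0"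
        unfolding wcoeff_mult
      proof (intro sum.neutral ballI)
        fix k assume "k \<in> {..length w}"
        then show "wcoeff (G t - H t) (take k w) * wcoeff (B t) (drop k w) = 0"
          using 1[rule_format, of "take k w" t] B[OF t] t by (cases "k = length w") auto
      qed
      ultimately show ?thesis by (auto simp: ncd_def has_field_derivative_def fun_eq_iff intro: has_derivative_eq_rhs)
    qed
    moreover have "continuous_on {a..b} (\<lambda>s. wcoeff (G s - H s) w)"
      using ncc_diff[OF G(1) H(1)] by (auto simp: ncc_def)
    ultimately show ?case
      using has_derivative_zero_unique_strong_interval[OF assms(1), of a b "\<lambda>s. wcoeff (G s - H s) w" 0] ini
      by auto
  qed
  then show ?thesis using x by (intro ncps_eqI) auto
qed

subsection \<open>Integrals\<close>

definition nint :: "real \<Rightarrow> real \<Rightarrow> (real \<Rightarrow> 'a ncps) \<Rightarrow> 'a ncps" where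
  "nint a b f = Ncps (\<lambda>w. integral {a..b} (\<lambda>t. wcoeff (f t) w))"

lemma wcoeff_nint: "wcoeff (nint a b f) w = integral {a..b} (\<lambda>t. wcoeff (f t) w)"
  by (simp add: nint_def)

lemma ncc_integrable:
  fixes f :: "real \<Rightarrow> 'a ncps"
  shows "ncc {a..b} f \<Longrightarrow> (\<lambda>t. wcoeff (f t) w) integrable_on {a..b}"
  unfolding ncc_def by (rule integrable_continuous_interval) blast

lemma nint_ncd: "ncc {a..b} f \<Longrightarrow> t \<in> {a..b} \<Longrightarrow> ncd (\<lambda>t. nint a t f) (f t) t {a..b}"
  by (auto simp: ncd_def ncc_def wcoeff_nint intro: integral_has_real_derivative)

text \<open>Each coefficient of the image is a finite combination of coefficients of the argument,
  so integration passes through it. Multiplication by a fixed series and \<open>dd\<close> are of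
  this form.\<close>

lemma nint_linear_combination:
  assumes "ncc {a..b} f"
    and "\<And>f. ncc {a..b} f \<Longrightarrow> ncc {a..b} (\<lambda>t. \<Phi> (f t))"
    and fin: "\<And>w. finite (I w)" and \<Phi>: "\<And>x w. wcoeff (\<Phi> x) w = (\<Sum>i\<in>I w. c w i * wcoeff x (u w i))"
  shows "\<Phi> (nint a b f) = nint a b (\<lambda>t. \<Phi> (f t))"
proof (rule ncps_eqI)
  fix w
  have "integral {a..b} (\<lambda>t. \<Sum>i\<in>I w. c w i * wcoeff (f t) (u w i)) =
      (\<Sum>i\<in>I w. integral {a..b} (\<lambda>t. c w i * wcoeff (f t) (u w i)))"
    using assms(1) unfolding ncc_def
    by (intro integral_sum fin integrable_continuous_interval continuous_intros) blast
  then show "wcoeff (\<Phi> (nint a b f)) w = wcoeff (nint a b (\<lambda>t. \<Phi> (f t))) w"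
    by (simp add: \<Phi> wcoeff_nint)
qed

lemma nint_mult_left: "ncc {a..b} f \<Longrightarrow> nint a b (\<lambda>t. x * f t) = x * nint a b f"
  by (rule nint_linear_combination[where \<Phi> = "\<lambda>y. x * y" and I = "\<lambda>w. {..length w}"
        and c = "\<lambda>w k. wcoeff x (take k w)" and u = "\<lambda>w k. drop k w", symmetric])
     (auto simp: wcoeff_mult)

lemma nint_mult_right: "ncc {a..b} f \<Longrightarrow> nint a b (\<lambda>t. f t * x) = nint a b f * x"
  by (rule nint_linear_combination[where \<Phi> = "\<lambda>y. y * x" and I = "\<lambda>w. {..length w}"
        and c = "\<lambda>w k. wcoeff x (drop k w)" and u = "\<lambda>w k. take k w", symmetric])
     (auto simp: wcoeff_mult mult.commute)

lemma nint_combine: "a \<le> c \<Longrightarrow> c \<le> b \<Longrightarrow> ncc {a..b} f \<Longrightarrow> nint a c f + nint c b f = nint a b f"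
  by (auto simp: ncps_eq_iff wcoeff_nint intro!: Henstock_Kurzweil_Integration.integral_combine ncc_integrable)

lemma nint_cong: "(\<And>t. t \<in> {a..b} \<Longrightarrow> f t = g t) \<Longrightarrow> nint a b f = nint a b g"
  by (auto simp: ncps_eq_iff wcoeff_nint intro!: Henstock_Kurzweil_Integration.integral_cong)

lemma nint_refl [simp]: "nint a a f = 0"
  by (simp add: ncps_eq_iff wcoeff_nint)

lemma nint_ftc:
  assumes "a \<le> b" "\<And>t. t \<in> {a..b} \<Longrightarrow> ncd f (f' t) t {a..b}"
  shows "nint a b f' = f b - f a"
proof (rule ncps_eqI)
  fix w
  have "((\<lambda>t. wcoeff (f' t) w) has_integral (wcoeff (f b) w - wcoeff (f a) w)) {a..b}"
    using assms by (intro fundamental_theorem_of_calculus)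
      (auto simp: ncd_def has_real_derivative_iff_has_vector_derivative)
  then show "wcoeff (nint a b f') w = wcoeff (f b - f a) w"
    by (simp add: wcoeff_nint integral_unique)
qed


section \<open>Path signatures as flows\<close>

definition lets :: "real ^ 'n::finite \<Rightarrow> 'n gen ncps" where
  "lets v = (\<Sum>i\<in>UNIV. (v $ i) *\<^sub>R letter (Z i))"

lemma wcoeff_lets: "wcoeff (lets v) w = (case w of [Z i] \<Rightarrow> v $ i | _ \<Rightarrow> 0)"
proof (cases "\<exists>i. w = [Z i]")
  case True
  then obtain i where "w = [Z i]" by blast
  then have "wcoeff (lets v) w = (\<Sum>j\<in>UNIV. if j = i then v $ j else 0)"
    unfolding lets_def wcoeff_sum by (intro sum.cong[OF refl]) simp
  then have "wcoeff (lets v) w = v $ i"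
    by (simp only: sum.delta[OF finite]) simp
  then show ?thesis using \<open>w = [Z i]\<close> by simp
next
  case False
  then show ?thesis unfolding lets_def wcoeff_sum
    by (auto split: list.splits gen.splits)
qed

lemma lets_scale: "lets (c *\<^sub>R v) = c *\<^sub>R lets v"
  and lets_minus: "lets (- v) = - lets v"
  and lets_0 [simp]: "lets 0 = 0"
  by (auto simp: ncps_eq_iff wcoeff_lets split: list.splits gen.splits)

lemma ncc_lets: "continuous_on S y \<Longrightarrow> ncc S (\<lambda>t. lets (y t))"
  unfolding lets_def by (intro ncc_sum ncc_scale continuous_intros) auto

text \<open>Right multiplication by a combination of letters only reads off the last letter, which
  makes the signature equation a recursion on words.\<close>

lemma wcoeff_mult_lets:
  "wcoeff (a * lets v) (u @ [g]) = (case g of Z i \<Rightarrow> wcoeff a u * v $ i | _ \<Rightarrow> 0)"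
proof -
  have "wcoeff (a * lets v) (u @ [g]) =
      (\<Sum>k\<le>length (u @ [g]). if k = length u then (case g of Z i \<Rightarrow> wcoeff a u * v $ i | _ \<Rightarrow> 0) else 0)"
    unfolding wcoeff_mult
  proof (rule sum.cong[OF refl])
    fix k assume k: "k \<in> {..length (u @ [g])}"
    consider "k = length u" | "k < length u" | "k = Suc (length u)"
      using k by (auto simp: le_Suc_eq nat_less_le)
    then show "wcoeff a (take k (u @ [g])) * wcoeff (lets v) (drop k (u @ [g])) =
        (if k = length u then (case g of Z i \<Rightarrow> wcoeff a u * v $ i | _ \<Rightarrow> 0) else 0)"
    proof cases
      case 2
      then have "2 \<le> length (drop k (u @ [g]))" by simp
      then obtain x y z where "drop k (u @ [g]) = x # y # z"
        by (cases "drop k (u @ [g])"; cases "tl (drop k (u @ [g]))") auto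
      then have "wcoeff (lets v) (drop k (u @ [g])) = 0"
        unfolding wcoeff_lets by (auto split: gen.splits)
      then show ?thesis using 2 by simp
    qed (auto simp: wcoeff_lets split: gen.splits)
  qed
  then show ?thesis by simp
qed

lemma wcoeff_lets_Nil [simp]: "wcoeff (lets v) [] = 0"
  by (simp add: wcoeff_lets)

lemma ncd_transform_open:
  assumes "ncd f f' t UNIV" "open U" "t \<in> U" "\<And>s. s \<in> U \<Longrightarrow> f s = g s"
  shows "ncd g f' t UNIV"
  unfolding ncd_def
proof
  fix w
  show "((\<lambda>s. wcoeff (g s) w) has_real_derivative wcoeff f' w) (at t)"
    by (rule has_field_derivative_transform_within_open[OF _ assms(2,3), of "\<lambda>s. wcoeff (f s) w"]) (use assms in \<open>auto simp: ncd_def\<close>)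
qed

lemma ncd_affine: "ncd f f' (m * t + c) UNIV \<Longrightarrow> ncd (\<lambda>t. f (m * t + c)) (m *\<^sub>R f') t UNIV"
  unfolding ncd_def
proof
  fix w
  assume "\<forall>w. ((\<lambda>s. wcoeff (f s) w) has_real_derivative wcoeff f' w) (at (m * t + c))"
  then have "((\<lambda>s. wcoeff (f (m * s + c)) w) has_real_derivative wcoeff f' w * m) (at t)"
    by (intro DERIV_chain2[of "\<lambda>s. wcoeff (f s) w" _ "\<lambda>s. m * s + c"]) (auto intro!: derivative_eq_intros)
  then show "((\<lambda>s. wcoeff (f (m * s + c)) w) has_real_derivative wcoeff (m *\<^sub>R f') w) (at t)"
    by (simp add: mult.commute)
qed

text \<open>Corners of the path go into the finite set \<open>F\<close>. Continuity on the closed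
  interval is demanded separately, so that the exceptional times cannot produce jumps.\<close>

definition sig_flow :: "(real \<Rightarrow> real ^ 'n::finite) \<Rightarrow> real \<Rightarrow> real \<Rightarrow> (real \<Rightarrow> 'n gen ncps) \<Rightarrow> bool" where
  "sig_flow \<eta> a b S \<longleftrightarrow> S a = 1 \<and> ncc {a..b} S \<and>
     (\<exists>F. finite F \<and> (\<forall>t\<in>{a<..<b} - F. \<exists>v. (\<eta> has_vector_derivative v) (at t) \<and> ncd S (S t * lets v) t UNIV))"

definition transport :: "(real \<Rightarrow> real ^ 'n::finite) \<Rightarrow> real \<Rightarrow> real \<Rightarrow> 'n gen ncps \<Rightarrow> bool" where
  "transport \<eta> a b s \<longleftrightarrow> (\<exists>S. sig_flow \<eta> a b S \<and> S b = s)"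

lemma sig_flow_ode:
  assumes "sig_flow \<eta> a b S"
  obtains F where "finite F"
    "\<And>t. t \<in> {a..b} - F \<Longrightarrow> ncd S (S t * lets (vector_derivative \<eta> (at t))) t {a..b}"
    "\<And>t. t \<in> {a..b} - F \<Longrightarrow> ncd S (S t * lets (vector_derivative \<eta> (at t))) t UNIV"
proof -
  obtain F where F: "finite F"
    "\<And>t. t \<in> {a<..<b} - F \<Longrightarrow> \<exists>v. (\<eta> has_vector_derivative v) (at t) \<and> ncd S (S t * lets v) t UNIV"
    using assms by (auto simp: sig_flow_def)
  have *: "ncd S (S t * lets (vector_derivative \<eta> (at t))) t UNIV" if "t \<in> {a..b} - (F \<union> {a, b})" for t
  proof -
    have "t \<in> {a<..<b} - F" using that by auto
    then obtain v where "(\<eta> has_vector_derivative v) (at t)" "ncd S (S t * lets v) t UNIV"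
      using F(2) by blast
    then show ?thesis by (simp add: vector_derivative_at)
  qed
  show ?thesis
    by (rule that[of "F \<union> {a, b}"]) (use F(1) * in \<open>auto intro: ncd_subset\<close>)
qed

lemma sig_flow_unique:
  assumes S: "sig_flow \<eta> a b S" "sig_flow \<eta> a b S'" and x: "x \<in> {a..b}"
  shows "S x = S' x"
proof -
  let ?B = "\<lambda>t. lets (vector_derivative \<eta> (at t))"
  obtain F where F: "finite F" "\<And>t. t \<in> {a..b} - F \<Longrightarrow> ncd S (S t * ?B t) t {a..b}"
    using sig_flow_ode[OF S(1)] by metis
  obtain F' where F': "finite F'" "\<And>t. t \<in> {a..b} - F' \<Longrightarrow> ncd S' (S' t * ?B t) t {a..b}"
    using sig_flow_ode[OF S(2)] by metis
  show ?thesis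
    by (rule linear_ode_unique[of "F \<union> F'" a b S ?B S']) (use F F' S x in \<open>auto simp: sig_flow_def\<close>)
qed

lemma sig_flow_Nil:
  assumes S: "sig_flow \<eta> a b S" and x: "x \<in> {a..b}"
  shows "wcoeff (S x) [] = 1"
proof -
  obtain F where F: "finite F"
    "\<And>t. t \<in> {a..b} - F \<Longrightarrow> ncd S (S t * lets (vector_derivative \<eta> (at t))) t {a..b}"
    using sig_flow_ode[OF S] by metis
  have "((\<lambda>s. wcoeff (S s) []) has_derivative (\<lambda>h. 0)) (at t within {a..b})" if t: "t \<in> {a..b} - F" for t
  proof -
    have "((\<lambda>s. wcoeff (S s) []) has_real_derivative 0) (at t within {a..b})"
      using F(2)[OF t] unfolding ncd_def by (metis mult_zero_right wcoeff_lets_Nil wcoeff_mult_Nil)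
    then show ?thesis by (simp add: has_field_derivative_def fun_eq_iff lambda_zero)
  qed
  moreover have "continuous_on {a..b} (\<lambda>s. wcoeff (S s) [])" "wcoeff (S a) [] = 1"
    using S by (auto simp: sig_flow_def ncc_def)
  ultimately show ?thesis
    using has_derivative_zero_unique_strong_interval[OF F(1), of a b "\<lambda>s. wcoeff (S s) []" 1 x] x by blast
qed

lemma transport_unique: "transport \<eta> a b s \<Longrightarrow> transport \<eta> a b s' \<Longrightarrow> a \<le> b \<Longrightarrow> s = s'"
  unfolding transport_def using sig_flow_unique by (metis atLeastAtMost_iff order_refl)

lemma transport_Nil: "transport \<eta> a b s \<Longrightarrow> a \<le> b \<Longrightarrow> wcoeff s [] = 1"
  unfolding transport_def using sig_flow_Nil by (metis atLeastAtMost_iff order_refl)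

lemma transport_refl: "transport \<eta> a a 1"
  unfolding transport_def sig_flow_def by (rule exI[of _ "\<lambda>_. 1"]) auto

lemma transport_const: "transport (\<lambda>_. p) a b 1"
  unfolding transport_def sig_flow_def
  by (rule exI[of _ "\<lambda>_. 1"]) (auto intro!: exI[of _ "{}"] exI[of _ 0])

lemma transport_cong:
  assumes "transport \<eta> a b s" "\<And>t. t \<in> {a<..<b} \<Longrightarrow> \<eta> t = \<eta>' t"
  shows "transport \<eta>' a b s"
proof -
  have "(\<eta>' has_vector_derivative v) (at t)" if "(\<eta> has_vector_derivative v) (at t)" "t \<in> {a<..<b}" for v t
    by (rule has_vector_derivative_transform_within_open[OF that(1) open_greaterThanLessThan that(2) assms(2)])
  note * = this
  obtain S F where S: "S a = 1" "ncc {a..b} S" "S b = s" "finite F"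
    "\<forall>t\<in>{a<..<b} - F. \<exists>v. (\<eta> has_vector_derivative v) (at t) \<and> ncd S (S t * lets v) t UNIV"
    using assms(1) unfolding transport_def sig_flow_def by blast
  have "\<exists>v. (\<eta>' has_vector_derivative v) (at t) \<and> ncd S (S t * lets v) t UNIV" if "t \<in> {a<..<b} - F" for t
    using S(5) that * by blast
  then show ?thesis
    using S unfolding transport_def sig_flow_def by blast
qed

text \<open>Chen's identity: the flow is continued after c by s times the second flow, which still
  solves the equation because left multiplication by a constant commutes with it.\<close>

lemma transport_join:
  assumes c: "a \<le> c" "c \<le> b" and s: "transport \<eta> a c s" "transport \<eta> c b s'"
  shows "transport \<eta> a b (s * s')"
proof -
  obtain S S' where S: "sig_flow \<eta> a c S" "S c = s" "sig_flow \<eta> c b S'" "S' b = s'"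
    using s by (auto simp: transport_def)
  obtain F F' where F: "finite F" "finite F'"
    "\<And>t. t \<in> {a<..<c} - F \<Longrightarrow> \<exists>v. (\<eta> has_vector_derivative v) (at t) \<and> ncd S (S t * lets v) t UNIV"
    "\<And>t. t \<in> {c<..<b} - F' \<Longrightarrow> \<exists>v. (\<eta> has_vector_derivative v) (at t) \<and> ncd S' (S' t * lets v) t UNIV"
    using S by (auto simp: sig_flow_def)
  define T where "T = (\<lambda>t. if t \<le> c then S t else s * S' t)"
  have c1: "S' c = 1" using S by (simp add: sig_flow_def)
  have "sig_flow \<eta> a b T"
    unfolding sig_flow_def
  proof (intro conjI exI[of _ "F \<union> F' \<union> {c}"] ballI)
    show "T a = 1" using c S by (simp add: T_def sig_flow_def)
    show "ncc {a..b} T"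
      unfolding ncc_def
    proof
      fix w
      have "continuous_on {a..b} (\<lambda>t. if t \<le> c then wcoeff (S t) w else wcoeff (s * S' t) w)"
      proof (rule continuous_on_cases_le)
        have "ncc {a..c} S" "ncc {c..b} (\<lambda>t. s * S' t)"
          using S by (auto simp: sig_flow_def)
        moreover have "{t \<in> {a..b}. t \<le> c} = {a..c}" "{t \<in> {a..b}. c \<le> t} = {c..b}" using c by auto
        ultimately show "continuous_on {t \<in> {a..b}. t \<le> c} (\<lambda>t. wcoeff (S t) w)"
          "continuous_on {t \<in> {a..b}. c \<le> t} (\<lambda>t. wcoeff (s * S' t) w)"
          by (auto simp: ncc_def)
      qed (use c1 S in auto)
      then show "continuous_on {a..b} (\<lambda>t. wcoeff (T t) w)"
        by (simp add: T_def if_distrib if_distribR cong: if_cong)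
    qed
    fix t assume t: "t \<in> {a<..<b} - (F \<union> F' \<union> {c})"
    show "\<exists>v. (\<eta> has_vector_derivative v) (at t) \<and> ncd T (T t * lets v) t UNIV"
    proof (cases "t < c")
      case True
      with F(3)[of t] t obtain v where v: "(\<eta> has_vector_derivative v) (at t)" "ncd S (S t * lets v) t UNIV"
        by auto
      have "ncd T (S t * lets v) t UNIV"
        by (rule ncd_transform_open[OF v(2), of "{..<c}"]) (use True in \<open>auto simp: T_def\<close>)
      then show ?thesis using v True by (auto simp: T_def)
    next
      case False
      with F(4)[of t] t obtain v where v: "(\<eta> has_vector_derivative v) (at t)" "ncd S' (S' t * lets v) t UNIV"
        by auto
      have "ncd T (s * (S' t * lets v)) t UNIV"
        by (rule ncd_transform_open[OF ncd_mult_left[OF v(2)], of "{c<..}"]) (use False t in \<open>auto simp: T_def\<close>)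
      then show ?thesis using v False t by (intro exI[of _ v]) (auto simp: T_def mult.assoc)
    qed
  qed (use F in auto)
  moreover have "T b = s * s'"
    using S c1 c by (cases "b = c") (auto simp: T_def)
  ultimately show ?thesis by (auto simp: transport_def)
qed

lemma transport_affine:
  assumes "transport \<eta> (m * a + c) (m * b + c) s" "m > 0"
  shows "transport (\<lambda>t. \<eta> (m * t + c)) a b s"
proof -
  obtain S where S: "sig_flow \<eta> (m * a + c) (m * b + c) S" "S (m * b + c) = s"
    using assms by (auto simp: transport_def)
  then obtain F where F: "finite F" "\<And>t. t \<in> {m * a + c<..<m * b + c} - F \<Longrightarrow>
      \<exists>v. (\<eta> has_vector_derivative v) (at t) \<and> ncd S (S t * lets v) t UNIV"
    by (auto simp: sig_flow_def)
  have "sig_flow (\<lambda>t. \<eta> (m * t + c)) a b (\<lambda>t. S (m * t + c))"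
    unfolding sig_flow_def
  proof (intro conjI exI[of _ "(\<lambda>x. (x - c) / m) ` F"] ballI)
    show "ncc {a..b} (\<lambda>t. S (m * t + c))"
      by (rule ncc_compose[of "{m * a + c..m * b + c}"])
         (use S assms(2) in \<open>auto simp: sig_flow_def intro!: continuous_intros\<close>)
    fix t assume t: "t \<in> {a<..<b} - (\<lambda>x. (x - c) / m) ` F"
    have "m * t + c \<notin> F"
    proof
      assume "m * t + c \<in> F"
      then have "(m * t + c - c) / m \<in> (\<lambda>x. (x - c) / m) ` F" by blast
      then show False using t assms(2) by simp
    qed
    then obtain v where v: "(\<eta> has_vector_derivative v) (at (m * t + c))" "ncd S (S (m * t + c) * lets v) (m * t + c) UNIV"
      using F(2)[of "m * t + c"] t assms(2) by auto
    have "(\<eta> \<circ> (\<lambda>t. m * t + c) has_vector_derivative m *\<^sub>R v) (at t)"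
      by (rule vector_diff_chain_at) (use v(1) in \<open>auto intro!: derivative_eq_intros\<close>)
    moreover have "ncd (\<lambda>t. S (m * t + c)) (S (m * t + c) * lets (m *\<^sub>R v)) t UNIV"
      using ncd_affine[OF v(2)] by (simp add: lets_scale)
    ultimately show "\<exists>v. ((\<lambda>t. \<eta> (m * t + c)) has_vector_derivative v) (at t) \<and>
        ncd (\<lambda>t. S (m * t + c)) (S (m * t + c) * lets v) t UNIV"
      by (auto simp: o_def)
  qed (use S F in \<open>auto simp: sig_flow_def\<close>)
  then show ?thesis using S by (auto simp: transport_def)
qed

text \<open>The reversed flow is s^(-1) S(a + b - t): it starts at 1 because S(b) = s, and ends at
  s^(-1) because S(a) = 1.\<close>

lemma transport_reverse:
  assumes "transport \<eta> a b s" "a \<le> b"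
  shows "transport (\<lambda>t. \<eta> (a + b - t)) a b (nc_inv s)"
proof -
  obtain S where S: "sig_flow \<eta> a b S" "S b = s"
    using assms by (auto simp: transport_def)
  then obtain F where F: "finite F" "\<And>t. t \<in> {a<..<b} - F \<Longrightarrow>
      \<exists>v. (\<eta> has_vector_derivative v) (at t) \<and> ncd S (S t * lets v) t UNIV"
    by (auto simp: sig_flow_def)
  have s1: "wcoeff s [] = 1" using transport_Nil assms by blast
  have "sig_flow (\<lambda>t. \<eta> (a + b - t)) a b (\<lambda>t. nc_inv s * S (a + b - t))"
    unfolding sig_flow_def
  proof (intro conjI exI[of _ "(\<lambda>x. a + b - x) ` F"] ballI ncc_mult)
    show "ncc {a..b} (\<lambda>t. S (a + b - t))"
      by (rule ncc_compose[of "{a..b}"])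
         (use S in \<open>auto simp: sig_flow_def intro!: continuous_intros\<close>)
    fix t assume t: "t \<in> {a<..<b} - (\<lambda>x. a + b - x) ` F"
    have "a + b - t \<notin> F"
    proof
      assume "a + b - t \<in> F"
      then have "a + b - (a + b - t) \<in> (\<lambda>x. a + b - x) ` F" by blast
      then show False using t by simp
    qed
    then obtain v where v: "(\<eta> has_vector_derivative v) (at (a + b - t))" "ncd S (S (a + b - t) * lets v) (a + b - t) UNIV"
      using F(2)[of "a + b - t"] t by auto
    have "(\<eta> \<circ> (\<lambda>t. a + b - t) has_vector_derivative (-1) *\<^sub>R v) (at t)"
      by (rule vector_diff_chain_at) (use v(1) in \<open>auto intro!: derivative_eq_intros\<close>)
    moreover have "ncd (\<lambda>t. S (a + b - t)) (S (a + b - t) * lets ((-1) *\<^sub>R v)) t UNIV"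
      using ncd_affine[of S _ "-1" t "a + b"] v(2) by (simp add: lets_scale lets_minus)
    ultimately show "\<exists>v. ((\<lambda>t. \<eta> (a + b - t)) has_vector_derivative v) (at t) \<and>
        ncd (\<lambda>t. nc_inv s * S (a + b - t)) (nc_inv s * S (a + b - t) * lets v) t UNIV"
      using ncd_mult_left[of "\<lambda>t. S (a + b - t)" _ t UNIV "nc_inv s"]
      by (intro exI[of _ "(-1) *\<^sub>R v"]) (auto simp: o_def mult.assoc)
  qed (use S F nc_inv[OF s1] in \<open>auto simp: sig_flow_def\<close>)
  moreover have "nc_inv s * S (a + b - b) = nc_inv s"
    using S by (simp add: sig_flow_def)
  ultimately show ?thesis unfolding transport_def by (intro exI conjI)
qed

text \<open>The recursion runs along the reversed word.\<close>

primrec itr :: "(real \<Rightarrow> real ^ 'n::finite) \<Rightarrow> real \<Rightarrow> 'n gen list \<Rightarrow> real \<Rightarrow> real" where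
  "itr y a [] r = 1"
| "itr y a (g # u) r = (case g of Z i \<Rightarrow> integral {a..r} (\<lambda>\<rho>. itr y a u \<rho> * y \<rho> $ i) | ZZ i j \<Rightarrow> 0)"

definition tr :: "(real \<Rightarrow> real ^ 'n::finite) \<Rightarrow> real \<Rightarrow> real \<Rightarrow> 'n gen ncps" where
  "tr y a r = Ncps (\<lambda>w. itr y a (rev w) r)"

lemma itr_cont: "continuous_on {a..b} y \<Longrightarrow> continuous_on {a..b} (itr y a u)"
proof (induction u)
  case (Cons g u)
  then show ?case
    by (cases g) (auto intro!: indefinite_integral_continuous_1 integrable_continuous_interval continuous_intros)
qed (simp cong: continuous_on_cong)

lemma tr_ncd:
  fixes y :: "real \<Rightarrow> real ^ 'n::finite"
  assumes "continuous_on {a..b} y" "r \<in> {a..b}"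
  shows "ncd (tr y a) (tr y a r * lets (y r)) r {a..b}"
  unfolding ncd_def
proof
  fix w :: "'n gen list"
  show "((\<lambda>s. wcoeff (tr y a s) w) has_real_derivative wcoeff (tr y a r * lets (y r)) w) (at r within {a..b})"
  proof (cases w rule: rev_cases)
    case (snoc u g)
    show ?thesis
    proof (cases g)
      case (Z i)
      have "((\<lambda>s. integral {a..s} (\<lambda>\<rho>. itr y a (rev u) \<rho> * y \<rho> $ i)) has_real_derivative
          itr y a (rev u) r * y r $ i) (at r within {a..b})"
        using assms by (intro integral_has_real_derivative continuous_intros itr_cont)
      then show ?thesis by (simp add: snoc Z tr_def wcoeff_mult_lets)
    qed (simp add: snoc tr_def wcoeff_mult_lets)
  qed (simp add: tr_def)
qed

lemma tr_start [simp]: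
  fixes y :: "real \<Rightarrow> real ^ 'n::finite"
  shows "tr y a a = 1"
proof (rule ncps_eqI)
  fix w :: "'n gen list"
  show "wcoeff (tr y a a) w = wcoeff 1 w"
    by (cases w rule: rev_cases) (auto simp: tr_def split: gen.splits)
qed

lemma sig_flow_tr:
  assumes \<eta>: "\<And>t. t \<in> {a<..<b} \<Longrightarrow> (\<eta> has_vector_derivative y t) (at t)" and y: "continuous_on {a..b} y"
  shows "sig_flow \<eta> a b (tr y a)"
  unfolding sig_flow_def
proof (intro conjI exI[of _ "{}"] ballI)
  show "ncc {a..b} (tr y a)"
    by (rule ncd_imp_ncc[OF tr_ncd[OF y]])
  fix t assume t: "t \<in> {a<..<b} - {}"
  have "at t within {a..b} = at t"
    using t by (intro at_within_interior) auto
  then have "ncd (tr y a) (tr y a t * lets (y t)) t UNIV"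
    using tr_ncd[OF y, of t] t by (auto simp: ncd_def)
  then show "\<exists>v. (\<eta> has_vector_derivative v) (at t) \<and> ncd (tr y a) (tr y a t * lets v) t UNIV"
    using \<eta>[of t] t by auto
qed auto

lemma transport_tr:
  assumes "\<And>t. t \<in> {a<..<b} \<Longrightarrow> (\<eta> has_vector_derivative y t) (at t)" and "continuous_on {a..b} y"
  shows "transport \<eta> a b (tr y a b)"
  using sig_flow_tr[OF assms] by (auto simp: transport_def)

subsection \<open>The signature of a path\<close>

text \<open>\<open>signature_eq\<close> provides no differentiability of \<open>S\<close>, but its
  integrand at a word involves \<open>S\<close> only at the word without its last letter, so
  induction on the length determines every coefficient.\<close>

lemma signature_eq_unique:
  assumes "signature_eq \<eta> S" "signature_eq \<eta> S'" "t \<in> {0..1}"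
  shows "S t = S' t"
proof -
  let ?A = "\<lambda>s. lets (vector_derivative \<eta> (at s))"
  have "\<forall>t\<in>{0..1}. wcoeff (S t) w = wcoeff (S' t) w" for w
  proof (induction w rule: length_induct)
    case (1 w)
    show ?case
    proof
      fix t :: real assume t: "t \<in> {0..1}"
      have "wcoeff (S s * ?A s) w = wcoeff (S' s * ?A s) w" if "s \<in> {0..t}" for s
      proof (cases w rule: rev_cases)
        case (snoc u g)
        then show ?thesis using 1 that t by (auto simp: wcoeff_mult_lets split: gen.splits)
      qed simp
      moreover have "((\<lambda>s. wcoeff (S s * ?A s) w) has_integral (wcoeff (S t) w - wcoeff 1 w)) {0..t}"
        "((\<lambda>s. wcoeff (S' s * ?A s) w) has_integral (wcoeff (S' t) w - wcoeff 1 w)) {0..t}"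
        using assms t by (auto simp: signature_eq_def lets_def)
      ultimately have "wcoeff (S t) w - wcoeff 1 w = wcoeff (S' t) w - wcoeff 1 w"
        by (metis (no_types, lifting) has_integral_cong has_integral_unique)
      then show "wcoeff (S t) w = wcoeff (S' t) w" by simp
    qed
  qed
  then show ?thesis using assms(3) by (auto intro: ncps_eqI)
qed

lemma sig_flow_signature_eq:
  assumes "sig_flow \<eta> 0 1 S" shows "signature_eq \<eta> S"
  unfolding signature_eq_def
proof (intro ballI allI)
  fix t :: real and w assume t: "t \<in> {0..1}"
  obtain F where F: "finite F"
    "\<And>t. t \<in> {0..1} - F \<Longrightarrow> ncd S (S t * lets (vector_derivative \<eta> (at t))) t UNIV"
    using sig_flow_ode[OF assms] by metis
  have "((\<lambda>s. wcoeff (S s * lets (vector_derivative \<eta> (at s))) w) has_integral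
      (wcoeff (S t) w - wcoeff (S 0) w)) {0..t}"
  proof (rule fundamental_theorem_of_calculus_interior_strong[OF F(1)])
    show "continuous_on {0..t} (\<lambda>s. wcoeff (S s) w)"
      using assms t by (auto simp: sig_flow_def ncc_def intro: continuous_on_subset)
    show "((\<lambda>s. wcoeff (S s) w) has_vector_derivative wcoeff (S x * lets (vector_derivative \<eta> (at x))) w) (at x)"
      if "x \<in> {0<..<t} - F" for x
      using F(2)[of x] that t by (auto simp: ncd_def has_real_derivative_iff_has_vector_derivative)
  qed (use t in auto)
  then show "((\<lambda>s. wcoeff (S s * (\<Sum>i\<in>UNIV. (vector_derivative \<eta> (at s) $ i) *\<^sub>R letter (Z i))) w)
      has_integral wcoeff (S t) w - wcoeff 1 w) {0..t}"
    using assms by (simp add: sig_flow_def lets_def)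
qed

lemma path_signature_eq:
  assumes "transport \<eta> 0 1 s" shows "path_signature \<eta> = s"
  unfolding path_signature_def
proof (rule the_equality)
  obtain S where S: "sig_flow \<eta> 0 1 S" "S 1 = s" using assms by (auto simp: transport_def)
  note S' = sig_flow_signature_eq[OF S(1)]
  show "\<exists>S. signature_eq \<eta> S \<and> S 1 = s" using S S' by blast
  show "x = s" if "\<exists>S. signature_eq \<eta> S \<and> S 1 = x" for x
    using that signature_eq_unique[OF S'] S(2) by auto
qed

lemma transport_joinpaths:
  assumes "transport \<eta> 0 1 s" "transport \<eta>' 0 1 s'"
  shows "transport (\<eta> +++ \<eta>') 0 1 (s * s')"
proof -
  have 1: "transport (\<lambda>t. \<eta> (2 * t + 0)) 0 (1/2) s" "transport (\<lambda>t. \<eta>' (2 * t + (-1))) (1/2) 1 s'"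
    by (rule transport_affine; use assms in simp)+
  have "transport (\<eta> +++ \<eta>') 0 (1/2) s" "transport (\<eta> +++ \<eta>') (1/2) 1 s'"
    by (rule transport_cong[OF 1(1)] transport_cong[OF 1(2)]; simp add: joinpaths_def)+
  then show ?thesis by (intro transport_join[of 0 "1/2"]) auto
qed

lemma transport_reversepath: "transport \<eta> 0 1 s \<Longrightarrow> transport (reversepath \<eta>) 0 1 (nc_inv s)"
  using transport_reverse[of \<eta> 0 1 s] by (simp add: reversepath_def)

lemma transport_line:
  fixes X :: "real \<times> real \<Rightarrow> real ^ 'n::finite"
  assumes "a \<le> b"
  shows "transport (\<lambda>r. X (r, v)) a b s \<Longrightarrow> transport (X \<circ> linepath (a, v) (b, v)) 0 1 s"
    and "transport (\<lambda>r. X (v, r)) a b s \<Longrightarrow> transport (X \<circ> linepath (v, a) (v, b)) 0 1 s"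
proof -
  have *: "transport (\<lambda>t. \<eta> ((b - a) * t + a)) 0 1 s" if s: "transport \<eta> a b s" for \<eta> :: "real \<Rightarrow> real ^ 'n"
  proof (cases "a = b")
    case True
    \<comment> \<open>The affine rule needs positive slope. Here the segment is a point, and both
      its transport and that of the constant path are 1.\<close>
    then have "s = 1" using transport_unique[OF s] transport_refl by auto
    then show ?thesis using True transport_const[of "\<eta> a" 0 1] by simp
  next
    case False
    then show ?thesis using assms s by (intro transport_affine) auto
  qed
  have l: "linepath (a, v) (b, v) t = ((b - a) * t + a, v)" "linepath (v, a) (v, b) t = (v, (b - a) * t + a)" for t
    by (auto simp: linepath_def algebra_simps)
  show "transport (\<lambda>r. X (r, v)) a b s \<Longrightarrow> transport (X \<circ> linepath (a, v) (b, v)) 0 1 s"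
    "transport (\<lambda>r. X (v, r)) a b s \<Longrightarrow> transport (X \<circ> linepath (v, a) (v, b)) 0 1 s"
    using *[of "\<lambda>r. X (r, v)"] *[of "\<lambda>r. X (v, r)"] by (simp_all add: o_def l)
qed


section \<open>Smooth maps\<close>

lemma Ck_affine:
  assumes "bounded_linear L"
  shows "Ck k f \<Longrightarrow> Ck k (\<lambda>x. f (L x + c))"
proof (induction k arbitrary: f)
  case 0
  have "continuous_on UNIV (\<lambda>x. L x + c)"
    by (intro continuous_on_add continuous_on_const linear_continuous_on assms)
  then show ?case
    using 0 by (auto intro: continuous_on_compose2[of UNIV f])
next
  case (Suc k)
  have d: "((\<lambda>x. f (L x + c)) has_derivative (\<lambda>v. frechet_derivative f (at (L x + c)) (L v))) (at x)" for x
  proof -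
    have "(f has_derivative frechet_derivative f (at (L x + c))) (at (L x + c))"
      using Suc.prems by (auto simp: frechet_derivative_works)
    moreover have "((\<lambda>x. L x + c) has_derivative L) (at x)"
      using bounded_linear_imp_has_derivative[OF assms] by (auto intro!: derivative_eq_intros)
    ultimately show ?thesis by (rule has_derivative_compose[rotated])
  qed
  have "frechet_derivative (\<lambda>x. f (L x + c)) (at x) = (\<lambda>v. frechet_derivative f (at (L x + c)) (L v))" for x
    using frechet_derivative_at[OF d] by simp
  moreover have "Ck k (\<lambda>x. frechet_derivative f (at (L x + c)) (L v))" for v
    using Suc.IH[of "\<lambda>z. frechet_derivative f (at z) (L v)"] Suc.prems by simp
  ultimately show ?case using d by (auto simp: differentiable_def)
qed

lemma smooth_affine: "smooth f \<Longrightarrow> bounded_linear L \<Longrightarrow> smooth (\<lambda>x. f (L x + c))"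
  by (auto simp: smooth_def intro: Ck_affine)

lemma Ck_const: "Ck k (\<lambda>x. c)"
  by (induction k arbitrary: c) auto

lemma smooth_affine_map: "bounded_linear L \<Longrightarrow> smooth (\<lambda>x. L x + c)"
proof -
  assume L: "bounded_linear L"
  have d: "((\<lambda>x. L x + c) has_derivative L) (at x)" for x
    using bounded_linear_imp_has_derivative[OF L] by (auto intro!: derivative_eq_intros)
  then have "frechet_derivative (\<lambda>x. L x + c) (at x) = L" for x
    using frechet_derivative_at by metis
  then have "Ck (Suc k) (\<lambda>x. L x + c)" for k
    using d by (auto simp: differentiable_def Ck_const)
  moreover have "continuous_on UNIV (\<lambda>x. L x + c)"
    by (intro continuous_on_add continuous_on_const linear_continuous_on L)
  ultimately show "smooth (\<lambda>x. L x + c)"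
    unfolding smooth_def by (metis Ck.simps(1) not0_implies_Suc)
qed

lemma smooth_linepath: "smooth (linepath a b)"
proof -
  have "linepath a b = (\<lambda>t. t *\<^sub>R (b - a) + a)"
    by (auto simp: linepath_def algebra_simps)
  then show ?thesis by (simp add: smooth_affine_map bounded_linear_scaleR_left)
qed

lemma smooth_deriv:
  assumes "smooth f"
  shows "(f has_derivative frechet_derivative f (at x)) (at x)"
    and "smooth (\<lambda>x. frechet_derivative f (at x) v)"
    and "continuous_on S (\<lambda>x. frechet_derivative f (at x) v)"
    and "continuous_on S f"
proof -
  have c: "Ck (Suc k) f" for k using assms by (auto simp: smooth_def)
  show "(f has_derivative frechet_derivative f (at x)) (at x)"
    using c[of 0] by (auto simp: frechet_derivative_works)
  show "smooth (\<lambda>x. frechet_derivative f (at x) v)"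
    using c by (auto simp: smooth_def)
  show "continuous_on S (\<lambda>x. frechet_derivative f (at x) v)"
    using c[of 0] by (auto intro: continuous_on_subset)
  have "Ck 0 f" using assms unfolding smooth_def by blast
  then show "continuous_on S f" by (auto intro: continuous_on_subset)
qed

lemma smooth_partial:
  assumes "smooth (f :: real \<times> real \<Rightarrow> 'v::real_normed_vector)"
  shows "((\<lambda>r. f (r, t)) has_vector_derivative frechet_derivative f (at (r, t)) (1, 0)) (at r)"
    and "((\<lambda>t. f (r, t)) has_vector_derivative frechet_derivative f (at (r, t)) (0, 1)) (at t)"
proof -
  note d = smooth_deriv(1)[OF assms]
  interpret bounded_linear "frechet_derivative f (at (r, t))"
    using d by (rule has_derivative_bounded_linear)
  have p: "frechet_derivative f (at (r, t)) (h, 0) = h *\<^sub>R frechet_derivative f (at (r, t)) (1, 0)"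
    "frechet_derivative f (at (r, t)) (0, h) = h *\<^sub>R frechet_derivative f (at (r, t)) (0, 1)" for h
    by (simp_all flip: scaleR)
  have "((\<lambda>r. (r, t)) has_derivative (\<lambda>h. (h, 0))) (at r)" "((\<lambda>t. (r, t)) has_derivative (\<lambda>h. (0, h))) (at t)"
    by (auto intro!: derivative_eq_intros)
  note c = this[THEN has_derivative_compose, OF d]
  show "((\<lambda>r. f (r, t)) has_vector_derivative frechet_derivative f (at (r, t)) (1, 0)) (at r)"
    unfolding has_vector_derivative_def by (rule has_derivative_eq_rhs[OF c(1) ext[OF p(1)]])
  show "((\<lambda>t. f (r, t)) has_vector_derivative frechet_derivative f (at (r, t)) (0, 1)) (at t)"
    unfolding has_vector_derivative_def by (rule has_derivative_eq_rhs[OF c(2) ext[OF p(2)]])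
qed

lemma frechet_expand:
  assumes "smooth (f :: real \<times> real \<Rightarrow> 'v::real_normed_vector)"
  shows "frechet_derivative f (at p) v =
    fst v *\<^sub>R frechet_derivative f (at p) (1, 0) + snd v *\<^sub>R frechet_derivative f (at p) (0, 1)"
proof -
  interpret bounded_linear "frechet_derivative f (at p)"
    using smooth_deriv(1)[OF assms] by (rule has_derivative_bounded_linear)
  have "v = fst v *\<^sub>R (1, 0) + snd v *\<^sub>R (0, 1)" by (cases v) auto
  then show ?thesis by (metis add scaleR)
qed

lemma smooth_compose_curve:
  assumes "smooth (f :: real \<times> real \<Rightarrow> 'v::real_normed_vector)" and g: "(g has_vector_derivative w) (at t)"
  shows "((\<lambda>t. f (g t)) has_vector_derivative
    fst w *\<^sub>R frechet_derivative f (at (g t)) (1, 0) + snd w *\<^sub>R frechet_derivative f (at (g t)) (0, 1)) (at t)"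
proof -
  interpret bounded_linear "frechet_derivative f (at (g t))"
    using smooth_deriv(1)[OF assms(1)] by (rule has_derivative_bounded_linear)
  have "((\<lambda>t. f (g t)) has_derivative (\<lambda>h. frechet_derivative f (at (g t)) (h *\<^sub>R w))) (at t)"
    using has_derivative_compose[OF g[unfolded has_vector_derivative_def] smooth_deriv(1)[OF assms(1)]] .
  then show ?thesis
    unfolding has_vector_derivative_def by (simp add: scaleR frechet_expand[OF assms(1), of _ w])
qed

section \<open>The non-abelian Stokes theorem\<close>

text \<open>Moves the variable end point into the integrand, so that joint continuity in the end
  point and a parameter follows from integrals over the fixed interval [0, 1].\<close>

lemma integral_upto:
  fixes g :: "real \<Rightarrow> real"
  assumes "a \<le> r" "continuous_on {a..r} g"
  shows "integral {a..r} g = (r - a) * integral {0..1} (\<lambda>s. g ((r - a) * s + a))"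
proof (cases "a = r")
  case False
  have "(g has_integral integral {a..r} g) (cbox a r)"
    using assms(2) by (simp add: integrable_continuous_interval integrable_integral)
  from has_integral_affinity[OF this, of "r - a" a]
  have "((\<lambda>s. g ((r - a) * s + a)) has_integral integral {a..r} g / (r - a))
      ((\<lambda>x. x / (r - a) - a / (r - a)) ` {a..r})"
    using False assms(1) by (simp add: field_simps)
  moreover have "(\<lambda>x. x / (r - a) - a / (r - a)) ` {a..r} = {0..1}"
  proof -
    have "x \<in> (\<lambda>x. x / (r - a) - a / (r - a)) ` {a..r}" if x: "0 \<le> x" "x \<le> 1" for x
    proof (rule image_eqI)
      show "x = ((r - a) * x + a) / (r - a) - a / (r - a)"
        using nonzero_mult_div_cancel_left[of "r - a" x] False by (simp add: diff_divide_distrib[symmetric])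
      have "(r - a) * x \<le> (r - a) * 1"
        using x assms(1) by (intro mult_left_mono) auto
      then show "(r - a) * x + a \<in> {a..r}" using x assms(1) by auto
    qed
    then show ?thesis using False assms(1) by (auto simp: field_simps diff_divide_distrib[symmetric])
  qed
  ultimately have "integral {0..1} (\<lambda>s. g ((r - a) * s + a)) = integral {a..r} g / (r - a)"
    by (auto intro: integral_unique)
  then show ?thesis using False by simp
qed simp

lemma integral_upto_continuous:
  fixes g :: "real \<Rightarrow> real \<Rightarrow> real"
  assumes "continuous_on ({a..b} \<times> UNIV) (\<lambda>(r, t). g r t)"
  shows "continuous_on ({a..b} \<times> UNIV) (\<lambda>(r, t). integral {a..r} (\<lambda>\<rho>. g \<rho> t))"
proof -
  have "continuous_on {a..r} (\<lambda>\<rho>. g \<rho> t)" if "r \<in> {a..b}" for r t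
    by (rule continuous_on_compose2[OF assms, of _ "\<lambda>\<rho>. (\<rho>, t)", simplified])
       (use that in \<open>auto intro!: continuous_intros\<close>)
  then have eq: "integral {a..r} (\<lambda>\<rho>. g \<rho> t) = (r - a) * integral {0..1} (\<lambda>s. g ((r - a) * s + a) t)"
    if "r \<in> {a..b}" for r t
    using that by (intro integral_upto) auto
  have mem: "(r - a) * s + a \<in> {a..b}" if "r \<in> {a..b}" "s \<in> {0..1}" for r s
  proof -
    have "(r - a) * s \<le> (r - a) * 1" using that by (intro mult_left_mono) auto
    then show ?thesis using that by auto
  qed
  have "continuous_on ({a..b} \<times> UNIV) (\<lambda>p. (fst p - a) * integral (cbox 0 1) (\<lambda>s. g ((fst p - a) * s + a) (snd p)))"
  proof (intro continuous_intros integral_continuous_on_param)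
    show "continuous_on (({a..b} \<times> UNIV) \<times> cbox 0 1) (\<lambda>(p, s). g ((fst p - a) * s + a) (snd p))"
      unfolding split_beta
      by (rule continuous_on_compose2[OF assms, of _ "\<lambda>q. ((fst (fst q) - a) * snd q + a, snd (fst q))", simplified])
         (use mem in \<open>auto intro!: continuous_intros\<close>)
  qed
  then show ?thesis
    by (rule continuous_on_eq) (auto simp: eq)
qed

text \<open>Differentiability comes from exp and log; the value is then forced by differentiating
  the product of f with its inverse.\<close>

lemma ncd_inv:
  assumes f: "ncd f f' t S" and t: "t \<in> S" "at t within S \<noteq> bot" and f1: "\<And>s. s \<in> S \<Longrightarrow> wcoeff (f s) [] = 1"
  shows "ncd (\<lambda>s. nc_inv (f s)) (- (nc_inv (f t) * f' * nc_inv (f t))) t S"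
proof -
  obtain l where "ncd (\<lambda>s. nc_log (f s)) l t S"
    using ncd_ev_fps[of "\<lambda>s. f s - 1" f' t S "fps_ln 1"] ncd_diff[OF f ncd_const] t(1) f1
    by (auto simp: nc_log_ev)
  then obtain D where D: "ncd (\<lambda>s. nc_inv (f s)) D t S"
    using ncd_ev_fps[of "\<lambda>s. - nc_log (f s)" "- l" t S "fps_exp 1"] ncd_minus t(1) f1
    by (force simp: nc_inv_def nc_exp_ev)
  have "ncd (\<lambda>s. 1) (f' * nc_inv (f t) + f t * D) t S"
    by (rule ncd_transform[OF ncd_mult[OF f D] t(1)]) (simp add: nc_inv f1)
  then have "f' * nc_inv (f t) + f t * D = 0"
    by (rule ncd_unique[OF _ ncd_const t(2)])
  then have "nc_inv (f t) * (f t * D) = nc_inv (f t) * (- (f' * nc_inv (f t)))"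
    by (simp add: add_eq_0_iff)
  then have "D = - (nc_inv (f t) * f' * nc_inv (f t))"
    using nc_inv(2)[OF f1[OF t(1)]] by (simp add: mult.assoc[symmetric])
  then show ?thesis using D by simp
qed

lemma at_within_ray: "c \<le> t \<Longrightarrow> at t within {c..} \<noteq> bot" for t :: real
  using at_le[of "{t<..}" "{c..}" t] trivial_limit_at_right_real[of t]
  by (metis atLeast_iff bot.extremum_uniqueI greaterThan_iff less_imp_le order_trans subsetI)

lemma tr_ncd_ray:
  assumes "continuous_on UNIV y" "a \<le> r"
  shows "ncd (tr y a) (tr y a r * lets (y r)) r {a..}"
proof -
  have "at r within {a..} = at r within {a..r + 1}"
    by (rule at_within_nhd[of r "{..<r + 1}"]) auto
  then show ?thesis
    using tr_ncd[OF continuous_on_subset[OF assms(1)], of a "r + 1" r] assms(2) by (simp add: ncd_def)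
qed

lemma tr_Nil: "wcoeff (tr y a r) [] = 1"
  by (simp add: tr_def)

text \<open>\<open>Y12\<close> is the mixed derivative in one order only; the other order is derived
  in \<open>d21\<close>. The locale serves both for \<open>X\<close> itself and for \<open>X\<close>
  composed with a smooth piece of a homotopy.\<close>

locale surface =
  fixes Y Y1 Y2 Y12 :: "real \<times> real \<Rightarrow> real ^ 'n::finite"
  assumes d1: "((\<lambda>r. Y (r, t)) has_vector_derivative Y1 (r, t)) (at r)"
    and d2: "((\<lambda>t. Y (r, t)) has_vector_derivative Y2 (r, t)) (at t)"
    and d12: "((\<lambda>t. Y1 (r, t)) has_vector_derivative Y12 (r, t)) (at t)"
    and cont: "continuous_on UNIV Y1" "continuous_on UNIV Y2" "continuous_on UNIV Y12"
begin

lemma cont_param: "continuous_on S f \<Longrightarrow> continuous_on S g \<Longrightarrow> continuous_on S (\<lambda>x. Y1 (f x, g x))"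
  "continuous_on S f \<Longrightarrow> continuous_on S g \<Longrightarrow> continuous_on S (\<lambda>x. Y2 (f x, g x))"
  "continuous_on S f \<Longrightarrow> continuous_on S g \<Longrightarrow> continuous_on S (\<lambda>x. Y12 (f x, g x))"
  by (auto intro!: continuous_on_compose2[OF cont(1)] continuous_on_compose2[OF cont(2)]
    continuous_on_compose2[OF cont(3)] continuous_intros)

text \<open>Symmetry of the mixed derivative: differentiate Y(rho, t) - Y(r - 1, t) as an integral
  of \<open>Y1\<close> under the integral sign, so that \<open>Y2\<close> becomes an integral of
  \<open>Y12\<close>, and apply the fundamental theorem.\<close>

lemma d21: "((\<lambda>r. Y2 (r, t)) has_vector_derivative Y12 (r, t)) (at r)"
proof -
  let ?a = "r - 1"
  have eq: "Y2 (\<rho>, t) = Y2 (?a, t) + integral {?a..\<rho>} (\<lambda>\<sigma>. Y12 (\<sigma>, t))" if "?a \<le> \<rho>" for \<rho>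
  proof -
    have "((\<lambda>t. integral (cbox ?a \<rho>) (\<lambda>\<sigma>. Y1 (\<sigma>, t))) has_vector_derivative
        integral (cbox ?a \<rho>) (\<lambda>\<sigma>. Y12 (\<sigma>, t))) (at t within UNIV)"
      by (rule leibniz_rule_vector_derivative)
         (auto simp: d12 split_beta intro!: integrable_continuous_interval cont_param continuous_intros)
    moreover have "integral (cbox ?a \<rho>) (\<lambda>\<sigma>. Y1 (\<sigma>, t)) = Y (\<rho>, t) - Y (?a, t)" for t
      using integral_unique[OF fundamental_theorem_of_calculus[OF that has_vector_derivative_at_within[OF d1]]]
      by simp
    ultimately have "((\<lambda>t. Y (\<rho>, t) - Y (?a, t)) has_vector_derivative
        integral {?a..\<rho>} (\<lambda>\<sigma>. Y12 (\<sigma>, t))) (at t)"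
      by simp
    moreover have "((\<lambda>t. Y (\<rho>, t) - Y (?a, t)) has_vector_derivative Y2 (\<rho>, t) - Y2 (?a, t)) (at t)"
      by (intro derivative_intros d2)
    ultimately have "integral {?a..\<rho>} (\<lambda>\<sigma>. Y12 (\<sigma>, t)) = Y2 (\<rho>, t) - Y2 (?a, t)"
      by (rule vector_derivative_unique_at)
    then show ?thesis by simp
  qed
  have "((\<lambda>\<rho>. integral {?a..\<rho>} (\<lambda>\<sigma>. Y12 (\<sigma>, t))) has_vector_derivative Y12 (r, t)) (at r within {?a..r + 1})"
    by (rule integral_has_vector_derivative) (auto intro!: cont_param continuous_intros)
  then have "((\<lambda>\<rho>. integral {?a..\<rho>} (\<lambda>\<sigma>. Y12 (\<sigma>, t))) has_vector_derivative Y12 (r, t)) (at r)"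
    by (subst (asm) at_within_interior) auto
  then have "((\<lambda>\<rho>. Y2 (?a, t) + integral {?a..\<rho>} (\<lambda>\<sigma>. Y12 (\<sigma>, t))) has_vector_derivative 0 + Y12 (r, t)) (at r)"
    by (intro derivative_intros) auto
  then have "((\<lambda>\<rho>. Y2 (\<rho>, t)) has_vector_derivative 0 + Y12 (r, t)) (at r)"
    by (rule has_vector_derivative_transform_within_open[of _ _ r "{?a<..}"]) (auto intro: eq[symmetric])
  then show ?thesis by simp
qed

text \<open>\<open>hor a r t\<close> is the signature along the segment from (a, t) to (r, t); in
  \<open>ver r c t\<close> the fixed abscissa comes first, and the segment runs from (r, c) to (r,
  t).\<close>

definition hor :: "real \<Rightarrow> real \<Rightarrow> real \<Rightarrow> 'n gen ncps" where
  "hor a r t = tr (\<lambda>\<rho>. Y1 (\<rho>, t)) a r"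

definition ver :: "real \<Rightarrow> real \<Rightarrow> real \<Rightarrow> 'n gen ncps" where
  "ver r c t = tr (\<lambda>\<tau>. Y2 (r, \<tau>)) c t"

lemma transport_hor: "transport (\<lambda>r. Y (r, t)) a b (hor a b t)"
  unfolding hor_def by (rule transport_tr) (auto intro!: d1 cont_param continuous_intros)

lemma transport_ver: "transport (\<lambda>t. Y (r, t)) c d (ver r c d)"
  unfolding ver_def by (rule transport_tr) (auto intro!: d2 cont_param continuous_intros)

lemma hor_Nil [simp]: "wcoeff (hor a r t) [] = 1" and ver_Nil [simp]: "wcoeff (ver r c t) [] = 1"
  by (simp_all add: hor_def ver_def tr_Nil)

lemma hor_start [simp]: "hor a a t = 1" and ver_start [simp]: "ver r c c = 1"
  by (simp_all add: hor_def ver_def)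

abbreviation "A1 p \<equiv> lets (Y1 p)"
abbreviation "A2 p \<equiv> lets (Y2 p)"

lemma hor_ncd: "r \<in> {a..b} \<Longrightarrow> ncd (\<lambda>r. hor a r t) (hor a r t * A1 (r, t)) r {a..b}"
  unfolding hor_def by (rule tr_ncd) (auto intro!: cont_param continuous_intros)

lemma ver_ncd: "c \<le> t \<Longrightarrow> ncd (ver r c) (ver r c t * A2 (r, t)) t {c..}"
  unfolding ver_def by (rule tr_ncd_ray[of "\<lambda>\<tau>. Y2 (r, \<tau>)"]) (auto intro!: cont_param continuous_intros)

primrec ditr :: "real \<Rightarrow> 'n gen list \<Rightarrow> real \<Rightarrow> real \<Rightarrow> real" where
  "ditr a [] r t = 0"
| "ditr a (g # u) r t = (case g of Z i \<Rightarrow> integral {a..r} (\<lambda>\<rho>. ditr a u \<rho> t * Y1 (\<rho>, t) $ i +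
      itr (\<lambda>\<rho>. Y1 (\<rho>, t)) a u \<rho> * Y12 (\<rho>, t) $ i) | ZZ i j \<Rightarrow> 0)"

text \<open>Differentiation under the integral sign needs joint continuity of the integrand and of
  its derivative, so the three claims go through one induction. \<open>ditr\<close> is what the
  product rule yields at each level.\<close>

lemma itr_param:
  "continuous_on ({a..b} \<times> UNIV) (\<lambda>(r, t). itr (\<lambda>\<rho>. Y1 (\<rho>, t)) a u r) \<and>
   continuous_on ({a..b} \<times> UNIV) (\<lambda>(r, t). ditr a u r t) \<and>
   (\<forall>r\<in>{a..b}. \<forall>t. ((\<lambda>t. itr (\<lambda>\<rho>. Y1 (\<rho>, t)) a u r) has_real_derivative ditr a u r t) (at t))"
proof (induction u)
  case Nil
  then show ?case by (simp add: split_beta)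
next
  case (Cons g u)
  show ?case
  proof (cases g)
    case (Z i)
    let ?I = "\<lambda>\<rho> t. itr (\<lambda>\<rho>. Y1 (\<rho>, t)) a u \<rho>"
    have c1: "continuous_on ({a..b} \<times> UNIV) (\<lambda>(\<rho>, t). ?I \<rho> t * Y1 (\<rho>, t) $ i)"
      and c2: "continuous_on ({a..b} \<times> UNIV) (\<lambda>(\<rho>, t). ditr a u \<rho> t * Y1 (\<rho>, t) $ i + ?I \<rho> t * Y12 (\<rho>, t) $ i)"
      using Cons cont[THEN continuous_on_subset, OF subset_UNIV]
      unfolding split_beta by (auto intro!: continuous_intros)
    have "((\<lambda>t. integral {a..r} (\<lambda>\<rho>. ?I \<rho> t * Y1 (\<rho>, t) $ i)) has_real_derivative ditr a (g # u) r t) (at t)"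
      if r: "r \<in> {a..b}" for r t
    proof -
      have "((\<lambda>t. integral (cbox a r) (\<lambda>\<rho>. ?I \<rho> t * Y1 (\<rho>, t) $ i)) has_vector_derivative
        integral (cbox a r) (\<lambda>\<rho>. ditr a u \<rho> t * Y1 (\<rho>, t) $ i + ?I \<rho> t * Y12 (\<rho>, t) $ i)) (at t within UNIV)"
      proof (rule leibniz_rule_vector_derivative)
        show "((\<lambda>t. ?I \<rho> t * Y1 (\<rho>, t) $ i) has_vector_derivative
          ditr a u \<rho> t * Y1 (\<rho>, t) $ i + ?I \<rho> t * Y12 (\<rho>, t) $ i) (at t within UNIV)" if "\<rho> \<in> cbox a r" for t \<rho>
        proof -
          have "((\<lambda>t. Y1 (\<rho>, t) $ i) has_real_derivative Y12 (\<rho>, t) $ i) (at t)"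
            using bounded_linear.has_vector_derivative[OF bounded_linear_vec_nth d12]
            by (simp add: has_real_derivative_iff_has_vector_derivative)
          moreover have "((\<lambda>t. ?I \<rho> t) has_real_derivative ditr a u \<rho> t) (at t)"
            using Cons that r by auto
          ultimately show ?thesis
            by (auto simp: has_real_derivative_iff_has_vector_derivative[symmetric] intro!: derivative_eq_intros)
        qed
        show "(\<lambda>\<rho>. ?I \<rho> t * Y1 (\<rho>, t) $ i) integrable_on cbox a r" for t
          unfolding cbox_interval
          by (rule integrable_continuous_interval, rule continuous_on_compose2[OF c1, of _ "\<lambda>\<rho>. (\<rho>, t)", simplified])
             (use r in \<open>auto intro!: continuous_intros\<close>)
        show "continuous_on (UNIV \<times> cbox a r)
          (\<lambda>(t, \<rho>). ditr a u \<rho> t * Y1 (\<rho>, t) $ i + ?I \<rho> t * Y12 (\<rho>, t) $ i)"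
          unfolding split_beta
          by (rule continuous_on_compose2[OF c2, of _ "\<lambda>p. (snd p, fst p)", simplified])
             (use r in \<open>auto intro!: continuous_intros\<close>)
      qed auto
      then show ?thesis by (simp add: Z has_real_derivative_iff_has_vector_derivative)
    qed
    then show ?thesis
      using integral_upto_continuous[OF c1] integral_upto_continuous[OF c2] by (simp add: Z)
  qed (simp add: split_beta)
qed

definition dhor :: "real \<Rightarrow> real \<Rightarrow> real \<Rightarrow> 'n gen ncps" where
  "dhor a r t = Ncps (\<lambda>w. ditr a (rev w) r t)"

lemma ncc_hor: "ncc ({a..b} \<times> UNIV) (\<lambda>p. hor a (fst p) (snd p))"
  and hor_ncd_t: "a \<le> r \<Longrightarrow> ncd (hor a r) (dhor a r t) t UNIV"
proof -
  show "ncc ({a..b} \<times> UNIV) (\<lambda>p. hor a (fst p) (snd p))"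
    using itr_param[of a b] by (auto simp: ncc_def hor_def tr_def split_beta)
  show "ncd (hor a r) (dhor a r t) t UNIV" if "a \<le> r"
    using itr_param[of a r] that by (auto simp: ncd_def hor_def tr_def dhor_def)
qed

lemma ncc_hor': "continuous_on S f \<Longrightarrow> continuous_on S g \<Longrightarrow> f ` S \<subseteq> {a..b} \<Longrightarrow> ncc S (\<lambda>x. hor a (f x) (g x))"
  using ncc_compose[OF ncc_hor, of S "\<lambda>x. (f x, g x)" a b] by (auto intro!: continuous_intros)

lemma ncc_ver: "c \<le> d \<Longrightarrow> ncc {c..d} (ver r c)"
  by (rule ncd_imp_ncc[of _ _ "\<lambda>t. ver r c t * A2 (r, t)"]) (auto intro: ncd_subset[OF ver_ncd])

text \<open>The linearised transport equation: differentiating T' = T A1 in the height adds the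
  inhomogeneity with the mixed derivative.\<close>

lemma dhor_ncd:
  assumes r: "r \<in> {a..b}"
  shows "ncd (\<lambda>r. dhor a r t) (dhor a r t * A1 (r, t) + hor a r t * lets (Y12 (r, t))) r {a..b}"
  unfolding ncd_def
proof
  fix w :: "'n gen list"
  show "((\<lambda>r. wcoeff (dhor a r t) w) has_real_derivative
      wcoeff (dhor a r t * A1 (r, t) + hor a r t * lets (Y12 (r, t))) w) (at r within {a..b})"
  proof (cases w rule: rev_cases)
    case (snoc u g)
    show ?thesis
    proof (cases g)
      case (Z i)
      let ?u = "rev u"
      have "continuous_on {a..b} (\<lambda>\<rho>. ditr a ?u \<rho> t * Y1 (\<rho>, t) $ i + itr (\<lambda>\<rho>. Y1 (\<rho>, t)) a ?u \<rho> * Y12 (\<rho>, t) $ i)"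
        using itr_param[of a b ?u]
        by (intro continuous_intros cont_param)
           (auto simp: split_beta intro!: itr_cont cont_param continuous_intros
             intro: continuous_on_compose2[of "{a..b} \<times> UNIV" "\<lambda>p. ditr a ?u (fst p) (snd p)" _ "\<lambda>\<rho>. (\<rho>, t)", simplified])
      from integral_has_real_derivative[OF this r]
      show ?thesis by (simp add: snoc Z dhor_def hor_def tr_def wcoeff_mult_lets)
    qed (simp add: snoc dhor_def wcoeff_mult_lets)
  qed (simp add: dhor_def)
qed

text \<open>The full curvature is d1 A2 - d2 A1 + [A1, A2]. By \<open>d21\<close> the first two
  terms cancel, since the form is pulled back from constant coefficients.\<close>

definition curv :: "real \<times> real \<Rightarrow> 'n gen ncps" where
  "curv p = act (A1 p) (A2 p)"

lemma ncc_curv: "continuous_on S f \<Longrightarrow> continuous_on S g \<Longrightarrow> ncc S (\<lambda>x. curv (f x, g x))"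
  unfolding curv_def act_eq by (intro ncc_diff ncc_mult ncc_lets cont_param)

text \<open>Both sides satisfy the same inhomogeneous linear equation in the right end point and
  vanish when it equals \<open>a\<close>; their difference solves the homogeneous equation of
  \<open>linear_ode_unique\<close>.\<close>

lemma dhor_eq:
  assumes r: "a \<le> b" and I: "I = (\<lambda>r. nint a r (\<lambda>\<rho>. hor a \<rho> t * curv (\<rho>, t) * nc_inv (hor a \<rho> t)))"
  shows "dhor a b t = hor a b t * A2 (b, t) - A2 (a, t) * hor a b t - I b * hor a b t"
proof -
  let ?T = "\<lambda>r. hor a r t"
  let ?C = "\<lambda>r. ?T r * A2 (r, t) - A2 (a, t) * ?T r - I r * ?T r"
  have ct: "ncc {a..b} ?T" by (rule ncc_hor') (auto intro!: continuous_intros)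
  have ci: "ncc {a..b} (\<lambda>\<rho>. ?T \<rho> * curv (\<rho>, t) * nc_inv (?T \<rho>))"
    by (intro ncc_mult ncc_inv ct ncc_curv) (auto intro!: continuous_intros)
  have dI: "ncd I (?T r * curv (r, t) * nc_inv (?T r)) r {a..b}" if "r \<in> {a..b}" for r
    using nint_ncd[OF ci that] by (simp add: I)
  have dA: "ncd (\<lambda>r. A2 (r, t)) (lets (Y12 (r, t))) r {a..b}" for r
    unfolding ncd_def
  proof
    fix w
    have "((\<lambda>r. Y2 (r, t) $ i) has_real_derivative Y12 (r, t) $ i) (at r)" for i
      using bounded_linear.has_vector_derivative[OF bounded_linear_vec_nth d21]
      by (simp add: has_real_derivative_iff_has_vector_derivative)
    then show "((\<lambda>s. wcoeff (A2 (s, t)) w) has_real_derivative wcoeff (lets (Y12 (r, t))) w) (at r within {a..b})"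
      unfolding wcoeff_lets by (auto split: list.splits gen.splits intro: DERIV_subset)
  qed
  have dC: "ncd ?C (?C r * A1 (r, t) + ?T r * lets (Y12 (r, t))) r {a..b}" if r: "r \<in> {a..b}" for r
  proof -
    \<comment> \<open>The commutator coming from the derivative of \<open>I\<close> turns T A1 A2
      into T A2 A1, so that \<open>A1\<close> stands on the right in every term.\<close>
    have "?T r * A1 (r, t) * A2 (r, t) + ?T r * lets (Y12 (r, t)) - A2 (a, t) * (?T r * A1 (r, t)) -
        (?T r * curv (r, t) * nc_inv (?T r) * ?T r + I r * (?T r * A1 (r, t))) =
        ?C r * A1 (r, t) + ?T r * lets (Y12 (r, t))"
      using nc_inv(2)[of "?T r"] by (simp add: mult.assoc curv_def act_eq algebra_simps)
    moreover have "ncd ?C (?T r * A1 (r, t) * A2 (r, t) + ?T r * lets (Y12 (r, t)) - A2 (a, t) * (?T r * A1 (r, t)) -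
        (?T r * curv (r, t) * nc_inv (?T r) * ?T r + I r * (?T r * A1 (r, t)))) r {a..b}"
      by (intro ncd_diff ncd_mult ncd_mult_left hor_ncd dI dA r)
    ultimately show ?thesis by (simp only:)
  qed
  have "ncd (\<lambda>r. dhor a r t - ?C r) ((dhor a r t - ?C r) * A1 (r, t)) r {a..b}" if r: "r \<in> {a..b}" for r
    using ncd_diff[OF dhor_ncd[OF r, of t] dC[OF r]] by (simp add: left_diff_distrib)
  note d = this
  have "dhor a b t - ?C b = 0"
  proof (rule linear_ode_unique[of "{}" a b "\<lambda>r. dhor a r t - ?C r" "\<lambda>r. A1 (r, t)" "\<lambda>_. 0"])
    show "ncc {a..b} (\<lambda>r. dhor a r t - ?C r)" by (rule ncd_imp_ncc[OF d])
    have "dhor a a t = 0"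
    proof (rule ncps_eqI)
      fix w :: "'n gen list"
      show "wcoeff (dhor a a t) w = wcoeff 0 w"
        by (cases w rule: rev_cases) (auto simp: dhor_def split: gen.splits)
    qed
    then show "dhor a a t - ?C a = 0"
      by (simp add: I)
  qed (use d r in auto)
  then show ?thesis by simp
qed

text \<open>The signature \<open>H(t)\<close> of the overview: bottom edge, right edge, then top and
  left edge backwards. The companion \<open>stail\<close> belongs to
  \<open>tail_path\<close>.\<close>

definition loop :: "real \<Rightarrow> real \<Rightarrow> real \<Rightarrow> real \<Rightarrow> 'n gen ncps" where
  "loop a c b t = hor a b c * ver b c t * nc_inv (hor a b t) * nc_inv (ver a c t)"

definition stail :: "real \<Rightarrow> real \<Rightarrow> real \<Rightarrow> real \<Rightarrow> 'n gen ncps" where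
  "stail a c r t = ver a c t * hor a r t"

lemma stail_Nil [simp]: "wcoeff (stail a c r t) [] = 1"
  by (simp add: stail_def)

lemma loop_Nil [simp]: "wcoeff (loop a c b t) [] = 1"
  by (simp add: loop_def nc_inv)

text \<open>Differentiating the four factors, the terms \<open>A2\<close> of the two vertical edges
  cancel against those in the derivative of the top edge (\<open>dhor_eq\<close>), and only the
  curvature integral survives. Conjugation by the left edge turns \<open>hor\<close> into
  \<open>stail\<close>.\<close>

theorem stokes:
  assumes "a \<le> b" "c \<le> t"
  shows "ncd (loop a c b) (loop a c b t * nint a b (\<lambda>r. stail a c r t * curv (r, t) * nc_inv (stail a c r t))) t {c..}"
proof -
  let ?T = "hor a b" and ?U = "ver a c" and ?R = "ver b c"
  let ?iT = "nc_inv (?T t)" and ?iU = "nc_inv (?U t)"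
  let ?I = "nint a b (\<lambda>r. hor a r t * curv (r, t) * nc_inv (hor a r t))"
  have nt: "t \<in> {c..}" "at t within {c..} \<noteq> bot"
    using assms(2) by (auto simp: at_within_ray)
  have dT: "ncd ?T (?T t * A2 (b, t) - A2 (a, t) * ?T t - ?I * ?T t) t {c..}"
    using hor_ncd_t[OF assms(1), of t] ncd_subset unfolding dhor_eq[OF assms(1) refl] by blast
  have iT: "ncd (\<lambda>t. nc_inv (?T t)) (- (?iT * (?T t * A2 (b, t) - A2 (a, t) * ?T t - ?I * ?T t) * ?iT)) t {c..}"
    by (rule ncd_inv[OF dT nt]) simp
  have iU: "ncd (\<lambda>t. nc_inv (?U t)) (- (?iU * (?U t * A2 (a, t)) * ?iU)) t {c..}"
    by (rule ncd_inv[OF ver_ncd[OF assms(2)] nt]) simp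
  have e1: "- (?iT * (?T t * A2 (b, t) - A2 (a, t) * ?T t - ?I * ?T t) * ?iT) =
      - (A2 (b, t) * ?iT) + ?iT * A2 (a, t) + ?iT * ?I"
  proof -
    have "?iT * (?T t * A2 (b, t) - A2 (a, t) * ?T t - ?I * ?T t) * ?iT =
      (?iT * ?T t) * A2 (b, t) * ?iT - ?iT * A2 (a, t) * (?T t * ?iT) - ?iT * ?I * (?T t * ?iT)"
      by (simp add: algebra_simps)
    then show ?thesis by (simp add: nc_inv)
  qed
  have e2: "- (?iU * (?U t * A2 (a, t)) * ?iU) = - (A2 (a, t) * ?iU)"
    using nc_inv(2)[of "?U t"] by (simp add: mult.assoc[symmetric])
  have "nint a b (\<lambda>r. stail a c r t * curv (r, t) * nc_inv (stail a c r t)) =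
      nint a b (\<lambda>r. ?U t * (hor a r t * curv (r, t) * nc_inv (hor a r t)) * ?iU)"
    by (simp add: stail_def nc_inv_mult mult.assoc)
  also have "\<dots> = ?U t * ?I * ?iU"
  proof -
    have c: "ncc {a..b} (\<lambda>r. hor a r t * curv (r, t) * nc_inv (hor a r t))"
      by (intro ncc_mult ncc_inv ncc_curv ncc_hor') (auto intro!: continuous_intros)
    then have "ncc {a..b} (\<lambda>r. ?U t * (hor a r t * curv (r, t) * nc_inv (hor a r t)))" by auto
    then show ?thesis by (simp add: nint_mult_right nint_mult_left[OF c])
  qed
  finally have B: "loop a c b t * nint a b (\<lambda>r. stail a c r t * curv (r, t) * nc_inv (stail a c r t)) =
      hor a b c * ?R t * ?iT * ?I * ?iU"
    using nc_inv(2)[of "?U t"] by (simp add: loop_def mult.assoc) (simp add: mult.assoc[symmetric])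
  have d: "ncd (loop a c b) ((hor a b c * (?R t * A2 (b, t)) * ?iT +
      hor a b c * ?R t * (- (A2 (b, t) * ?iT) + ?iT * A2 (a, t) + ?iT * ?I)) * ?iU +
      hor a b c * ?R t * ?iT * (- (A2 (a, t) * ?iU))) t {c..}"
    unfolding loop_def
    by (intro ncd_mult ncd_mult_left ver_ncd assms iT[unfolded e1] iU[unfolded e2])
  moreover have "(hor a b c * (?R t * A2 (b, t)) * ?iT +
      hor a b c * ?R t * (- (A2 (b, t) * ?iT) + ?iT * A2 (a, t) + ?iT * ?I)) * ?iU +
      hor a b c * ?R t * ?iT * (- (A2 (a, t) * ?iU)) = hor a b c * ?R t * ?iT * ?I * ?iU"
    by (simp add: algebra_simps)
  ultimately show ?thesis unfolding B by simp
qed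

text \<open>Without curvature the loop has derivative zero, so it stays at its initial value 1: the
  two ways around the rectangle agree.\<close>

lemma flat_square:
  assumes "a \<le> b" "c \<le> d" and flat: "\<And>p. p \<in> {a..b} \<times> {c..d} \<Longrightarrow> curv p = 0"
  shows "hor a b c * ver b c d = ver a c d * hor a b d"
proof -
  have z: "ncd (loop a c b) (loop a c b t * 0) t {c..d}" if "t \<in> {c..d}" for t
  proof -
    have "nint a b (\<lambda>r. stail a c r t * curv (r, t) * nc_inv (stail a c r t)) = nint a b (\<lambda>r. 0)"
      by (rule nint_cong) (use flat that in auto)
    also have "\<dots> = 0" by (simp add: ncps_eq_iff wcoeff_nint)
    finally show ?thesis
      using ncd_subset[OF stokes[OF assms(1), of c t], of "{c..d}"] that by auto
  qed
  have "loop a c b d = loop a c b c"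
    by (rule linear_ode_unique[of "{}" c d "loop a c b" "\<lambda>_. 0" "\<lambda>_. loop a c b c"])
       (use z assms(2) in \<open>auto intro: ncd_imp_ncc[of _ _ "\<lambda>_. 0"]\<close>)
  also have "loop a c b c = 1"
    using nc_inv(1)[of "hor a b c"] by (simp add: loop_def)
  finally have "hor a b c * ver b c d * nc_inv (hor a b d) * nc_inv (ver a c d) * ver a c d * hor a b d =
      ver a c d * hor a b d"
    by (simp add: loop_def)
  moreover have "hor a b c * ver b c d * nc_inv (hor a b d) * nc_inv (ver a c d) * ver a c d * hor a b d =
      hor a b c * ver b c d * (nc_inv (hor a b d) * ((nc_inv (ver a c d) * ver a c d) * hor a b d))"
    by (simp only: mult.assoc)
  ultimately show ?thesis by (simp add: nc_inv)
qed

end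


section \<open>Piecewise smooth paths and thin homotopies\<close>

text \<open>Strong induction on the number of mesh points strictly between the end points: an
  interval without any is a cell, otherwise it is split at one of them.\<close>

lemma mesh_induct:
  assumes K: "finite K" and ab: "a \<in> K" "b \<in> K" "a < b"
    and cell: "\<And>a b. (a, b) \<in> cells K \<Longrightarrow> Q a b"
    and join: "\<And>a b c. a \<in> K \<Longrightarrow> b \<in> K \<Longrightarrow> c \<in> K \<Longrightarrow> a < c \<Longrightarrow> c < b \<Longrightarrow> Q a c \<Longrightarrow> Q c b \<Longrightarrow> Q a b"
  shows "Q a b"
  using ab
proof (induction "card (K \<inter> {a<..<b})" arbitrary: a b rule: less_induct)
  case less
  show ?case
  proof (cases "{a<..<b} \<inter> K = {}")
    case True
    then show ?thesis using less.prems by (intro cell) (auto simp: cells_def)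
  next
    case False
    then obtain c where c: "c \<in> K" "a < c" "c < b" by auto
    have "card (K \<inter> {a<..<c}) < card (K \<inter> {a<..<b})" "card (K \<inter> {c<..<b}) < card (K \<inter> {a<..<b})"
      using c K by (auto intro!: psubset_card_mono)
    then show ?thesis using c less by (intro join[of a b c]) auto
  qed
qed

lemma ball_pairs: "(\<forall>(a, b)\<in>K. P a b) \<longleftrightarrow> (\<forall>a b. (a, b) \<in> K \<longrightarrow> P a b)"
  by auto

lemma piecewise_smooth_iff: "piecewise_smooth \<gamma> \<longleftrightarrow> path \<gamma> \<and>
    (\<exists>K. mesh K \<and> (\<forall>a b. (a, b) \<in> cells K \<longrightarrow> (\<exists>f. smooth f \<and> (\<forall>s\<in>{a..b}. \<gamma> s = f s))))"
  unfolding piecewise_smooth_def ball_pairs ..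

lemma piecewise_smooth_linepath: "piecewise_smooth (linepath a b)"
  unfolding piecewise_smooth_iff
  by (auto intro!: exI[of _ "{0, 1}"] smooth_linepath simp: mesh_def)

lemma piecewise_smooth_join:
  assumes "piecewise_smooth p" "piecewise_smooth q" "pathfinish p = pathstart q"
  shows "piecewise_smooth (p +++ q)"
proof -
  obtain K where K: "mesh K" "\<And>a b. (a, b) \<in> cells K \<Longrightarrow> \<exists>f. smooth f \<and> (\<forall>s\<in>{a..b}. p s = f s)"
    using assms(1) unfolding piecewise_smooth_iff by blast
  obtain L where L: "mesh L" "\<And>a b. (a, b) \<in> cells L \<Longrightarrow> \<exists>f. smooth f \<and> (\<forall>s\<in>{a..b}. q s = f s)"
    using assms(2) unfolding piecewise_smooth_iff by blast
  let ?M = "(\<lambda>x. x / 2) ` K \<union> (\<lambda>x. x / 2 + 1 / 2) ` L"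
  have half: "1 / 2 \<in> ?M" using K(1) by (auto simp: mesh_def intro: image_eqI[of _ _ 1])
  have "mesh ?M" using K(1) L(1) by (auto simp: mesh_def intro: image_eqI[of _ _ 0] image_eqI[of _ _ 1])
  moreover have "\<exists>f. smooth f \<and> (\<forall>s\<in>{a..b}. (p +++ q) s = f s)" if ab: "(a, b) \<in> cells ?M" for a b
  proof -
    have ab': "a \<in> ?M" "b \<in> ?M" "a < b" "{a<..<b} \<inter> ?M = {}" using ab by (auto simp: cells_def)
    \<comment> \<open>The junction 1/2 belongs to the mesh, so a cell lies entirely in one of the
      two halves.\<close>
    have "\<not> (a < 1 / 2 \<and> 1 / 2 < b)" using half ab'(4) by (metis IntI empty_iff greaterThanLessThan_iff)
    then consider "b \<le> 1 / 2" | "1 / 2 \<le> a" by linarith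
    then show ?thesis
    proof cases
      case 1
      have "2 * a \<in> K" using ab' 1 L(1) by (fastforce simp: mesh_def)
      moreover have "2 * b \<in> K" using ab' 1 K(1) L(1) by (fastforce simp: mesh_def)
      moreover have "{2 * a<..<2 * b} \<inter> K = {}"
      proof -
        have False if "x \<in> K" "2 * a < x" "x < 2 * b" for x
        proof -
          have "x / 2 \<in> {a<..<b} \<inter> ?M" using that by auto
          then show False using ab'(4) by blast
        qed
        then show ?thesis by auto
      qed
      ultimately have "(2 * a, 2 * b) \<in> cells K" using ab' by (auto simp: cells_def)
      then obtain f where f: "smooth f" "\<And>s. s \<in> {2 * a..2 * b} \<Longrightarrow> p s = f s" using K(2) by blast
      have "smooth (\<lambda>s. f (2 * s + 0))"
        by (rule smooth_affine[OF f(1)]) (rule bounded_linear_mult_right)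
      moreover have "(p +++ q) s = f (2 * s + 0)" if "s \<in> {a..b}" for s
        using f(2)[of "2 * s"] that 1 by (auto simp: joinpaths_def)
      ultimately show ?thesis by (intro exI[of _ "\<lambda>s. f (2 * s + 0)"]) auto
    next
      case 2
      have "2 * a - 1 \<in> L" using ab' 2 K(1) L(1) by (fastforce simp: mesh_def)
      moreover have "2 * b - 1 \<in> L" using ab' 2 K(1) L(1) by (fastforce simp: mesh_def)
      moreover have "{2 * a - 1<..<2 * b - 1} \<inter> L = {}"
      proof -
        have False if "x \<in> L" "2 * a - 1 < x" "x < 2 * b - 1" for x
        proof -
          have "x / 2 + 1 / 2 \<in> {a<..<b} \<inter> ?M" using that by auto
          then show False using ab'(4) by blast
        qed
        then show ?thesis by auto
      qed
      ultimately have "(2 * a - 1, 2 * b - 1) \<in> cells L" using ab' by (auto simp: cells_def)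
      then obtain f where f: "smooth f" "\<And>s. s \<in> {2 * a - 1..2 * b - 1} \<Longrightarrow> q s = f s" using L(2) by blast
      have "smooth (\<lambda>s. f (2 * s + (-1)))"
        by (rule smooth_affine[OF f(1)]) (rule bounded_linear_mult_right)
      moreover have "(p +++ q) s = f (2 * s + (-1))" if "s \<in> {a..b}" for s
      \<comment> \<open>At 1/2 the joined path takes the value of the first path, so agreement with
        \<open>q\<close> uses the matching end points.\<close>
      proof (cases "s = 1 / 2")
        case True
        then have "2 * s = 1" by simp
        moreover have "q 0 = f 0" using f(2)[of 0] that 2 True by auto
        ultimately show ?thesis using assms(3)
          by (simp add: joinpaths_def pathfinish_def pathstart_def)
      next
        case False
        then show ?thesis using f(2)[of "2 * s - 1"] that 2 by (auto simp: joinpaths_def)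
      qed
      ultimately show ?thesis by (intro exI[of _ "\<lambda>s. f (2 * s + (-1))"]) auto
    qed
  qed
  ultimately show ?thesis
    using assms unfolding piecewise_smooth_iff by auto
qed

section \<open>Transport along piecewise smooth paths and across thin homotopies\<close>

lemma smooth_curve: "smooth (f :: real \<Rightarrow> 'v::real_normed_vector) \<Longrightarrow>
    (f has_vector_derivative frechet_derivative f (at t) 1) (at t)"
proof -
  assume "smooth f"
  note d = smooth_deriv(1)[OF this, of t]
  interpret bounded_linear "frechet_derivative f (at t)" using d by (rule has_derivative_bounded_linear)
  have "frechet_derivative f (at t) h = h *\<^sub>R frechet_derivative f (at t) 1" for h
    using scaleR[of h 1] by simp
  then show ?thesis
    unfolding has_vector_derivative_def by (intro has_derivative_eq_rhs[OF d] ext)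
qed

lemma transport_exists:
  assumes X: "smooth (X :: real \<times> real \<Rightarrow> real ^ 'n::finite)" and "piecewise_smooth \<gamma>"
  shows "\<exists>s. transport (X \<circ> \<gamma>) 0 1 s"
proof -
  obtain K where K: "mesh K" "\<And>a b. (a, b) \<in> cells K \<Longrightarrow> \<exists>f. smooth f \<and> (\<forall>s\<in>{a..b}. \<gamma> s = f s)"
    using assms(2) unfolding piecewise_smooth_iff by blast
  show ?thesis
  proof (rule mesh_induct[of K 0 1])
    fix a b assume "(a, b) \<in> cells K"
    then obtain f where f: "smooth f" "\<And>s. s \<in> {a..b} \<Longrightarrow> \<gamma> s = f s" using K(2) by blast
    let ?w = "\<lambda>t. frechet_derivative f (at t) 1"
    have "transport (\<lambda>t. X (f t)) a b (tr (\<lambda>t. fst (?w t) *\<^sub>R frechet_derivative X (at (f t)) (1, 0) +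
        snd (?w t) *\<^sub>R frechet_derivative X (at (f t)) (0, 1)) a b)"
      by (intro transport_tr smooth_compose_curve[OF X] smooth_curve f continuous_intros smooth_deriv(3)
          continuous_on_compose2[OF smooth_deriv(3)[OF X, of UNIV]] smooth_deriv(4)) auto
    then have "transport (X \<circ> \<gamma>) a b (tr (\<lambda>t. fst (?w t) *\<^sub>R frechet_derivative X (at (f t)) (1, 0) +
        snd (?w t) *\<^sub>R frechet_derivative X (at (f t)) (0, 1)) a b)"
      by (rule transport_cong) (use f in auto)
    then show "\<exists>s. transport (X \<circ> \<gamma>) a b s" by blast
  next
    show "\<exists>s. transport (X \<circ> \<gamma>) a b s"
      if "a < c" "c < b" "\<exists>s. transport (X \<circ> \<gamma>) a c s" "\<exists>s. transport (X \<circ> \<gamma>) c b s" for a b c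
      using that transport_join[of a c b] by (meson less_imp_le)
  qed (use K in \<open>auto simp: mesh_def\<close>)
qed

lemma surface_compose:
  fixes X :: "real \<times> real \<Rightarrow> real ^ 'n::finite" and f :: "real \<times> real \<Rightarrow> real \<times> real"
  assumes X: "smooth X" and f: "smooth f"
  obtains Y12 where "surface (\<lambda>p. X (f p)) (\<lambda>p. frechet_derivative X (at (f p)) (frechet_derivative f (at p) (1, 0)))
    (\<lambda>p. frechet_derivative X (at (f p)) (frechet_derivative f (at p) (0, 1))) Y12"
proof -
  let ?X1 = "\<lambda>p. frechet_derivative X (at p) (1, 0)" and ?X2 = "\<lambda>p. frechet_derivative X (at p) (0, 1)"
  let ?f1 = "\<lambda>p. frechet_derivative f (at p) (1, 0)" and ?f2 = "\<lambda>p. frechet_derivative f (at p) (0, 1)"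
  let ?f12 = "\<lambda>p. frechet_derivative ?f1 (at p) (0, 1)"
  note sX = smooth_deriv(2)[OF X, of "(1, 0)"] smooth_deriv(2)[OF X, of "(0, 1)"]
  note sf = smooth_deriv(2)[OF f, of "(1, 0)"]
  note cf = smooth_deriv(4)[OF f] smooth_deriv(3)[OF f] smooth_deriv(3)[OF sf]
  let ?c = "\<lambda>g p. fst (?f2 p) *\<^sub>R frechet_derivative g (at (f p)) (1, 0) + snd (?f2 p) *\<^sub>R frechet_derivative g (at (f p)) (0, 1)"
  \<comment> \<open>Product and chain rule for the derivative in the second variable of dX(f)(d1 f),
    which is \<open>Y1\<close> for the composed surface.\<close>
  let ?Y12 = "\<lambda>p. fst (?f1 p) *\<^sub>R ?c ?X1 p + fst (?f12 p) *\<^sub>R ?X1 (f p) +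
      (snd (?f1 p) *\<^sub>R ?c ?X2 p + snd (?f12 p) *\<^sub>R ?X2 (f p))"
  have cX: "continuous_on UNIV (\<lambda>p. frechet_derivative g (at (f p)) v)" if "smooth g"
    for g :: "real \<times> real \<Rightarrow> real ^ 'n" and v
    by (rule continuous_on_compose2[OF smooth_deriv(3)[OF that, of UNIV] cf(1)]) auto
  have "surface (\<lambda>p. X (f p)) (\<lambda>p. frechet_derivative X (at (f p)) (?f1 p))
    (\<lambda>p. frechet_derivative X (at (f p)) (?f2 p)) ?Y12"
    unfolding frechet_expand[OF X, of _ "frechet_derivative f _ _"]
  proof
    fix r t
    show "((\<lambda>r. X (f (r, t))) has_vector_derivative
        fst (?f1 (r, t)) *\<^sub>R ?X1 (f (r, t)) + snd (?f1 (r, t)) *\<^sub>R ?X2 (f (r, t))) (at r)"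
      by (rule smooth_compose_curve[OF X smooth_partial(1)[OF f]])
    show "((\<lambda>t. X (f (r, t))) has_vector_derivative
        fst (?f2 (r, t)) *\<^sub>R ?X1 (f (r, t)) + snd (?f2 (r, t)) *\<^sub>R ?X2 (f (r, t))) (at t)"
      by (rule smooth_compose_curve[OF X smooth_partial(2)[OF f]])
    have 1: "((\<lambda>t. ?X1 (f (r, t))) has_vector_derivative ?c ?X1 (r, t)) (at t)"
      "((\<lambda>t. ?X2 (f (r, t))) has_vector_derivative ?c ?X2 (r, t)) (at t)"
      by (rule smooth_compose_curve[OF sX(1) smooth_partial(2)[OF f]]
          smooth_compose_curve[OF sX(2) smooth_partial(2)[OF f]])+
    have 2: "((\<lambda>t. fst (?f1 (r, t))) has_real_derivative fst (?f12 (r, t))) (at t)"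
      "((\<lambda>t. snd (?f1 (r, t))) has_real_derivative snd (?f12 (r, t))) (at t)"
      using bounded_linear.has_vector_derivative[OF bounded_linear_fst smooth_partial(2)[OF sf]]
        bounded_linear.has_vector_derivative[OF bounded_linear_snd smooth_partial(2)[OF sf]]
      by (simp_all add: has_real_derivative_iff_has_vector_derivative)
    show "((\<lambda>t. fst (?f1 (r, t)) *\<^sub>R ?X1 (f (r, t)) + snd (?f1 (r, t)) *\<^sub>R ?X2 (f (r, t)))
        has_vector_derivative ?Y12 (r, t)) (at t)"
      by (rule has_vector_derivative_add[OF has_vector_derivative_scaleR[OF 2(1) 1(1)]
            has_vector_derivative_scaleR[OF 2(2) 1(2)]])
  qed (intro continuous_intros cf cX X sX)+
  then show ?thesis by (rule that)
qed

text \<open>The range of \<open>D\<close> lies in a line, so both values are multiples of one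
  vector, and proportional elements commute.\<close>

lemma curvature_zero:
  fixes D :: "'v::euclidean_space \<Rightarrow> real \<times> real" and E :: "real \<times> real \<Rightarrow> real ^ 'n::finite"
  assumes "dim (range D) \<le> 1" "linear E"
  shows "act (lets (E (D u))) (lets (E (D v))) = 0"
proof -
  obtain B where B: "independent B" "range D \<subseteq> span B" "card B = dim (range D)"
    using basis_exists[of "range D"] by metis
  have "finite B" using B(1) by (rule independent_imp_finite)
  then obtain b where "B \<subseteq> {b}"
    using B(3) assms(1) by (metis card_le_Suc0_iff_eq One_nat_def insertCI subsetI subset_singleton_iff empty_iff)
  then have "span B \<subseteq> span {b}" by (rule span_mono)
  then have "D x \<in> range (\<lambda>k. k *\<^sub>R b)" for x
    using B(2) rangeI[of D x] unfolding span_singleton by (meson subsetD)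
  then obtain c d where "D u = c *\<^sub>R b" "D v = d *\<^sub>R b"
    by (meson imageE)
  then show ?thesis
    using assms(2) by (simp add: linear_scale lets_scale act_eq)
qed

text \<open>The pullback of the connection along a thin homotopy is flat. Each cell gives a
  commuting square of transports, and since the end points stay fixed the squares combine to equal
  transports along both paths.\<close>

lemma thin_homotopy_transport:
  fixes X :: "real \<times> real \<Rightarrow> real ^ 'n::finite"
  assumes X: "smooth X" and h: "thin_homotopy \<gamma> \<gamma>' h" and s: "transport (X \<circ> \<gamma>) 0 1 s"
  shows "transport (X \<circ> \<gamma>') 0 1 s"
proof -
  let ?V = "\<lambda>s. transport (\<lambda>t. X (h (s, t)))" and ?H = "\<lambda>t. transport (\<lambda>s. X (h (s, t)))"
  obtain K L where KL: "mesh K" "mesh L"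
    and cell: "\<And>a b a' b'. (a, b) \<in> cells K \<Longrightarrow> (a', b') \<in> cells L \<Longrightarrow>
        (\<exists>f. smooth f \<and> (\<forall>p\<in>{a..b} \<times> {a'..b'}. h p = f p)) \<and>
        (\<forall>p\<in>{a<..<b} \<times> {a'<..<b'}. dim (range (frechet_derivative h (at p))) \<le> 1)"
    using h unfolding thin_homotopy_def ball_pairs by metis
  have ends: "\<And>t. t \<in> {0..1} \<Longrightarrow> h (0, t) = \<gamma> t" "\<And>t. t \<in> {0..1} \<Longrightarrow> h (1, t) = \<gamma>' t"
    "\<And>s. s \<in> {0..1} \<Longrightarrow> h (s, 0) = pathstart \<gamma>" "\<And>s. s \<in> {0..1} \<Longrightarrow> h (s, 1) = pathfinish \<gamma>"
    using h by (auto simp: thin_homotopy_def)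
  \<comment> \<open>The commuting square over [a, b] x [a', b']. It holds on cells, and uniqueness
    of the shared horizontal transport allows squares to be stacked in the second variable.\<close>
  define Q where "Q a b a' b' \<longleftrightarrow> (\<exists>ha hb va vb. ?H a' a b ha \<and> ?H b' a b hb \<and> ?V a a' b' va \<and> ?V b a' b' vb \<and>
      ha * vb = va * hb)" for a b a' b'
  have Qcell: "Q a b a' b'" if c: "(a, b) \<in> cells K" "(a', b') \<in> cells L" for a b a' b'
  proof -
    have lt: "a < b" "a' < b'" using c by (auto simp: cells_def)
    obtain f where f: "smooth f" "\<And>p. p \<in> {a..b} \<times> {a'..b'} \<Longrightarrow> h p = f p"
      using cell[OF c] by blast
    let ?Y1 = "\<lambda>p. frechet_derivative X (at (f p)) (frechet_derivative f (at p) (1, 0))"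
    let ?Y2 = "\<lambda>p. frechet_derivative X (at (f p)) (frechet_derivative f (at p) (0, 1))"
    obtain Y12 where "surface (\<lambda>p. X (f p)) ?Y1 ?Y2 Y12"
      using surface_compose[OF X f(1)] .
    then interpret S: surface "\<lambda>p. X (f p)" ?Y1 ?Y2 Y12 .
    have lin: "linear (frechet_derivative X (at p))" for p
      by (rule has_derivative_linear[OF smooth_deriv(1)[OF X]])
    have z: "S.curv p = 0" if p: "p \<in> {a<..<b} \<times> {a'<..<b'}" for p
    proof -
      have "(h has_derivative frechet_derivative f (at p)) (at p)"
        by (rule has_derivative_transform_within_open[OF smooth_deriv(1)[OF f(1)], where s = "{a<..<b} \<times> {a'<..<b'}"])
           (use p f(2) in \<open>auto intro!: open_Times\<close>)
      then have "frechet_derivative h (at p) = frechet_derivative f (at p)"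
        by (rule frechet_derivative_at[symmetric])
      then have "dim (range (frechet_derivative f (at p))) \<le> 1"
        using cell[OF c] p by metis
      then show ?thesis unfolding S.curv_def by (rule curvature_zero[OF _ lin])
    qed
    \<comment> \<open>The rank condition concerns only the open cell; continuity extends the
      vanishing of the curvature to the closed cell.\<close>
    have "S.curv p = 0" if p: "p \<in> {a..b} \<times> {a'..b'}" for p
    proof (rule ncps_eqI)
      fix w
      have cl: "closure ({a<..<b} \<times> {a'<..<b'}) = {a..b} \<times> {a'..b'}"
        using lt by (simp add: closure_Times)
      have "ncc ({a..b} \<times> {a'..b'}) (\<lambda>p. S.curv (fst p, snd p))"
        by (rule S.ncc_curv) (intro continuous_intros)+
      then have "continuous_on (closure ({a<..<b} \<times> {a'<..<b'})) (\<lambda>p. wcoeff (S.curv p) w)"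
        unfolding cl ncc_def by simp
      then have "wcoeff (S.curv p) w = 0"
        by (rule continuous_constant_on_closure) (use p z cl in auto)
      then show "wcoeff (S.curv p) w = wcoeff 0 w" by simp
    qed
    then have "S.hor a b a' * S.ver b a' b' = S.ver a a' b' * S.hor a b b'"
      using lt by (intro S.flat_square) auto
    moreover have "?H t a b (S.hor a b t)" if "t \<in> {a'..b'}" for t
      by (rule transport_cong[OF S.transport_hor]) (use that f(2) in auto)
    moreover have "?V r a' b' (S.ver r a' b')" if "r \<in> {a..b}" for r
      by (rule transport_cong[OF S.transport_ver]) (use that f(2) in auto)
    ultimately show ?thesis unfolding Q_def using lt by (meson atLeastAtMost_iff less_imp_le order_refl)
  qed
  have Q: "Q a b 0 1" if ab: "(a, b) \<in> cells K" for a b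
  proof (rule mesh_induct[of L 0 1])
    fix a' b' c assume "a' < c" "c < b'" "Q a b a' c" "Q a b c b'"
    then obtain ha hc va vb hc' hb va' vb' where *: "?H a' a b ha" "?H c a b hc" "?V a a' c va" "?V b a' c vb"
      "ha * vb = va * hc" "?H c a b hc'" "?H b' a b hb" "?V a c b' va'" "?V b c b' vb'" "hc' * vb' = va' * hb"
      unfolding Q_def by blast
    have "hc' = hc" using transport_unique[OF *(6,2)] ab by (auto simp: cells_def)
    then have "ha * (vb * vb') = (va * va') * hb"
      using *(5,10) by (metis mult.assoc)
    moreover have "?V a a' b' (va * va')" "?V b a' b' (vb * vb')"
      using transport_join[OF _ _ *(3,8)] transport_join[OF _ _ *(4,9)] \<open>a' < c\<close> \<open>c < b'\<close> by simp_all
    ultimately show "Q a b a' b'" unfolding Q_def using *(1,7) by blast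
  qed (use KL Qcell ab in \<open>auto simp: mesh_def\<close>)
  have "\<exists>v. ?V 0 0 1 v \<and> ?V 1 0 1 v"
  proof (rule mesh_induct[of K 0 1 "\<lambda>a b. \<exists>v. ?V a 0 1 v \<and> ?V b 0 1 v"])
    fix a b assume ab: "(a, b) \<in> cells K"
    then have sub: "a \<le> b" "{a<..<b} \<subseteq> {0..1}" using KL(1) by (auto simp: cells_def mesh_def subset_iff)
    obtain ha hb va vb where *: "?H 0 a b ha" "?H 1 a b hb" "?V a 0 1 va" "?V b 0 1 vb" "ha * vb = va * hb"
      using Q[OF ab] unfolding Q_def by blast
    \<comment> \<open>The homotopy is constant on the edges t = 0 and t = 1, so both horizontal
      transports are 1 and the square relation equates the slices at a and b.\<close>
    have "?H 0 a b 1"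
      by (rule transport_cong[OF transport_const[of "X (pathstart \<gamma>)"]])
         (use ends(3) sub(2) in \<open>simp add: subset_iff\<close>)
    moreover have "?H 1 a b 1"
      by (rule transport_cong[OF transport_const[of "X (pathfinish \<gamma>)"]])
         (use ends(4) sub(2) in \<open>simp add: subset_iff\<close>)
    ultimately have "ha = 1" "hb = 1" using *(1,2) transport_unique sub(1) by blast+
    then show "\<exists>v. ?V a 0 1 v \<and> ?V b 0 1 v" using * by auto
  next
    fix a b c assume "\<exists>v. ?V a 0 1 v \<and> ?V c 0 1 v" "\<exists>v. ?V c 0 1 v \<and> ?V b 0 1 v"
    then show "\<exists>v. ?V a 0 1 v \<and> ?V b 0 1 v"
      using transport_unique[of "\<lambda>t. X (h (c, t))" 0 1] by auto
  qed (use KL in \<open>auto simp: mesh_def\<close>)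
  then obtain v where v: "?V 0 0 1 v" "?V 1 0 1 v" by blast
  have "transport (X \<circ> \<gamma>) 0 1 v" by (rule transport_cong[OF v(1)]) (use ends(1) in auto)
  then have "v = s" using transport_unique[OF _ s] by auto
  moreover have "transport (X \<circ> \<gamma>') 0 1 v" by (rule transport_cong[OF v(2)]) (use ends(2) in auto)
  ultimately show ?thesis by simp
qed

text \<open>Puts the path into its own class, so that \<open>the_elem\<close> in
  \<open>omega\<close> is taken over a nonempty set.\<close>

lemma thin_homotopy_refl:
  assumes "piecewise_smooth \<gamma>" shows "thin_homotopy \<gamma> \<gamma> (\<lambda>p. \<gamma> (snd p))"
proof -
  obtain L where L: "mesh L" "\<And>a b. (a, b) \<in> cells L \<Longrightarrow> \<exists>f. smooth f \<and> (\<forall>s\<in>{a..b}. \<gamma> s = f s)"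
    using assms unfolding piecewise_smooth_iff by blast
  have "(\<exists>g. smooth g \<and> (\<forall>p\<in>{a..b} \<times> {a'..b'}. \<gamma> (snd p) = g p)) \<and>
      (\<forall>p\<in>{a<..<b} \<times> {a'<..<b'}. dim (range (frechet_derivative (\<lambda>p. \<gamma> (snd p)) (at p))) \<le> 1)"
    if c: "(a', b') \<in> cells L" for a b a' b' :: real
  proof -
    obtain f where f: "smooth f" "\<And>s. s \<in> {a'..b'} \<Longrightarrow> \<gamma> s = f s" using L(2)[OF c] by auto
    have "smooth (\<lambda>p :: real \<times> real. f (snd p + 0))"
      by (rule smooth_affine[OF f(1) bounded_linear_snd])
    moreover have "dim (range (frechet_derivative (\<lambda>p. \<gamma> (snd p)) (at p))) \<le> 1" if p: "p \<in> {a<..<b} \<times> {a'<..<b'}" for p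
    proof -
      have "((\<lambda>p. f (snd p)) has_derivative (\<lambda>v. snd v *\<^sub>R frechet_derivative f (at (snd p)) 1)) (at p)"
        using has_derivative_compose[OF _ smooth_curve[OF f(1), unfolded has_vector_derivative_def], of snd snd p UNIV]
        by (simp add: has_derivative_snd)
      then have "((\<lambda>p. \<gamma> (snd p)) has_derivative (\<lambda>v. snd v *\<^sub>R frechet_derivative f (at (snd p)) 1)) (at p)"
        by (rule has_derivative_transform_within_open[where s = "{a<..<b} \<times> {a'<..<b'}"])
           (use p f(2) in \<open>auto intro!: open_Times\<close>)
      then have "frechet_derivative (\<lambda>p. \<gamma> (snd p)) (at p) = (\<lambda>v. snd v *\<^sub>R frechet_derivative f (at (snd p)) 1)"
        by (rule frechet_derivative_at[symmetric])
      then have "range (frechet_derivative (\<lambda>p. \<gamma> (snd p)) (at p)) \<subseteq> span {frechet_derivative f (at (snd p)) 1}"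
        by (auto simp: span_singleton)
      from dim_le_card[OF this] show ?thesis by simp
    qed
    ultimately show ?thesis using f(2) by (intro conjI exI[of _ "\<lambda>p. f (snd p + 0)"]) auto
  qed
  note c = this
  show ?thesis
    unfolding thin_homotopy_def ball_pairs
  proof (intro conjI)
    have "continuous_on {0..1} \<gamma>"
      using assms by (simp only: piecewise_smooth_def path_def)
    then show "continuous_on ({0..1} \<times> {0..1}) (\<lambda>p. \<gamma> (snd p))"
      by (rule continuous_on_compose2) (auto intro: continuous_on_snd continuous_on_id)
    have "mesh {0, 1}" by (simp add: mesh_def)
    then show "\<exists>K L. mesh K \<and> mesh L \<and> (\<forall>a b. (a, b) \<in> cells K \<longrightarrow> (\<forall>a' b'. (a', b') \<in> cells L \<longrightarrow>
        (\<exists>f. smooth f \<and> (\<forall>p\<in>{a..b} \<times> {a'..b'}. \<gamma> (snd p) = f p)) \<and>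
        (\<forall>p\<in>{a<..<b} \<times> {a'<..<b'}. dim (range (frechet_derivative (\<lambda>p. \<gamma> (snd p)) (at p))) \<le> 1)))"
      using L(1) c by (intro exI[of _ "{0, 1}"] exI[of _ L]) blast
  qed (simp_all add: pathstart_def pathfinish_def)
qed

lemma omega_pclass:
  assumes X: "smooth X" and \<gamma>: "piecewise_smooth \<gamma>" and s: "transport (X \<circ> \<gamma>) 0 1 s"
  shows "omega X (pclass \<gamma>) = nc_log s"
proof -
  have "\<gamma> \<in> pclass \<gamma>"
    using thin_homotopy_refl[OF \<gamma>] \<gamma> by (auto simp: pclass_def thin_rel_def)
  moreover have "path_signature (X \<circ> \<gamma>') = s" if "\<gamma>' \<in> pclass \<gamma>" for \<gamma>'
    using that thin_homotopy_transport[OF X _ s]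
    by (auto simp: pclass_def thin_rel_def intro!: path_signature_eq)
  ultimately have "(\<lambda>\<gamma>. nc_log (path_signature (X \<circ> \<gamma>))) ` pclass \<gamma> = {nc_log s}"
    by auto
  then show ?thesis by (simp add: omega_def)
qed


section \<open>Weights and completions\<close>

lemma weight_append [simp]: "weight (u @ v) = weight u + weight v"
  and weight_Cons [simp]: "weight (g # u) = gweight g + weight u"
  and weight_Nil [simp]: "weight [] = 0"
  and wdeg_Cons [simp]: "wdeg (g # u) = gdeg g + wdeg u"
  and wdeg_Nil [simp]: "wdeg [] = 0"
  by (simp_all add: weight_def wdeg_def)

lemma gweight_pos: "0 < gweight g"
  by (cases g) auto

lemma length_le_weight: "length w \<le> weight w"
proof (induction w)
  case (Cons g w)
  then show ?case using gweight_pos[of g] by simp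
qed simp

lemma weight_eq_0 [simp]: "weight w = 0 \<longleftrightarrow> w = []"
  using length_le_weight[of w] by auto

lemma weight_take_drop: "weight (take k w) + weight (drop k w) = weight w"
  by (metis append_take_drop_id weight_append)

lemma finite_gen: "finite (UNIV :: 'n::finite gen set)"
proof -
  have eq: "(UNIV :: 'n gen set) = range Z \<union> range (\<lambda>(i, j). ZZ i j)"
    by (auto simp: image_iff) (metis gen.exhaust)
  show ?thesis by (rule ssubst[OF eq]) simp
qed

lemma finite_weight_le: "finite {w :: 'n::finite gen list. weight w \<le> k}"
  by (rule finite_subset[OF _ finite_lists_length_le[OF finite_gen, of k]])
     (auto intro: le_trans[OF length_le_weight])

lemma finite_weight [simp]: "finite {w :: 'n::finite gen list. weight w = k}"
  by (rule finite_subset[OF _ finite_weight_le[of k]]) auto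

text \<open>Products and \<open>dd\<close>, evaluated at words of weight at most k, see only the
  truncation. Since it has finite support, identities of finitely supported elements extend to all
  series.\<close>

definition wtrunc :: "nat \<Rightarrow> 'n gen ncps \<Rightarrow> 'n gen ncps" where
  "wtrunc k a = Ncps (\<lambda>w. if weight w \<le> k then wcoeff a w else 0)"

lemma wcoeff_wtrunc [simp]: "wcoeff (wtrunc k a) w = (if weight w \<le> k then wcoeff a w else 0)"
  and wcoeff_homog [simp]: "wcoeff (homog k a) w = (if weight w = k then wcoeff a w else 0)"
  by (simp_all add: wtrunc_def homog_def)

lemma fin_supp_wtrunc [simp]: "fin_supp (wtrunc k (a :: 'n::finite gen ncps))"
  and fin_supp_homog [simp]: "fin_supp (homog k (a :: 'n::finite gen ncps))"
  unfolding fin_supp_def by (rule finite_subset[OF _ finite_weight_le[of k]]; auto split: if_splits)+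

lemma wcoeff_mult_wtrunc:
  "weight w \<le> k \<Longrightarrow> wcoeff (wtrunc k a * wtrunc k b) w = wcoeff (a * b) w"
  unfolding wcoeff_mult
proof (rule sum.cong[OF refl])
  fix i assume "weight w \<le> k"
  then show "wcoeff (wtrunc k a) (take i w) * wcoeff (wtrunc k b) (drop i w) = wcoeff a (take i w) * wcoeff b (drop i w)"
    using weight_take_drop[of i w] by simp
qed

lemma homog_linear: "linear (homog k)"
  by (rule linearI) (auto simp: ncps_eq_iff)

lemmas homog_simps [simp] = linear_add[OF homog_linear] linear_diff[OF homog_linear]
  linear_scale[OF homog_linear] linear_0[OF homog_linear] linear_neg[OF homog_linear]
  linear_sum[OF homog_linear]

lemma homog_homog [simp]: "homog j (homog k a) = (if j = k then homog k a else 0)"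
  by (auto simp: ncps_eq_iff)

lemma homog_mult: "homog k (a * b) = (\<Sum>i\<le>k. homog i a * homog (k - i) b)"
proof (rule ncps_eqI)
  fix w
  have "wcoeff (\<Sum>i\<le>k. homog i a * homog (k - i) b) w =
      (\<Sum>l\<le>length w. \<Sum>i\<le>k. if i = weight (take l w) then
        (if weight w = k then wcoeff a (take l w) * wcoeff b (drop l w) else 0) else 0)"
    unfolding wcoeff_sum wcoeff_mult
  proof (subst sum.swap, intro sum.cong refl)
    fix l i assume i: "i \<in> {..k}"
    show "wcoeff (homog i a) (take l w) * wcoeff (homog (k - i) b) (drop l w) = (if i = weight (take l w) then
        (if weight w = k then wcoeff a (take l w) * wcoeff b (drop l w) else 0) else 0)"
      using weight_take_drop[of l w] i by auto
  qed
  also have "\<dots> = (\<Sum>l\<le>length w. if weight w = k then wcoeff a (take l w) * wcoeff b (drop l w) else 0)"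
  proof (rule sum.cong[OF refl])
    fix l
    show "(\<Sum>i\<le>k. if i = weight (take l w) then
        (if weight w = k then wcoeff a (take l w) * wcoeff b (drop l w) else 0) else 0) =
        (if weight w = k then wcoeff a (take l w) * wcoeff b (drop l w) else 0)"
      using weight_take_drop[of l w] by (subst sum.delta) auto
  qed
  also have "\<dots> = wcoeff (homog k (a * b)) w"
    by (simp add: wcoeff_mult)
  finally show "wcoeff (homog k (a * b)) w = wcoeff (\<Sum>i\<le>k. homog i a * homog (k - i) b) w" by simp
qed

lemma homog_mult': "homog k (a * b) = (\<Sum>i\<le>k. homog (k - i) a * homog i b)"
  unfolding homog_mult by (rule sum.reindex_bij_witness[of _ "\<lambda>i. k - i" "\<lambda>i. k - i"]) auto

lemma homog_gbr: "homog k (gbr p q a b) = (\<Sum>i\<le>k. gbr p q (homog i a) (homog (k - i) b))"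
  by (simp add: gbr_def homog_mult[of k a b] homog_mult'[of k b a] sum_subtractf scaleR_sum_right)

lemma ncps_eq_homog: "(\<And>k. homog k a = homog k b) \<Longrightarrow> a = b"
  by (metis ncps_eqI wcoeff_homog)

lemma homog_op_series:
  assumes "raising T"
  shows "homog k (op_series c T y) = (\<Sum>m\<le>k. c m *\<^sub>R homog k ((T ^^ m) y))"
proof (rule ncps_eqI)
  fix w
  show "wcoeff (homog k (op_series c T y)) w = wcoeff (\<Sum>m\<le>k. c m *\<^sub>R homog k ((T ^^ m) y)) w"
    using op_series_coeff[OF assms, of w k c y] length_le_weight[of w] by (simp add: wcoeff_sum)
qed

section \<open>Subspaces described weight by weight, under integration and differentiation\<close>

lemma wcompletion_subspace: "subspace V \<Longrightarrow> subspace (wcompletion V)"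
  by (auto simp: subspace_def wcompletion_def)

text \<open>A functional that vanishes on a basis of \<open>V\<close> but not on the weight
  component of \<open>a\<close>. As there are finitely many words of weight k, it is a finite
  combination of coefficients and so commutes with derivatives and integrals.\<close>

lemma homog_functional:
  fixes V :: "'n::finite gen ncps set"
  assumes V: "subspace V" and a: "homog k a \<notin> V"
  obtains c where "\<And>v. homog k v \<in> V \<Longrightarrow> (\<Sum>w | weight w = k. c w * wcoeff v w) = 0"
    "(\<Sum>w | weight w = k. c w * wcoeff a w) \<noteq> 0"
proof -
  obtain B where B: "B \<subseteq> V" "independent B" "V \<subseteq> span B"
    using maximal_independent_subset by blast
  have "homog k a \<notin> span B"
    using a B(1) V span_minimal by blast
  then have "independent (insert (homog k a) B)"
    using B(2) by (rule independent_insertI)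
  then obtain \<phi> :: "'n gen ncps \<Rightarrow> real" where \<phi>: "linear \<phi>"
    "\<And>x. x \<in> insert (homog k a) B \<Longrightarrow> \<phi> x = (if x = homog k a then 1 else 0)"
    using linear_independent_extend[of "insert (homog k a) B" "\<lambda>x. if x = homog k a then 1 else 0"] by blast
  have "\<phi> x = 0" if "x \<in> B" for x
    using \<phi>(2)[of x] that \<open>homog k a \<notin> span B\<close> span_base by auto
  then have V0: "\<phi> v = 0" if "v \<in> V" for v
    using linear_eq_0_on_span[OF \<phi>(1)] that B(3) by blast
  have e: "\<phi> (homog k v) = (\<Sum>w | weight w = k. \<phi> (mono_nc w) * wcoeff v w)" for v
  proof -
    have "homog k v = (\<Sum>w | weight w = k. wcoeff v w *\<^sub>R mono_nc w)"
    proof (rule ncps_eqI)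
      fix u
      have "wcoeff (\<Sum>w | weight w = k. wcoeff v w *\<^sub>R mono_nc w) u = (\<Sum>w | weight w = k. if w = u then wcoeff v w else 0)"
        unfolding wcoeff_sum by (rule sum.cong) auto
      then show "wcoeff (homog k v) u = wcoeff (\<Sum>w | weight w = k. wcoeff v w *\<^sub>R mono_nc w) u"
        by (simp add: sum.delta[OF finite_weight])
    qed
    then show ?thesis by (simp add: linear_sum[OF \<phi>(1)] linear_scale[OF \<phi>(1)] mult.commute)
  qed
  show ?thesis
    by (rule that[of "\<lambda>w. \<phi> (mono_nc w)"]) (use e V0 \<phi>(2)[of "homog k a"] in \<open>auto simp flip: e\<close>)
qed

lemma homog_nint:
  fixes V :: "'n::finite gen ncps set"
  assumes V: "subspace V" and f: "ncc {a..b} f" "\<And>t. t \<in> {a..b} \<Longrightarrow> homog k (f t) \<in> V"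
  shows "homog k (nint a b f) \<in> V"
proof (rule ccontr)
  assume "homog k (nint a b f) \<notin> V"
  then obtain c where c: "\<And>v. homog k v \<in> V \<Longrightarrow> (\<Sum>w | weight w = k. c w * wcoeff v w) = 0"
    "(\<Sum>w | weight w = k. c w * wcoeff (nint a b f) w) \<noteq> 0"
    using homog_functional[OF V] by blast
  have "(\<Sum>w | weight w = k. c w * wcoeff (nint a b f) w) =
      integral {a..b} (\<lambda>t. \<Sum>w | weight w = k. c w * wcoeff (f t) w)"
    using f(1) unfolding wcoeff_nint ncc_def
    by (subst integral_sum) (auto intro!: integrable_continuous_interval continuous_intros)
  also have "\<dots> = integral {a..b} (\<lambda>t. 0)"
    by (rule Henstock_Kurzweil_Integration.integral_cong) (use c(1) f(2) in auto)
  finally show False using c(2) by simp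
qed

text \<open>Were the component outside \<open>V\<close> somewhere, a separating functional would
  give a continuous real function with derivative zero off a finite set, zero at the start but not
  there.\<close>

lemma homog_derivative:
  fixes V :: "'n::finite gen ncps set"
  assumes V: "subspace V" and F: "finite F" and f: "ncc {a..b} f"
    and f': "\<And>t. t \<in> {a..b} - F \<Longrightarrow> \<exists>f'. homog k f' \<in> V \<and>
        (\<forall>w. ((\<lambda>s. wcoeff (f s) w) has_real_derivative wcoeff f' w) (at t within {a..b}))"
    and ini: "homog k (f a) \<in> V" and x: "x \<in> {a..b}"
  shows "homog k (f x) \<in> V"
proof (rule ccontr)
  assume "homog k (f x) \<notin> V"
  then obtain c where c: "\<And>v. homog k v \<in> V \<Longrightarrow> (\<Sum>w | weight w = k. c w * wcoeff v w) = 0"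
    "(\<Sum>w | weight w = k. c w * wcoeff (f x) w) \<noteq> 0"
    using homog_functional[OF V] by blast
  have "((\<lambda>t. \<Sum>w | weight w = k. c w * wcoeff (f t) w) has_derivative (\<lambda>h. 0)) (at t within {a..b})"
    if t: "t \<in> {a..b} - F" for t
  proof -
    obtain f' where f': "homog k f' \<in> V"
      "\<And>w. ((\<lambda>s. wcoeff (f s) w) has_real_derivative wcoeff f' w) (at t within {a..b})"
      using f'[OF t] by blast
    have "((\<lambda>t. \<Sum>w | weight w = k. c w * wcoeff (f t) w) has_real_derivative
        (\<Sum>w | weight w = k. c w * wcoeff f' w)) (at t within {a..b})"
      by (intro DERIV_sum DERIV_cmult f')
    then show ?thesis using c(1)[OF f'(1)] by (simp add: has_field_derivative_def fun_eq_iff lambda_zero)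
  qed
  note d = this
  have cont: "continuous_on {a..b} (\<lambda>t. \<Sum>w | weight w = k. c w * wcoeff (f t) w)"
    using f by (auto simp: ncc_def intro!: continuous_intros)
  have "(\<Sum>w | weight w = k. c w * wcoeff (f x) w) = 0"
    by (rule has_derivative_zero_unique_strong_interval[OF F cont c(1)[OF ini] _ x]) (rule d)
  then show False using c(2) by simp
qed

lemma wcompletion_nint:
  fixes V :: "'n::finite gen ncps set"
  assumes "subspace V" "ncc {a..b} f" "\<And>t. t \<in> {a..b} \<Longrightarrow> f t \<in> wcompletion V"
  shows "nint a b f \<in> wcompletion V"
  using homog_nint[OF assms(1,2)] assms(3) by (auto simp: wcompletion_def)

section \<open>The differential as a derivation\<close>

lemma wcoeff_letter_mult:
  "wcoeff (letter g * x) w = (case w of [] \<Rightarrow> 0 | h # v \<Rightarrow> if h = g then wcoeff x v else 0)"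
proof (cases w)
  case (Cons h v)
  have "wcoeff (letter g * x) w = (\<Sum>k\<le>length w. if k = 1 then (if h = g then wcoeff x v else 0) else 0)"
    unfolding wcoeff_mult
  proof (rule sum.cong[OF refl])
    fix k assume "k \<in> {..length w}"
    then show "wcoeff (letter g) (take k w) * wcoeff x (drop k w) = (if k = 1 then (if h = g then wcoeff x v else 0) else 0)"
      using Cons by (cases k; cases "k - 1") auto
  qed
  also have "\<dots> = (if 1 \<in> {..length w} then (if h = g then wcoeff x v else 0) else 0)"
    by (rule sum.delta) simp
  finally show ?thesis using Cons by simp
qed simp

lemma d_word_ZZ: "d_word (ZZ i j # w) =
    mono_nc (Z i # Z j # w) - mono_nc (Z j # Z i # w) - letter (ZZ i j) * d_word w"
  by (simp add: gbr_def mono_nc_mult left_diff_distrib)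

lemma generators_Z [simp]: "Z i \<in> generators"
  by (auto simp: generators_def)

lemma d_word_support:
  fixes u :: "'n::linorder gen list"
  shows "wcoeff (d_word u) w \<noteq> 0 \<Longrightarrow> weight w = weight u \<and> length w = Suc (length u) \<and>
    Suc (wdeg w) = wdeg u \<and> (set u \<subseteq> generators \<longrightarrow> set w \<subseteq> generators)"
proof (induction u arbitrary: w rule: d_word.induct)
  case (2 i u)
  then show ?case by (auto simp: wcoeff_letter_mult split: list.splits if_splits)
next
  case (3 i j u)
  have "w = Z i # Z j # u \<or> w = Z j # Z i # u \<or> wcoeff (letter (ZZ i j) * d_word u) w \<noteq> 0"
    using 3(2) unfolding d_word_ZZ by (auto split: if_splits)
  then show ?case using 3(1) by (auto simp: wcoeff_letter_mult split: list.splits if_splits)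
qed simp

lemma wcoeff_dd: "wcoeff (dd a) w = (\<Sum>u | weight u = weight w. wcoeff a u * wcoeff (d_word u) w)"
  by (simp add: dd_def)

lemma dd_linear: "linear dd"
  by (rule linearI) (auto simp: ncps_eq_iff wcoeff_dd algebra_simps sum.distrib sum_distrib_left)

lemmas dd_simps [simp] = linear_add[OF dd_linear] linear_diff[OF dd_linear]
  linear_scale[OF dd_linear] linear_0[OF dd_linear] linear_neg[OF dd_linear]

lemma dd_mono:
  fixes u :: "'n::{finite,linorder} gen list"
  shows "dd (mono_nc u) = d_word u"
proof (rule ncps_eqI)
  fix w
  have "wcoeff (dd (mono_nc u)) w = (\<Sum>v | weight v = weight w. if v = u then wcoeff (d_word u) w else 0)"
    unfolding wcoeff_dd by (rule sum.cong) auto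
  also have "\<dots> = (if weight u = weight w then wcoeff (d_word u) w else 0)"
    by (simp add: sum.delta[OF finite_weight])
  also have "\<dots> = wcoeff (d_word u) w" using d_word_support[of u w] by (cases "wcoeff (d_word u) w = 0") auto
  finally show "wcoeff (dd (mono_nc u)) w = wcoeff (d_word u) w" .
qed

lemma dd_lin_ext:
  fixes a :: "'n::{finite,linorder} gen ncps"
  shows "fin_supp a \<Longrightarrow> dd a = lin_ext d_word a"
  by (induction rule: fin_supp_induct) (auto simp: dd_mono)

lemma dd_wtrunc: "weight w \<le> k \<Longrightarrow> wcoeff (dd (wtrunc k a)) w = wcoeff (dd a) w"
  unfolding wcoeff_dd by (rule sum.cong) auto

lemma dd_homog: "dd (homog k a) = homog k (dd a)"
  by (auto simp: ncps_eq_iff wcoeff_dd intro!: sum.cong)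

lemma dd_ordge:
  fixes a :: "'n::{finite,linorder} gen ncps"
  shows "ordge n a \<Longrightarrow> ordge (Suc n) (dd a)"
  unfolding ordge_def wcoeff_dd
proof (intro allI impI sum.neutral ballI)
  fix w u :: "'n gen list" assume "\<forall>w. length w < n \<longrightarrow> wcoeff a w = 0" "length w < Suc n"
  then show "wcoeff a u * wcoeff (d_word u) w = 0"
    using d_word_support[of u w] by (cases "wcoeff (d_word u) w = 0") auto
qed

lemma lin_ext_linear: "linear F \<Longrightarrow> lin_ext (\<lambda>v. F (h v)) b = F (lin_ext h b)"
  by (simp add: lin_ext_def linear_sum linear_scale)

lemma lin_ext_mono_nc: "fin_supp b \<Longrightarrow> lin_ext mono_nc b = b"
  unfolding lin_ext_def using fin_supp_expand by metis

lemma lin_ext_plus: "lin_ext (\<lambda>v. f v + g v) b = lin_ext f b + lin_ext g b"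
  by (simp add: lin_ext_def scaleR_add_right sum.distrib)

lemma linear_mult_nc: "linear (\<lambda>x. a * x)" "linear (\<lambda>x. x * a)" "linear (\<lambda>x. c *\<^sub>R (a * x))"
  for a :: "'a ncps"
  by (auto intro!: linearI simp: algebra_simps)

lemma fin_supp_d_word: "fin_supp (d_word u)"
  by (induction u rule: d_word.induct) (auto simp: lin_ext_mult(1) gbr_def)

text \<open>The word case is \<open>d_word_append\<close>. It extends bilinearly to finite support
  and by weight truncation to all series.\<close>

lemma dd_mult:
  fixes a b :: "'n::{finite,linorder} gen ncps"
  assumes a: "\<And>w. wcoeff a w \<noteq> 0 \<Longrightarrow> wdeg w = p"
  shows "dd (a * b) = dd a * b + (-1) ^ p *\<^sub>R (a * dd b)"
proof -
  have fin: "dd (a * b) = dd a * b + (-1) ^ p *\<^sub>R (a * dd b)"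
    if fa: "fin_supp a" and fb: "fin_supp b" and a: "\<And>w. wcoeff a w \<noteq> 0 \<Longrightarrow> wdeg w = p" for a b :: "'n gen ncps"
  proof -
    have "lin_ext (\<lambda>v. d_word (u @ v)) b = d_word u * b + (-1) ^ wdeg u *\<^sub>R (mono_nc u * dd b)" for u
    proof -
      have "lin_ext (\<lambda>v. d_word (u @ v)) b =
          lin_ext (\<lambda>v. d_word u * mono_nc v) b + lin_ext (\<lambda>v. (-1) ^ wdeg u *\<^sub>R (mono_nc u * d_word v)) b"
        by (simp add: d_word_append lin_ext_plus)
      also have "lin_ext (\<lambda>v. d_word u * mono_nc v) b = d_word u * b"
        using lin_ext_linear[OF linear_mult_nc(1)[of "d_word u"], of mono_nc b] fb by (simp add: lin_ext_mono_nc)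
      also have "lin_ext (\<lambda>v. (-1) ^ wdeg u *\<^sub>R (mono_nc u * d_word v)) b = (-1) ^ wdeg u *\<^sub>R (mono_nc u * dd b)"
        using lin_ext_linear[OF linear_mult_nc(3)[of "(-1) ^ wdeg u" "mono_nc u"], of d_word b] fb by (simp add: dd_lin_ext)
      finally show ?thesis .
    qed
    then have "dd (a * b) = lin_ext (\<lambda>u. d_word u * b + (-1) ^ wdeg u *\<^sub>R (mono_nc u * dd b)) a"
      using fa fb by (simp add: dd_lin_ext lin_ext_mult)
    also have "\<dots> = lin_ext (\<lambda>u. d_word u * b + (-1) ^ p *\<^sub>R (mono_nc u * dd b)) a"
      by (rule lin_ext_cong) (use a in auto)
    also have "\<dots> = lin_ext (\<lambda>u. d_word u * b) a + lin_ext (\<lambda>u. (-1) ^ p *\<^sub>R (mono_nc u * dd b)) a"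
      by (rule lin_ext_plus)
    also have "lin_ext (\<lambda>u. d_word u * b) a = dd a * b"
      using lin_ext_linear[OF linear_mult_nc(2)[of b], of d_word a] fa by (simp add: dd_lin_ext)
    also have "lin_ext (\<lambda>u. (-1) ^ p *\<^sub>R (mono_nc u * dd b)) a = (-1) ^ p *\<^sub>R (a * dd b)"
    proof -
      have "linear (\<lambda>x. (-1) ^ p *\<^sub>R (x * dd b))" by (auto intro!: linearI simp: algebra_simps)
      from lin_ext_linear[OF this, of mono_nc a] fa show ?thesis by (simp add: lin_ext_mono_nc)
    qed
    finally show ?thesis .
  qed
  show ?thesis
  proof (rule ncps_eqI)
    fix w :: "'n gen list"
    let ?k = "weight w"
    let ?a = "wtrunc ?k a" and ?b = "wtrunc ?k b"
    have tr: "wcoeff (wtrunc ?k x * wtrunc ?k y) w = wcoeff (x * y) w" for x y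
      by (rule wcoeff_mult_wtrunc) simp
    have te: "wtrunc ?k (wtrunc ?k x) = wtrunc ?k x" for x
      by (simp add: ncps_eq_iff)
    have td: "wtrunc ?k (dd (wtrunc ?k x)) = wtrunc ?k (dd x)" for x
      by (simp add: ncps_eq_iff dd_wtrunc)
    have "wcoeff (dd (a * b)) w = wcoeff (dd (?a * ?b)) w"
      unfolding wcoeff_dd by (rule sum.cong) (auto simp: wcoeff_mult_wtrunc)
    also have "dd (?a * ?b) = dd ?a * ?b + (-1) ^ p *\<^sub>R (?a * dd ?b)"
      by (rule fin) (use a in \<open>auto split: if_splits\<close>)
    also have "wcoeff \<dots> w = wcoeff (dd a * b + (-1) ^ p *\<^sub>R (a * dd b)) w"
      using tr[of "dd ?a" ?b] tr[of "dd a" b] tr[of ?a "dd ?b"] tr[of a "dd b"] by (simp add: te td)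
    finally show "wcoeff (dd (a * b)) w = wcoeff (dd a * b + (-1) ^ p *\<^sub>R (a * dd b)) w" .
  qed
qed

text \<open>The degree -p part of the completed free associative algebra. Restricting the letters
  matters because the type \<open>gen\<close> also contains \<open>ZZ i j\<close> with
  \<open>j \<le> i\<close>, which are not generators.\<close>

definition deg_part :: "nat \<Rightarrow> 'n::linorder gen ncps set" where
  "deg_part p = {a. \<forall>w. wcoeff a w \<noteq> 0 \<longrightarrow> set w \<subseteq> generators \<and> wdeg w = p}"

lemma deg_partD: "a \<in> deg_part p \<Longrightarrow> wcoeff a w \<noteq> 0 \<Longrightarrow> set w \<subseteq> generators \<and> wdeg w = p"
  by (simp add: deg_part_def)

lemma deg_part_support:
  assumes "\<And>w. \<forall>a\<in>A. wcoeff a w = 0 \<Longrightarrow> wcoeff b w = 0" "A \<subseteq> deg_part p"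
  shows "b \<in> deg_part p"
  unfolding deg_part_def mem_Collect_eq
proof (intro allI impI)
  fix w assume "wcoeff b w \<noteq> 0"
  then obtain a where "a \<in> A" "wcoeff a w \<noteq> 0" using assms(1)[of w] by blast
  then show "set w \<subseteq> generators \<and> wdeg w = p" using assms(2) by (intro deg_partD) auto
qed

lemma deg_part_subspace: "subspace (deg_part p)"
proof (rule subspaceI)
  show "x + y \<in> deg_part p" if "x \<in> deg_part p" "y \<in> deg_part p" for x y
    by (rule deg_part_support[of "{x, y}"]) (use that in auto)
  show "c *\<^sub>R x \<in> deg_part p" if "x \<in> deg_part p" for x c
    by (rule deg_part_support[of "{x}"]) (use that in auto)
qed (simp add: deg_part_def)

lemma deg_part_simps [simp, intro]:
  "0 \<in> deg_part p" "a \<in> deg_part p \<Longrightarrow> b \<in> deg_part p \<Longrightarrow> a + b \<in> deg_part p"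
  "a \<in> deg_part p \<Longrightarrow> b \<in> deg_part p \<Longrightarrow> a - b \<in> deg_part p"
  "a \<in> deg_part p \<Longrightarrow> c *\<^sub>R a \<in> deg_part p" "a \<in> deg_part p \<Longrightarrow> - a \<in> deg_part p"
  using deg_part_subspace[of p] by (auto intro: subspace_0 subspace_add subspace_diff subspace_scale subspace_neg)

lemma deg_part_1 [simp, intro]: "1 \<in> deg_part 0"
  by (auto simp: deg_part_def)

lemma deg_part_mult: "a \<in> deg_part p \<Longrightarrow> b \<in> deg_part q \<Longrightarrow> a * b \<in> deg_part (p + q)"
proof -
  assume ab: "a \<in> deg_part p" "b \<in> deg_part q"
  have "set w \<subseteq> generators \<and> wdeg w = p + q" if "wcoeff (a * b) w \<noteq> 0" for w
  proof -
    from that obtain k where "wcoeff a (take k w) * wcoeff b (drop k w) \<noteq> 0"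
      unfolding wcoeff_mult by (metis (lifting) sum.neutral)
    then have "set (take k w) \<subseteq> generators \<and> wdeg (take k w) = p" "set (drop k w) \<subseteq> generators \<and> wdeg (drop k w) = q"
      using ab by (auto dest: deg_partD)
    then show ?thesis
      using wdeg_append[of "take k w" "drop k w"] set_append[of "take k w" "drop k w"] by simp
  qed
  then show ?thesis by (simp add: deg_part_def)
qed

lemma deg_part_mult0 [intro]:
  "a \<in> deg_part 0 \<Longrightarrow> b \<in> deg_part q \<Longrightarrow> a * b \<in> deg_part q"
  "a \<in> deg_part q \<Longrightarrow> b \<in> deg_part 0 \<Longrightarrow> a * b \<in> deg_part q"
  using deg_part_mult[of a 0 b q] deg_part_mult[of a q b 0] by auto

lemma deg_part_sum [intro]: "(\<And>i. i \<in> I \<Longrightarrow> f i \<in> deg_part p) \<Longrightarrow> sum f I \<in> deg_part p"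
  by (rule subspace_sum[OF deg_part_subspace])

lemma deg_part_power [intro]: "a \<in> deg_part 0 \<Longrightarrow> a ^ m \<in> deg_part 0"
  by (induction m) auto

lemma deg_part_op_series:
  assumes "raising T" "\<And>m. (T ^^ m) y \<in> deg_part p" shows "op_series c T y \<in> deg_part p"
  by (rule deg_part_support[of "{(T ^^ m) y | m. True}"])
     (use assms(2) in \<open>auto simp: op_series_coeff[OF assms(1) order_refl] intro!: sum.neutral\<close>)

lemma deg_part_ev_fps: "a \<in> deg_part 0 \<Longrightarrow> wcoeff a [] = 0 \<Longrightarrow> ev_fps f a \<in> deg_part 0"
  unfolding ev_fps_def by (rule deg_part_op_series[OF raising_mult]) (auto simp: funpow_mult_1)

lemma deg_part_exp: "a \<in> deg_part 0 \<Longrightarrow> wcoeff a [] = 0 \<Longrightarrow> nc_exp a \<in> deg_part 0"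
  and deg_part_log: "a \<in> deg_part 0 \<Longrightarrow> wcoeff a [] = 1 \<Longrightarrow> nc_log a \<in> deg_part 0"
  unfolding nc_exp_ev nc_log_ev by (auto intro!: deg_part_ev_fps)

lemma deg_part_inv: "a \<in> deg_part 0 \<Longrightarrow> wcoeff a [] = 1 \<Longrightarrow> nc_inv a \<in> deg_part 0"
  unfolding nc_inv_def by (intro deg_part_exp deg_part_simps deg_part_log) auto

lemma deg_part_act [intro]: "x \<in> deg_part 0 \<Longrightarrow> y \<in> deg_part p \<Longrightarrow> act x y \<in> deg_part p"
  by (auto simp: act_eq)

lemma deg_part_nint:
  assumes "\<And>t. t \<in> {a..b} \<Longrightarrow> f t \<in> deg_part p" shows "nint a b f \<in> deg_part p"
proof (rule deg_part_support[of "f ` {a..b}"])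
  fix w assume *: "\<forall>x\<in>f ` {a..b}. wcoeff x w = 0"
  have "integral {a..b} (\<lambda>t. wcoeff (f t) w) = integral {a..b} (\<lambda>t. 0)"
    by (rule Henstock_Kurzweil_Integration.integral_cong) (use * in auto)
  then show "wcoeff (nint a b f) w = 0" by (simp add: wcoeff_nint)
qed (use assms in auto)

lemma deg_part_dd: "a \<in> deg_part (Suc p) \<Longrightarrow> dd a \<in> deg_part p" for a :: "'n::{finite,linorder} gen ncps"
proof -
  assume a: "a \<in> deg_part (Suc p)"
  have "set w \<subseteq> generators \<and> wdeg w = p" if w: "wcoeff (dd a) w \<noteq> 0" for w
  proof -
    obtain u where "wcoeff a u * wcoeff (d_word u) w \<noteq> 0"
      using w unfolding wcoeff_dd by (metis (lifting) sum.neutral)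
    then show ?thesis using d_word_support[of u w] deg_partD[OF a, of u] by auto
  qed
  then show ?thesis by (simp add: deg_part_def)
qed

lemma dd_deg0: "a \<in> deg_part 0 \<Longrightarrow> dd a = 0" for a :: "'n::{finite,linorder} gen ncps"
proof (rule ncps_eqI)
  fix w assume a: "a \<in> deg_part 0"
  show "wcoeff (dd a) w = wcoeff 0 w"
    unfolding wcoeff_dd wcoeff_simps
  proof (intro sum.neutral ballI)
    fix u
    show "wcoeff a u * wcoeff (d_word u) w = 0"
      using deg_partD[OF a, of u] d_word_support[of u w] by (cases "wcoeff a u = 0") auto
  qed
qed

lemma dd_mult_deg: "a \<in> deg_part p \<Longrightarrow> dd (a * b) = dd a * b + (-1) ^ p *\<^sub>R (a * dd b)"
  for a :: "'n::{finite,linorder} gen ncps"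
  by (rule dd_mult) (auto dest: deg_partD)

lemma dd_mult_0: "a \<in> deg_part 0 \<Longrightarrow> dd (a * b) = a * dd b"
  and dd_mult_1: "a \<in> deg_part 1 \<Longrightarrow> dd (a * b) = dd a * b - a * dd b"
  for a :: "'n::{finite,linorder} gen ncps"
  using dd_mult_deg[of a 0 b] dd_mult_deg[of a 1 b] by (auto simp: dd_deg0)

text \<open>On a word starting with \<open>ZZ i j\<close> the two terms [Z_i, Z_j] d w cancel by the
  sign in the Leibniz rule. Linearity covers finite support, and weight components give the general
  case.\<close>

lemma dd_dd: "dd (dd a) = 0" for a :: "'n::{finite,linorder} gen ncps"
proof -
  have l: "dd (letter (ZZ i j) :: 'n gen ncps) = act (letter (Z i)) (letter (Z j))" for i j
    using dd_mono[of "[ZZ i j]"] by (simp add: gbr_def act_eq mono_nc_Nil)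
  have z: "letter (Z i) \<in> (deg_part 0 :: 'n gen ncps set)" for i
    by (auto simp: deg_part_def)
  have w: "dd (d_word u) = 0" for u :: "'n gen list"
  proof (induction u rule: d_word.induct)
    case (2 i w)
    then show ?case using z by (simp add: dd_mult_0)
  next
    case (3 i j w)
    have "dd (letter (ZZ i j) * d_word w) = act (letter (Z i)) (letter (Z j)) * d_word w - letter (ZZ i j) * dd (d_word w)"
      using dd_mult[of "letter (ZZ i j)" 1 "d_word w"] by (auto simp: l split: if_splits)
    moreover have "gbr 0 0 (letter (Z i)) (letter (Z j)) = act (letter (Z i)) (letter (Z j) :: 'n gen ncps)"
      by (simp add: gbr_def act_eq)
    moreover have "act (letter (Z i)) (letter (Z j)) \<in> (deg_part 0 :: 'n gen ncps set)"
      using z by auto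
    ultimately show ?case using 3 by (simp add: dd_mult_0 dd_mono)
  qed simp
  have f: "dd (dd a) = 0" if "fin_supp a" for a :: "'n gen ncps"
    using that by (induction rule: fin_supp_induct) (auto simp: dd_mono w)
  show ?thesis
  proof (rule ncps_eq_homog)
    fix k show "homog k (dd (dd a)) = homog k 0"
      using f[OF fin_supp_homog[of k a]] by (simp add: dd_homog)
  qed
qed

section \<open>Completed Lie series\<close>

lemma fLie_simps:
  "a \<in> fLie p \<Longrightarrow> b \<in> fLie q \<Longrightarrow> gbr p q a b \<in> fLie (p + q)"
  "g \<in> generators \<Longrightarrow> gdeg g = p \<Longrightarrow> letter g \<in> fLie p"
  by (auto simp: fLie_def intro: fLie_pairs.intros)

lemma fLie_deg_part: "a \<in> fLie p \<Longrightarrow> a \<in> deg_part p \<and> wcoeff a [] = 0"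
proof -
  have "(p, a) \<in> fLie_pairs \<Longrightarrow> a \<in> deg_part p \<and> wcoeff a [] = 0"
  proof (induction p a rule: fLie_pairs.induct)
    case (fLie_br p a q b)
    then have "a * b \<in> deg_part (p + q)" "b * a \<in> deg_part (p + q)"
      using deg_part_mult[of a p b q] deg_part_mult[of b q a p] by (auto simp: add.commute)
    then show ?case using fLie_br by (auto simp: gbr_def)
  next
    case (fLie_gen g)
    then show ?case by (auto simp: deg_part_def)
  qed auto
  then show "a \<in> fLie p \<Longrightarrow> a \<in> deg_part p \<and> wcoeff a [] = 0" by (simp add: fLie_def)
qed

lemma fLie_homog: "a \<in> fLie p \<Longrightarrow> homog k a \<in> fLie p"
proof -
  have "(p, a) \<in> fLie_pairs \<Longrightarrow> \<forall>k. homog k a \<in> fLie p"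
  proof (induction p a rule: fLie_pairs.induct)
    case (fLie_gen g)
    have "homog k (letter g) = (if gweight g = k then letter g else 0)" for k
      by (auto simp: ncps_eq_iff)
    then show ?case using fLie_gen by (auto intro: fLie_simps subspace_0[OF fLie_subspace])
  next
    case (fLie_br p a q b)
    then show ?case unfolding homog_gbr by (auto intro!: subspace_sum[OF fLie_subspace] fLie_simps)
  qed (auto intro: subspace_0[OF fLie_subspace] subspace_add[OF fLie_subspace] subspace_scale[OF fLie_subspace])
  then show "a \<in> fLie p \<Longrightarrow> homog k a \<in> fLie p" by (simp add: fLie_def)
qed

lemma fLie_dd: "a \<in> fLie (Suc p) \<Longrightarrow> dd a \<in> fLie p" for a :: "'n::{finite,linorder} gen ncps"
proof -
  have "(p, a) \<in> fLie_pairs \<Longrightarrow> p > 0 \<longrightarrow> dd a \<in> fLie (p - 1)" for p and a :: "'n gen ncps"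
  proof (induction p a rule: fLie_pairs.induct)
    case (fLie_gen g)
    show ?case
    proof (cases g)
      case (ZZ i j)
      have "dd (letter (ZZ i j)) = gbr 0 0 (letter (Z i)) (letter (Z j))"
        using dd_mono[of "[ZZ i j]"] by (simp add: mono_nc_Nil)
      moreover have "letter (Z i) \<in> fLie 0" for i :: 'n
        by (rule fLie_simps(2)) auto
      ultimately show ?thesis using fLie_simps(1)[of "letter (Z i)" 0 "letter (Z j)" 0] ZZ by simp
    qed simp
  next
    case (fLie_br p a q b)
    have ab: "a \<in> fLie p" "b \<in> fLie q" using fLie_br by (auto simp: fLie_def)
    then have d: "a \<in> deg_part p" "b \<in> deg_part q" using fLie_deg_part by auto
    \<comment> \<open>The Leibniz rule for the bracket, with exponents that remain meaningful for p
      = 0 or q = 0, where \<open>dd a\<close> or \<open>dd b\<close> vanishes. For p > 0 the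
      exponent p q + q has the parity of (p - 1) q, the sign of a bracket with
      \<open>dd a\<close>.\<close>
    have e: "dd (gbr p q a b) = (dd a * b - (-1) ^ (p * q + q) *\<^sub>R (b * dd a)) +
        (-1) ^ p *\<^sub>R (a * dd b - (-1) ^ (p * q + p) *\<^sub>R (dd b * a))"
      using d by (simp add: gbr_def dd_mult_deg algebra_simps power_add sign_sq)
    have A: "dd a * b - (-1) ^ (p * q + q) *\<^sub>R (b * dd a) \<in> fLie (p + q - 1)"
    proof (cases "p = 0")
      case True
      then show ?thesis using d dd_deg0[of a] by (simp add: subspace_0[OF fLie_subspace])
    next
      case False
      then obtain p' where p': "p = Suc p'" by (cases p) auto
      have "(-1) ^ (p * q + q) = ((-1) ^ (p' * q) :: real)"
        by (simp add: p' power_add algebra_simps sign_sq)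
      moreover have "gbr p' q (dd a) b \<in> fLie (p' + q)" using fLie_br.IH(1) p' ab by (auto intro: fLie_simps)
      ultimately show ?thesis by (simp add: gbr_def p')
    qed
    have B: "a * dd b - (-1) ^ (p * q + p) *\<^sub>R (dd b * a) \<in> fLie (p + q - 1)"
    proof (cases "q = 0")
      case True
      then show ?thesis using d dd_deg0[of b] by (simp add: subspace_0[OF fLie_subspace])
    next
      case False
      then obtain q' where q': "q = Suc q'" by (cases q) auto
      have "(-1) ^ (p * q + p) = ((-1) ^ (p * q') :: real)"
        by (simp add: q' power_add algebra_simps sign_sq)
      moreover have "gbr p q' a (dd b) \<in> fLie (p + q')" using fLie_br.IH(2) q' ab by (auto intro: fLie_simps)
      ultimately show ?thesis by (simp add: gbr_def q')
    qed
    show ?case unfolding e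
      using A B by (auto intro: subspace_add[OF fLie_subspace] subspace_scale[OF fLie_subspace])
  qed (auto intro: subspace_0[OF fLie_subspace] subspace_add[OF fLie_subspace] subspace_scale[OF fLie_subspace])
  then show "a \<in> fLie (Suc p) \<Longrightarrow> dd a \<in> fLie p" by (force simp: fLie_def)
qed

abbreviation fbar :: "nat \<Rightarrow> 'n::{finite,linorder} gen ncps set" where
  "fbar p \<equiv> wcompletion (fLie p)"

lemmas fbar_subspace = wcompletion_subspace[OF fLie_subspace]

lemma fbar_fLie: "a \<in> fLie p \<Longrightarrow> a \<in> fbar p"
  by (simp add: wcompletion_def fLie_homog)

lemma fbar_deg_part: "a \<in> fbar p \<Longrightarrow> a \<in> deg_part p"
  unfolding deg_part_def mem_Collect_eq
proof (intro allI impI)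
  fix w assume "a \<in> fbar p" "wcoeff a w \<noteq> 0"
  then show "set w \<subseteq> generators \<and> wdeg w = p"
    using fLie_deg_part[of "homog (weight w) a" p] deg_partD[of "homog (weight w) a" p w]
    by (simp add: wcompletion_def)
qed

lemma fbar_Nil: "a \<in> fbar p \<Longrightarrow> wcoeff a [] = 0"
  using fLie_deg_part[of "homog 0 a" p] by (simp add: wcompletion_def)

lemma fbar_gbr: "a \<in> fbar p \<Longrightarrow> b \<in> fbar q \<Longrightarrow> gbr p q a b \<in> fbar (p + q)"
  by (auto simp: wcompletion_def homog_gbr intro!: subspace_sum[OF fLie_subspace] fLie_simps)

lemma fbar_act: "x \<in> fbar 0 \<Longrightarrow> y \<in> fbar p \<Longrightarrow> act x y \<in> fbar p"
  using fbar_gbr[of x 0 y p] by (simp add: act_def gbr_def)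

lemma fbar_dd: "a \<in> fbar (Suc p) \<Longrightarrow> dd a \<in> fbar p"
  by (simp add: wcompletion_def dd_homog[symmetric] fLie_dd)

lemma fbar_op_series:
  assumes "x \<in> fbar 0" "y \<in> fbar p" shows "op_series c (act x) y \<in> fbar p"
proof -
  have "(act x ^^ m) y \<in> fbar p" for m
    using assms by (induction m) (auto intro: fbar_act)
  then show ?thesis
    unfolding wcompletion_def mem_Collect_eq homog_op_series[OF raising_act[OF fbar_Nil[OF assms(1)]]]
    by (intro allI subspace_sum[OF fLie_subspace] subspace_scale[OF fLie_subspace]) blast
qed

section \<open>Logarithms of transports are Lie series\<close>

lemma fbar_lets: "lets v \<in> fbar 0"
  unfolding lets_def
  by (intro subspace_sum[OF fbar_subspace] subspace_scale[OF fbar_subspace] fbar_fLie fLie_simps) auto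

text \<open>As \<open>B\<close> has no constant term, each commutator pairs a component of
  \<open>L\<close> with one of positive weight. Weight k therefore involves only components of
  \<open>L\<close> below k.\<close>

lemma homog_act_series_cong:
  assumes L: "wcoeff L [] = 0" "wcoeff L' [] = 0" "\<And>i. i < k \<Longrightarrow> homog i L = homog i L'" and B: "wcoeff B [] = 0"
  shows "homog k (op_series c (act L) B) = homog k (op_series c (act L') B)"
proof -
  have N: "wcoeff ((act L ^^ m) B) [] = 0" "wcoeff ((act L' ^^ m) B) [] = 0" for m
    using B by (induction m) (auto simp: act_eq)
  have h0: "homog 0 u = 0" if "wcoeff u [] = 0" for u :: "'a gen ncps"
    using that by (auto simp: ncps_eq_iff)
  have "\<forall>j\<le>k. homog j ((act L ^^ m) B) = homog j ((act L' ^^ m) B)" for m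
  proof (induction m)
    case (Suc m)
    let ?u = "(act L ^^ m) B" and ?u' = "(act L' ^^ m) B"
    show ?case
    proof (intro allI impI)
      fix j assume j: "j \<le> k"
      have t: "homog i L * homog (j - i) ?u = homog i L' * homog (j - i) ?u'"
        "homog (j - i) ?u * homog i L = homog (j - i) ?u' * homog i L'" if i: "i \<le> j" for i
      proof -
        have u: "homog (j - i) ?u = homog (j - i) ?u'" using Suc j by auto
        show "homog i L * homog (j - i) ?u = homog i L' * homog (j - i) ?u'"
          "homog (j - i) ?u * homog i L = homog (j - i) ?u' * homog i L'"
          using u L(3)[of i] h0[OF N(1)[of m]] h0[OF N(2)[of m]] i j by (cases "i < k"; auto)+
      qed
      show "homog j ((act L ^^ Suc m) B) = homog j ((act L' ^^ Suc m) B)"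
        using t by (simp add: act_eq homog_mult[of j L] homog_mult[of j L'] homog_mult'[of j _ L] homog_mult'[of j _ L'])
    qed
  qed simp
  then show ?thesis
    by (simp add: homog_op_series raising_act L)
qed

text \<open>Induction on the weight: component k of the right-hand side involves only lower
  components of L, which are Lie already. So this component of L has its derivative in the Lie
  polynomials and stays there by \<open>homog_derivative\<close>.\<close>

lemma fbar_log_ode:
  assumes F: "finite F" and L: "ncc {a..b} L" "\<And>t. t \<in> {a..b} \<Longrightarrow> wcoeff (L t) [] = 0"
    and ode: "\<And>t. t \<in> {a..b} - F \<Longrightarrow> ncd L (toddad (L t) (B t)) t {a..b}"
    and B: "\<And>t. t \<in> {a..b} - F \<Longrightarrow> B t \<in> fbar 0" and ini: "L a \<in> fbar 0" and x: "x \<in> {a..b}"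
  shows "L x \<in> fbar 0"
proof -
  have "\<forall>x\<in>{a..b}. homog k (L x) \<in> fLie 0" for k
  proof (induction k rule: less_induct)
    case (less k)
    show ?case
    proof
      fix x assume x: "x \<in> {a..b}"
      show "homog k (L x) \<in> fLie 0"
      proof (rule homog_derivative[OF fLie_subspace F L(1) _ _ x])
        fix t assume t: "t \<in> {a..b} - F"
        \<comment> \<open>L itself is not known to be Lie; cutting off the weights from k on gives a
          Lie element with the same component k of the right-hand side.\<close>
        define L' where "L' = (\<Sum>j<k. homog j (L t))"
        have "homog i L' = (if i < k then homog i (L t) else 0)" for i
          by (simp add: L'_def if_distrib sum.delta cong: if_cong)
        note L'h = this
        have L': "L' \<in> fbar 0"
          unfolding L'_def using less t by (intro subspace_sum[OF fbar_subspace] fbar_fLie) auto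
        have "homog k (toddad (L t) (B t)) = homog k (toddad L' (B t))"
          by (rule homog_act_series_cong) (use L(2) t fbar_Nil[OF L'] fbar_Nil[OF B[OF t]] L'h in auto)
        also have "\<dots> \<in> fLie 0"
          using fbar_op_series[OF L' B[OF t]] by (simp add: wcompletion_def)
        finally show "\<exists>f'. homog k f' \<in> fLie 0 \<and>
            (\<forall>w. ((\<lambda>s. wcoeff (L s) w) has_real_derivative wcoeff f' w) (at t within {a..b}))"
          using ode[OF t] unfolding ncd_def by blast
      qed (use ini in \<open>simp add: wcompletion_def\<close>)
    qed
  qed
  then show ?thesis using x by (simp add: wcompletion_def)
qed

text \<open>Chen's theorem. The logarithm starts at 0 and satisfies the Magnus equation with driving
  term in degree 0 and weight 1, so \<open>fbar_log_ode\<close> applies.\<close>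

lemma transport_log_Lie:
  fixes \<eta> :: "real \<Rightarrow> real ^ 'n::{finite,linorder}"
  assumes "transport \<eta> a b s" "a \<le> b"
  shows "nc_log s \<in> g0bar"
proof -
  obtain S where S: "sig_flow \<eta> a b S" "S b = s" using assms(1) by (auto simp: transport_def)
  let ?B = "\<lambda>t. lets (vector_derivative \<eta> (at t))"
  obtain F where F: "finite F" "\<And>t. t \<in> {a..b} - F \<Longrightarrow> ncd S (S t * ?B t) t {a..b}"
    using sig_flow_ode[OF S(1)] by metis
  have S1: "wcoeff (S t) [] = 1" if "t \<in> {a..b}" for t
    using sig_flow_Nil[OF S(1) that] .
  have 0: "S a = 1" "ncc {a..b} S" using S(1) by (auto simp: sig_flow_def)
  have "nc_log 1 = (0 :: 'n gen ncps)" using nc_log_exp[of 0] by simp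
  have "nc_log (S b) \<in> fbar 0"
  proof (rule fbar_log_ode[of "F \<union> {a, b}" a b "\<lambda>t. nc_log (S t)" ?B])
    fix t assume t: "t \<in> {a..b} - (F \<union> {a, b})"
    have "at t within {a..b} \<noteq> bot"
      using t by (subst at_within_interior) auto
    then show "ncd (\<lambda>t. nc_log (S t)) (toddad (nc_log (S t)) (?B t)) t {a..b}"
      using log_derivative[of S t "?B t" "{a..b}"] F(2)[of t] t S1 by auto
  next
    show "ncc {a..b} (\<lambda>t. nc_log (S t))" using 0 S1 by (intro ncc_log) auto
    show "nc_log (S a) \<in> fbar 0" using 0 \<open>nc_log 1 = 0\<close> by (simp add: subspace_0[OF fbar_subspace])
  qed (use F assms(2) S1 in \<open>auto intro: fbar_lets\<close>)
  then show ?thesis using S(2) by (simp add: g0bar_def)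
qed


section \<open>The associative algebra of the crossed module\<close>

text \<open>Modulo \<open>boundaries\<close>, the part of degree \<open>-1\<close> of the free associative dg algebra is an
  associative algebra under \<open>x * y = dx y = x dy\<close>, and its commutator is the derived bracket.\<close>

definition boundaries :: "'n::{finite,linorder} gen ncps set" where
  "boundaries = dd ` deg_part 2"

lemma boundaries_subspace: "subspace boundaries"
  unfolding boundaries_def by (intro linear_subspace_image dd_linear deg_part_subspace)

lemmas boundaries_simps [simp, intro] = subspace_0[OF boundaries_subspace] subspace_add[OF boundaries_subspace]
  subspace_diff[OF boundaries_subspace] subspace_scale[OF boundaries_subspace] subspace_neg[OF boundaries_subspace]
  subspace_sum[OF boundaries_subspace]

lemma dd_boundaries: "a \<in> boundaries \<Longrightarrow> dd a = 0"
  by (auto simp: boundaries_def dd_dd)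

lemma boundaries_mult [intro]:
  "x \<in> deg_part 0 \<Longrightarrow> a \<in> boundaries \<Longrightarrow> x * a \<in> boundaries"
  "x \<in> deg_part 0 \<Longrightarrow> a \<in> boundaries \<Longrightarrow> a * x \<in> boundaries"
proof -
  assume x: "x \<in> deg_part 0" and "a \<in> boundaries"
  then obtain c where c: "c \<in> deg_part 2" "a = dd c" by (auto simp: boundaries_def)
  have "x * a = dd (x * c)" "a * x = dd (c * x)"
    using dd_mult_0[OF x, of c] dd_mult_deg[OF c(1), of x] dd_deg0[OF x] c(2) by auto
  moreover have "x * c \<in> deg_part 2" "c * x \<in> deg_part 2" using x c by auto
  ultimately show "x * a \<in> boundaries" "a * x \<in> boundaries" by (auto simp: boundaries_def)
qed

text \<open>The expression is d(x y); this is the Peiffer relation, and it makes the two candidates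
  for the product agree.\<close>

lemma boundaries_peiffer: "x \<in> deg_part 1 \<Longrightarrow> y \<in> deg_part 1 \<Longrightarrow> dd x * y - x * dd y \<in> boundaries"
  using deg_part_mult[of x 1 y 1] dd_mult_1[of x y] unfolding boundaries_def
  by (metis image_eqI one_add_one)

text \<open>\<open>dd\<close> preserves the weight, so primitives chosen separately in the different
  weights can be assembled into one series.\<close>

lemma boundaries_homog_iff: "a \<in> boundaries \<longleftrightarrow> (\<forall>k. homog k a \<in> boundaries)"
proof
  have h: "homog k c \<in> deg_part p" if "c \<in> deg_part p" for k p and c :: "'a gen ncps"
    using that by (auto simp: deg_part_def)
  assume "a \<in> boundaries"
  then obtain c where "c \<in> deg_part 2" "a = dd c" by (auto simp: boundaries_def)
  then show "\<forall>k. homog k a \<in> boundaries"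
    using h by (auto simp: boundaries_def dd_homog[symmetric])
next
  assume "\<forall>k. homog k a \<in> boundaries"
  then have "\<forall>k. \<exists>c. c \<in> deg_part 2 \<and> homog k a = dd c" by (auto simp: boundaries_def)
  then obtain c where c: "\<And>k. c k \<in> deg_part 2" "\<And>k. homog k a = dd (c k)" by metis
  define C where "C = Ncps (\<lambda>w. wcoeff (c (weight w)) w)"
  have "C \<in> deg_part 2" using c(1) by (auto simp: deg_part_def C_def)
  moreover have "dd C = a"
  proof (rule ncps_eq_homog)
    fix k
    have "homog k C = homog k (c k)" by (auto simp: ncps_eq_iff C_def)
    then have "homog k (dd C) = homog k (dd (c k))" by (metis dd_homog)
    also have "\<dots> = homog k a" by (simp add: c(2)[symmetric])
    finally show "homog k (dd C) = homog k a" .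
  qed
  ultimately show "a \<in> boundaries" by (auto simp: boundaries_def)
qed

text \<open>The series (e^z - 1)/z. For the product dx y, the power of x with m + 1 factors is
  (dx)^m x, so e^x - 1 is this series at \<open>dd x\<close> times \<open>x\<close>.\<close>

definition epsi_fps :: "real fps" where
  "epsi_fps = Abs_fps (\<lambda>m. 1 / fact (Suc m))"

lemma epsi_fps: "epsi_fps * fps_X = fps_exp 1 - 1"
proof (rule fps_ext)
  fix n show "fps_nth (epsi_fps * fps_X) n = fps_nth (fps_exp 1 - 1) n"
    by (cases n) (auto simp: epsi_fps_def mult.commute[of _ fps_X] simp del: fact_Suc)
qed

lemma ev_epsi: "wcoeff a [] = 0 \<Longrightarrow> ev_fps epsi_fps a * a = nc_exp a - 1"
  using ev_fps_mult[of a epsi_fps fps_X] by (simp add: ev_fps_X epsi_fps ev_fps_diff nc_exp_ev)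

text \<open>The exponential minus one in this algebra.\<close>

definition expN :: "'n::{finite,linorder} gen ncps \<Rightarrow> 'n gen ncps" where
  "expN x = ev_fps epsi_fps (dd x) * x"

lemma dd_Nil [simp]: "wcoeff (dd x) [] = 0" for x :: "'n::{finite,linorder} gen ncps"
  using dd_ordge[of 0 x] by (simp add: ordge_1_iff)

lemma deg_part_1_Nil: "x \<in> deg_part (Suc p) \<Longrightarrow> wcoeff x [] = 0"
  by (auto simp: deg_part_def)

lemma dd_deg_part1: "x \<in> deg_part 1 \<Longrightarrow> dd x \<in> deg_part 0" for x :: "'n::{finite,linorder} gen ncps"
  using deg_part_dd[of x 0] by simp

lemma dd_expN: "x \<in> deg_part 1 \<Longrightarrow> dd (expN x) = nc_exp (dd x) - 1"
  unfolding expN_def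
  by (subst dd_mult_0) (auto intro!: deg_part_ev_fps dd_deg_part1 simp: ev_epsi)

lemma expN_cong:
  assumes "x \<in> deg_part 1" "x - x' \<in> boundaries"
  shows "expN x - expN x' \<in> boundaries"
proof -
  have "dd x' = dd x" using dd_boundaries[OF assms(2)] by simp
  then have e: "expN x - expN x' = ev_fps epsi_fps (dd x) * (x - x')"
    by (simp add: expN_def right_diff_distrib)
  show ?thesis unfolding e
    by (intro boundaries_mult(1) deg_part_ev_fps dd_deg_part1 assms dd_Nil)
qed

text \<open>Applying \<open>dd\<close> shows that nc_exp has the same value at \<open>dd x\<close>
  and \<open>dd x'\<close>, so these agree by taking logarithms. The difference of the images is
  then an invertible degree 0 factor times x - x'.\<close>

lemma expN_inj:
  assumes x: "x \<in> deg_part 1" "x' \<in> deg_part 1" and e: "expN x - expN x' \<in> boundaries"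
  shows "x - x' \<in> boundaries"
proof -
  have "nc_exp (dd x) = nc_exp (dd x')" using dd_boundaries[OF e] x by (simp add: dd_expN)
  then have d: "dd x' = dd x" by (metis nc_log_exp dd_Nil)
  have "ev_fps (inverse epsi_fps) (dd x) * (expN x - expN x') =
      (ev_fps (inverse epsi_fps) (dd x) * ev_fps epsi_fps (dd x)) * (x - x')"
    by (simp add: expN_def d algebra_simps)
  also have "ev_fps (inverse epsi_fps) (dd x) * ev_fps epsi_fps (dd x) = 1"
    by (simp add: ev_fps_mult[symmetric] inverse_mult_eq_1 epsi_fps_def)
  finally have e': "x - x' = ev_fps (inverse epsi_fps) (dd x) * (expN x - expN x')" by simp
  show ?thesis unfolding e'
    by (intro boundaries_mult(1) deg_part_ev_fps dd_deg_part1 x e dd_Nil)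
qed

lemma power_deriv_ordge:
  assumes "wcoeff x [] = 0" "ordge n y" shows "ordge (m + n) (power_deriv x (Suc m) y)"
  unfolding power_deriv_def
proof (rule ordge_sum)
  fix i assume "i \<in> {..<Suc m}"
  then have "(Suc m - 1 - i) + n + i = m + n" by auto
  then show "ordge (m + n) (x ^ (Suc m - 1 - i) * y * x ^ i)"
    using ordge_mult[OF ordge_mult[OF ordge_power[OF assms(1), of "Suc m - 1 - i"] assms(2)] ordge_power[OF assms(1), of i]]
    by simp
qed

text \<open>The derivative of (dx)^m x in direction y has one summand per factor. The Peiffer
  relation moves d off the varied factor y to everything on its right, so that y itself stands in
  each place.\<close>

lemma power_deriv_boundaries:
  assumes y: "y \<in> deg_part 1" and x: "x \<in> deg_part 1"
  shows "power_deriv (dd x) m (dd y) * x + dd x ^ m * y - power_deriv (dd x) (Suc m) y \<in> boundaries"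
proof (induction m)
  case (Suc m)
  let ?w = "dd x"
  have w: "?w \<in> deg_part 0" by (rule dd_deg_part1[OF x])
  have e: "power_deriv ?w (Suc m) (dd y) * x + ?w ^ Suc m * y - power_deriv ?w (Suc (Suc m)) y =
      ?w * (power_deriv ?w m (dd y) * x + ?w ^ m * y - power_deriv ?w (Suc m) y) +
      (dd y * (?w ^ m * x) - y * dd (?w ^ m * x))"
    using w by (simp add: power_deriv_Suc[of ?w "Suc m"] power_deriv_Suc[of ?w m "dd y"] dd_mult_0 deg_part_power
      algebra_simps power_commutes)
  have "dd y * (?w ^ m * x) - y * dd (?w ^ m * x) \<in> boundaries"
    by (intro boundaries_peiffer y deg_part_mult0(1) deg_part_power w x)
  then show ?case unfolding e by (intro boundaries_simps(2) boundaries_mult(1) w Suc)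
qed (simp add: power_deriv_def)

text \<open>The formula of \<open>ncd_exp\<close> persists one degree lower, modulo boundaries:
  termwise it is \<open>power_deriv_boundaries\<close> divided by (m + 1)!. Passing to weight
  components leaves finitely many terms.\<close>

lemma expN_derivative:
  assumes f: "ncd f f' t S" and t: "t \<in> S" and f1: "\<And>s. s \<in> S \<Longrightarrow> f s \<in> deg_part 1" "f' \<in> deg_part 1"
  shows "\<exists>D. ncd (\<lambda>s. expN (f s)) D t S \<and>
    D - nc_exp (dd (f t)) * op_series (fps_nth phi_fps) (act (dd (f t))) f' \<in> boundaries"
proof -
  let ?x = "f t"
  let ?D = "\<lambda>m. power_deriv (dd ?x) m (dd f') * ?x + dd ?x ^ m * f'"
  let ?R = "nc_exp (dd ?x) * op_series (fps_nth phi_fps) (act (dd ?x)) f'"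
  define D where "D = Ncps (\<lambda>w. \<Sum>m\<le>length w. (1 / fact (Suc m)) * wcoeff (?D m) w)"
  have ddf: "ncd (\<lambda>s. dd (f s)) (dd f') t S"
    unfolding ncd_def wcoeff_dd
    using f by (auto simp: ncd_def intro!: DERIV_sum DERIV_cmult_right)
  have d: "ncd (\<lambda>s. dd (f s) ^ m * f s) (?D m) t S" for m
    by (rule ncd_mult[OF ncd_power[OF ddf] f])
  have e: "wcoeff (expN (f s)) w = (\<Sum>m\<le>length w. (1 / fact (Suc m)) * wcoeff (dd (f s) ^ m * f s) w)" for s w
    using op_series_left_mult[of "dd (f s)" epsi_fps "f s"] op_series_coeff[OF raising_mult[of "dd (f s)"] order_refl, of "fps_nth epsi_fps" "f s" w]
    by (simp add: expN_def funpow_mult_1 epsi_fps_def)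
  have "ncd (\<lambda>s. expN (f s)) D t S"
    unfolding ncd_def e D_def wcoeff_Ncps
    by (intro allI DERIV_sum DERIV_cmult d[unfolded ncd_def, rule_format])
  moreover have "D - ?R \<in> boundaries"
    unfolding boundaries_homog_iff[of "D - ?R"]
  proof
    fix k
    let ?P = "\<lambda>m. power_deriv (dd ?x) (Suc m) f'"
    have ord: "ordge m (?D m)" "ordge m (?P m)" for m
    proof -
      show "ordge m (?P m)" using power_deriv_ordge[of "dd ?x" 0 f' m] by simp
      have "ordge m (power_deriv (dd ?x) m (dd f'))"
      proof (cases m)
        case (Suc m')
        then show ?thesis using power_deriv_ordge[of "dd ?x" 1 "dd f'" m'] dd_ordge[of 0 f'] by simp
      qed simp
      then show "ordge m (?D m)"
        using ordge_power[of "dd ?x" m] by (intro ordge_simps ordge_mult_right) auto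
    qed
    have "homog k (D - ?R) = homog k (\<Sum>m\<le>k. (1 / fact (Suc m)) *\<^sub>R (?D m - ?P m))"
    proof (rule ncps_eqI)
      fix w
      show "wcoeff (homog k (D - ?R)) w = wcoeff (homog k (\<Sum>m\<le>k. (1 / fact (Suc m)) *\<^sub>R (?D m - ?P m))) w"
      proof (cases "weight w = k")
        case True
        have R: "wcoeff ?R w = (\<Sum>m\<le>length w. (1 / fact (Suc m)) * wcoeff (?P m) w)"
          unfolding exp_deriv_series[OF dd_Nil]
          by (subst sum.atMost_Suc_shift) (simp add: power_deriv_def del: fact_Suc)
        have "wcoeff (D - ?R) w = (\<Sum>m\<le>length w. (1 / fact (Suc m)) * wcoeff (?D m - ?P m) w)"
          by (simp add: R D_def sum_subtractf algebra_simps del: fact_Suc)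
        also have "\<dots> = (\<Sum>m\<le>k. (1 / fact (Suc m)) * wcoeff (?D m - ?P m) w)"
          by (rule sum.mono_neutral_left) (use True length_le_weight[of w] ord in \<open>auto simp: ordge_def simp del: fact_Suc\<close>)
        finally show ?thesis using True by (simp add: wcoeff_sum del: fact_Suc)
      next
        case False
        then show ?thesis by (simp only: wcoeff_homog if_False)
      qed
    qed
    also have "\<dots> \<in> boundaries"
      by (intro boundaries_homog_iff[THEN iffD1, rule_format] boundaries_simps(4,6)
          power_deriv_boundaries[OF f1(2) f1(1)[OF t]])
    finally show "homog k (D - ?R) \<in> boundaries" .
  qed
  ultimately show ?thesis by blast
qed

section \<open>The Dynkin operator\<close>

lemma graded_lie_UNIV: "graded_lie (\<lambda>_. UNIV :: 'n::linorder gen ncps set) gbr"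
proof
  fix p q r :: nat and x y z :: "'n gen ncps"
  show "gbr p q x y = (-1) ^ (p * q + 1) *\<^sub>R gbr q p y x"
    by (simp add: gbr_def algebra_simps sign_sq)
  show "gbr p (q + r) x (gbr q r y z) =
        gbr (p + q) r (gbr p q x y) z + (-1) ^ (p * q) *\<^sub>R gbr q (p + r) y (gbr p r x z)"
    by (simp add: gbr_def algebra_simps sign_sq power_add)
qed (auto simp: gbr_bilinear)

text \<open>With the letters sent to themselves in the associative algebra, \<open>phi\<close> is
  the Dynkin operator, nested commutators divided by length. Being compatible with brackets of Lie
  polynomials, it fixes them (Dynkin-Specht-Wever).\<close>

interpretation dyn: lie_extension "\<lambda>_. UNIV :: 'n::linorder gen ncps set" gbr letter
  by (intro lie_extension.intro graded_lie_UNIV lie_extension_axioms.intro) simp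

lemma dyn_phi_len: "(p, k, a) \<in> fLie_len \<Longrightarrow> dyn.phi a = a"
proof (induction p k a rule: fLie_len.induct)
  case (2 p k a q l b)
  then show ?case using dyn.phi_key(2)[of p k a q l b] by simp
qed (simp add: dyn.phi_def)

lemma dyn_phi: "a \<in> fLie p \<Longrightarrow> dyn.phi a = a"
proof -
  assume "a \<in> fLie p"
  then have "a \<in> span {b. \<exists>k. (p, k, b) \<in> fLie_len}" by (simp add: fLie_def fLie_pairs_span)
  then have "fin_supp a \<and> dyn.phi a = a"
  proof (rule span_induct)
    show "subspace {a. fin_supp a \<and> dyn.phi a = a}" by (auto simp: subspace_def)
    fix x assume "x \<in> {b. \<exists>k. (p, k, b) \<in> fLie_len}"
    then obtain k where "(p, k, x) \<in> fLie_len" by auto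
    then show "fin_supp x \<and> dyn.phi x = x"
      using dyn_phi_len fLie_len_bihom[of p k x] by (simp add: bihom_def)
  qed
  then show ?thesis by blast
qed

text \<open>The variant in which the innermost letter is multiplied by its weight is the convolution of the
  antipode with the weight derivation.  Both commute with \<open>d\<close>, which changes the word length but not
  the weight, and on Lie elements it is multiplication by the weight.\<close>

fun wnest :: "'n gen list \<Rightarrow> 'n gen ncps" where
  "wnest [] = 0"
| "wnest [g] = real (gweight g) *\<^sub>R letter g"
| "wnest (g # w) = gbr (gdeg g) (wdeg w) (letter g) (wnest w)"

lemma wnest_Cons: "w \<noteq> [] \<Longrightarrow> wnest (g # w) = gbr (gdeg g) (wdeg w) (letter g) (wnest w)"
  by (cases w) auto

lemma wnest_append: "v \<noteq> [] \<Longrightarrow> wnest (u @ v) = dyn.wact u (wdeg v) (wnest v)"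
  by (induction u) (auto simp: wnest_Cons wdeg_append)

definition wscale :: "'n gen ncps \<Rightarrow> 'n gen ncps" where
  "wscale a = Ncps (\<lambda>w. real (weight w) * wcoeff a w)"

lemma wcoeff_wscale [simp]: "wcoeff (wscale a) w = real (weight w) * wcoeff a w"
  by (simp add: wscale_def)

lemma wscale_mult: "wscale (a * b) = wscale a * b + a * wscale b"
proof (rule ncps_eqI)
  fix w :: "'a gen list"
  have "real (weight w) = real (weight (take k w)) + real (weight (drop k w))" for k
    using weight_take_drop[of k w] by (metis of_nat_add)
  note e = this
  show "wcoeff (wscale (a * b)) w = wcoeff (wscale a * b + a * wscale b) w"
    unfolding wcoeff_simps wcoeff_wscale wcoeff_mult sum_distrib_left sum.distrib[symmetric]
  proof (rule sum.cong[OF refl])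
    fix k
    show "real (weight w) * (wcoeff a (take k w) * wcoeff b (drop k w)) =
      real (weight (take k w)) * wcoeff a (take k w) * wcoeff b (drop k w) +
      wcoeff a (take k w) * (real (weight (drop k w)) * wcoeff b (drop k w))"
      unfolding e[of k] by (simp add: algebra_simps)
  qed
qed

lemma wscale_simps: "wscale (a + b) = wscale a + wscale b" "wscale (a - b) = wscale a - wscale b"
  "wscale (c *\<^sub>R a) = c *\<^sub>R wscale a" "wscale 0 = 0"
  by (auto simp: ncps_eq_iff algebra_simps)

lemma wnest_mult:
  assumes "fin_supp a" "bihom q l b" "l > 0"
  shows "lin_ext wnest (a * b) = dyn.Act a q (lin_ext wnest b)"
proof -
  have "lin_ext (\<lambda>v. wnest (u @ v)) b = dyn.wact u q (lin_ext wnest b)" for u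
  proof -
    have "lin_ext (\<lambda>v. wnest (u @ v)) b = lin_ext (\<lambda>v. dyn.wact u q (wnest v)) b"
      using assms by (intro lin_ext_cong) (auto simp: bihom_def wnest_append)
    also have "\<dots> = dyn.wact u q (lin_ext wnest b)"
      by (rule dyn.wact_lin_ext[symmetric]) auto
    finally show ?thesis .
  qed
  then show ?thesis
    using assms by (simp add: lin_ext_mult(2) dyn.Act_def bihom_def)
qed

text \<open>On a bracket the operator yields [a, wscale b] minus the signed [b, wscale a], which is
  the derivation \<open>wscale\<close> applied to [a, b].\<close>

lemma wnest_fLie_len: "(p, k, a) \<in> fLie_len \<Longrightarrow> lin_ext wnest a = wscale a"
proof (induction p k a rule: fLie_len.induct)
  case (1 g)
  then show ?case by (auto simp: ncps_eq_iff)
next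
  case (2 p k a q l b)
  note ha = fLie_len_bihom[OF 2(1)] and hb = fLie_len_bihom[OF 2(2)]
  have fin: "fin_supp a" "fin_supp b" using ha hb by (auto simp: bihom_def)
  have Act: "dyn.Act a q m = gbr p q a m" "dyn.Act b p m = gbr q p b m" for m
    using dyn.phi_key(1)[OF 2(1)] dyn.phi_key(1)[OF 2(2)] dyn_phi_len[OF 2(1)] dyn_phi_len[OF 2(2)] by auto
  have "lin_ext wnest (gbr p q a b) = lin_ext wnest (a * b) - (-1) ^ (p * q) *\<^sub>R lin_ext wnest (b * a)"
    unfolding gbr_def using fin by (simp add: lin_ext_diff lin_ext_mult(1))
  also have "\<dots> = gbr p q a (wscale b) - (-1) ^ (p * q) *\<^sub>R gbr q p b (wscale a)"
    using wnest_mult[OF fin(1), of q l b] wnest_mult[OF fin(2), of p k a] ha hb 2 Act by simp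
  also have "\<dots> = wscale (gbr p q a b)"
    by (simp add: gbr_def wscale_simps wscale_mult algebra_simps sign_sq)
  finally show ?case .
qed

lemma wnest_fLie: "a \<in> fLie p \<Longrightarrow> lin_ext wnest a = wscale a"
proof -
  assume "a \<in> fLie p"
  then have "a \<in> span {b. \<exists>k. (p, k, b) \<in> fLie_len}" by (simp add: fLie_def fLie_pairs_span)
  then have "fin_supp a \<and> lin_ext wnest a = wscale a"
  proof (rule span_induct)
    show "subspace {a. fin_supp a \<and> lin_ext wnest a = wscale a}"
      by (auto simp: subspace_def wscale_simps)
    fix x assume "x \<in> {b. \<exists>k. (p, k, b) \<in> fLie_len}"
    then obtain k where "(p, k, x) \<in> fLie_len" by auto
    then show "fin_supp x \<and> lin_ext wnest x = wscale x"
      using wnest_fLie_len fLie_len_bihom[of p k x] by (simp add: bihom_def)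
  qed
  then show ?thesis by blast
qed

lemma gbr_support:
  assumes "\<And>w. wcoeff a w \<noteq> 0 \<Longrightarrow> wdeg w = p" "\<And>w. wcoeff b w \<noteq> 0 \<Longrightarrow> wdeg w = q" "wcoeff (gbr p q a b) w \<noteq> 0"
  shows "wdeg w = p + q"
proof -
  have m: "wdeg w = i + j" if "wcoeff (x * y) w \<noteq> 0" "\<And>w. wcoeff x w \<noteq> 0 \<Longrightarrow> wdeg w = i" "\<And>w. wcoeff y w \<noteq> 0 \<Longrightarrow> wdeg w = j"
    for x y :: "'a gen ncps" and i j
  proof -
    from that(1) obtain k where "wcoeff x (take k w) * wcoeff y (drop k w) \<noteq> 0"
      unfolding wcoeff_mult by (metis (lifting) sum.neutral)
    then show ?thesis
      using that(2)[of "take k w"] that(3)[of "drop k w"] wdeg_append[of "take k w" "drop k w"] by auto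
  qed
  have "wcoeff (a * b) w \<noteq> 0 \<or> wcoeff (b * a) w \<noteq> 0" using assms(3) by (auto simp: gbr_def)
  then show ?thesis using m[of a b p q] m[of b a q p] assms(1,2) by (auto simp: add.commute)
qed

lemma wnest_wdeg: "wcoeff (wnest w) u \<noteq> 0 \<Longrightarrow> wdeg u = wdeg w"
proof (induction w arbitrary: u rule: wnest.induct)
  case (3 g h w)
  have "wdeg u = gdeg g + wdeg (h # w)"
    by (rule gbr_support[of "letter g" "gdeg g" "wnest (h # w)" "wdeg (h # w)"])
       (use 3 in \<open>auto split: if_splits\<close>)
  then show ?case by simp
qed (auto split: if_splits)

lemma lin_ext_wnest_letter:
  assumes x: "fin_supp x" "\<And>w. wcoeff x w \<noteq> 0 \<Longrightarrow> w \<noteq> [] \<and> wdeg w = q"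
  shows "lin_ext wnest (letter g * x) = gbr (gdeg g) q (letter g) (lin_ext wnest x)"
proof -
  have "lin_ext wnest (letter g * x) = lin_ext (\<lambda>v. wnest ([g] @ v)) x"
    using x(1) by (simp add: lin_ext_mult(2))
  also have "\<dots> = lin_ext (\<lambda>v. gbr (gdeg g) q (letter g) (wnest v)) x"
    using x(2) by (intro lin_ext_cong) (auto simp: wnest_Cons)
  also have "\<dots> = gbr (gdeg g) q (letter g) (lin_ext wnest x)"
    by (rule lin_ext_linear) (auto intro!: linearI simp: gbr_bilinear)
  finally show ?thesis .
qed

text \<open>Peeling off the first letter reduces this to the graded Leibniz rule and the Jacobi
  identity; the weight factor decides the case of a single letter.\<close>

lemma wnest_d_word: "lin_ext wnest (d_word u) = dd (wnest u)" for u :: "'n::{finite,linorder} gen list"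
proof (induction u)
  case (Cons g w)
  have Z0: "dd (letter (Z i)) = (0 :: 'n gen ncps)" for i
    using dd_mono[of "[Z i]"] by simp
  have ZZ0: "dd (letter (ZZ i j)) = letter (Z i) * letter (Z j) - letter (Z j) * (letter (Z i) :: 'n gen ncps)" for i j
    using dd_mono[of "[ZZ i j]"] by (simp add: gbr_def mono_nc_Nil)
  have dZ: "dd (letter (Z i) * y) = letter (Z i) * dd y" for i and y :: "'n gen ncps"
    using dd_mult[of "letter (Z i)" 0 y] by (auto simp: Z0 split: if_splits)
  have dZZ: "dd (letter (ZZ i j) * y) = dd (letter (ZZ i j)) * y - letter (ZZ i j) * dd y" for i j and y :: "'n gen ncps"
    using dd_mult[of "letter (ZZ i j)" 1 y] by (auto split: if_splits)
  have dn: "dd (wnest w * y) = dd (wnest w) * y + (-1) ^ wdeg w *\<^sub>R (wnest w * dd y)" for y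
    by (rule dd_mult) (use wnest_wdeg in auto)
  have sup: "v \<noteq> [] \<and> wdeg v = wdeg w - 1" if "wcoeff (d_word w) v \<noteq> 0" for v
    using d_word_support[OF that] by auto
  show ?case
  proof (cases "w = []")
    case True
    show ?thesis
    proof (cases g)
      case (ZZ i j)
      have "d_word [ZZ i j] = mono_nc [Z i, Z j] - mono_nc [Z j, Z i]"
        by (simp add: gbr_def mono_nc_mult mono_nc_Nil)
      \<comment> \<open>Both sides are 2 [Z_i, Z_j]: on the left from two opposite nested
        commutators, on the right from the weight 2 of \<open>ZZ i j\<close>.\<close>
      then have "lin_ext wnest (d_word [ZZ i j]) = wnest [Z i, Z j] - wnest [Z j, Z i]"
        by (simp only: lin_ext_diff fin_supp_simps lin_ext_mono)
      then show ?thesis using True ZZ by (simp add: ZZ0 gbr_def algebra_simps scaleR_2 del: d_word.simps)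
    qed (use True Z0 in simp)
  next
    case False
    show ?thesis
    proof (cases g)
      case (Z i)
      have "lin_ext wnest (d_word (Z i # w)) = gbr 0 (wdeg w - 1) (letter (Z i)) (dd (wnest w))"
        using lin_ext_wnest_letter[OF fin_supp_d_word sup, of w "Z i"] Cons by simp
      also have "\<dots> = dd (wnest (Z i # w))"
        using False by (simp add: wnest_Cons gbr_def dZ dn Z0)
      finally show ?thesis using Z by simp
    next
      case (ZZ i j)
      have 1: "lin_ext wnest (mono_nc (Z i # Z j # w)) = gbr 0 (wdeg w) (letter (Z i)) (gbr 0 (wdeg w) (letter (Z j)) (wnest w))" for i j
        using False by (simp add: wnest_Cons)
      have 2: "lin_ext wnest (letter (ZZ i j) * d_word w) = gbr 1 (wdeg w - 1) (letter (ZZ i j)) (dd (wnest w))"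
        using lin_ext_wnest_letter[OF fin_supp_d_word sup, of w "ZZ i j"] Cons by simp
      \<comment> \<open>By Jacobi the first two terms form the bracket of [Z_i, Z_j] = d Z_ij with
        \<open>wnest w\<close>; the third is the other half of the Leibniz rule.\<close>
      have "lin_ext wnest (d_word (ZZ i j # w)) = gbr 0 (wdeg w) (letter (Z i)) (gbr 0 (wdeg w) (letter (Z j)) (wnest w))
          - gbr 0 (wdeg w) (letter (Z j)) (gbr 0 (wdeg w) (letter (Z i)) (wnest w))
          - gbr 1 (wdeg w - 1) (letter (ZZ i j)) (dd (wnest w))"
        unfolding d_word_ZZ using fin_supp_d_word[of w] 
        by (simp only: lin_ext_diff fin_supp_simps lin_ext_mult(1) 1 2)
      also have "\<dots> = dd (gbr 1 (wdeg w) (letter (ZZ i j)) (wnest w))"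
      \<comment> \<open>For degree 0 the index \<open>wdeg w - 1\<close> is truncated, but then
        \<open>dd (wnest w)\<close> vanishes and the bracket with it is 0.\<close>
      proof (cases "wdeg w")
        case 0
        then have "dd (wnest w) = 0"
          unfolding ncps_eq_iff wcoeff_dd wcoeff_simps
          using wnest_wdeg[of w] d_word_support by (intro allI sum.neutral ballI) fastforce
        then show ?thesis using 0 by (simp add: gbr_def dZZ dn ZZ0 algebra_simps)
      next
        case (Suc q)
        then show ?thesis by (simp add: gbr_def dZZ dn ZZ0 algebra_simps sign_sq)
      qed
      also have "\<dots> = dd (wnest (ZZ i j # w))"
        using False by (simp add: wnest_Cons)
      finally show ?thesis using ZZ by simp
    qed
  qed
qed simp

lemma wnest_dd: "fin_supp c \<Longrightarrow> lin_ext wnest (dd c) = dd (lin_ext wnest c)" for c :: "'n::{finite,linorder} gen ncps"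
proof -
  assume c: "fin_supp c"
  then have "fin_supp (dd c) \<and> lin_ext wnest (dd c) = dd (lin_ext wnest c)"
    by (induction rule: fin_supp_induct) (auto simp: dd_mono fin_supp_d_word wnest_d_word)
  then show ?thesis by blast
qed

lemma wnest_in_fLie: "set w \<subseteq> generators \<Longrightarrow> wnest w \<in> fLie (wdeg w)"
proof (induction w rule: wnest.induct)
  case (3 g h w)
  then show ?case using fLie_simps(1)[of "letter g" "gdeg g" "wnest (h # w)" "wdeg (h # w)"]
    by (auto intro: fLie_simps)
qed (auto intro!: subspace_0[OF fLie_subspace] subspace_scale[OF fLie_subspace] fLie_simps)

text \<open>Letters \<open>Z i\<close> act as derivations and so preserve [f^-1, f^-1]. The first
  letter of degree -1 is bracketed with an element of degree -1, and a single letter never has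
  degree -2.\<close>

lemma wnest_span:
  "set w \<subseteq> generators \<Longrightarrow> wdeg w = 2 \<Longrightarrow> wnest w \<in> span {gbr 1 1 a b | a b. a \<in> fLie 1 \<and> b \<in> fLie 1}"
proof (induction w rule: wnest.induct)
  case (2 g)
  then show ?case by (cases g) auto
next
  case (3 g h w)
  let ?S = "span {gbr 1 1 a b | a b. a \<in> fLie 1 \<and> b \<in> (fLie 1 :: 'a gen ncps set)}"
  show ?case
  proof (cases g)
    case (Z i)
    have Z1: "letter (Z i) \<in> fLie 0" by (rule fLie_simps) auto
    have "wnest (h # w) \<in> ?S" using 3 Z by auto
    then have "gbr 0 2 (letter (Z i)) (wnest (h # w)) \<in> ?S"
    proof (rule span_induct)
      show "subspace {x. gbr 0 2 (letter (Z i)) x \<in> ?S}"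
        by (auto simp: subspace_def gbr_bilinear span_0 span_add span_scale)
      fix x assume "x \<in> {gbr 1 1 a b | a b. a \<in> fLie 1 \<and> b \<in> (fLie 1 :: 'a gen ncps set)}"
      then obtain a b where x: "x = gbr 1 1 a b" "a \<in> fLie 1" "b \<in> fLie 1" by blast
      have e: "gbr 0 2 (letter (Z i)) x = gbr 1 1 (gbr 0 1 (letter (Z i)) a) b + gbr 1 1 a (gbr 0 1 (letter (Z i)) b)"
        unfolding x(1) by (simp add: gbr_def algebra_simps)
      have "gbr 0 1 (letter (Z i)) a \<in> fLie 1" "gbr 0 1 (letter (Z i)) b \<in> fLie 1"
        using fLie_simps(1)[OF Z1 x(2)] fLie_simps(1)[OF Z1 x(3)] by auto
      then have "gbr 1 1 (gbr 0 1 (letter (Z i)) a) b \<in> ?S" "gbr 1 1 a (gbr 0 1 (letter (Z i)) b) \<in> ?S"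
        using x(2,3) by (blast intro: span_base)+
      then show "gbr 0 2 (letter (Z i)) x \<in> ?S"
        unfolding e by (rule span_add)
    qed
    then show ?thesis using 3 Z by auto
  next
    case (ZZ i j)
    then have "wdeg (h # w) = 1" using 3 by auto
    moreover have "letter g \<in> fLie 1" using 3 ZZ by (intro fLie_simps) auto
    ultimately show ?thesis
      using wnest_in_fLie[of "h # w"] 3(2) ZZ by (auto intro!: span_base)
  qed
qed simp

text \<open>A Lie element that bounds some associative c also bounds a sum of brackets. In weight k
  > 0 the weighted Dynkin operator gives k a = d(wnest c) with \<open>wnest\<close> of c in
  [f^-1, f^-1]; Lie elements have no component of weight 0.\<close>

theorem boundaries_Lie: "a \<in> f1bar \<Longrightarrow> a \<in> wcompletion peiffer \<longleftrightarrow> a \<in> boundaries"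
proof
  assume "a \<in> wcompletion peiffer"
  moreover have "peiffer \<subseteq> (boundaries :: 'a gen ncps set)"
  proof -
    have "span {gbr 1 1 a b | a b. a \<in> fLie 1 \<and> b \<in> fLie 1} \<subseteq> (deg_part 2 :: 'a gen ncps set)"
    proof (rule span_minimal[OF _ deg_part_subspace], clarify)
      fix a b :: "'a gen ncps" assume "a \<in> fLie 1" "b \<in> fLie 1"
      then have "gbr 1 1 a b \<in> fLie (1 + 1)" by (rule fLie_simps)
      then show "gbr 1 1 a b \<in> deg_part 2" using fLie_deg_part[of "gbr 1 1 a b" "1 + 1"] by (simp add: numeral_2_eq_2)
    qed
    then show ?thesis by (auto simp: peiffer_def boundaries_def)
  qed
  ultimately show "a \<in> boundaries"
    by (subst boundaries_homog_iff) (auto simp: wcompletion_def)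
next
  assume f1: "a \<in> f1bar" and a: "a \<in> boundaries"
  obtain c where c: "c \<in> deg_part 2" "a = dd c" using a by (auto simp: boundaries_def)
  have "homog k a \<in> peiffer" for k
  proof (cases "k = 0")
    case True
    have "homog 0 a = dd 0"
      using fbar_Nil[of a 1] f1 by (auto simp: f1bar_def ncps_eq_iff)
    then show ?thesis using True span_0 unfolding peiffer_def by blast
  next
    case False
    let ?c = "homog k c"
    have "homog k a \<in> fLie 1" using f1 by (auto simp: f1bar_def wcompletion_def)
    then have "wscale (homog k a) = lin_ext wnest (homog k a)" by (simp add: wnest_fLie)
    also have "\<dots> = dd (lin_ext wnest ?c)" by (simp add: c(2) dd_homog[symmetric] wnest_dd)
    also have "wscale (homog k a) = real k *\<^sub>R homog k a"
      by (auto simp: ncps_eq_iff)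
    finally have e: "real k *\<^sub>R homog k a = dd (lin_ext wnest ?c)" .
    have "lin_ext wnest ?c \<in> span {gbr 1 1 a b | a b. a \<in> fLie 1 \<and> b \<in> fLie 1}"
      unfolding lin_ext_def
      using deg_partD[OF c(1)] by (intro span_sum span_scale wnest_span) (auto split: if_splits)
    then have "(1 / real k) *\<^sub>R lin_ext wnest ?c \<in> span {gbr 1 1 a b | a b. a \<in> fLie 1 \<and> b \<in> fLie 1}"
      by (rule span_scale)
    moreover have "homog k a = dd ((1 / real k) *\<^sub>R lin_ext wnest ?c)"
      using False by (simp add: e[symmetric])
    ultimately show ?thesis unfolding peiffer_def by (rule rev_image_eqI)
  qed
  then show "a \<in> wcompletion peiffer" by (simp add: wcompletion_def)
qed


section \<open>The Baker--Campbell--Hausdorff series\<close>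

subsection \<open>Substitution\<close>

text \<open>Cutting at the length of \<open>v\<close> loses nothing when the substituted series have
  no constant term, the case in which it is used.\<close>

definition subst :: "('a::finite \<Rightarrow> 'b ncps) \<Rightarrow> 'a ncps \<Rightarrow> 'b ncps" where
  "subst f a = Ncps (\<lambda>v. \<Sum>w | length w \<le> length v. wcoeff a w * wcoeff (prod_list (map f w)) v)"

lemma finite_length [simp]: "finite {w :: 'a::finite list. length w \<le> n}" "finite {w :: 'a::finite list. length w = n}"
  using finite_lists_length_le[of "UNIV :: 'a set" n] finite_lists_length_eq[of "UNIV :: 'a set" n] by simp_all

lemma prod_list_ordge: "(\<And>x. wcoeff (f x) [] = 0) \<Longrightarrow> ordge (length w) (prod_list (map f w))"
proof (induction w)
  case (Cons x w)
  then show ?case using ordge_mult[of 1 "f x" "length w"] by (simp add: ordge_1_iff)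
qed simp

lemma subst_coeff:
  assumes f: "\<And>x. wcoeff (f x) [] = 0" and n: "length v \<le> n"
  shows "wcoeff (subst f a) v = (\<Sum>w | length w \<le> n. wcoeff a w * wcoeff (prod_list (map f w)) v)"
  unfolding subst_def wcoeff_Ncps
  by (rule sum.mono_neutral_left) (use n prod_list_ordge[of f, OF f] in \<open>auto simp: ordge_def\<close>)

lemma subst_linear: "linear (subst f)"
  by (rule linearI)
     (auto simp: ncps_eq_iff subst_def distrib_right sum.distrib sum_distrib_left mult.assoc)

lemma subst_ordge: "ordge n a \<Longrightarrow> ordge n (subst f a)"
  by (auto simp: ordge_def subst_def intro!: sum.neutral)

lemma subst_mono:
  fixes f :: "'a::finite \<Rightarrow> 'b ncps"
  assumes f: "\<And>x. wcoeff (f x) [] = 0"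
  shows "subst f (mono_nc w) = prod_list (map f w)"
proof (rule ncps_eqI)
  fix v :: "'b list"
  let ?n = "max (length v) (length w)"
  have "wcoeff (subst f (mono_nc w)) v = (\<Sum>u | length u \<le> ?n. if u = w then wcoeff (prod_list (map f w)) v else 0)"
    unfolding subst_coeff[where n = ?n, OF f max.cobounded1] by (rule sum.cong) auto
  also have "\<dots> = wcoeff (prod_list (map f w)) v"
    by (subst sum.delta) auto
  finally show "wcoeff (subst f (mono_nc w)) v = wcoeff (prod_list (map f w)) v" .
qed

text \<open>Splittings of words are reindexed by pairs of words. Pairs of total length above that of
  \<open>v\<close> may be added, since the product of their images has too high an order to be seen
  at \<open>v\<close>.\<close>

lemma subst_mult:
  fixes f :: "'a::finite \<Rightarrow> 'b ncps"
  assumes f: "\<And>x. wcoeff (f x) [] = 0"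
  shows "subst f (a * b) = subst f a * subst f b"
proof (rule ncps_eqI)
  fix v :: "'b list"
  let ?n = "length v" and ?P = "\<lambda>w. prod_list (map f w)"
  let ?W = "{w :: 'a list. length w \<le> ?n}"
  let ?t = "\<lambda>w1 w2. wcoeff a w1 * wcoeff b w2 * wcoeff (?P w1 * ?P w2) v"
  have "wcoeff (subst f (a * b)) v = (\<Sum>w\<in>?W. \<Sum>k\<le>length w. ?t (take k w) (drop k w))"
    unfolding subst_def wcoeff_Ncps wcoeff_mult[of a b] sum_distrib_right
  proof (intro sum.cong refl)
    fix w :: "'a list" and k :: nat
    have "?P (take k w) * ?P (drop k w) = ?P w"
      by (metis append_take_drop_id map_append prod_list.append)
    then show "wcoeff a (take k w) * wcoeff b (drop k w) * wcoeff (?P w) v = ?t (take k w) (drop k w)" by simp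
  qed
  also have "\<dots> = (\<Sum>(w, k)\<in>(SIGMA w:?W. {..length w}). ?t (take k w) (drop k w))"
    by (simp add: sum.Sigma)
  also have "\<dots> = (\<Sum>(w1, w2) | length w1 + length w2 \<le> ?n. ?t w1 w2)"
    by (rule sum.reindex_bij_witness[where j = "\<lambda>(w, k). (take k w, drop k w)" and i = "\<lambda>(w1, w2). (w1 @ w2, length w1)"])
       (auto simp: min_def)
  also have "\<dots> = (\<Sum>(w1, w2)\<in>?W \<times> ?W. ?t w1 w2)"
  proof (rule sum.mono_neutral_left)
    show "\<forall>p\<in>?W \<times> ?W - {(w1, w2). length w1 + length w2 \<le> ?n}. (case p of (w1, w2) \<Rightarrow> ?t w1 w2) = 0"
    proof
      fix p :: "'a list \<times> 'a list" assume "p \<in> ?W \<times> ?W - {(w1, w2). length w1 + length w2 \<le> ?n}"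
      then obtain w1 w2 where p: "p = (w1, w2)" "?n < length w1 + length w2" by (cases p) auto
      have "ordge (length w1 + length w2) (?P w1 * ?P w2)"
        by (intro ordge_mult prod_list_ordge f)
      then show "(case p of (w1, w2) \<Rightarrow> ?t w1 w2) = 0" using p by (simp add: ordge_def)
    qed
  qed auto
  also have "\<dots> = (\<Sum>w1\<in>?W. \<Sum>w2\<in>?W. ?t w1 w2)"
    by (simp add: sum.cartesian_product)
  also have "\<dots> = (\<Sum>w1\<in>?W. \<Sum>w2\<in>?W. \<Sum>k\<le>?n. (wcoeff a w1 * wcoeff (?P w1) (take k v)) * (wcoeff b w2 * wcoeff (?P w2) (drop k v)))"
    by (simp add: wcoeff_mult sum_distrib_left mult_ac)
  also have "\<dots> = (\<Sum>w1\<in>?W. \<Sum>k\<le>?n. \<Sum>w2\<in>?W. (wcoeff a w1 * wcoeff (?P w1) (take k v)) * (wcoeff b w2 * wcoeff (?P w2) (drop k v)))"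
    by (rule sum.cong[OF refl], rule sum.swap)
  also have "\<dots> = (\<Sum>k\<le>?n. \<Sum>w1\<in>?W. \<Sum>w2\<in>?W. (wcoeff a w1 * wcoeff (?P w1) (take k v)) * (wcoeff b w2 * wcoeff (?P w2) (drop k v)))"
    by (rule sum.swap)
  also have "\<dots> = (\<Sum>k\<le>?n. wcoeff (subst f a) (take k v) * wcoeff (subst f b) (drop k v))"
  proof (rule sum.cong[OF refl])
    fix k assume "k \<in> {..?n}"
    then have "length (take k v) \<le> ?n" "length (drop k v) \<le> ?n" by auto
    then show "(\<Sum>w1\<in>?W. \<Sum>w2\<in>?W. (wcoeff a w1 * wcoeff (?P w1) (take k v)) * (wcoeff b w2 * wcoeff (?P w2) (drop k v))) =
        wcoeff (subst f a) (take k v) * wcoeff (subst f b) (drop k v)"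
      by (simp only: subst_coeff[of f, OF f] sum_product)
  qed
  also have "\<dots> = wcoeff (subst f a * subst f b) v"
    by (simp add: wcoeff_mult)
  finally show "wcoeff (subst f (a * b)) v = wcoeff (subst f a * subst f b) v" .
qed

lemma subst_1:
  assumes f: "\<And>x. wcoeff (f x) [] = 0" shows "subst f 1 = 1"
  using subst_mono[of f "[]", OF f] by (simp add: mono_nc_Nil)

lemma subst_Nil: "wcoeff (subst f a) [] = wcoeff a []"
  by (simp add: subst_def)

lemma subst_ev_fps:
  assumes f: "\<And>x. wcoeff (f x) [] = 0" and a: "wcoeff a [] = 0"
  shows "subst f (ev_fps g a) = ev_fps g (subst f a)"
  unfolding ev_fps_def
  using op_series_hom[OF raising_mult[OF a] raising_mult[of "subst f a"] subst_linear subst_ordge, of f "fps_nth g" 1]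
  by (simp add: subst_mult[of f, OF f] subst_1[of f, OF f] subst_Nil a)

lemma subst_deg_part:
  assumes "\<And>x. f x \<in> deg_part 0" shows "subst f a \<in> deg_part 0"
proof (rule deg_part_support[of "range (\<lambda>w. prod_list (map f w))"])
  have "prod_list (map f w) \<in> deg_part 0" for w
    using assms by (induction w) auto
  then show "range (\<lambda>w. prod_list (map f w)) \<subseteq> deg_part 0" by auto
qed (auto simp: subst_def)

text \<open>Strips a final letter. A series without constant term is the sum of its quotients times
  the letters, which isolates the last factor of every word for \<open>substN\<close>.\<close>

definition rquot :: "'a \<Rightarrow> 'a ncps \<Rightarrow> 'a ncps" where
  "rquot b a = Ncps (\<lambda>w. wcoeff a (w @ [b]))"

lemma wcoeff_rquot [simp]: "wcoeff (rquot b a) w = wcoeff a (w @ [b])"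
  by (simp add: rquot_def)

lemma rquot_mult:
  assumes "wcoeff c [] = 0" shows "rquot b (a * c) = a * rquot b c"
proof (rule ncps_eqI)
  fix w
  have "wcoeff (rquot b (a * c)) w = (\<Sum>k\<le>length w. wcoeff a (take k (w @ [b])) * wcoeff c (drop k (w @ [b])))"
    using assms by (simp add: wcoeff_mult)
  then show "wcoeff (rquot b (a * c)) w = wcoeff (a * rquot b c) w"
    by (simp add: wcoeff_mult)
qed

lemma wcoeff_mult_letter: "wcoeff (z * letter b) (u @ [c]) = (if c = b then wcoeff z u else 0)"
proof -
  have "wcoeff (z * letter b) (u @ [c]) = (\<Sum>k\<le>length (u @ [c]). if k = length u then (if c = b then wcoeff z u else 0) else 0)"
    unfolding wcoeff_mult
  proof (rule sum.cong[OF refl])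
    fix k assume k: "k \<in> {..length (u @ [c])}"
    have "drop k (u @ [c]) \<noteq> [b]" if "k \<noteq> length u"
    proof -
      have "length (drop k (u @ [c])) \<noteq> length [b]" using that k by auto
      then show ?thesis by metis
    qed
    then show "wcoeff z (take k (u @ [c])) * wcoeff (letter b) (drop k (u @ [c])) =
        (if k = length u then (if c = b then wcoeff z u else 0) else 0)"
      by auto
  qed
  then show ?thesis by simp
qed

lemma rquot_decompose:
  fixes a :: "'a::finite ncps"
  assumes "wcoeff a [] = 0" shows "(\<Sum>b\<in>UNIV. rquot b a * letter b) = a"
proof (rule ncps_eqI)
  fix w
  show "wcoeff (\<Sum>b\<in>UNIV. rquot b a * letter b) w = wcoeff a w"
  proof (cases w rule: rev_cases)
    case (snoc u c)
    have "wcoeff (\<Sum>b\<in>UNIV. rquot b a * letter b) w = (\<Sum>b\<in>UNIV. if b = c then wcoeff a w else 0)"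
      unfolding wcoeff_sum by (rule sum.cong) (auto simp: snoc wcoeff_mult_letter)
    then show ?thesis by simp
  qed (simp add: assms wcoeff_sum)
qed

lemma rquot_linear: "rquot b (u + v) = rquot b u + rquot b v" "rquot b (u - v) = rquot b u - rquot b v"
  "rquot b (c *\<^sub>R u) = c *\<^sub>R rquot b u"
  by (auto simp: ncps_eq_iff)

text \<open>Evaluation in the associative algebra of the crossed module at \<open>f\<close>; in a product only the last
  factor is not differentiated.\<close>

definition substN :: "('a::finite \<Rightarrow> 'n::{finite,linorder} gen ncps) \<Rightarrow> 'a ncps \<Rightarrow> 'n gen ncps" where
  "substN f a = (\<Sum>b\<in>UNIV. subst (\<lambda>x. dd (f x)) (rquot b a) * f b)"

lemma substN_linear: "linear (substN f)"
  unfolding substN_def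
  by (rule linearI)
     (simp_all add: rquot_linear linear_add[OF subst_linear] linear_scale[OF subst_linear] distrib_right
       sum.distrib scaleR_sum_right)

lemma substN_mult:
  "wcoeff c [] = 0 \<Longrightarrow> substN f (a * c) = subst (\<lambda>x. dd (f x)) a * substN f c"
  unfolding substN_def sum_distrib_left
  by (intro sum.cong refl) (simp add: rquot_mult subst_mult mult.assoc)

lemma substN_letter: "substN f (letter b) = f b"
proof -
  have r: "rquot c (letter b) = (if c = b then 1 else 0)" for c
    by (auto simp: ncps_eq_iff)
  have "substN f (letter b) = (\<Sum>c\<in>UNIV. if c = b then f b else 0)"
    unfolding substN_def by (rule sum.cong) (auto simp: r subst_1 linear_0[OF subst_linear])
  then show ?thesis by simp
qed

lemma substN_ordge:
  assumes "\<And>b. wcoeff (f b) [] = 0" "ordge n a" shows "ordge n (substN f a)"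
proof (cases n)
  case (Suc m)
  have "ordge m (rquot b a)" for b using assms(2) Suc by (auto simp: ordge_def)
  then have "ordge (m + 1) (subst (\<lambda>x. dd (f x)) (rquot b a) * f b)" for b
    using assms(1)[of b] by (intro ordge_mult subst_ordge) (auto simp: ordge_1_iff)
  then show ?thesis unfolding substN_def Suc by (intro ordge_sum) simp
qed simp

lemma substN_deg_part:
  assumes "\<And>b. f b \<in> deg_part 1" shows "substN f a \<in> deg_part 1"
  unfolding substN_def
  using assms by (intro deg_part_sum deg_part_mult0(1) subst_deg_part dd_deg_part1) auto

lemma dd_substN:
  assumes f: "\<And>b. f b \<in> deg_part 1" and a: "wcoeff a [] = 0"
  shows "dd (substN f a) = subst (\<lambda>x. dd (f x)) a"
proof -
  let ?X = "\<lambda>x. dd (f x)"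
  have X: "?X b \<in> deg_part 0" for b by (rule dd_deg_part1[OF f])
  have "dd (substN f a) = (\<Sum>b\<in>UNIV. dd (subst ?X (rquot b a) * f b))"
    by (simp add: substN_def linear_sum[OF dd_linear])
  also have "\<dots> = (\<Sum>b\<in>UNIV. subst ?X (rquot b a * letter b))"
    using subst_mono[of ?X "[_]"] by (intro sum.cong refl) (simp add: dd_mult_0 subst_deg_part X subst_mult)
  also have "\<dots> = subst ?X (\<Sum>b\<in>UNIV. rquot b a * letter b)"
    by (simp add: linear_sum[OF subst_linear])
  finally show ?thesis by (simp add: rquot_decompose a)
qed

text \<open>Evaluation respects exponentials exactly: the powers differentiate all but the last
  factor, just as \<open>substN\<close> does.\<close>

lemma expN_substN:
  assumes f: "\<And>b. f b \<in> deg_part 1" and a: "wcoeff a [] = 0"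
  shows "expN (substN f a) = substN f (nc_exp a - 1)"
proof -
  have "expN (substN f a) = ev_fps epsi_fps (subst (\<lambda>x. dd (f x)) a) * substN f a"
    using f a by (simp add: expN_def dd_substN)
  also have "\<dots> = substN f (ev_fps epsi_fps a * a)"
    using a by (simp add: substN_mult subst_ev_fps)
  finally show ?thesis using a by (simp add: ev_epsi)
qed

subsection \<open>Dynkin's form\<close>

fun nested_comm :: "'a list \<Rightarrow> 'a ncps" where
  "nested_comm [] = 0"
| "nested_comm [b] = letter b"
| "nested_comm (b # w) = act (letter b) (nested_comm w)"

lemma nested_comm_Nil: "wcoeff (nested_comm w) [] = 0"
  by (induction w rule: nested_comm.induct) (auto simp: act_eq)

lemma nested_br_deg_part:
  assumes "x \<in> deg_part 1" "y \<in> deg_part 1" shows "nested_br derived_br x y w \<in> deg_part 1"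
  by (induction w rule: nested_comm.induct)
     (use assms in \<open>auto simp: derived_br_eq intro!: deg_part_act dd_deg_part1\<close>)

lemma nested_br_ordge:
  assumes "x \<in> deg_part 1" "y \<in> deg_part 1" shows "ordge (length w) (nested_br derived_br x y w)"
proof (induction w rule: nested_comm.induct)
  case (3 b c w)
  have "raising (act (dd (if b then x else y)))" by (rule raising_act) simp
  then show ?case using 3 by (auto simp: derived_br_eq raising_def)
qed (use assms deg_part_1_Nil[of x 0] deg_part_1_Nil[of y 0] in \<open>auto simp: ordge_1_iff\<close>)

text \<open>In a commutator \<open>substN\<close> differentiates the left factor of both products,
  whereas the derived bracket differentiates the same letter in both. The discrepancy is a Peiffer
  expression at every step.\<close>

lemma nested_br_substN:
  assumes x: "x \<in> deg_part 1" and y: "y \<in> deg_part 1" and f: "f = (\<lambda>b. if b then x else y)"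
  shows "nested_br derived_br x y w - substN f (nested_comm w) \<in> boundaries"
proof (induction w rule: nested_comm.induct)
  case 1
  then show ?case by (simp add: linear_0[OF substN_linear])
next
  case (2 b)
  then show ?case by (simp add: substN_letter f)
next
  case (3 b c w)
  let ?n = "nested_br derived_br x y (c # w)" and ?t = "nested_comm (c # w)"
  let ?e = "substN f ?t"
  have f1: "f b \<in> deg_part 1" for b using x y by (simp add: f)
  have X: "subst (\<lambda>x. dd (f x)) (letter b) = dd (f b)"
    using subst_mono[of "\<lambda>x. dd (f x)" "[b]"] by simp
  have "substN f (nested_comm (b # c # w)) = dd (f b) * ?e - dd ?e * f b"
    using nested_comm_Nil[of "c # w"] f1
    by (simp add: act_eq linear_diff[OF substN_linear] substN_mult X substN_letter dd_substN del: nested_comm.simps(2,3))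
       (simp add: act_eq linear_diff[OF substN_linear] substN_mult X substN_letter dd_substN)
  then have "nested_br derived_br x y (b # c # w) - substN f (nested_comm (b # c # w)) =
      (dd (f b) * (?n - ?e) - (?n - ?e) * dd (f b)) + (dd ?e * f b - ?e * dd (f b))"
    by (simp add: derived_br_eq act_eq f algebra_simps)
  moreover have "dd ?e * f b - ?e * dd (f b) \<in> boundaries"
    by (intro boundaries_peiffer substN_deg_part f1)
  moreover have "dd (f b) * (?n - ?e) - (?n - ?e) * dd (f b) \<in> boundaries"
    by (intro boundaries_simps(3) boundaries_mult dd_deg_part1 f1 3)
  ultimately show ?case by (metis boundaries_simps(2))
qed

lemma op_series_kernel: "raising T \<Longrightarrow> T y = 0 \<Longrightarrow> op_series c T y = c 0 *\<^sub>R y"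
proof (rule ncps_eqI)
  fix w assume T: "raising T" "T y = 0"
  have "(T ^^ m) 0 = 0" for m by (rule linear_0[OF linear_funpow[OF raising_linear[OF T(1)]]])
  then have "(T ^^ m) y = 0" if "m > 0" for m
    using that T(2) by (cases m) (auto simp: funpow_swap1)
  then have "wcoeff (op_series c T y) w = (\<Sum>m\<le>length w. if m = 0 then c 0 * wcoeff y w else 0)"
    unfolding op_series_coeff[OF T(1) order_refl] by (intro sum.cong) auto
  then show "wcoeff (op_series c T y) w = wcoeff (c 0 *\<^sub>R y) w" by simp
qed

definition log_exp_exp :: "'a \<Rightarrow> 'a \<Rightarrow> 'a ncps" where
  "log_exp_exp a b = nc_log (nc_exp (letter a) * nc_exp (letter b))"

text \<open>H(t) = exp(Z_i) exp(t Z_j) satisfies H' = H Z_j, so its logarithm solves a Magnus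
  equation with Lie driving term and Lie initial value Z_i.\<close>

lemma log_exp_exp_Lie: "log_exp_exp (Z i) (Z j) \<in> (fbar 0 :: 'n::{finite,linorder} gen ncps set)"
proof -
  let ?F = "letter (Z j) :: 'n gen ncps"
  let ?H = "\<lambda>t. nc_exp (letter (Z i)) * nc_exp (t *\<^sub>R ?F)"
  have dF: "ncd (\<lambda>t. t *\<^sub>R ?F) ?F t S" for t S
    unfolding ncd_def by (auto intro!: derivative_eq_intros)
  have d: "ncd ?H (?H t * ?F) t S" if "t \<in> S" for t S
  proof -
    have "op_series (fps_nth phi_fps) (act (t *\<^sub>R ?F)) ?F = ?F"
      by (subst op_series_kernel[OF raising_act]) (auto simp: act_eq phi_fps_def)
    then show ?thesis
      using ncd_mult_left[OF ncd_exp[OF dF that]] by (simp add: mult.assoc)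
  qed
  have L: "letter (Z k) \<in> (fbar 0 :: 'n gen ncps set)" for k
    by (intro fbar_fLie fLie_simps) auto
  have "nc_log (?H 1) \<in> fbar 0"
  proof (rule fbar_log_ode[of "{}" 0 1 "\<lambda>t. nc_log (?H t)" "\<lambda>_. ?F"])
    show "ncc {0..1} (\<lambda>t. nc_log (?H t))"
      by (rule ncc_log, rule ncd_imp_ncc[OF d]) auto
    show "ncd (\<lambda>t. nc_log (?H t)) (toddad (nc_log (?H t)) ?F) t {0..1}" if "t \<in> {0..1} - {}" for t
      by (rule log_derivative[OF d]) (use that in \<open>auto simp: at_within_Icc_at_right at_within_Icc_at_left at_within_interior trivial_limit_within islimpt_Icc\<close>)
    show "nc_log (?H 0) \<in> fbar 0" using L by (simp add: nc_log_exp)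
  qed (use L in auto)
  then show ?thesis by (simp add: log_exp_exp_def)
qed

text \<open>Keeps the words in the letters \<open>Z i\<close> and renames them. The Lie results live
  over the alphabet \<open>gen\<close>, the BCH coefficients over \<open>bool\<close>; this map
  connects the two.\<close>

definition pull_Z :: "'n gen ncps \<Rightarrow> 'n ncps" where
  "pull_Z a = Ncps (\<lambda>w. wcoeff a (map Z w))"

lemma wcoeff_pull_Z [simp]: "wcoeff (pull_Z a) w = wcoeff a (map Z w)"
  by (simp add: pull_Z_def)

lemma pull_Z_linear: "linear pull_Z"
  by (rule linearI) (auto simp: ncps_eq_iff)

lemma pull_Z_mult: "pull_Z (a * b) = pull_Z a * pull_Z b"
  by (auto simp: ncps_eq_iff wcoeff_mult take_map drop_map)

lemma pull_Z_1: "pull_Z 1 = 1" and pull_Z_letter: "pull_Z (letter (Z i)) = letter i"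
  by (auto simp: ncps_eq_iff)

lemma pull_Z_ev_fps: "wcoeff a [] = 0 \<Longrightarrow> pull_Z (ev_fps g a) = ev_fps g (pull_Z a)"
  unfolding ev_fps_def
  using op_series_hom[OF raising_mult[of a] raising_mult[of "pull_Z a"] pull_Z_linear, of "fps_nth g" 1]
  by (simp add: pull_Z_mult pull_Z_1 ordge_def)

lemma pull_Z_log_exp_exp: "pull_Z (log_exp_exp (Z i) (Z j)) = log_exp_exp i j"
  by (simp add: log_exp_exp_def nc_log_ev nc_exp_ev pull_Z_ev_fps pull_Z_mult pull_Z_letter pull_Z_1
      linear_diff[OF pull_Z_linear] ev_fps_Nil)

lemma pull_Z_nest: "pull_Z (dyn.nest (map Z w)) = nested_comm w"
proof (induction w rule: nested_comm.induct)
  case (3 b c w)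
  have "wdeg (map Z w) = 0" for w :: "'a list" by (induction w) auto
  then have "dyn.nest (map Z (b # c # w)) = gbr 0 0 (letter (Z b)) (dyn.nest (map Z (c # w)))"
    by simp
  moreover have "pull_Z (gbr 0 0 u v) = act (pull_Z u) (pull_Z v)" for u v :: "'a gen ncps"
    by (simp add: gbr_def act_eq linear_diff[OF pull_Z_linear] pull_Z_mult)
  ultimately show ?case using 3 by (simp only: pull_Z_letter nested_comm.simps)
qed (simp_all add: linear_0[OF pull_Z_linear] pull_Z_letter)

text \<open>The part of length n is a Lie polynomial over the letters \<open>Z i\<close>, so the
  Dynkin operator fixes it; \<open>pull_Z\<close> carries this to plain letters.\<close>

lemma log_exp_exp_Dynkin:
  fixes i j :: "'n::{finite,linorder}"
  shows "(\<Sum>w | length w = n. (wcoeff (log_exp_exp i j) w / real n) *\<^sub>R nested_comm w) =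
    (\<Sum>w | length w = n. wcoeff (log_exp_exp i j) w *\<^sub>R mono_nc w)"
proof -
  let ?L = "log_exp_exp (Z i) (Z j)" and ?l = "log_exp_exp i j"
  let ?h = "homog n ?L"
  have l: "wcoeff ?l w = wcoeff ?L (map Z w)" for w
    unfolding pull_Z_log_exp_exp[of i j, symmetric] wcoeff_pull_Z ..
  have wt: "weight (map Z w) = length w" for w :: "'n list" by (induction w) auto
  have h: "?h \<in> fLie 0" using log_exp_exp_Lie[of i j] by (simp add: wcompletion_def)
  have sup: "w \<in> map Z ` {w. length w = n}" if "wcoeff ?h w \<noteq> 0" for w
  proof -
    have "wdeg w = 0" "weight w = n" "set w \<subseteq> generators"
      using that deg_partD[of ?h 0 w] fLie_deg_part[OF h] by (auto split: if_splits)
    moreover have "\<exists>u. w = map Z u" if "wdeg w = 0" for w :: "'n gen list"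
      using that
    proof (induction w)
      case (Cons g w)
      then obtain u where "w = map Z u" by auto
      with Cons show ?case by (cases g) (auto intro!: exI[of _ "_ # u"])
    qed simp
    ultimately obtain u where "w = map Z u" "length u = n" using wt by metis
    then show ?thesis by blast
  qed
  have "pull_Z ?h = pull_Z (dyn.phi ?h)" using dyn_phi[OF h] by simp
  also have "\<dots> = (\<Sum>w | wcoeff ?h w \<noteq> 0. wcoeff ?h w *\<^sub>R (1 / real (length w)) *\<^sub>R pull_Z (dyn.nest w))"
    by (simp add: dyn.phi_def lin_ext_def linear_sum[OF pull_Z_linear] linear_scale[OF pull_Z_linear])
  also have "\<dots> = (\<Sum>w\<in>map Z ` {w. length w = n}. wcoeff ?h w *\<^sub>R (1 / real (length w)) *\<^sub>R pull_Z (dyn.nest w))"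
    by (rule sum.mono_neutral_left) (use sup in auto)
  also have "\<dots> = (\<Sum>w | length w = n. wcoeff ?h (map Z w) *\<^sub>R (1 / real (length (map Z w))) *\<^sub>R pull_Z (dyn.nest (map Z w)))"
    by (rule sum.reindex[unfolded o_def]) (auto simp: inj_on_def inj_map_eq_map inj_def)
  also have "\<dots> = (\<Sum>w | length w = n. (wcoeff ?l w / real n) *\<^sub>R nested_comm w)"
    by (rule sum.cong) (auto simp: pull_Z_nest wt l)
  finally have 1: "pull_Z ?h = (\<Sum>w | length w = n. (wcoeff ?l w / real n) *\<^sub>R nested_comm w)" .
  have "pull_Z ?h = (\<Sum>w | length w = n. wcoeff ?l w *\<^sub>R mono_nc w)"
  proof (rule ncps_eqI)
    fix u
    have "wcoeff (\<Sum>w | length w = n. wcoeff ?l w *\<^sub>R mono_nc w) u = (\<Sum>w | length w = n. if w = u then wcoeff ?l u else 0)"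
      unfolding wcoeff_sum by (rule sum.cong) auto
    also have "\<dots> = (if length u = n then wcoeff ?l u else 0)"
      by (subst sum.delta) auto
    finally show "wcoeff (pull_Z ?h) u = wcoeff (\<Sum>w | length w = n. wcoeff ?l w *\<^sub>R mono_nc w) u"
      by (simp add: wt l)
  qed
  then show ?thesis using 1 by simp
qed

lemma wcoeff_bch:
  assumes "x \<in> deg_part 1" "y \<in> deg_part 1" "length v \<le> n"
  shows "wcoeff (bch x y) v = (\<Sum>m\<le>n. \<Sum>w | length w = m. bch_coeff w * wcoeff (nested_br derived_br x y w) v)"
  unfolding bch_def wcoeff_Ncps
proof (rule suminf_finite)
  fix m assume "m \<notin> {..n}"
  then show "(\<Sum>w | length w = m. bch_coeff w * wcoeff (nested_br derived_br x y w) v) = 0"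
    using nested_br_ordge[OF assms(1,2)] assms(3) by (intro sum.neutral) (auto simp: ordge_def)
qed simp

lemma homog_bch:
  assumes "x \<in> deg_part 1" "y \<in> deg_part 1"
  shows "homog k (bch x y) = (\<Sum>m\<le>k. \<Sum>w | length w = m. bch_coeff w *\<^sub>R homog k (nested_br derived_br x y w))"
proof (rule ncps_eqI)
  fix v
  show "wcoeff (homog k (bch x y)) v =
      wcoeff (\<Sum>m\<le>k. \<Sum>w | length w = m. bch_coeff w *\<^sub>R homog k (nested_br derived_br x y w)) v"
    using wcoeff_bch[OF assms, of v k] length_le_weight[of v] by (simp add: wcoeff_sum)
qed

lemma bch_Lie:
  assumes "x \<in> fbar 1" "y \<in> fbar 1" shows "bch x y \<in> fbar 1"
proof -
  have "nested_br derived_br x y w \<in> fbar 1" for w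
  proof (induction w rule: nested_comm.induct)
    case (3 b c w)
    have "dd x \<in> fbar 0" "dd y \<in> fbar 0" using fbar_dd[of _ 0] assms by auto
    then show ?case using 3 by (auto simp: derived_br_eq intro!: fbar_act)
  qed (use assms in \<open>auto intro: subspace_0[OF fbar_subspace]\<close>)
  then have "homog k (nested_br derived_br x y w) \<in> fLie 1" for k w
    by (simp add: wcompletion_def)
  then show ?thesis
    unfolding wcompletion_def homog_bch[OF fbar_deg_part[OF assms(1)] fbar_deg_part[OF assms(2)]] mem_Collect_eq
    by (intro allI subspace_sum[OF fLie_subspace] subspace_scale[OF fLie_subspace])
qed

text \<open>Up to length k, Dynkin's form writes log(e^x e^y) through nested commutators, whose
  images are the nested derived brackets modulo boundaries. Longer words do not reach weight
  k.\<close>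

lemma bch_substN:
  assumes x: "x \<in> deg_part 1" and y: "y \<in> deg_part 1" and f: "f = (\<lambda>b. if b then x else y)"
  shows "bch x y - substN f (log_exp_exp True False) \<in> boundaries"
  unfolding boundaries_homog_iff[of "bch x y - substN f (log_exp_exp True False)"]
proof
  fix k
  let ?l = "log_exp_exp True False" and ?N = "nested_br derived_br x y"
  have f1: "f b \<in> deg_part 1" for b using x y by (simp add: f)
  have c: "bch_coeff w = wcoeff ?l w / real (length w)" for w
    by (simp add: bch_coeff_def log_exp_exp_def)
  have "ordge (Suc k) (?l - (\<Sum>m\<le>k. \<Sum>w | length w = m. wcoeff ?l w *\<^sub>R mono_nc w))"
    unfolding ordge_def
  proof (intro allI impI)
    fix u :: "bool list" assume "length u < Suc k"
    moreover have "(\<Sum>w | length w = m. wcoeff ?l w * (if u = w then 1 else 0)) = (if m = length u then wcoeff ?l u else 0)" for m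
    proof -
      have "(\<Sum>w | length w = m. wcoeff ?l w * (if u = w then 1 else 0)) = (\<Sum>w | length w = m. if w = u then wcoeff ?l u else 0)"
        by (rule sum.cong) auto
      then show ?thesis by (subst (asm) sum.delta) auto
    qed
    ultimately show "wcoeff (?l - (\<Sum>m\<le>k. \<Sum>w | length w = m. wcoeff ?l w *\<^sub>R mono_nc w)) u = 0"
      by (simp add: wcoeff_sum)
  qed
  moreover have "(\<Sum>m\<le>k. \<Sum>w | length w = m. wcoeff ?l w *\<^sub>R mono_nc w) =
      (\<Sum>m\<le>k. \<Sum>w | length w = m. bch_coeff w *\<^sub>R nested_comm w)"
    unfolding log_exp_exp_Dynkin[symmetric] by (intro sum.cong refl) (auto simp: c)
  ultimately have "ordge (Suc k) (?l - (\<Sum>m\<le>k. \<Sum>w | length w = m. bch_coeff w *\<^sub>R nested_comm w))"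
    by simp
  then have "ordge (Suc k) (substN f (?l - (\<Sum>m\<le>k. \<Sum>w | length w = m. bch_coeff w *\<^sub>R nested_comm w)))"
    using f1 deg_part_1_Nil[of _ 0] by (intro substN_ordge) auto
  then have o: "ordge (Suc k) (substN f ?l - (\<Sum>m\<le>k. \<Sum>w | length w = m. bch_coeff w *\<^sub>R substN f (nested_comm w)))"
    by (simp add: linear_diff[OF substN_linear] linear_sum[OF substN_linear] linear_scale[OF substN_linear])
  have "homog k (substN f ?l) = (\<Sum>m\<le>k. \<Sum>w | length w = m. bch_coeff w *\<^sub>R homog k (substN f (nested_comm w)))"
  proof (rule ncps_eqI)
    fix v
    show "wcoeff (homog k (substN f ?l)) v =
        wcoeff (\<Sum>m\<le>k. \<Sum>w | length w = m. bch_coeff w *\<^sub>R homog k (substN f (nested_comm w))) v"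
      using ordge_wcoeff[OF o, of v] length_le_weight[of v] by (simp add: wcoeff_sum)
  qed
  then have "homog k (bch x y - substN f ?l) =
      (\<Sum>m\<le>k. \<Sum>w | length w = m. bch_coeff w *\<^sub>R homog k (?N w - substN f (nested_comm w)))"
    by (simp add: homog_bch[OF x y] scaleR_diff_right sum_subtractf)
  also have "\<dots> \<in> boundaries"
    by (intro boundaries_simps(6) boundaries_simps(4) boundaries_homog_iff[THEN iffD1, rule_format]
        nested_br_substN x y f)
  finally show "homog k (bch x y - substN f ?l) \<in> boundaries" .
qed

text \<open>Evaluation of e^x e^y - 1 = (e^x - 1) + e^x (e^y - 1): left factors are differentiated,
  which turns e^x into \<open>nc_exp (dd x)\<close>.\<close>

theorem expN_bch:
  assumes x: "x \<in> deg_part 1" and y: "y \<in> deg_part 1"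
  shows "expN (bch x y) - (expN x + nc_exp (dd x) * expN y) \<in> boundaries"
proof -
  define f where "f = (\<lambda>b. if b then x else y)"
  have f1: "f b \<in> deg_part 1" for b using x y by (simp add: f_def)
  let ?l = "log_exp_exp True False" and ?T = "letter True" and ?F = "letter False"
  have "expN (substN f ?l) = substN f (nc_exp ?T * nc_exp ?F - 1)"
    using f1 by (subst expN_substN) (auto simp: log_exp_exp_def nc_exp_log)
  also have "nc_exp ?T * nc_exp ?F - 1 = nc_exp ?T * (nc_exp ?F - 1) + (nc_exp ?T - 1)"
    by (simp add: algebra_simps)
  also have "substN f \<dots> = subst (\<lambda>x. dd (f x)) (nc_exp ?T) * substN f (nc_exp ?F - 1) + substN f (nc_exp ?T - 1)"
    by (simp add: linear_add[OF substN_linear] substN_mult)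
  also have "subst (\<lambda>x. dd (f x)) (nc_exp ?T) = nc_exp (dd x)"
    using subst_mono[of "\<lambda>x. dd (f x)" "[True]"] by (simp add: nc_exp_ev subst_ev_fps f_def)
  also have "substN f (nc_exp ?F - 1) = expN y"
    using expN_substN[of f ?F] f1 by (simp add: substN_letter) (simp add: f_def)
  also have "substN f (nc_exp ?T - 1) = expN x"
    using expN_substN[of f ?T] f1 by (simp add: substN_letter) (simp add: f_def)
  finally have e: "expN (substN f ?l) = expN x + nc_exp (dd x) * expN y"
    by (simp add: add.commute)
  have "substN f ?l - bch x y \<in> boundaries"
    using boundaries_simps(5)[OF bch_substN[OF x y f_def]] by simp
  then have "expN (substN f ?l) - expN (bch x y) \<in> boundaries"
    by (intro expN_cong substN_deg_part f1)
  then show ?thesis using boundaries_simps(5)[of "expN (substN f ?l) - expN (bch x y)"] by (simp add: e)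
qed


section \<open>The surface Magnus expansion\<close>

declare Omega.simps [simp del]

lemma f1bar_eq: "f1bar = fbar 1" and g0bar_eq: "g0bar = fbar 0"
  by (simp_all add: f1bar_def g0bar_def)

text \<open>By \<open>boundaries_Lie\<close>, classes become congruence modulo
  \<open>boundaries\<close>, and products from the associative algebra may be used.\<close>

lemma mem_cls: "b \<in> cls a \<longleftrightarrow> a \<in> fbar 1 \<and> b \<in> fbar 1 \<and> a - b \<in> boundaries"
  using boundaries_Lie[of "a - b"] subspace_diff[OF fbar_subspace, of a 1 b]
  by (auto simp: cls_def peiffer_rel_def f1bar_eq)

lemma cls_eqI:
  assumes "a \<in> fbar 1" "b \<in> fbar 1" "a - b \<in> boundaries" shows "cls a = cls b"
proof -
  have "a - c \<in> boundaries \<longleftrightarrow> b - c \<in> boundaries" for c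
    using boundaries_simps(2)[of "b - c" "a - b"] boundaries_simps(3)[of "a - c" "a - b"] assms(3) by auto
  then show ?thesis using assms by (auto simp: mem_cls)
qed

lemma cls_gm1bar: "a \<in> fbar 1 \<Longrightarrow> cls a \<in> gm1bar"
  by (auto simp: gm1bar_def cls_def f1bar_eq intro: quotientI)

lemma gm1bar_cls: "A \<in> gm1bar \<Longrightarrow> \<exists>a. a \<in> fbar 1 \<and> A = cls a"
  by (auto simp: gm1bar_def cls_def f1bar_eq elim!: quotientE)

lemma mem_cls_self: "a \<in> fbar 1 \<Longrightarrow> a \<in> cls a"
  by (simp add: mem_cls)

lemma tau_cls: "a \<in> fbar 1 \<Longrightarrow> tau (cls a) = dd a"
proof -
  assume a: "a \<in> fbar 1"
  have "dd b = dd a" if "b \<in> cls a" for b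
    using that dd_boundaries[of "a - b"] by (simp add: mem_cls)
  then have "dd ` cls a = {dd a}"
    using imageI[OF mem_cls_self[OF a], of dd] by (intro subset_antisym image_subsetI) simp_all
  then show ?thesis by (simp add: tau_def)
qed

text \<open>\<open>BCH\<close> is a union over representatives and must be shown constant. By
  \<open>expN_bch\<close> all choices have the same \<open>expN\<close> modulo boundaries, and
  \<open>expN_inj\<close> brings this back to the elements.\<close>

lemma BCH_cls:
  assumes x: "x \<in> fbar 1" and y: "y \<in> fbar 1" and z: "z \<in> fbar 1"
    and e: "expN z - (expN x + nc_exp (dd x) * expN y) \<in> boundaries"
  shows "BCH (cls x) (cls y) = cls z"
proof -
  have "cls (bch x' y') = cls z" if xy: "x' \<in> cls x" "y' \<in> cls y" for x' y'
  proof (rule cls_eqI[OF _ z])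
    have m: "x' \<in> fbar 1" "y' \<in> fbar 1" "x - x' \<in> boundaries" "y - y' \<in> boundaries"
      using xy by (auto simp: mem_cls)
    note d = fbar_deg_part[OF m(1)] fbar_deg_part[OF m(2)] fbar_deg_part[OF x] fbar_deg_part[OF y]
    have dx: "dd x' = dd x" using dd_boundaries[OF m(3)] by simp
    have g: "nc_exp (dd x) \<in> deg_part 0" by (intro deg_part_exp dd_deg_part1 d) simp
    have 1: "nc_exp (dd x) * (expN y - expN y') \<in> boundaries"
      by (intro boundaries_mult(1) g expN_cong d m)
    have 2: "expN x - expN x' \<in> boundaries"
      by (intro expN_cong d m)
    have 3: "expN (bch x' y') - (expN x' + nc_exp (dd x) * expN y') \<in> boundaries"
      using expN_bch[OF d(1,2)] by (simp add: dx)
    have "(expN (bch x' y') - (expN x' + nc_exp (dd x) * expN y')) -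
        ((expN x - expN x') + nc_exp (dd x) * (expN y - expN y')) - (expN z - (expN x + nc_exp (dd x) * expN y)) \<in> boundaries"
      by (rule boundaries_simps(3)[OF boundaries_simps(3)[OF 3 boundaries_simps(2)[OF 2 1]] e])
    then have "expN (bch x' y') - expN z \<in> boundaries"
      by (simp add: algebra_simps)
    then show "bch x' y' - z \<in> boundaries"
      by (rule expN_inj[OF fbar_deg_part[OF bch_Lie[OF m(1,2)]] fbar_deg_part[OF z]])
    show "bch x' y' \<in> fbar 1" by (intro bch_Lie m)
  qed
  then show ?thesis
    unfolding BCH_def using mem_cls_self[OF x] mem_cls_self[OF y] by blast
qed

lemma exp_act_log: "wcoeff g [] = 1 \<Longrightarrow> exp_act (nc_log g) y = g * y * nc_inv g"
  by (simp add: exp_act_conj nc_exp_log nc_inv_def)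

lemma exp_act_Lie: "x \<in> fbar 0 \<Longrightarrow> y \<in> fbar p \<Longrightarrow> exp_act x y \<in> fbar p"
  unfolding exp_act_def by (rule fbar_op_series)

lemma exp_act_q_cls:
  assumes g: "wcoeff g [] = 1" "nc_log g \<in> fbar 0" "g \<in> deg_part 0" and y: "y \<in> fbar 1"
  shows "exp_act_q (nc_log g) (cls y) = cls (g * y * nc_inv g)"
proof -
  have "cls (exp_act (nc_log g) y') = cls (g * y * nc_inv g)" if "y' \<in> cls y" for y'
  proof (rule cls_eqI)
    have y': "y' \<in> fbar 1" "y - y' \<in> boundaries" using that by (auto simp: mem_cls)
    show "exp_act (nc_log g) y' \<in> fbar 1" "g * y * nc_inv g \<in> fbar 1"
      using exp_act_Lie[OF g(2) y'(1)] exp_act_Lie[OF g(2) y] by (simp_all add: exp_act_log g)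
    have "- (g * (y - y') * nc_inv g) \<in> boundaries"
      by (intro boundaries_simps(5) boundaries_mult y' g deg_part_inv)
    then show "exp_act (nc_log g) y' - g * y * nc_inv g \<in> boundaries"
      by (simp add: exp_act_log g algebra_simps)
  qed
  then show ?thesis unfolding exp_act_q_def using mem_cls_self[OF y] by blast
qed

lemma ev_fps_conj:
  assumes g: "wcoeff g [] = 1" and x: "wcoeff x [] = 0"
  shows "ev_fps f (g * x * nc_inv g) = g * ev_fps f x * nc_inv g"
proof -
  have "g * ev_fps f x * nc_inv g = op_series (fps_nth f) ((*) (g * x * nc_inv g)) (g * 1 * nc_inv g)"
    unfolding ev_fps_def
  proof (rule op_series_hom[where \<Phi> = "\<lambda>u. g * u * nc_inv g"])
    show "g * (x * u) * nc_inv g = g * x * nc_inv g * (g * u * nc_inv g)" for u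
    proof -
      have "g * x * nc_inv g * (g * u * nc_inv g) = g * x * (nc_inv g * g) * u * nc_inv g"
        by (simp only: mult.assoc)
      then show ?thesis by (simp add: nc_inv(2)[OF g] mult.assoc)
    qed
    show "ordge n (g * u * nc_inv g)" if "ordge n u" for n u
      by (intro ordge_mult_right ordge_mult_left that)
  qed (use x in \<open>auto intro!: raising_mult linearI simp: algebra_simps\<close>)
  then show ?thesis by (simp add: ev_fps_def nc_inv(1)[OF g])
qed

lemma dd_conj:
  assumes "g \<in> deg_part 0" "wcoeff g [] = 1" "y \<in> deg_part p"
  shows "dd (g * y * nc_inv g) = g * dd y * nc_inv g"
  using dd_mult_deg[OF assms(3), of "nc_inv g"] dd_deg0[OF deg_part_inv[OF assms(1,2)]] dd_mult_0[OF assms(1), of "y * nc_inv g"]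
  by (simp add: mult.assoc)

lemma expN_conj:
  assumes g: "g \<in> deg_part 0" "wcoeff g [] = 1" and y: "y \<in> deg_part 1"
  shows "expN (g * y * nc_inv g) = g * expN y * nc_inv g"
proof -
  have "expN (g * y * nc_inv g) = (g * ev_fps epsi_fps (dd y) * nc_inv g) * (g * y * nc_inv g)"
    by (simp only: expN_def dd_conj[OF g y] ev_fps_conj[OF g(2) dd_Nil])
  also have "\<dots> = g * ev_fps epsi_fps (dd y) * (nc_inv g * g) * y * nc_inv g"
    by (simp only: mult.assoc)
  finally show ?thesis by (simp add: nc_inv(2)[OF g(2)] expN_def mult.assoc)
qed

lemma nc_exp_conj:
  "wcoeff g [] = 1 \<Longrightarrow> wcoeff x [] = 0 \<Longrightarrow> nc_exp (g * x * nc_inv g) = g * nc_exp x * nc_inv g"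
  by (simp add: nc_exp_ev ev_fps_conj)

lemma dd_act_series:
  fixes x :: "'n::{finite,linorder} gen ncps"
  assumes x: "x \<in> deg_part 0" "wcoeff x [] = 0" and y: "y \<in> deg_part p"
  shows "dd (op_series c (act x) y) = op_series c (act x) (dd y)"
proof (rule op_series_eqI[OF raising_act[OF x(2)], symmetric])
  fix n
  have m: "(act x ^^ m) y \<in> deg_part p" for m
    using x y by (induction m) auto
  have p: "dd ((act x ^^ m) y) = (act x ^^ m) (dd y)" for m
  proof (induction m)
    case (Suc m)
    have "dd (act x ((act x ^^ m) y)) = act x (dd ((act x ^^ m) y))"
      using dd_mult_deg[OF m, of m x] dd_mult_0[OF x(1)] dd_deg0[OF x(1)] by (simp add: act_eq)
    then show ?case using Suc by simp
  qed simp
  have "ordge (Suc n) (dd (op_series c (act x) y - (\<Sum>m\<le>n. c m *\<^sub>R (act x ^^ m) y)))"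
    by (rule ordge_mono[OF dd_ordge[OF op_series_approx[OF raising_act[OF x(2)]]]]) simp
  then show "ordge (Suc n) (dd (op_series c (act x) y) - (\<Sum>m\<le>n. c m *\<^sub>R (act x ^^ m) (dd y)))"
    by (simp add: linear_sum[OF dd_linear] p)
qed

lemma boundaries_act_series:
  assumes x: "x \<in> deg_part 0" "wcoeff x [] = 0" and y: "y \<in> boundaries"
  shows "op_series c (act x) y \<in> boundaries"
proof -
  have "(act x ^^ m) y \<in> boundaries" for m
    using x y by (induction m) (auto simp: act_eq)
  then show ?thesis
    unfolding boundaries_homog_iff[of "op_series c (act x) y"] homog_op_series[OF raising_act[OF x(2)]]
    by (intro allI boundaries_simps(6) boundaries_simps(4) boundaries_homog_iff[THEN iffD1, rule_format])
qed

section \<open>Calculus compatible with \<open>dd\<close> and modulo boundaries\<close>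

lemma ncc_dd: "ncc S f \<Longrightarrow> ncc S (\<lambda>t. dd (f t))"
  by (auto simp: ncc_def wcoeff_dd intro!: continuous_intros)

lemma ncd_dd: "ncd f f' t S \<Longrightarrow> ncd (\<lambda>t. dd (f t)) (dd f') t S"
  unfolding ncd_def wcoeff_dd by (intro allI DERIV_sum DERIV_cmult_right) blast

lemma nint_dd: "ncc {a..b} f \<Longrightarrow> dd (nint a b f) = nint a b (\<lambda>t. dd (f t))"
  by (rule nint_linear_combination[where I = "\<lambda>w. {u. weight u = weight w}" and u = "\<lambda>w u. u"
        and c = "\<lambda>w u. wcoeff (d_word u) w"])
     (auto simp: wcoeff_dd ncc_dd mult.commute)

lemma nint_ncd_ray:
  assumes "\<And>d. ncc {c..d} f" "c \<le> t" shows "ncd (\<lambda>t. nint c t f) (f t) t {c..}"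
proof -
  have "at t within {c..} = at t within {c..t + 1}"
    by (rule at_within_nhd[of t "{..<t + 1}"]) auto
  then show ?thesis using nint_ncd[OF assms(1), of t "t + 1"] assms(2) by (simp add: ncd_def)
qed

text \<open>Made for \<open>has_quotient_derivative\<close>: f itself may be irregular, and the
  differentiable curve h congruent to it may depend on t. A functional vanishing on \<open>V\<close>
  does not distinguish f from h.\<close>

lemma homog_derivative_mod:
  fixes V :: "'n::finite gen ncps set"
  assumes V: "subspace V"
    and f: "\<And>t. t \<in> {a..b} \<Longrightarrow> \<exists>h h'. (\<forall>s\<in>{a..b}. homog k (f s - h s) \<in> V) \<and> homog k h' \<in> V \<and> ncd h h' t {a..b}"
    and ini: "homog k (f a) \<in> V" and x: "x \<in> {a..b}"
  shows "homog k (f x) \<in> V"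
proof (rule ccontr)
  assume "homog k (f x) \<notin> V"
  then obtain c where c: "\<And>v. homog k v \<in> V \<Longrightarrow> (\<Sum>w | weight w = k. c w * wcoeff v w) = 0"
    "(\<Sum>w | weight w = k. c w * wcoeff (f x) w) \<noteq> 0"
    using homog_functional[OF V] by blast
  let ?g = "\<lambda>t. \<Sum>w | weight w = k. c w * wcoeff (f t) w"
  have d: "(?g has_derivative (\<lambda>h. 0)) (at t within {a..b})" if t: "t \<in> {a..b}" for t
  proof -
    obtain h h' where h: "\<And>s. s \<in> {a..b} \<Longrightarrow> homog k (f s - h s) \<in> V" "homog k h' \<in> V" "ncd h h' t {a..b}"
      using f[OF t] by blast
    have "((\<lambda>t. \<Sum>w | weight w = k. c w * wcoeff (h t) w) has_real_derivative
        (\<Sum>w | weight w = k. c w * wcoeff h' w)) (at t within {a..b})"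
      using h(3) unfolding ncd_def by (intro DERIV_sum DERIV_cmult) blast
    then have dh: "((\<lambda>t. \<Sum>w | weight w = k. c w * wcoeff (h t) w) has_derivative (\<lambda>h. 0)) (at t within {a..b})"
      using c(1)[OF h(2)] by (simp add: has_field_derivative_def fun_eq_iff lambda_zero)
    have e: "?g s = (\<Sum>w | weight w = k. c w * wcoeff (h s) w)" if "s \<in> {a..b}" for s
      using c(1)[OF h(1)[OF that]] by (simp add: right_diff_distrib sum_subtractf)
    show ?thesis by (rule has_derivative_transform[OF t e dh])
  qed
  have "?g x = 0"
    by (rule has_derivative_zero_unique_strong_interval[OF finite.emptyI has_derivative_continuous_on[OF d] c(1)[OF ini] _ x])
       (auto intro: d)
  then show False using c(2) by simp
qed

lemma boundaries_derivative:
  assumes f: "\<And>t. t \<in> {a..b} \<Longrightarrow> \<exists>h h'. (\<forall>s\<in>{a..b}. f s - h s \<in> boundaries) \<and> h' \<in> boundaries \<and> ncd h h' t {a..b}"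
    and ini: "f a \<in> boundaries" and x: "x \<in> {a..b}"
  shows "f x \<in> boundaries"
proof -
  note hom = boundaries_homog_iff[THEN iffD1, rule_format]
  have "homog k (f x) \<in> boundaries" for k
  proof (rule homog_derivative_mod[where f = f, OF boundaries_subspace _ hom[OF ini] x])
    fix t assume "t \<in> {a..b}"
    then obtain h h' where h: "\<And>s. s \<in> {a..b} \<Longrightarrow> f s - h s \<in> boundaries" "h' \<in> boundaries" "ncd h h' t {a..b}"
      using f by blast
    show "\<exists>h h'. (\<forall>s\<in>{a..b}. homog k (f s - h s) \<in> boundaries) \<and> homog k h' \<in> boundaries \<and> ncd h h' t {a..b}"
      by (rule exI[of _ h], rule exI[of _ h'], intro conjI ballI hom h)
  qed
  then show ?thesis by (subst boundaries_homog_iff) blast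
qed

lemma beta_Lie: "beta X p \<in> fbar 1"
proof -
  have "letter (ZZ i j) \<in> fbar 1" if "i < j" for i j :: 'a
    using that by (intro fbar_fLie fLie_simps) (auto simp: generators_def)
  then show ?thesis
    unfolding beta_def by (intro subspace_sum[OF fbar_subspace]) (auto intro!: subspace_scale[OF fbar_subspace])
qed

text \<open>Vanishing of the fake curvature: antisymmetry turns the sum over i < j into a full
  double sum of commutators, which factorises as [A1, A2].\<close>

lemma dd_beta:
  fixes X :: "real \<times> real \<Rightarrow> real ^ 'a::{finite,linorder}"
  shows "dd (beta X p) = act (lets (frechet_derivative X (at p) (1, 0))) (lets (frechet_derivative X (at p) (0, 1)))"
proof -
  let ?a = "\<lambda>i. frechet_derivative X (at p) (1, 0) $ i" and ?b = "\<lambda>i. frechet_derivative X (at p) (0, 1) $ i"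
  let ?c = "\<lambda>i j. act (letter (Z i)) (letter (Z j))"
  let ?f = "\<lambda>(i, j). (?a i * ?b j) *\<^sub>R ?c i j"
  have ZZ: "dd (letter (ZZ i j)) = ?c i j" for i j :: 'a
    using dd_mono[of "[ZZ i j]"] by (simp add: gbr_def mono_nc_Nil act_eq)
  have "dd (beta X p) = (\<Sum>(i, j) | i < j. jac X i j p *\<^sub>R ?c i j)"
    by (simp add: beta_def linear_sum[OF dd_linear] ZZ case_prod_unfold)
  also have "\<dots> = (\<Sum>(i, j) | i < j. ?f (i, j) + ?f (j, i))"
    by (rule sum.cong) (auto simp: jac_def act_eq algebra_simps)
  also have "\<dots> = (\<Sum>q | fst q < snd q. ?f q) + (\<Sum>q | fst q < snd q. ?f (snd q, fst q))"
    by (simp add: case_prod_unfold sum.distrib)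
  also have "(\<Sum>q | fst q < snd q. ?f (snd q, fst q)) = (\<Sum>q | snd q < fst q. ?f q)"
    by (rule sum.reindex_bij_witness[of _ "\<lambda>q. (snd q, fst q)" "\<lambda>q. (snd q, fst q)"]) auto
  also have "(\<Sum>q | fst q < snd q. ?f q) + \<dots> = (\<Sum>q\<in>{q. fst q < snd q} \<union> {q. snd q < fst q}. ?f q)"
    by (rule sum.union_disjoint[symmetric]) auto
  also have "\<dots> = (\<Sum>q\<in>UNIV. ?f q)"
  proof (rule sum.mono_neutral_left)
    show "\<forall>q\<in>UNIV - ({q. fst q < snd q} \<union> {q. snd q < fst q}). ?f q = 0"
    proof
      fix q :: "'a \<times> 'a" assume "q \<in> UNIV - ({q. fst q < snd q} \<union> {q. snd q < fst q} :: ('a \<times> 'a) set)"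
      then have "fst q = snd q" by auto
      then show "?f q = 0" by (simp add: case_prod_unfold act_eq)
    qed
  qed auto
  also have "\<dots> = (\<Sum>i\<in>UNIV. \<Sum>j\<in>UNIV. ?f (i, j))"
    unfolding UNIV_Times_UNIV[symmetric] by (simp add: sum.cartesian_product)
  also have "\<dots> = act (lets (frechet_derivative X (at p) (1, 0))) (lets (frechet_derivative X (at p) (0, 1)))"
  proof -
    have "(\<Sum>j\<in>UNIV. \<Sum>i\<in>UNIV. (?b j *\<^sub>R letter (Z j)) * (?a i *\<^sub>R letter (Z i))) =
        (\<Sum>i\<in>UNIV. \<Sum>j\<in>UNIV. (?b j *\<^sub>R letter (Z j)) * (?a i *\<^sub>R letter (Z i)))"
      by (rule sum.swap)
    then show ?thesis
      by (simp add: lets_def act_eq sum_product sum_subtractf scaleR_diff_right mult.commute)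
  qed
  finally show ?thesis .
qed

lemma tr_deg_part: "tr y a r \<in> deg_part 0"
proof -
  have "set u \<subseteq> range Z" if "itr y a u r \<noteq> 0" for u r
    using that
  proof (induction u arbitrary: r)
    case (Cons g u)
    show ?case
    proof (cases g)
      case (Z i)
      have "\<exists>\<rho>. itr y a u \<rho> \<noteq> 0"
      proof (rule ccontr)
        assume "\<not> (\<exists>\<rho>. itr y a u \<rho> \<noteq> 0)"
        then show False using Cons.prems Z by simp
      qed
      then show ?thesis using Cons.IH Z by auto
    qed (use Cons.prems in simp)
  qed simp
  moreover have "set w \<subseteq> generators \<and> wdeg w = 0" if "set w \<subseteq> range Z" for w :: "'a gen list"
    using that by (induction w) auto
  ultimately show ?thesis unfolding deg_part_def tr_def by force
qed

locale smooth_surface =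
  fixes X :: "real \<times> real \<Rightarrow> real ^ 'n::{finite,linorder}"
  assumes smooth: "smooth X"
begin

definition "X1 p = frechet_derivative X (at p) (1, 0)"
definition "X2 p = frechet_derivative X (at p) (0, 1)"
definition "X12 p = frechet_derivative X1 (at p) (0, 1)"

lemma smooth_X1: "smooth X1"
  using smooth_deriv(2)[OF smooth, of "(1, 0)"] unfolding X1_def[abs_def] .

sublocale surface X X1 X2 X12
proof
  show "((\<lambda>r. X (r, t)) has_vector_derivative X1 (r, t)) (at r)" for r t
    unfolding X1_def by (rule smooth_partial(1)[OF smooth])
  show "((\<lambda>t. X (r, t)) has_vector_derivative X2 (r, t)) (at t)" for r t
    unfolding X2_def by (rule smooth_partial(2)[OF smooth])
  show "((\<lambda>t. X1 (r, t)) has_vector_derivative X12 (r, t)) (at t)" for r t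
    unfolding X12_def by (rule smooth_partial(2)[OF smooth_X1])
  show "continuous_on UNIV X1" "continuous_on UNIV X2" "continuous_on UNIV X12"
    unfolding X1_def[abs_def] X2_def[abs_def] X12_def[abs_def]
    by (rule smooth_deriv(3)[OF smooth] smooth_deriv(3)[OF smooth_X1[unfolded X1_def[abs_def]]])+
qed

lemma hor_deg [simp, intro]: "hor a b t \<in> deg_part 0" and ver_deg [simp, intro]: "ver r c d \<in> deg_part 0"
  by (simp_all add: hor_def ver_def tr_deg_part)

lemma loop_deg [simp, intro]: "loop a c b t \<in> deg_part 0"
  unfolding loop_def by (intro deg_part_mult0 deg_part_inv) auto

lemma stail_deg [simp, intro]: "stail a c r t \<in> deg_part 0"
  unfolding stail_def by (intro deg_part_mult0) auto

lemma hor_mult: "a \<le> m \<Longrightarrow> m \<le> b \<Longrightarrow> hor a m t * hor m b t = hor a b t"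
  using transport_unique[OF transport_join[OF _ _ transport_hor transport_hor] transport_hor] by force

lemma ver_mult: "c \<le> m \<Longrightarrow> m \<le> d \<Longrightarrow> ver r c m * ver r m d = ver r c d"
  using transport_unique[OF transport_join[OF _ _ transport_ver transport_ver] transport_ver] by force

lemma transport_bottom: "a \<le> b \<Longrightarrow> transport (X \<circ> linepath (a, t) (b, t)) 0 1 (hor a b t)"
  by (rule transport_line(1)[OF _ transport_hor])

lemma transport_left: "c \<le> d \<Longrightarrow> transport (X \<circ> linepath (r, c) (r, d)) 0 1 (ver r c d)"
  by (rule transport_line(2)[OF _ transport_ver])

lemma transport_tail: "a \<le> r \<Longrightarrow> c \<le> t \<Longrightarrow> transport (X \<circ> tail_path a c r t) 0 1 (stail a c r t)"
  unfolding tail_path_def stail_def path_compose_join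
  by (intro transport_joinpaths transport_bottom transport_left)

lemma transport_boundary:
  "a \<le> b \<Longrightarrow> c \<le> t \<Longrightarrow> transport (X \<circ> boundary_path ((a, c), (b, t))) 0 1 (loop a c b t)"
  unfolding boundary_path_def loop_def path_compose_join path_compose_reversepath
    bottom_edge.simps right_edge.simps top_edge.simps left_edge.simps mult.assoc
  by (intro transport_joinpaths transport_reversepath transport_bottom transport_left)

lemma piecewise_smooth_boundary: "piecewise_smooth (boundary_path R)"
proof -
  obtain a c b t where "R = ((a, c), (b, t))" by (metis surj_pair)
  then show ?thesis
    unfolding boundary_path_def
    by (auto simp: reversepath_linepath intro!: piecewise_smooth_join piecewise_smooth_linepath)
qed

lemma omega_tail: "a \<le> r \<Longrightarrow> c \<le> t \<Longrightarrow> omega X (pclass (tail_path a c r t)) = nc_log (stail a c r t)"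
  by (rule omega_pclass[OF smooth _ transport_tail])
     (auto simp: tail_path_def intro!: piecewise_smooth_join piecewise_smooth_linepath)

lemma omega_boundary:
  "a \<le> b \<Longrightarrow> c \<le> t \<Longrightarrow> omega X (pclass (boundary_path ((a, c), (b, t)))) = nc_log (loop a c b t)"
  by (rule omega_pclass[OF smooth piecewise_smooth_boundary transport_boundary])

lemma log_stail_Lie: "a \<le> r \<Longrightarrow> c \<le> t \<Longrightarrow> nc_log (stail a c r t) \<in> fbar 0"
  and log_loop_Lie: "a \<le> b \<Longrightarrow> c \<le> t \<Longrightarrow> nc_log (loop a c b t) \<in> fbar 0"
  and log_hor_Lie: "a \<le> b \<Longrightarrow> nc_log (hor a b t) \<in> fbar 0"
  and log_ver_Lie: "c \<le> d \<Longrightarrow> nc_log (ver r c d) \<in> fbar 0"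
  using transport_log_Lie[OF transport_tail] transport_log_Lie[OF transport_boundary]
    transport_log_Lie[OF transport_hor] transport_log_Lie[OF transport_ver]
  by (auto simp: g0bar_eq)

text \<open>Explicit representatives for \<open>Kint\<close>: the exponential of the action of log
  \<open>stail\<close> is conjugation by \<open>stail\<close>.\<close>

definition "Kint_fun a c r t = stail a c r t * beta X (r, t) * nc_inv (stail a c r t)"
definition "K a c b t = nint a b (\<lambda>r. Kint_fun a c r t)"

lemma ncc_stail:
  "ncc ({a..b} \<times> {c..d}) (\<lambda>p. stail a c (fst p) (snd p))"
proof (cases "c \<le> d")
  case True
  show ?thesis unfolding stail_def
    by (intro ncc_mult ncc_hor'[of _ _ _ a b] ncc_compose[OF ncc_ver[OF True]] continuous_intros) auto
qed (simp add: ncc_def)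

lemma ncc_Kint_fun: "ncc ({a..b} \<times> {c..d}) (\<lambda>p. Kint_fun a c (fst p) (snd p))"
proof -
  have "ncc S (\<lambda>p. beta X (fst p, snd p))" for S
    unfolding beta_def case_prod_unfold jac_def X1_def[symmetric] X2_def[symmetric]
    by (intro ncc_sum ncc_scale continuous_intros cont_param) auto
  then show ?thesis unfolding Kint_fun_def
    by (intro ncc_mult ncc_inv ncc_stail) auto
qed

lemma ncc_Kint_fun_r: "c \<le> t \<Longrightarrow> ncc {a..b} (\<lambda>r. Kint_fun a c r t)"
proof -
  assume "c \<le> t"
  then have i: "(\<lambda>r. (r, t)) ` {a..b} \<subseteq> {a..b} \<times> {c..t}" by auto
  have "continuous_on {a..b} (\<lambda>r. (r, t))" by (intro continuous_intros)
  from ncc_compose[OF ncc_Kint_fun this i] show ?thesis by simp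
qed

lemma ncc_K: "ncc {c..d} (K a c b)"
  unfolding ncc_def
proof
  fix w
  have i: "(\<lambda>p. (snd p, fst p)) ` ({c..d} \<times> {a..b}) \<subseteq> {a..b} \<times> {c..d}" by auto
  have "continuous_on ({c..d} \<times> {a..b}) (\<lambda>p. (snd p, fst p))" by (intro continuous_intros)
  from ncc_compose[OF ncc_Kint_fun this i]
  have "ncc ({c..d} \<times> {a..b}) (\<lambda>p. Kint_fun a c (snd p) (fst p))" by simp
  then have "continuous_on {c..d} (\<lambda>t. integral (cbox a b) (\<lambda>r. wcoeff (Kint_fun a c r t) w))"
    by (intro integral_continuous_on_param) (auto simp: ncc_def split_beta)
  then show "continuous_on {c..d} (\<lambda>t. wcoeff (K a c b t) w)"
    by (simp add: K_def wcoeff_nint)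
qed

lemma Kint_fun_Lie: "a \<le> r \<Longrightarrow> c \<le> t \<Longrightarrow> Kint_fun a c r t \<in> fbar 1"
  using exp_act_Lie[OF log_stail_Lie beta_Lie[of X "(r, t)"], of a r c t] by (simp add: Kint_fun_def exp_act_log)

lemma K_Lie: "c \<le> t \<Longrightarrow> K a c b t \<in> fbar 1"
  unfolding K_def by (intro wcompletion_nint fLie_subspace ncc_Kint_fun_r Kint_fun_Lie) auto

lemma K_deg: "c \<le> t \<Longrightarrow> K a c b t \<in> deg_part 1"
  by (intro fbar_deg_part K_Lie)

lemma Kint_K: "c \<le> t \<Longrightarrow> Kint X a c b t = cls (K a c b t)"
proof -
  assume t: "c \<le> t"
  have "Ncps (\<lambda>w. integral {a..b} (\<lambda>r. wcoeff (exp_act (omega X (pclass (tail_path a c r t))) (beta X (r, t))) w)) = K a c b t"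
    unfolding K_def nint_def
    by (intro arg_cong[of _ _ Ncps] ext Henstock_Kurzweil_Integration.integral_cong)
       (use t in \<open>auto simp: omega_tail exp_act_log Kint_fun_def\<close>)
  then show ?thesis by (simp add: Kint_def)
qed

lemma dd_K: "c \<le> t \<Longrightarrow> dd (K a c b t) = nint a b (\<lambda>r. stail a c r t * curv (r, t) * nc_inv (stail a c r t))"
  unfolding K_def
  by (subst nint_dd[OF ncc_Kint_fun_r])
     (auto intro!: nint_cong simp: Kint_fun_def dd_conj[OF _ _ fbar_deg_part[OF beta_Lie]] dd_beta curv_def X1_def X2_def)

lemma loop_ncd: "a \<le> b \<Longrightarrow> c \<le> t \<Longrightarrow> ncd (loop a c b) (loop a c b t * dd (K a c b t)) t {c..}"
  using stokes by (simp add: dd_K)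

lemma loop_start [simp]: "loop a c b c = 1"
  using nc_inv(1)[of "hor a b c"] by (simp add: loop_def)

lemma ncc_loop: "a \<le> b \<Longrightarrow> ncc {c..d} (loop a c b)"
  by (rule ncd_imp_ncc[OF ncd_subset[OF loop_ncd]]) auto

lemma nc_log_1 [simp]: "nc_log 1 = (0 :: 'x ncps)"
  using nc_log_exp[of "0 :: 'x ncps"] by simp

definition "Om_fun a c b t = toddad (nc_log (loop a c b t)) (K a c b t)"
definition "Om a c b t = nint c t (Om_fun a c b)"

lemma Om_fun_Lie: "a \<le> b \<Longrightarrow> c \<le> t \<Longrightarrow> Om_fun a c b t \<in> fbar 1"
  unfolding Om_fun_def by (intro fbar_op_series log_loop_Lie K_Lie)

lemma ncc_Om_fun: "a \<le> b \<Longrightarrow> ncc {c..d} (Om_fun a c b)"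
  unfolding Om_fun_def[abs_def] by (intro ncc_act_series ncc_log ncc_loop ncc_K) auto

lemma Om_Lie: "a \<le> b \<Longrightarrow> c \<le> t \<Longrightarrow> Om a c b t \<in> fbar 1"
  unfolding Om_def by (intro wcompletion_nint fLie_subspace ncc_Om_fun Om_fun_Lie) auto

lemma Om_ncd: "a \<le> b \<Longrightarrow> c \<le> t \<Longrightarrow> ncd (Om a c b) (Om_fun a c b t) t {c..}"
  unfolding Om_def[abs_def] by (intro nint_ncd_ray ncc_Om_fun)

text \<open>\<open>dd\<close> passes through the integral and the Todd series; by Stokes and
  \<open>log_derivative\<close> the integrand becomes the derivative of the logarithm of the
  loop.\<close>

lemma dd_Om:
  assumes "a \<le> b" "c \<le> t" shows "dd (Om a c b t) = nc_log (loop a c b t)"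
proof -
  let ?L = "\<lambda>t. nc_log (loop a c b t)"
  have "dd (Om a c b t) = nint c t (\<lambda>t. dd (Om_fun a c b t))"
    unfolding Om_def by (rule nint_dd[OF ncc_Om_fun[OF assms(1)]])
  also have "\<dots> = nint c t (\<lambda>t. toddad (?L t) (dd (K a c b t)))"
    unfolding Om_fun_def
    by (intro nint_cong dd_act_series[OF deg_part_log _ K_deg]) auto
  also have "\<dots> = ?L t - ?L c"
  proof (rule nint_ftc[OF assms(2)])
    fix s assume "s \<in> {c..t}"
    then have "ncd ?L (toddad (?L s) (dd (K a c b s))) s {c..}"
      by (intro log_derivative loop_ncd assms at_within_ray) auto
    then show "ncd ?L (toddad (?L s) (dd (K a c b s))) s {c..t}"
      by (rule ncd_subset) auto
  qed
  finally show ?thesis by simp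
qed

text \<open>\<open>E\<close> is the integral of H K. Its image under \<open>dd\<close> is H - 1, as
  befits an exponential minus one.\<close>

definition "E_fun a c b t = loop a c b t * K a c b t"
definition "E a c b t = nint c t (E_fun a c b)"

lemma ncc_E_fun: "a \<le> b \<Longrightarrow> ncc {c..d} (E_fun a c b)"
  unfolding E_fun_def[abs_def] by (intro ncc_mult ncc_loop ncc_K)

lemma E_ncd: "a \<le> b \<Longrightarrow> c \<le> t \<Longrightarrow> ncd (E a c b) (E_fun a c b t) t {c..}"
  unfolding E_def[abs_def] by (intro nint_ncd_ray ncc_E_fun)

lemma E_start [simp]: "E a c b c = 0" and Om_start [simp]: "Om a c b c = 0"
  by (simp_all add: E_def Om_def)

lemma E_fun_deg: "c \<le> t \<Longrightarrow> E_fun a c b t \<in> deg_part 1"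
  unfolding E_fun_def by (intro deg_part_mult0(1) loop_deg K_deg)

lemma E_deg: "E a c b t \<in> deg_part 1"
  unfolding E_def by (intro deg_part_nint E_fun_deg) auto

lemma dd_E:
  assumes "a \<le> b" "c \<le> t" shows "dd (E a c b t) = loop a c b t - 1"
proof -
  have "dd (E a c b t) = nint c t (\<lambda>t. dd (E_fun a c b t))"
    unfolding E_def by (rule nint_dd[OF ncc_E_fun[OF assms(1)]])
  also have "\<dots> = nint c t (\<lambda>t. loop a c b t * dd (K a c b t))"
    unfolding E_fun_def by (simp add: dd_mult_0)
  also have "\<dots> = loop a c b t - loop a c b c"
    by (rule nint_ftc[OF assms(2)]) (auto intro: ncd_subset[OF loop_ncd[OF assms(1)]])
  finally show ?thesis by simp
qed

text \<open>In the derivative of \<open>expN\<close> the series phi cancels the Todd series, leaving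
  H K, the integrand of \<open>E\<close>, modulo boundaries; both sides vanish at height c.\<close>

theorem expN_Om:
  assumes "a \<le> b" "c \<le> d" shows "expN (Om a c b d) - E a c b d \<in> boundaries"
proof (rule boundaries_derivative[of c d "\<lambda>t. expN (Om a c b t) - E a c b t"])
  fix t assume t: "t \<in> {c..d}"
  then have ct: "c \<le> t" by simp
  have w: "dd (Om a c b t) = nc_log (loop a c b t)" by (rule dd_Om[OF assms(1) ct])
  have "\<exists>D. ncd (\<lambda>s. expN (Om a c b s)) D t {c..d} \<and>
      D - nc_exp (dd (Om a c b t)) * op_series (fps_nth phi_fps) (act (dd (Om a c b t))) (Om_fun a c b t) \<in> boundaries"
  proof (rule expN_derivative[OF ncd_subset[OF Om_ncd[OF assms(1) ct]] t])
    show "Om a c b s \<in> deg_part 1" if "s \<in> {c..d}" for s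
      by (intro fbar_deg_part Om_Lie assms(1)) (use that in simp)
    show "Om_fun a c b t \<in> deg_part 1"
      by (intro fbar_deg_part Om_fun_Lie assms(1) ct)
  qed auto
  moreover have "nc_exp (dd (Om a c b t)) * op_series (fps_nth phi_fps) (act (dd (Om a c b t))) (Om_fun a c b t) = E_fun a c b t"
    by (simp add: w Om_fun_def phi_todd_op nc_exp_log E_fun_def)
  ultimately obtain D where D: "ncd (\<lambda>s. expN (Om a c b s)) D t {c..d}" "D - E_fun a c b t \<in> boundaries" by auto
  have "ncd (\<lambda>s. expN (Om a c b s) - E a c b s) (D - E_fun a c b t) t {c..d}"
    by (rule ncd_diff[OF D(1) ncd_subset[OF E_ncd[OF assms(1) ct]]]) auto
  then show "\<exists>h h'. (\<forall>s\<in>{c..d}. expN (Om a c b s) - E a c b s - h s \<in> boundaries) \<and> h' \<in> boundaries \<and> ncd h h' t {c..d}"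
    using D(2) by (intro exI[of _ "\<lambda>s. expN (Om a c b s) - E a c b s"] exI[of _ "D - E_fun a c b t"]) auto
qed (use assms in \<open>auto simp: expN_def\<close>)

subsection \<open>The Magnus equation\<close>

lemma magnus_eq_Om: "a \<le> b \<Longrightarrow> magnus_eq X a c b (\<lambda>t. cls (Om a c b t))"
  unfolding magnus_eq_def has_quotient_derivative_def
proof (intro conjI allI impI)
  fix t assume ab: "a \<le> b" and t: "c \<le> t"
  show "cls (Om a c b t) \<in> gm1bar" by (intro cls_gm1bar Om_Lie ab t)
  have "Om_fun a c b t \<in> todd_q (cls (Om a c b t)) (Kint X a c b t)"
  proof -
    have "Om_fun a c b t \<in> cls (todd (Om a c b t) (K a c b t))"
      using mem_cls_self[OF Om_fun_Lie[OF ab t]] by (simp add: todd_eq dd_Om ab t Om_fun_def)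
    then show ?thesis
      unfolding todd_q_def Kint_K[OF t] using mem_cls_self[OF Om_Lie[OF ab t]] mem_cls_self[OF K_Lie[OF t]] by blast
  qed
  moreover have "\<forall>w. ((\<lambda>s. wcoeff (Om a c b s) w) has_real_derivative wcoeff (Om_fun a c b t) w) (at t within {c..})"
    using Om_ncd[OF ab t] by (simp add: ncd_def)
  moreover have "\<forall>s\<in>{c..}. Om a c b s \<in> cls (Om a c b s)"
    by (auto intro!: mem_cls_self Om_Lie ab)
  ultimately show "\<exists>f f'. f' \<in> todd_q (cls (Om a c b t)) (Kint X a c b t) \<and> (\<forall>s\<in>{c..}. f s \<in> cls (Om a c b s)) \<and>
      (\<forall>w. ((\<lambda>s. wcoeff (f s) w) has_real_derivative wcoeff f' w) (at t within {c..}))"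
    by blast
qed simp

text \<open>Uniqueness: the equation determines \<open>\<tau>\<close> of a solution, as the logarithm of a solution of a
  linear equation, and the right hand side depends on the solution only through \<open>\<tau>\<close>.\<close>

lemma magnus_eq_unique:
  assumes ab: "a \<le> b" and cd: "c \<le> d" and m: "magnus_eq X a c b Om'"
  shows "Om' d = cls (Om a c b d)"
proof -
  have m0: "Om' c = cls 0" and mg: "\<And>t. c \<le> t \<Longrightarrow> Om' t \<in> gm1bar"
    and md: "\<And>t. c \<le> t \<Longrightarrow> has_quotient_derivative Om' (todd_q (Om' t) (Kint X a c b t)) t {c..}"
    using m by (auto simp: magnus_eq_def)
  obtain g where g: "\<And>t. c \<le> t \<Longrightarrow> g t \<in> fbar 1" "\<And>t. c \<le> t \<Longrightarrow> Om' t = cls (g t)"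
    using gm1bar_cls[OF mg] by metis
  define w where "w = (\<lambda>t. dd (g t))"
  have wu: "dd u = w t" if "u \<in> Om' t" "c \<le> t" for u t
    using that dd_boundaries[of "g t - u"] by (simp add: g(2) mem_cls w_def)
  have gd: "g t \<in> deg_part 1" if "c \<le> t" for t by (intro fbar_deg_part g that)
  have w0: "w t \<in> deg_part 0" "wcoeff (w t) [] = 0" if "c \<le> t" for t
    using gd[OF that] by (auto simp: w_def intro: dd_deg_part1)
  \<comment> \<open>The lift and the representatives x, k may change with t. \<open>todd\<close>
    sees x only through \<open>dd x\<close>, which is \<open>w t\<close>, and k is replaced by
    \<open>K\<close> at the cost of a boundary.\<close>
  have lift: "\<exists>f f'. (\<forall>s\<ge>c. f s \<in> Om' s) \<and> ncd f f' t {c..} \<and> f' - toddad (w t) (K a c b t) \<in> boundaries"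
    if t: "c \<le> t" for t
  proof -
    obtain f f' where f: "f' \<in> todd_q (Om' t) (Kint X a c b t)" "\<And>s. c \<le> s \<Longrightarrow> f s \<in> Om' s"
      "ncd f f' t {c..}"
      using md[OF t] unfolding has_quotient_derivative_def ncd_def by auto
    then obtain x k where xk: "x \<in> Om' t" "k \<in> cls (K a c b t)" "f' \<in> cls (todd x k)"
      by (auto simp: todd_q_def Kint_K[OF t])
    have 1: "toddad (w t) k - f' \<in> boundaries"
      using xk(3) wu[OF xk(1) t] by (simp add: mem_cls todd_eq)
    have 2: "toddad (w t) (K a c b t - k) \<in> boundaries"
      using xk(2) by (intro boundaries_act_series w0 t) (simp add: mem_cls)
    have "- (toddad (w t) k - f') - toddad (w t) (K a c b t - k) \<in> boundaries"
      by (rule boundaries_simps(3)[OF boundaries_simps(5)[OF 1] 2])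
    then have "f' - toddad (w t) (K a c b t) \<in> boundaries"
      by (simp add: linear_diff[OF op_series_linear[OF raising_act[OF w0(2)[OF t]]]])
    then show ?thesis using f by blast
  qed
  \<comment> \<open>\<open>dd\<close> of every lift is \<open>w\<close>, so \<open>w\<close>
    inherits its derivative at t from the lift belonging to that t.\<close>
  have "ncd w (toddad (w t) (dd (K a c b t))) t {c..}" if t: "c \<le> t" for t
  proof -
    obtain f f' where f: "\<And>s. c \<le> s \<Longrightarrow> f s \<in> Om' s" "ncd f f' t {c..}" "f' - toddad (w t) (K a c b t) \<in> boundaries"
      using lift[OF t] by blast
    have "dd f' = dd (toddad (w t) (K a c b t))" using dd_boundaries[OF f(3)] by simp
    also have "\<dots> = toddad (w t) (dd (K a c b t))" by (intro dd_act_series[OF _ _ K_deg] w0 t)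
    finally have "ncd (\<lambda>s. dd (f s)) (toddad (w t) (dd (K a c b t))) t {c..}"
      using ncd_dd[OF f(2)] by simp
    then show ?thesis by (rule ncd_transform) (use t wu[OF f(1)] in auto)
  qed
  then have we: "ncd (\<lambda>s. nc_exp (w s)) (nc_exp (w t) * dd (K a c b t)) t {c..}" if "c \<le> t" for t
    using that w0(2) by (intro log_ode_exp) auto
  have "0 \<in> Om' c" by (simp add: m0 mem_cls subspace_0[OF fbar_subspace])
  then have wc: "w c = 0" using wu[of 0 c] by simp
  have "nc_exp (w t) = loop a c b t" if t: "c \<le> t" for t
    by (rule linear_ode_unique[of "{}" c t "\<lambda>s. nc_exp (w s)" "\<lambda>s. dd (K a c b s)" "loop a c b"])
       (use t wc in \<open>auto intro!: ncd_imp_ncc[OF ncd_subset[OF we]] ncc_loop ab intro: ncd_subset[OF we] ncd_subset[OF loop_ncd[OF ab]]\<close>)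
  then have wl: "w t = nc_log (loop a c b t)" if "c \<le> t" for t
    using nc_log_exp[OF w0(2)[OF that]] that by simp
  have "g d - Om a c b d \<in> boundaries"
  proof (rule boundaries_derivative[of c d "\<lambda>t. g t - Om a c b t"])
    fix t assume t: "t \<in> {c..d}"
    then obtain f f' where f: "\<And>s. c \<le> s \<Longrightarrow> f s \<in> Om' s" "ncd f f' t {c..}" "f' - toddad (w t) (K a c b t) \<in> boundaries"
      using lift[of t] by auto
    have "ncd (\<lambda>s. f s - Om a c b s) (f' - Om_fun a c b t) t {c..}"
      using t by (intro ncd_diff f Om_ncd ab) auto
    then have "ncd (\<lambda>s. f s - Om a c b s) (f' - Om_fun a c b t) t {c..d}"
      by (rule ncd_subset) auto
    moreover have "f' - Om_fun a c b t \<in> boundaries" using f(3) t by (simp add: Om_fun_def wl)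
    moreover have "g s - Om a c b s - (f s - Om a c b s) \<in> boundaries" if "s \<in> {c..d}" for s
      using f(1)[of s] that g(2)[of s] by (simp add: mem_cls)
    ultimately show "\<exists>h h'. (\<forall>s\<in>{c..d}. g s - Om a c b s - h s \<in> boundaries) \<and> h' \<in> boundaries \<and> ncd h h' t {c..d}"
      by (intro exI[of _ "\<lambda>s. f s - Om a c b s"] exI[of _ "f' - Om_fun a c b t"] conjI ballI)
  next
    have "g c \<in> cls 0" using g[of c] m0 mem_cls_self by auto
    then have "- (0 - g c) \<in> boundaries" by (intro boundaries_simps(5)) (simp add: mem_cls)
    then show "g c - Om a c b c \<in> boundaries" by simp
  qed (use cd in auto)
  then show ?thesis
    unfolding g(2)[OF cd] by (intro cls_eqI g(1) Om_Lie ab cd)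
qed

section \<open>Identification of \<open>Omega\<close> and the composition laws\<close>

theorem Omega_Om: "a \<le> b \<Longrightarrow> c \<le> d \<Longrightarrow> Omega X ((a, c), (b, d)) = cls (Om a c b d)"
  unfolding Omega.simps
  by (rule the_equality) (use magnus_eq_Om magnus_eq_unique in blast)+

text \<open>Reduces a composition law to an identity for \<open>E\<close> modulo boundaries, since
  \<open>expN\<close> separates classes and sends the expansion to \<open>E\<close>.\<close>

lemma Omega_BCH:
  assumes "a \<le> b" "c \<le> d" and x: "x \<in> fbar 1" and y: "y \<in> fbar 1"
    and e: "E a c b d - (expN x + nc_exp (dd x) * expN y) \<in> boundaries"
  shows "Omega X ((a, c), (b, d)) = BCH (cls x) (cls y)"
proof -
  have "(expN (Om a c b d) - E a c b d) + (E a c b d - (expN x + nc_exp (dd x) * expN y)) \<in> boundaries"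
    by (rule boundaries_simps(2)[OF expN_Om[OF assms(1,2)] e])
  then have "expN (Om a c b d) - (expN x + nc_exp (dd x) * expN y) \<in> boundaries"
    by (simp add: algebra_simps)
  then show ?thesis
    unfolding Omega_Om[OF assms(1,2)] by (rule BCH_cls[OF x y Om_Lie[OF assms(1,2)], symmetric])
qed

text \<open>Above height m the loop is H_A times the loop of B conjugated by the left edge g of A,
  and \<open>K\<close> is conjugated alike. Splitting the integral of H K at m gives E_A + H_A (g
  E_B g^-1) exactly.\<close>

theorem Omega_vertical:
  assumes ab: "a \<le> b" and cm: "c \<le> m" and md: "m \<le> d"
  shows "Omega X ((a, c), (b, d)) =
    BCH (Omega X ((a, c), (b, m))) (exp_act_q (nc_log (ver a c m)) (Omega X ((a, m), (b, d))))"
proof -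
  let ?g = "ver a c m" and ?HA = "loop a c b m"
  let ?y = "?g * Om a m b d * nc_inv ?g"
  have iv: "nc_inv ?g * (?g * z) = z" for z
    using nc_inv(2)[of ?g] by (simp add: mult.assoc[symmetric])
  have ih: "nc_inv (hor a b m) * (hor a b m * z) = z" for z
    using nc_inv(2)[of "hor a b m"] by (simp add: mult.assoc[symmetric])
  have l: "loop a c b t = ?HA * ?g * loop a m b t * nc_inv ?g" if "m \<le> t" for t
    using ver_mult[OF cm that, of a, symmetric] ver_mult[OF cm that, of b, symmetric]
    by (simp add: loop_def nc_inv_mult mult.assoc iv ih)
  have k: "K a c b t = ?g * K a m b t * nc_inv ?g" if t: "m \<le> t" for t
  proof -
    have c: "ncc {a..b} (\<lambda>r. Kint_fun a m r t)" "ncc {a..b} (\<lambda>r. ?g * Kint_fun a m r t)"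
      using ncc_Kint_fun_r[OF t] by auto
    have "Kint_fun a c r t = ?g * Kint_fun a m r t * nc_inv ?g" for r
      using ver_mult[OF cm t, of a, symmetric]
      by (simp add: Kint_fun_def stail_def nc_inv_mult mult.assoc)
    then show ?thesis
      unfolding K_def by (simp add: nint_mult_right[OF c(2)] nint_mult_left[OF c(1)])
  qed
  have EA: "E a c b d = E a c b m + ?HA * (?g * E a m b d * nc_inv ?g)"
  proof -
    have cB: "ncc {m..d} (E_fun a m b)" "ncc {m..d} (\<lambda>t. ?HA * ?g * E_fun a m b t)"
      using ncc_E_fun[OF ab] by auto
    have "E a c b d = nint c m (E_fun a c b) + nint m d (E_fun a c b)"
      unfolding E_def by (rule nint_combine[OF cm md ncc_E_fun[OF ab], symmetric])
    also have "nint m d (E_fun a c b) = nint m d (\<lambda>t. ?HA * ?g * E_fun a m b t * nc_inv ?g)"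
    proof (rule nint_cong)
      fix t assume "t \<in> {m..d}"
      then have t: "m \<le> t" by simp
      show "E_fun a c b t = ?HA * ?g * E_fun a m b t * nc_inv ?g"
        unfolding E_fun_def l[OF t] k[OF t] by (simp add: mult.assoc iv)
    qed
    also have "\<dots> = ?HA * ?g * E a m b d * nc_inv ?g"
      by (simp add: nint_mult_right[OF cB(2)] nint_mult_left[OF cB(1)] E_def)
    finally show ?thesis by (simp add: E_def mult.assoc)
  qed
  have OB: "Om a m b d \<in> fbar 1" by (rule Om_Lie[OF ab md])
  have y: "?y \<in> fbar 1"
    using exp_act_Lie[OF log_ver_Lie[OF cm] OB] by (simp add: exp_act_log)
  have 1: "expN (Om a c b m) - E a c b m \<in> boundaries" by (rule expN_Om[OF ab cm])
  have 2: "?HA * (?g * (expN (Om a m b d) - E a m b d) * nc_inv ?g) \<in> boundaries"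
    by (intro boundaries_mult expN_Om ab md loop_deg ver_deg deg_part_inv) simp
  have "- ((expN (Om a c b m) - E a c b m) + ?HA * (?g * (expN (Om a m b d) - E a m b d) * nc_inv ?g)) \<in> boundaries"
    by (rule boundaries_simps(5)[OF boundaries_simps(2)[OF 1 2]])
  moreover have "expN ?y = ?g * expN (Om a m b d) * nc_inv ?g"
    by (rule expN_conj[OF _ _ fbar_deg_part[OF OB]]) auto
  moreover have "nc_exp (dd (Om a c b m)) = ?HA"
    by (simp add: dd_Om ab cm nc_exp_log)
  ultimately have "E a c b d - (expN (Om a c b m) + nc_exp (dd (Om a c b m)) * expN ?y) \<in> boundaries"
    by (simp add: EA algebra_simps)
  then have "Omega X ((a, c), (b, d)) = BCH (cls (Om a c b m)) (cls ?y)"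
    using cm md by (intro Omega_BCH ab Om_Lie y) auto
  then show ?thesis
    using exp_act_q_cls[OF _ log_ver_Lie[OF cm] _ OB, of a] by (simp add: Omega_Om ab cm md)
qed

text \<open>Both rectangles grow together with t, so the integral does not split in time. Instead H
  = P H_A, and E is compared with G + P E_A by differentiating in t modulo boundaries.\<close>

theorem Omega_horizontal:
  assumes am: "a \<le> m" and mb: "m \<le> b" and cd: "c \<le> d"
  shows "Omega X ((a, c), (b, d)) =
    BCH (exp_act_q (nc_log (hor a m c)) (Omega X ((m, c), (b, d)))) (Omega X ((a, c), (m, d)))"
proof -
  let ?g = "hor a m c"
  let ?A = "loop a c m" and ?B = "loop m c b"
  let ?x = "?g * Om m c b d * nc_inv ?g"
  \<comment> \<open>\<open>P\<close> is the loop of B and \<open>G\<close> its integral E_B, both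
    conjugated by the bottom edge of A. \<open>G'\<close> is the derivative of \<open>G\<close>, and
    \<open>dd (G' t)\<close> will be that of \<open>P\<close>.\<close>
  define P where "P = (\<lambda>t. ?g * ?B t * nc_inv ?g)"
  define G where "G = (\<lambda>t. ?g * E m c b t * nc_inv ?g)"
  define G' where "G' = (\<lambda>t. ?g * E_fun m c b t * nc_inv ?g)"
  have ab: "a \<le> b" using am mb by simp
  have ig: "nc_inv ?g * (?g * z) = z" for z
    using nc_inv(2)[of ?g] by (simp add: mult.assoc[symmetric])
  have iv: "nc_inv (ver m c t) * (ver m c t * z) = z" for t z
    using nc_inv(2)[of "ver m c t"] by (simp add: mult.assoc[symmetric])
  have iA: "?A t * (nc_inv (?A t) * z) = z" for t z
    using nc_inv(1)[of "?A t"] by (simp add: mult.assoc[symmetric])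
  have ii: "nc_inv (nc_inv x) = x" if "wcoeff x [] = 1" for x :: "'n gen ncps"
    using nc_inv_unique[OF nc_inv(3)[OF that], of x] nc_inv[OF that] by simp
  have l: "loop a c b t = P t * ?A t" for t
    using hor_mult[OF am mb, of t, symmetric] hor_mult[OF am mb, of c, symmetric]
    by (simp add: P_def loop_def nc_inv_mult mult.assoc iv ig)
  \<comment> \<open>A point right of m is reached by going once clockwise round A, then along its
    bottom edge, then along the tail path of B: the inverse loop cancels the detour.\<close>
  have st: "stail a c r t = nc_inv (?A t) * ?g * stail m c r t" if "m \<le> r" for r t
  proof -
    have "nc_inv (?A t) = ver a c t * hor a m t * nc_inv (ver m c t) * nc_inv ?g"
      by (simp add: loop_def nc_inv_mult nc_inv ii mult.assoc)
    then show ?thesis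
      using hor_mult[OF am that, of t, symmetric] by (simp add: stail_def mult.assoc ig iv)
  qed
  have k: "K a c b t = K a c m t + nc_inv (?A t) * ?g * K m c b t * nc_inv ?g * ?A t" if t: "c \<le> t" for t
  proof -
    have c: "ncc {m..b} (\<lambda>r. Kint_fun m c r t)" "ncc {m..b} (\<lambda>r. nc_inv (?A t) * ?g * Kint_fun m c r t)"
      using ncc_Kint_fun_r[OF t] by auto
    have "K a c b t = K a c m t + nint m b (\<lambda>r. Kint_fun a c r t)"
      unfolding K_def by (rule nint_combine[OF am mb ncc_Kint_fun_r[OF t], symmetric])
    also have "nint m b (\<lambda>r. Kint_fun a c r t) = nint m b (\<lambda>r. nc_inv (?A t) * ?g * Kint_fun m c r t * (nc_inv ?g * ?A t))"
      by (rule nint_cong) (simp add: Kint_fun_def st nc_inv_mult nc_inv ii mult.assoc)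
    also have "\<dots> = nc_inv (?A t) * ?g * K m c b t * (nc_inv ?g * ?A t)"
      by (simp add: nint_mult_right[OF c(2)] nint_mult_left[OF c(1)] K_def)
    finally show ?thesis by (simp add: mult.assoc)
  qed
  have e: "E_fun a c b t = P t * E_fun a c m t + G' t * ?A t" if "c \<le> t" for t
    unfolding E_fun_def l k[OF that] G'_def
    by (simp add: P_def distrib_left mult.assoc iA ig)
  have P': "ncd P (dd (G' t)) t {c..}" if t: "c \<le> t" for t
  proof -
    have "dd (G' t) = ?g * (?B t * dd (K m c b t)) * nc_inv ?g"
      using dd_conj[of ?g "E_fun m c b t" 1] E_fun_deg[OF t] by (simp add: G'_def E_fun_def dd_mult_0)
    then show ?thesis unfolding P_def
      using ncd_mult_right[OF ncd_mult_left[OF loop_ncd[OF mb t]]] by simp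
  qed
  have Gd: "ncd G (G' t) t {c..}" if "c \<le> t" for t
    unfolding G_def G'_def using ncd_mult_right[OF ncd_mult_left[OF E_ncd[OF mb that]]] .
  have G'1: "G' t \<in> deg_part 1" if "c \<le> t" for t
    unfolding G'_def by (intro deg_part_mult0 deg_part_inv E_fun_deg that) auto
  have main: "E a c b d - (G d + P d * E a c m d) \<in> boundaries"
  proof (rule boundaries_derivative[of c d "\<lambda>t. E a c b t - (G t + P t * E a c m t)"])
    fix t assume t: "t \<in> {c..d}"
    let ?h' = "E_fun a c b t - (G' t + (dd (G' t) * E a c m t + P t * E_fun a c m t))"
    have "ncd (\<lambda>t. E a c b t - (G t + P t * E a c m t)) ?h' t {c..}"
      using t by (intro ncd_diff ncd_add ncd_mult E_ncd Gd P' am ab) auto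
    then have dh: "ncd (\<lambda>t. E a c b t - (G t + P t * E a c m t)) ?h' t {c..d}"
      by (rule ncd_subset) auto
    \<comment> \<open>Since H_A = 1 + d E_A (\<open>dd_E\<close>), what remains of the derivative is
      a Peiffer expression in \<open>G'\<close> and E_A.\<close>
    have he: "?h' = - (dd (G' t) * E a c m t - G' t * dd (E a c m t))"
      using t by (simp add: e dd_E am algebra_simps)
    have hb: "?h' \<in> boundaries"
      unfolding he using t by (intro boundaries_simps(5) boundaries_peiffer G'1 E_deg) auto
    show "\<exists>h h'. (\<forall>s\<in>{c..d}. E a c b s - (G s + P s * E a c m s) - h s \<in> boundaries) \<and>
        h' \<in> boundaries \<and> ncd h h' t {c..d}"
      by (rule exI[of _ "\<lambda>t. E a c b t - (G t + P t * E a c m t)"], rule exI[of _ ?h'], intro conjI ballI hb dh) simp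
  qed (use cd in \<open>auto simp: G_def\<close>)
  have OB: "Om m c b d \<in> fbar 1" by (rule Om_Lie[OF mb cd])
  have x: "?x \<in> fbar 1"
    using exp_act_Lie[OF log_hor_Lie[OF am] OB] by (simp add: exp_act_log)
  have ex: "nc_exp (dd ?x) = P d"
    using dd_conj[OF hor_deg hor_Nil fbar_deg_part[OF OB], of a m c]
    by (simp add: nc_exp_conj dd_Om mb cd nc_exp_log P_def)
  have "expN ?x = ?g * expN (Om m c b d) * nc_inv ?g"
    by (rule expN_conj[OF _ _ fbar_deg_part[OF OB]]) auto
  moreover have "?g * (expN (Om m c b d) - E m c b d) * nc_inv ?g \<in> boundaries"
    by (intro boundaries_mult expN_Om mb cd hor_deg deg_part_inv) simp
  ultimately have 1: "expN ?x - G d \<in> boundaries"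
    by (simp add: G_def algebra_simps)
  have 2: "P d * (expN (Om a c m d) - E a c m d) \<in> boundaries"
    unfolding P_def by (intro boundaries_mult(1) expN_Om am cd deg_part_mult0(1) hor_deg loop_deg deg_part_inv) simp
  have "(E a c b d - (G d + P d * E a c m d)) - (expN ?x - G d) - P d * (expN (Om a c m d) - E a c m d) \<in> boundaries"
    by (rule boundaries_simps(3)[OF boundaries_simps(3)[OF main 1] 2])
  then have "E a c b d - (expN ?x + nc_exp (dd ?x) * expN (Om a c m d)) \<in> boundaries"
    unfolding ex by (simp add: algebra_simps)
  then have "Omega X ((a, c), (b, d)) = BCH (cls ?x) (cls (Om a c m d))"
    by (intro Omega_BCH ab cd Om_Lie x am)
  then show ?thesis
    using exp_act_q_cls[OF _ log_hor_Lie[OF am] _ OB, of c] by (simp add: Omega_Om am mb cd)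
qed

end

lemma linepath_eqD: "linepath a b = linepath a' b' \<Longrightarrow> a = a' \<and> b = b'"
  by (metis pathfinish_linepath pathstart_linepath)

text \<open>\<open>omega\<close> is defined by \<open>the_elem\<close> and \<open>Omega\<close> by
  \<open>THE\<close>; the conjuncts on their values rule out that the laws relate unspecified
  objects.\<close>

theorem theorem5p1:
  fixes X :: "real \<times> real \<Rightarrow> real ^ 'n::{finite,linorder}"
  assumes "smooth X"
  shows "(\<forall>C\<in>Paths2. omega X C \<in> g0bar) \<and>
         (\<forall>\<gamma>. piecewise_smooth \<gamma> \<longrightarrow> omega X (pclass \<gamma>) = nc_log (path_signature (X \<circ> \<gamma>))) \<and>
         (\<forall>R\<in>Rect. Omega X R \<in> gm1bar) \<and>
         (\<forall>R\<in>Rect. tau (Omega X R) = omega X (pclass (boundary_path R))) \<and>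
         (\<forall>A\<in>Rect. \<forall>B\<in>Rect. hcomposable A B \<longrightarrow>
            Omega X (compose_rect A B) =
              BCH (exp_act_q (omega X (pclass (bottom_edge A))) (Omega X B)) (Omega X A)) \<and>
         (\<forall>A\<in>Rect. \<forall>B\<in>Rect. vcomposable A B \<longrightarrow>
            Omega X (compose_rect A B) =
              BCH (Omega X A) (exp_act_q (omega X (pclass (left_edge A))) (Omega X B)))"
proof -
  interpret smooth_surface X by unfold_locales (rule assms)
  have sig: "omega X (pclass \<gamma>) = nc_log (path_signature (X \<circ> \<gamma>)) \<and> omega X (pclass \<gamma>) \<in> g0bar"
    if \<gamma>: "piecewise_smooth \<gamma>" for \<gamma>
  proof -
    obtain s where s: "transport (X \<circ> \<gamma>) 0 1 s" using transport_exists[OF assms \<gamma>] by blast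
    show ?thesis
      using omega_pclass[OF assms \<gamma> s] path_signature_eq[OF s] transport_log_Lie[OF s] by simp
  qed
  have "omega X C \<in> g0bar" if "C \<in> Paths2" for C
    using that sig by (auto simp: Paths2_def pclass_def elim!: quotientE)
  moreover have "Omega X R \<in> gm1bar \<and> tau (Omega X R) = omega X (pclass (boundary_path R))" if RR: "R \<in> Rect" for R
  proof -
    obtain a c b d where R: "R = ((a, c), (b, d))" "a \<le> b" "c \<le> d" using RR by (auto simp: Rect_def)
    show ?thesis unfolding R(1) Omega_Om[OF R(2,3)] omega_boundary[OF R(2,3)]
      using cls_gm1bar[OF Om_Lie[OF R(2,3)]] tau_cls[OF Om_Lie[OF R(2,3)]] dd_Om[OF R(2,3)] by simp
  qed
  moreover have "Omega X (compose_rect A B) = BCH (exp_act_q (omega X (pclass (bottom_edge A))) (Omega X B)) (Omega X A)"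
    if AB: "A \<in> Rect" "B \<in> Rect" "hcomposable A B" for A B
  proof -
    obtain a c m d where A: "A = ((a, c), (m, d))" "a \<le> m" "c \<le> d" using AB(1) by (auto simp: Rect_def)
    obtain m' c' b d' where B: "B = ((m', c'), (b, d'))" "m' \<le> b" using AB(2) by (auto simp: Rect_def)
    \<comment> \<open>Composability is equality of edges as parametrised paths, so comparing end
      points identifies the corners.\<close>
    have eq: "m' = m" "c' = c" "d' = d"
      using linepath_eqD[of "(m, c)" "(m, d)" "(m', c')" "(m', d')"] AB(3) A(1) B(1) by (auto simp: hcomposable_def)
    have "omega X (pclass (bottom_edge A)) = nc_log (hor a m c)"
      unfolding A(1) bottom_edge.simps
      by (rule omega_pclass[OF assms piecewise_smooth_linepath transport_bottom[OF A(2)]])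
    then show ?thesis using Omega_horizontal[OF A(2) _ A(3), of b] A B eq by (simp add: compose_rect_def)
  qed
  moreover have "Omega X (compose_rect A B) = BCH (Omega X A) (exp_act_q (omega X (pclass (left_edge A))) (Omega X B))"
    if AB: "A \<in> Rect" "B \<in> Rect" "vcomposable A B" for A B
  proof -
    obtain a c b m where A: "A = ((a, c), (b, m))" "a \<le> b" "c \<le> m" using AB(1) by (auto simp: Rect_def)
    obtain a' m' b' d where B: "B = ((a', m'), (b', d))" "m' \<le> d" using AB(2) by (auto simp: Rect_def)
    have eq: "m' = m" "a' = a" "b' = b"
      using linepath_eqD[of "(a, m)" "(b, m)" "(a', m')" "(b', m')"] AB(3) A(1) B(1) by (auto simp: vcomposable_def)
    have "omega X (pclass (left_edge A)) = nc_log (ver a c m)"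
      unfolding A(1) left_edge.simps
      by (rule omega_pclass[OF assms piecewise_smooth_linepath transport_left[OF A(3)]])
    then show ?thesis using Omega_vertical[OF A(2,3), of d] A B eq by (simp add: compose_rect_def)
  qed
  ultimately show ?thesis using sig by blast
qed


end
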